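(* Let $\theta^*$ be the unique minimizer of $f$ over $\Theta$, and suppose that for $P_*$-a.e. $x$ the function $l(x,\cdot)$ is continuously differentiable. Assume the following. (1) (Uniform second order growth) There are a neighborhood $\mathcal{V}$ of $\theta^*$ and a constant $c>0$ such that for every $v$ in a neighborhood of $0\in\mathbb{R}^m$ the problem $\min_{\theta\in\Theta}\{f(\theta)+v^T\theta\}$ has an optimal solution $\theta_*(v)\in\mathcal{V}$ and $$f(\theta)+v^T(\theta-\theta_*(v))\ge f(\theta_*(v))+c\|\theta-\theta_*(v)\|^2\quad\text{for all }\theta\in\Theta\cap\mathcal{V}.$$ (2) (i) For some $\bar\theta\in\Theta$, $\mathbb{E}_{P_*}[\|\nabla l(X,\bar\theta)\|^2]<\infty$; (ii) there is a measurable $\Psi:\mathcal{S}\to\mathbb{R}_+$ with $\mathbb{E}_{P_*}[\Psi(X)^2]<\infty$ such that $\|\nabla l(X,\theta)-\nabla l(X,\theta')\|\le\Psi(X)\|\theta-\theta'\|$ for all $\theta,\theta'\in\Theta$ and $P_*$-a.e. $X\in\mathcal{S}$. (3) $\phi$ is two times continuously differentiable in a neighborhood of $t=1$ with $\kappa:=2/\phi''(1)>0$. (4) $\sup_{\theta\in\Theta}|l(X,\theta)|$ is $P_*$-essentially bounded, and $\sigma^2(\theta^* )>0$. (5) The mapping $v\mapsto\theta_*(v)$ is directionally differentiable at $v=0$ in the Hadamard sense, with directional derivative $\theta_*'(0,\cdot)$. Let $Z\sim N(0,\Sigma)$, where $\Sigma$ is the covariance matrix of $\nabla l(X,\theta^*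 )$ under $P_*$. Then, as $n\to\infty$: (A-phi) If $\delta_n=o(n^{-1})$, then $n^{1/2}(\bar\theta_n-\theta^* )\rightsquigarrow\theta_*'(0,Z)$. (B-phi) If $\delta_n=\beta n^{-1}$ for a constant $\beta>0$, then $n^{1/2}(\bar\theta_n-\theta^* )\rightsquigarrow\theta_*'\big(0,Z+\kappa^{1/2}\beta^{1/2}\nabla\sigma(\theta^* )\big)$. (C-phi) If $n^{-1}=o(\delta_n)$, then $\delta_n^{-1/2}(\bar\theta_n-\theta^* )\rightsquigarrow\theta_*'\big(0,\kappa^{1/2}\nabla\sigma(\theta^* )\big)$.
   Context: $\mathcal{S}\subset\mathbb{R}^d$ is a nonempty closed set, and $X,X_1,X_2,\dots$ are i.i.d. with distribution $P_*$, a Borel probability measure on $\mathcal{S}$. $P_n=n^{-1}\sum_{i=1}^n\delta_{X_i}$ is the empirical measure. $\Theta\subset\mathbb{R}^m$ is compact and $l:\mathbb{R}^d\times\Theta\to\mathbb{R}$ is continuous on $\mathcal{S}\times\Theta$. Gradients $\nabla$ are taken with respect to $\theta$. $f(\theta):=\mathbb{E}_{P_*}[l(X,\theta)]$, $\sigma^2(\theta):=\mathrm{Var}_{P_*}(l(X,\theta))$, $\sigma(\theta):=\sqrt{\sigma^2(\theta)}$. $\phi:\mathbb{R}\to\mathbb{R}_+\cup\{+\infty\}$ is a convex lower semicontinuous function with $\phi(1)=0$ and $\phi(t)=+\infty$ for $t<0$. For $Q\ll P$, $D_\phi(Q\|P):=\mathbb{E}_P[\phi(dQ/dP)]$, and the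 ambiguity set is $\mathfrak{M}_\delta(P):=\{Q\ll P:D_\phi(Q\|P)\le\delta\}$. $(\delta_n)$ is a monotonically decreasing sequence of positive numbers tending to $0$, $\mathcal{F}_n(\theta,\delta_n):=\sup_{Q\in\mathfrak{M}_{\delta_n}(P_n)}\mathbb{E}_Q[l(X,\theta)]$, and $\bar\theta_n\in\arg\min_{\theta\in\Theta}\mathcal{F}_n(\theta,\delta_n)$. Directional differentiability of $\theta_*$ at $0$ in the Hadamard sense means that $\theta_*'(0,w)=\lim_{t\downarrow0,\,w'\to w}(\theta_*(tw')-\theta_*(0))/t$ exists for every $w\in\mathbb{R}^m$. The symbol $\rightsquigarrow$ denotes convergence in distribution.
   Formalization: Continuous differentiability of l(x,·) and the Lipschitz bound (2)(ii) are required on a set D containing Θ and the convex hull of Θ near θ* (D = Θ if Θ is convex or θ* is interior); with the bound on an arbitrary compact Θ alone, the claim is false. *)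

theory Defs
  imports "HOL-Probability.Probability" "HOL-Library.Landau_Symbols"
begin

definition loss_mean :: "'x measure \<Rightarrow> ('x \<Rightarrow> 'p \<Rightarrow> real) \<Rightarrow> 'p \<Rightarrow> real" where
  "loss_mean P l \<theta> = (\<integral>x. l x \<theta> \<partial>P)"

definition loss_var :: "'x measure \<Rightarrow> ('x \<Rightarrow> 'p \<Rightarrow> real) \<Rightarrow> 'p \<Rightarrow> real" where
  "loss_var P l \<theta> = (\<integral>x. (l x \<theta> - loss_mean P l \<theta>)\<^sup>2 \<partial>P)"

definition loss_sd :: "'x measure \<Rightarrow> ('x \<Rightarrow> 'p \<Rightarrow> real) \<Rightarrow> 'p \<Rightarrow> real" where
  "loss_sd P l \<theta> = sqrt (loss_var P l \<theta>)"

text \<open>The empirical measure of the sample points with indices 1, ..., n, as a measure on the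
  measurable space of \<open>P\<close>; it is meaningful for \<open>n \<ge> 1\<close>.\<close>

definition empirical_measure :: "'x measure \<Rightarrow> (nat \<Rightarrow> 'x) \<Rightarrow> nat \<Rightarrow> 'x measure" where
  "empirical_measure P xs n = distr (uniform_count_measure {1..n}) P xs"

text \<open>A function \<open>\<phi>\<close> with values in \<open>[0, \<infinity>]\<close> is modelled with codomain \<^typ>\<open>ennreal\<close>, in which
  \<open>0 * \<infinity> = 0\<close>.\<close>

definition ennreal_convex :: "(real \<Rightarrow> ennreal) \<Rightarrow> bool" where
  "ennreal_convex \<phi> \<longleftrightarrow>
     (\<forall>s t u. 0 \<le> u \<and> u \<le> 1 \<longrightarrow>
        \<phi> (u * s + (1 - u) * t) \<le> ennreal u * \<phi> s + ennreal (1 - u) * \<phi> t)"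

definition lower_semicontinuous :: "(real \<Rightarrow> ennreal) \<Rightarrow> bool" where
  "lower_semicontinuous \<phi> \<longleftrightarrow> (\<forall>t. \<phi> t \<le> Liminf (at t) \<phi>)"

definition phi_divergence :: "(real \<Rightarrow> ennreal) \<Rightarrow> 'x measure \<Rightarrow> 'x measure \<Rightarrow> ennreal" where
  "phi_divergence \<phi> Q P = (\<integral>\<^sup>+x. \<phi> (enn2real (RN_deriv P Q x)) \<partial>P)"

definition ambiguity_set :: "(real \<Rightarrow> ennreal) \<Rightarrow> real \<Rightarrow> 'x measure \<Rightarrow> 'x measure set" where
  "ambiguity_set \<phi> \<delta> P =
     {Q. prob_space Q \<and> sets Q = sets P \<and> absolutely_continuous P Q \<and>
         phi_divergence \<phi> Q P \<le> ennreal \<delta>}"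

definition robust_loss ::
    "(real \<Rightarrow> ennreal) \<Rightarrow> ('x \<Rightarrow> 'p \<Rightarrow> real) \<Rightarrow> 'x measure \<Rightarrow> real \<Rightarrow> 'p \<Rightarrow> real" where
  "robust_loss \<phi> l P \<delta> \<theta> = (SUP Q\<in>ambiguity_set \<phi> \<delta> P. loss_mean Q l \<theta>)"

text \<open>A gradient relative to a set, so that it also makes sense at boundary points. At interior
  points of \<open>S\<close> it is the usual gradient; elsewhere it need not be unique.\<close>

definition has_gradient_within ::
    "('a::real_inner \<Rightarrow> real) \<Rightarrow> 'a \<Rightarrow> 'a \<Rightarrow> 'a set \<Rightarrow> bool" where
  "has_gradient_within f g x S \<longleftrightarrow> (f has_derivative (\<lambda>h. g \<bullet> h)) (at x within S)"

definition gradient_within :: "('a::real_inner \<Rightarrow> real) \<Rightarrow> 'a \<Rightarrow> 'a set \<Rightarrow> 'a" where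
  "gradient_within f x S = (SOME g. has_gradient_within f g x S)"

definition has_hadamard_deriv ::
    "('a::real_normed_vector \<Rightarrow> 'b::real_normed_vector) \<Rightarrow> 'a \<Rightarrow> ('a \<Rightarrow> 'b) \<Rightarrow> bool" where
  "has_hadamard_deriv F x F' \<longleftrightarrow>
     (\<forall>w. ((\<lambda>(t, w'). (F (x + t *\<^sub>R w') - F x) /\<^sub>R t) \<longlongrightarrow> F' w) (at_right 0 \<times>\<^sub>F nhds w))"

definition covariance_matrix :: "'x measure \<Rightarrow> ('x \<Rightarrow> real ^ 'm) \<Rightarrow> real ^ 'm ^ 'm" where
  "covariance_matrix P g =
     (\<chi> i j. \<integral>x. (g x $ i - (\<integral>y. g y $ i \<partial>P)) * (g x $ j - (\<integral>y. g y $ j \<partial>P)) \<partial>P)"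

text \<open>The one-dimensional normal law with mean \<open>\<mu>\<close> and variance \<open>v \<ge> 0\<close>, a point mass if \<open>v = 0\<close>.\<close>

definition normal_law :: "real \<Rightarrow> real \<Rightarrow> real measure" where
  "normal_law \<mu> v =
     (if v = 0 then return borel \<mu> else density lborel (normal_density \<mu> (sqrt v)))"

text \<open>A random vector is multivariate normal if all its linear functionals are normal; the
  covariance matrix may be singular.\<close>

definition multivariate_normal ::
    "'z measure \<Rightarrow> ('z \<Rightarrow> real ^ 'm) \<Rightarrow> real ^ 'm \<Rightarrow> real ^ 'm ^ 'm \<Rightarrow> bool" where
  "multivariate_normal N Z \<mu> \<Sigma> \<longleftrightarrow>
     prob_space N \<and> Z \<in> borel_measurable N \<and> transpose \<Sigma> = \<Sigma> \<and>
     (\<forall>t. 0 \<le> t \<bullet> (\<Sigma> *v t) \<and>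
          distr N borel (\<lambda>\<omega>. t \<bullet> Z \<omega>) = normal_law (t \<bullet> \<mu>) (t \<bullet> (\<Sigma> *v t)))"

text \<open>Convergence in distribution of random elements \<open>Y n\<close> on \<open>M\<close> to a random element \<open>W\<close> on a
  possibly different probability space \<open>N\<close>.\<close>

definition converges_in_distribution ::
    "'w measure \<Rightarrow> (nat \<Rightarrow> 'w \<Rightarrow> 'a::metric_space) \<Rightarrow> 'z measure \<Rightarrow> ('z \<Rightarrow> 'a) \<Rightarrow> bool" where
  "converges_in_distribution M Y N W \<longleftrightarrow>
     (\<forall>n. Y n \<in> borel_measurable M) \<and> W \<in> borel_measurable N \<and>
     (\<forall>h::'a \<Rightarrow> real. continuous_on UNIV h \<and> bounded (range h) \<longrightarrow>
        (\<lambda>n. \<integral>\<omega>. h (Y n \<omega>) \<partial>M) \<longlonglongrightarrow> (\<integral>\<omega>. h (W \<omega>) \<partial>N))"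

text \<open>Smoothness of the loss: \<open>G x \<theta>\<close> is the gradient of \<open>l x\<close> at \<open>\<theta>\<close>, for almost every \<open>x\<close>, and
  depends continuously on \<open>\<theta>\<close>. It is taken along a set \<open>D\<close>, the domain on which \<open>l x\<close> is
  differentiated. Where the gradient relative to \<open>D\<close> is not unique, \<open>G\<close> is any measurable
  version.\<close>

definition continuously_differentiable_loss ::
    "'x measure \<Rightarrow> ('x \<Rightarrow> real ^ 'm \<Rightarrow> real) \<Rightarrow> ('x \<Rightarrow> real ^ 'm \<Rightarrow> real ^ 'm) \<Rightarrow>
      (real ^ 'm) set \<Rightarrow> bool" where
  "continuously_differentiable_loss P l G D \<longleftrightarrow>
     (AE x in P. (\<forall>\<theta>\<in>D. has_gradient_within (l x) (G x \<theta>) \<theta> D) \<and> continuous_on D (G x)) \<and>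
     (\<forall>\<theta>\<in>D. (\<lambda>x. G x \<theta>) \<in> borel_measurable P)"

text \<open>The domain of differentiation contains \<open>\<Theta>\<close> and, near the minimizer \<open>\<theta>\<^sub>0\<close>, all segments
  between points of \<open>\<Theta>\<close>: increments of the loss are estimated by integrating its gradient along
  such segments. \<open>D = \<Theta>\<close> qualifies if \<open>\<Theta>\<close> is convex, or if \<open>\<theta>\<^sub>0\<close> is an interior point of \<open>\<Theta>\<close>.
  For general compact \<open>\<Theta>\<close>, a Lipschitz bound for the gradient at the points of \<open>\<Theta>\<close> alone gives no
  control of these increments: at scattered points one can prescribe the values of the loss and
  its gradients independently.\<close>

definition differentiation_domain :: "(real ^ 'm) set \<Rightarrow> real ^ 'm \<Rightarrow> (real ^ 'm) set \<Rightarrow> bool" where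
  "differentiation_domain \<Theta> \<theta>\<^sub>0 D \<longleftrightarrow>
     \<Theta> \<subseteq> D \<and> (\<exists>r>0. convex hull (\<Theta> \<inter> ball \<theta>\<^sub>0 r) \<subseteq> D)"

lemma differentiation_domain_convex:
  assumes "convex \<Theta>"
  shows "differentiation_domain \<Theta> \<theta>\<^sub>0 \<Theta>"
  unfolding differentiation_domain_def
  using hull_minimal[of "\<Theta> \<inter> ball \<theta>\<^sub>0 1" \<Theta> convex] assms
  by (auto intro!: exI[of _ "1::real"])

lemma differentiation_domain_interior:
  assumes "\<theta>\<^sub>0 \<in> interior \<Theta>"
  shows "differentiation_domain \<Theta> \<theta>\<^sub>0 \<Theta>"
proof -
  obtain r where r: "r > 0" "ball \<theta>\<^sub>0 r \<subseteq> \<Theta>"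
    using assms mem_interior by blast
  then have "convex hull (\<Theta> \<inter> ball \<theta>\<^sub>0 r) \<subseteq> \<Theta>"
    using hull_minimal[of "\<Theta> \<inter> ball \<theta>\<^sub>0 r" "ball \<theta>\<^sub>0 r" convex] convex_ball by blast
  then show ?thesis
    using r by (auto simp: differentiation_domain_def)
qed

end

theory Submission
  imports Defs
begin

text \<open>
  The estimator is compared with the solution \<open>\<theta>sol (\<zeta> n)\<close> of the tilted problem
  \<open>min f(\<theta>) + \<zeta> n \<bullet> \<theta>\<close>, where \<open>\<zeta> n\<close> is the deviation of the mean gradient at \<open>\<theta>opt\<close> from its
  expectation plus \<open>sqrt (\<kappa> * \<delta> n)\<close> times the gradient of \<open>\<sigma>\<close>. Let \<open>a n\<close> be the larger of
  \<open>1 / sqrt n\<close> and \<open>sqrt (\<delta> n)\<close> up to constants. Uniform second order growth, applied at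
  \<open>\<theta>opt\<close>, shows that the estimator is at distance \<open>O(a n)\<close> from \<open>\<theta>opt\<close> in probability; applied
  again at \<open>\<theta>sol (\<zeta> n)\<close>, it shows that the distance to \<open>\<theta>sol (\<zeta> n)\<close> is \<open>o(a n)\<close>. The central
  limit theorem for \<open>\<zeta> n / a n\<close> and the Hadamard derivative of \<open>\<theta>sol\<close> then give the limit laws.

  Both comparisons bound differences \<open>F \<theta> - F \<theta>'\<close> of the robust loss up to \<open>o(a n ^ 2)\<close>, for which
  an expansion of \<open>F\<close> with error \<open>o(sqrt (\<delta> n))\<close> is too coarse. Instead the
  worst-case distribution at \<open>\<theta>\<close>, which is known from its optimality conditions, is inserted as a
  competitor at \<open>\<theta>'\<close>. It has a density that differs uniformly by \<open>o(sqrt (\<delta> n))\<close> from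
  \<open>1 + sqrt (\<kappa> * \<delta> n) * (l - mean) / sd\<close>, and the differences of the loss are of order \<open>a n\<close>.
\<close>

section \<open>The divergence function near 1\<close>

text \<open>The precision \<open>o(a n ^ 2)\<close> is forced because growth bounds the square of a
  distance. One density has to serve at both points so that the values of the loss cancel and only
  its increments meet the density error: \<open>o(sqrt (\<delta> n))\<close> times an increment of
  order \<open>a n\<close> is small enough, times the loss itself it is not. The comparison is
  one-sided. The density is optimal at \<open>\<theta>opt\<close> or at the tilted solution and
  merely admissible at the estimator, whose minimality supplies the sign; the worst case at the
  estimator is never examined. Averaging the leading term of the density against a loss increment
  gives a sample covariance divided by a standard deviation, hence nearly the increment of \<sigma>.
  This is where the second summand of the tilt comes from. For an arbitrary compact
  \<open>\<Theta>\<close> there are no first order conditions at the minimizer, and a gradient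
  relative to \<open>\<Theta>\<close> may fail to be unique. The argument therefore works with
  growth inequalities and with increments between points of \<open>\<Theta>\<close>.\<close>

locale divergence_generator =
  fixes \<phi> :: "real \<Rightarrow> ennreal" and \<kappa> :: real
  assumes phi_convex: "ennreal_convex \<phi>"
    and phi_one: "\<phi> 1 = 0"
    and phi_neg: "\<And>t. t < 0 \<Longrightarrow> \<phi> t = \<infinity>"
    and phi_C2: "\<exists>\<epsilon>>0.
        (\<forall>t\<in>ball 1 \<epsilon>. \<phi> t < \<infinity> \<and> (\<lambda>s. enn2real (\<phi> s)) differentiable (at t) \<and>
                   deriv (\<lambda>s. enn2real (\<phi> s)) differentiable (at t)) \<and>
        continuous_on (ball 1 \<epsilon>) (deriv (deriv (\<lambda>s. enn2real (\<phi> s))))"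
    and kappa: "\<kappa> = 2 / deriv (deriv (\<lambda>s. enn2real (\<phi> s))) 1"
    and kappa_pos: "\<kappa> > 0"
begin

abbreviation p :: "real \<Rightarrow> real" where "p \<equiv> \<lambda>s. enn2real (\<phi> s)"

lemma p_one: "p 1 = 0"
  by (simp add: phi_one)

lemma p_C2_ball:
  obtains \<epsilon> where "\<epsilon> > 0" "\<And>t. \<bar>t - 1\<bar> < \<epsilon> \<Longrightarrow> \<phi> t < \<infinity>"
    "\<And>t. \<bar>t - 1\<bar> < \<epsilon> \<Longrightarrow> (p has_real_derivative deriv p t) (at t)"
    "\<And>t. \<bar>t - 1\<bar> < \<epsilon> \<Longrightarrow> (deriv p has_real_derivative deriv (deriv p) t) (at t)"
    "continuous_on (ball 1 \<epsilon>) (deriv (deriv p))"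
proof -
  obtain \<epsilon> where e: "\<epsilon> > 0" "\<forall>t\<in>ball 1 \<epsilon>. \<phi> t < \<infinity> \<and> p differentiable (at t) \<and> deriv p differentiable (at t)"
    "continuous_on (ball 1 \<epsilon>) (deriv (deriv p))"
    using phi_C2 by blast
  have b: "t \<in> ball 1 \<epsilon>" if "\<bar>t - 1\<bar> < \<epsilon>" for t
    using that by (auto simp: dist_real_def)
  show ?thesis
    by (rule that[of \<epsilon>]) (use e b in \<open>auto simp: DERIV_deriv_iff_real_differentiable\<close>)
qed

text \<open>By convexity the difference quotients of \<open>p\<close> at \<open>s\<close> along the
  segment towards \<open>t\<close> are at most \<open>p t - p s\<close>, and they tend to
  \<open>d * (t - s)\<close>. The bound is stated in \<open>ennreal\<close> so as to cover
  \<open>\<phi> t = \<infinity>\<close>. It drives both the optimality proof and the a priori bound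
  for reweightings below.\<close>

lemma phi_tangent:
  assumes fin: "\<phi> s < \<infinity>" and der: "(p has_real_derivative d) (at s)"
    and near: "\<forall>\<^sub>F u in nhds s. \<phi> u < \<infinity>"
  shows "ennreal (p s + d * (t - s)) \<le> \<phi> t"
proof (cases "\<phi> t = \<infinity>")
  case False
  then have ft: "\<phi> t = ennreal (p t)"
    by (simp add: less_top)
  have fs: "\<phi> s = ennreal (p s)"
    using fin by (simp add: less_top)
  have "((\<lambda>u. p (s + u * (t - s))) has_real_derivative d * (t - s)) (at 0)"
    by (rule DERIV_chain2[where g = "\<lambda>u. s + u * (t - s)"]) (auto intro!: derivative_eq_intros der)
  then have lim: "((\<lambda>u. (p (s + u * (t - s)) - p s) / u) \<longlongrightarrow> d * (t - s)) (at_right 0)"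
    unfolding DERIV_def by (auto intro: tendsto_mono[OF at_le])
  have "((\<lambda>u. s + u * (t - s)) \<longlongrightarrow> s) (at_right 0)"
    by (auto intro!: tendsto_eq_intros)
  from filterlim_iff[THEN iffD1, rule_format, OF this near]
  have ev: "\<forall>\<^sub>F u in at_right 0. \<phi> (s + u * (t - s)) < \<infinity>" .
  have "\<forall>\<^sub>F u in at_right (0::real). u < 1"
    by (rule eventually_at_rightI[of 0 1]) auto
  with ev eventually_at_right_less[of "0::real"]
  have "\<forall>\<^sub>F u in at_right 0. (p (s + u * (t - s)) - p s) / u \<le> p t - p s"
  proof eventually_elim
    case (elim u)
    have "\<phi> (u * t + (1 - u) * s) \<le> ennreal u * \<phi> t + ennreal (1 - u) * \<phi> s"
      using phi_convex elim by (auto simp: ennreal_convex_def)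
    also have "\<dots> = ennreal (u * p t + (1 - u) * p s)"
      using elim by (subst ft, subst fs) (simp add: ennreal_mult ennreal_plus)
    also have "u * t + (1 - u) * s = s + u * (t - s)"
      by (simp add: algebra_simps)
    finally have "p (s + u * (t - s)) \<le> u * p t + (1 - u) * p s"
      using elim by (intro enn2real_leI) auto
    then show ?case
      using elim by (simp add: field_simps)
  qed
  then have "d * (t - s) \<le> p t - p s"
    by (rule tendsto_upperbound[OF lim]) simp
  then show ?thesis
    by (subst ft) (intro ennreal_leI, simp)
qed simp

text \<open>\<open>p\<close> is nonnegative and vanishes at 1, so 1 is a minimum.\<close>

lemma p_deriv_one: "deriv p 1 = 0"
proof -
  obtain \<epsilon> where e: "\<epsilon> > 0" "\<And>t. \<bar>t - 1\<bar> < \<epsilon> \<Longrightarrow> (p has_real_derivative deriv p t) (at t)"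
    using p_C2_ball by metis
  show ?thesis
    by (rule DERIV_local_min[OF e(2) e(1)]) (use e p_one in auto)
qed

text \<open>Taylor expansion at 1, where the second derivative is \<open>2 / \<kappa>\<close>:
  locally the divergence is a chi-square divergence divided by \<kappa>. Continuity of the second
  derivative gives the error, and the mean value bound \<open>mvt\<close>, applied twice, carries it
  to the first derivative and to \<open>p\<close>.\<close>

lemma p_expansion:
  assumes "\<eta> > 0"
  obtains r where "r > 0"
    "\<And>q. \<bar>q\<bar> \<le> r \<Longrightarrow> \<bar>deriv p (1 + q) - 2 * q / \<kappa>\<bar> \<le> \<eta> * \<bar>q\<bar>"
    "\<And>q. \<bar>q\<bar> \<le> r \<Longrightarrow> \<bar>p (1 + q) - q\<^sup>2 / \<kappa>\<bar> \<le> \<eta> * q\<^sup>2"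
proof -
  obtain \<epsilon> where e: "\<epsilon> > 0"
    "\<And>t. \<bar>t - 1\<bar> < \<epsilon> \<Longrightarrow> (p has_real_derivative deriv p t) (at t)"
    "\<And>t. \<bar>t - 1\<bar> < \<epsilon> \<Longrightarrow> (deriv p has_real_derivative deriv (deriv p) t) (at t)"
    "continuous_on (ball 1 \<epsilon>) (deriv (deriv p))"
    using p_C2_ball by metis
  have k: "deriv (deriv p) 1 = 2 / \<kappa>"
    using kappa kappa_pos by simp
  have "isCont (deriv (deriv p)) 1"
    using e(1,4) by (simp add: continuous_on_eq_continuous_at)
  then obtain r0 where r0: "r0 > 0" "\<And>t. \<bar>t - 1\<bar> < r0 \<Longrightarrow> \<bar>deriv (deriv p) t - 2 / \<kappa>\<bar> < \<eta>"
    using assms k unfolding continuous_at_eps_delta dist_real_def by metis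
  define r where "r = min \<epsilon> r0 / 2"
  have r: "r > 0" "r < \<epsilon>" "r < r0"
    using e r0 by (auto simp: r_def)
  have mvt: "\<bar>g b\<bar> \<le> K * \<bar>b\<bar>"
    if "g 0 = 0" "\<And>x. \<bar>x\<bar> \<le> \<bar>b\<bar> \<Longrightarrow> (g has_real_derivative g' x) (at x)" "\<And>x. \<bar>x\<bar> \<le> \<bar>b\<bar> \<Longrightarrow> \<bar>g' x\<bar> \<le> K"
    for g g' :: "real \<Rightarrow> real" and b K
  proof -
    have "norm (g b - g 0) \<le> K * norm (b - 0)"
    proof (rule field_differentiable_bound[of "{-\<bar>b\<bar>..\<bar>b\<bar>}"])
      show "(g has_field_derivative g' z) (at z within {- \<bar>b\<bar>..\<bar>b\<bar>})" if "z \<in> {-\<bar>b\<bar>..\<bar>b\<bar>}" for z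
        using \<open>\<And>x. \<bar>x\<bar> \<le> \<bar>b\<bar> \<Longrightarrow> (g has_real_derivative g' x) (at x)\<close>[of z] that
        by (auto intro: has_field_derivative_at_within)
      show "norm (g' z) \<le> K" if "z \<in> {-\<bar>b\<bar>..\<bar>b\<bar>}" for z
        using \<open>\<And>x. \<bar>x\<bar> \<le> \<bar>b\<bar> \<Longrightarrow> \<bar>g' x\<bar> \<le> K\<close>[of z] that by auto
    qed auto
    then show ?thesis
      using that by simp
  qed
  have 1: "\<bar>deriv p (1 + q) - 2 * q / \<kappa>\<bar> \<le> \<eta> * \<bar>q\<bar>" if "\<bar>q\<bar> \<le> r" for q
  proof (rule mvt[where g = "\<lambda>q. deriv p (1 + q) - 2 * q / \<kappa>" and g' = "\<lambda>q. deriv (deriv p) (1 + q) - 2 / \<kappa>"])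
    show "deriv p (1 + 0) - 2 * 0 / \<kappa> = 0"
      by (simp add: p_deriv_one)
    show "((\<lambda>q. deriv p (1 + q) - 2 * q / \<kappa>) has_real_derivative deriv (deriv p) (1 + x) - 2 / \<kappa>) (at x)"
      if "\<bar>x\<bar> \<le> \<bar>q\<bar>" for x
    proof -
      have "((\<lambda>q. deriv p (1 + q)) has_real_derivative deriv (deriv p) (1 + x) * 1) (at x)"
        by (rule DERIV_chain2[where g = "\<lambda>x. 1 + x"])
          (use e(3)[of "1 + x"] r that \<open>\<bar>q\<bar> \<le> r\<close> in \<open>auto intro!: derivative_eq_intros\<close>)
      then show ?thesis
        using kappa_pos by (auto intro!: derivative_eq_intros)
    qed
    show "\<bar>deriv (deriv p) (1 + x) - 2 / \<kappa>\<bar> \<le> \<eta>" if "\<bar>x\<bar> \<le> \<bar>q\<bar>" for x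
      using r0(2)[of "1 + x"] r that \<open>\<bar>q\<bar> \<le> r\<close> by auto
  qed
  have 2: "\<bar>p (1 + q) - q\<^sup>2 / \<kappa>\<bar> \<le> \<eta> * q\<^sup>2" if q: "\<bar>q\<bar> \<le> r" for q
  proof -
    have "\<bar>p (1 + q) - q\<^sup>2 / \<kappa>\<bar> \<le> (\<eta> * \<bar>q\<bar>) * \<bar>q\<bar>"
    proof (rule mvt[where g = "\<lambda>q. p (1 + q) - q\<^sup>2 / \<kappa>" and g' = "\<lambda>q. deriv p (1 + q) - 2 * q / \<kappa>"])
      show "p (1 + 0) - 0\<^sup>2 / \<kappa> = 0"
        by (simp add: p_one phi_one)
      show "((\<lambda>q. p (1 + q) - q\<^sup>2 / \<kappa>) has_real_derivative deriv p (1 + x) - 2 * x / \<kappa>) (at x)"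
        if "\<bar>x\<bar> \<le> \<bar>q\<bar>" for x
      proof -
        have "((\<lambda>q. p (1 + q)) has_real_derivative deriv p (1 + x) * 1) (at x)"
          by (rule DERIV_chain2[where g = "\<lambda>x. 1 + x" and f = p])
            (use e(2)[of "1 + x"] r that q in \<open>auto intro!: derivative_eq_intros\<close>)
        then show ?thesis
          using kappa_pos by (auto intro!: derivative_eq_intros)
      qed
      show "\<bar>deriv p (1 + x) - 2 * x / \<kappa>\<bar> \<le> \<eta> * \<bar>q\<bar>" if "\<bar>x\<bar> \<le> \<bar>q\<bar>" for x
      proof -
        have "\<eta> * \<bar>x\<bar> \<le> \<eta> * \<bar>q\<bar>"
          using that assms by simp
        then show ?thesis
          using 1[of x] that q by linarith
      qed
    qed
    then show ?thesis
      by (simp add: power2_eq_square mult.assoc)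
  qed
  show ?thesis
    using that[OF r(1) 1 2] by blast
qed

text \<open>\<open>1 + \<psi> y\<close> is the density value at which \<open>p\<close> has slope
  \<open>y\<close>. The derivative of \<open>p\<close> is inverted only near 1, but
  \<open>\<psi>\<close> is extended to a strictly increasing function on the whole line, so that the
  mass equation can be solved by monotonicity without tracking domains. The tangent inequality at
  \<open>1 + \<psi> y\<close> will certify optimality.\<close>

lemma deriv_inverse:
  obtains \<psi> \<tau> where "strict_mono \<psi>" "continuous_on UNIV \<psi>" "\<psi> 0 = 0" "\<tau> > 0"
    "\<And>y. \<bar>y\<bar> \<le> \<tau> \<Longrightarrow> \<bar>\<psi> y\<bar> \<le> 1 / 2" "\<And>y. \<bar>y\<bar> \<le> \<tau> \<Longrightarrow> deriv p (1 + \<psi> y) = y"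
    "\<And>y. \<bar>y\<bar> \<le> \<tau> \<Longrightarrow> \<bar>\<psi> y\<bar> \<le> \<kappa> * \<bar>y\<bar>"
    "\<And>y t. \<bar>y\<bar> \<le> \<tau> \<Longrightarrow> ennreal (p (1 + \<psi> y) + y * (t - (1 + \<psi> y))) \<le> \<phi> t"
    "\<And>y. \<bar>y\<bar> \<le> \<tau> \<Longrightarrow> \<phi> (1 + \<psi> y) = ennreal (p (1 + \<psi> y))"
    "continuous_on {-\<tau>..\<tau>} (\<lambda>y. p (1 + \<psi> y))"
proof -
  obtain \<epsilon> where e: "\<epsilon> > 0" "\<And>t. \<bar>t - 1\<bar> < \<epsilon> \<Longrightarrow> \<phi> t < \<infinity>"
    "\<And>t. \<bar>t - 1\<bar> < \<epsilon> \<Longrightarrow> (p has_real_derivative deriv p t) (at t)"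
    "\<And>t. \<bar>t - 1\<bar> < \<epsilon> \<Longrightarrow> (deriv p has_real_derivative deriv (deriv p) t) (at t)"
    "continuous_on (ball 1 \<epsilon>) (deriv (deriv p))"
    using p_C2_ball by metis
  have k: "deriv (deriv p) 1 = 2 / \<kappa>"
    using kappa kappa_pos by simp
  have "isCont (deriv (deriv p)) 1"
    using e(1,5) by (simp add: continuous_on_eq_continuous_at)
  \<comment> \<open>The tolerance equals the value at 1, so the second derivative stays positive
    within \<open>r0\<close> of 1.\<close>
  then obtain r0 where r0: "r0 > 0" "\<And>t. \<bar>t - 1\<bar> < r0 \<Longrightarrow> \<bar>deriv (deriv p) t - 2 / \<kappa>\<bar> < 2 / \<kappa>"
    using kappa_pos k unfolding continuous_at_eps_delta dist_real_def
    by (metis zero_less_divide_iff zero_less_numeral)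
  \<comment> \<open>The tolerance \<open>1 / \<kappa>\<close> is half the slope of the linear part;
    this yields \<open>\<bar>\<psi> y\<bar> \<le> \<kappa> * \<bar>y\<bar>\<close> at the
    end.\<close>
  obtain r1 where r1: "r1 > 0" "\<And>q. \<bar>q\<bar> \<le> r1 \<Longrightarrow> \<bar>deriv p (1 + q) - 2 * q / \<kappa>\<bar> \<le> 1 / \<kappa> * \<bar>q\<bar>"
    using p_expansion[of "1 / \<kappa>"] kappa_pos by (metis zero_less_divide_1_iff)
  \<comment> \<open>The cap \<open>1/2\<close> keeps density values at least \<open>1/2\<close>,
    hence nonnegative.\<close>
  define r where "r = min (1/2) (min (\<epsilon> / 2) (min (r0 / 2) r1))"
  have r: "r > 0" "r < \<epsilon>" "r < r0" "r \<le> r1" "r \<le> 1/2"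
    using e r0 r1 by (auto simp: r_def)
  define f where "f q = deriv p (1 + q)" for q
  have fder: "(f has_real_derivative deriv (deriv p) (1 + x)) (at x)" if "\<bar>x\<bar> \<le> r" for x
  proof -
    have "((\<lambda>q. deriv p (1 + q)) has_real_derivative deriv (deriv p) (1 + x) * 1) (at x)"
      by (rule DERIV_chain2[where g = "\<lambda>x. 1 + x"])
        (use e(4)[of "1 + x"] r that in \<open>auto intro!: derivative_eq_intros\<close>)
    then show ?thesis
      by (simp add: f_def[abs_def])
  qed
  have finc: "f x < f y" if "-r \<le> x" "x < y" "y \<le> r" for x y
  proof (rule DERIV_pos_imp_increasing[OF that(2)])
    fix z assume "x \<le> z" "z \<le> y"
    then have "\<bar>z\<bar> \<le> r"
      using that by auto
    then show "\<exists>d. (f has_real_derivative d) (at z) \<and> 0 < d"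
      using fder[of z] r0(2)[of "1 + z"] r by (intro exI[of _ "deriv (deriv p) (1 + z)"]) auto
  qed
  have fcont: "continuous_on {-r..r} f"
    proof (rule DERIV_continuous_on)
    show "(f has_real_derivative deriv (deriv p) (1 + x)) (at x within {-r..r})" if "x \<in> {-r..r}" for x
      by (rule has_field_derivative_at_within[OF fder]) (use that in \<open>simp add: abs_le_iff\<close>)
  qed
  have f0: "f 0 = 0"
    by (simp add: f_def p_deriv_one)
  \<comment> \<open>The largest symmetric interval around 0 inside the range of \<open>f\<close> on
    \<open>{-r..r}\<close>.\<close>
  define \<tau> where "\<tau> = min (f r) (- f (-r))"
  have tau: "\<tau> > 0" "\<tau> \<le> f r" "f (-r) \<le> - \<tau>"
    using finc[of 0 r] finc[of "-r" 0] r f0 by (auto simp: \<tau>_def)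
  have ex: "\<exists>q\<in>{-r..r}. f q = y" if "\<bar>y\<bar> \<le> \<tau>" for y
    using IVT'[of f "-r" y r] fcont r tau that by (auto simp: abs_le_iff)
  define g where "g = the_inv_into {-r..r} f"
  have inj: "inj_on f {-r..r}"
    by (rule linorder_inj_onI') (use finc in force)
  have gf: "g (f q) = q" if "q \<in> {-r..r}" for q
    unfolding g_def using inj that by (rule the_inv_into_f_f)
  have gcont: "continuous_on (f ` {-r..r}) g"
    by (rule continuous_on_inv[OF fcont]) (use gf in auto)
  have img: "{-\<tau>..\<tau>} \<subseteq> f ` {-r..r}"
  proof
    fix y assume "y \<in> {-\<tau>..\<tau>}"
    then have "\<bar>y\<bar> \<le> \<tau>"
      by (simp add: abs_le_iff)
    from ex[OF this] show "y \<in> f ` {-r..r}"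
      by blast
  qed
  have g1: "f (g y) = y" "\<bar>g y\<bar> \<le> r" if "\<bar>y\<bar> \<le> \<tau>" for y
  proof -
    from ex[OF that] obtain q where "q \<in> {-r..r}" "f q = y"
      by blast
    with gf[of q] show "f (g y) = y" "\<bar>g y\<bar> \<le> r"
      by auto
  qed
  have ginc: "g x < g y" if "\<bar>x\<bar> \<le> \<tau>" "\<bar>y\<bar> \<le> \<tau>" "x < y" for x y
  proof (rule ccontr)
    assume "\<not> g x < g y"
    then have "f (g y) \<le> f (g x)"
      using finc[of "g y" "g x"] g1(2)[OF that(1)] g1(2)[OF that(2)] by (cases "g x = g y") (simp_all add: abs_le_iff)
    then show False
      using g1(1)[OF that(1)] g1(1)[OF that(2)] that(3) by linarith
  qed
  \<comment> \<open>Clamping to \<open>[-\<tau>, \<tau>]\<close>. Outside this interval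
    \<open>\<psi>\<close> continues with slope 1, which keeps it continuous and strictly
    increasing.\<close>
  define cl where "cl y = max (-\<tau>) (min \<tau> y)" for y
  define \<psi> where "\<psi> y = g (cl y) + (y - cl y)" for y
  have clb: "\<bar>cl y\<bar> \<le> \<tau>" for y
    using tau by (auto simp: cl_def)
  have psi_in: "\<psi> y = g y" if "\<bar>y\<bar> \<le> \<tau>" for y
    using that by (auto simp: \<psi>_def cl_def abs_le_iff)
  have b: "\<bar>\<psi> y\<bar> \<le> r" if "\<bar>y\<bar> \<le> \<tau>" for y
    using psi_in g1 that by auto
  show ?thesis
  proof
    show "strict_mono \<psi>"
    proof (rule strict_monoI)
      fix x y :: real assume xy: "x < y"
      show "\<psi> x < \<psi> y"
      proof (cases "cl x = cl y")
        case False
        then have "cl x < cl y"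
          using xy by (auto simp: cl_def max_def min_def split: if_splits)
        then have "g (cl x) < g (cl y)"
          using ginc clb by blast
        moreover have "x - cl x \<le> y - cl y"
          using xy tau by (auto simp: cl_def max_def min_def split: if_splits)
        ultimately show ?thesis
          by (simp add: \<psi>_def)
      qed (use xy in \<open>simp add: \<psi>_def\<close>)
    qed
    have "continuous_on UNIV (\<lambda>y. g (cl y))"
      by (rule continuous_on_compose2[OF gcont])
        (use img clb in \<open>auto simp: cl_def[abs_def] abs_le_iff intro!: continuous_intros\<close>)
    then show "continuous_on UNIV \<psi>"
      unfolding \<psi>_def[abs_def] cl_def by (auto intro!: continuous_intros)
    then have cont: "continuous_on {-\<tau>..\<tau>} \<psi>"
      by (rule continuous_on_subset) simp
    show "\<psi> 0 = 0"
      using gf[of 0] f0 r tau by (simp add: psi_in)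
    show "\<tau> > 0" by fact
    show "\<bar>\<psi> y\<bar> \<le> 1 / 2" if "\<bar>y\<bar> \<le> \<tau>" for y
      using b[OF that] r by simp
    show d: "deriv p (1 + \<psi> y) = y" if "\<bar>y\<bar> \<le> \<tau>" for y
      using g1[OF that] psi_in[OF that] by (simp add: f_def)
    show "\<bar>\<psi> y\<bar> \<le> \<kappa> * \<bar>y\<bar>" if "\<bar>y\<bar> \<le> \<tau>" for y
    proof -
      have "\<bar>y - 2 * \<psi> y / \<kappa>\<bar> \<le> 1 / \<kappa> * \<bar>\<psi> y\<bar>"
        using r1(2)[of "\<psi> y"] b[OF that] r d[OF that] by simp
      moreover have "\<bar>2 * \<psi> y / \<kappa>\<bar> = 2 * (1 / \<kappa> * \<bar>\<psi> y\<bar>)"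
        using kappa_pos by (simp add: abs_mult)
      ultimately have "1 / \<kappa> * \<bar>\<psi> y\<bar> \<le> \<bar>y\<bar>"
        by linarith
      then show ?thesis
        using kappa_pos by (simp add: field_simps)
    qed
    have near: "\<bar>1 + \<psi> y - 1\<bar> < \<epsilon>" if "\<bar>y\<bar> \<le> \<tau>" for y
      using b[OF that] r by simp
    show "\<phi> (1 + \<psi> y) = ennreal (p (1 + \<psi> y))" if "\<bar>y\<bar> \<le> \<tau>" for y
      using e(2)[OF near[OF that]] by (simp add: less_top)
    show "ennreal (p (1 + \<psi> y) + y * (t - (1 + \<psi> y))) \<le> \<phi> t" if "\<bar>y\<bar> \<le> \<tau>" for y t
    proof (rule phi_tangent[OF e(2)[OF near[OF that]]])
      show "(p has_real_derivative y) (at (1 + \<psi> y))"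
        using e(3)[OF near[OF that]] d[OF that] by simp
      show "\<forall>\<^sub>F u in nhds (1 + \<psi> y). \<phi> u < \<infinity>"
        unfolding eventually_nhds
        using near[OF that] e(2) by (intro exI[of _ "ball 1 \<epsilon>"]) (auto simp: dist_real_def)
    qed
    have "continuous_on (ball 1 \<epsilon>) p"
      by (rule continuous_at_imp_continuous_on) (auto intro!: DERIV_isCont e(3) simp: dist_real_def)
    then show "continuous_on {-\<tau>..\<tau>} (\<lambda>y. p (1 + \<psi> y))"
      by (rule continuous_on_compose2)
        (use near in \<open>auto intro!: continuous_intros cont simp: dist_real_def abs_le_iff\<close>)
  qed
qed

end

section \<open>Worst-case weights of a finite sample\<close>

definition sample_mean :: "nat \<Rightarrow> (nat \<Rightarrow> real) \<Rightarrow> real" where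
  "sample_mean n y = (\<Sum>i=1..n. y i) / real n"

text \<open>Normalized by \<open>n\<close>: this is the variance under the empirical measure, the
  one that worst-case weights see.\<close>

definition sample_var :: "nat \<Rightarrow> (nat \<Rightarrow> real) \<Rightarrow> real" where
  "sample_var n y = sample_mean n (\<lambda>i. (y i - sample_mean n y)\<^sup>2)"

lemma sample_mean_const: "n \<ge> 1 \<Longrightarrow> sample_mean n (\<lambda>i. a) = a"
  by (simp add: sample_mean_def)

lemma sample_mean_cong: "(\<And>i. i \<in> {1..n} \<Longrightarrow> f i = g i) \<Longrightarrow> sample_mean n f = sample_mean n g"
  unfolding sample_mean_def by (metis (no_types, lifting) sum.cong)

lemma sample_mean_add: "sample_mean n (\<lambda>i. f i + g i) = sample_mean n f + sample_mean n g"
  by (simp add: sample_mean_def sum.distrib add_divide_distrib)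

lemma sample_mean_diff: "sample_mean n (\<lambda>i. f i - g i) = sample_mean n f - sample_mean n g"
  by (simp add: sample_mean_def sum_subtractf diff_divide_distrib)

lemma sample_mean_cmult: "sample_mean n (\<lambda>i. a * f i) = a * sample_mean n f"
  by (simp add: sample_mean_def sum_distrib_left)

lemma sample_mean_multc: "sample_mean n (\<lambda>i. f i * a) = sample_mean n f * a"
  by (simp add: sample_mean_def sum_distrib_right)

lemma sample_mean_mono: "(\<And>i. i \<in> {1..n} \<Longrightarrow> f i \<le> g i) \<Longrightarrow> sample_mean n f \<le> sample_mean n g"
  unfolding sample_mean_def by (intro divide_right_mono sum_mono) auto

lemma sample_mean_nonneg: "(\<And>i. i \<in> {1..n} \<Longrightarrow> 0 \<le> f i) \<Longrightarrow> 0 \<le> sample_mean n f"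
  unfolding sample_mean_def by (intro divide_nonneg_nonneg sum_nonneg) auto

lemma abs_sample_mean_le:
  assumes "\<And>i. i \<in> {1..n} \<Longrightarrow> \<bar>f i\<bar> \<le> g i"
  shows "\<bar>sample_mean n f\<bar> \<le> sample_mean n g"
proof -
  have "\<bar>sample_mean n f\<bar> \<le> sample_mean n (\<lambda>i. \<bar>f i\<bar>)"
    unfolding sample_mean_def by (simp add: divide_right_mono)
  also have "\<dots> \<le> sample_mean n g"
    by (intro sample_mean_mono assms)
  finally show ?thesis .
qed

lemma abs_sample_mean_le_const:
  assumes "n \<ge> 1" "\<And>i. i \<in> {1..n} \<Longrightarrow> \<bar>f i\<bar> \<le> a"
  shows "\<bar>sample_mean n f\<bar> \<le> a"
  using abs_sample_mean_le[of n f "\<lambda>_. a"] assms sample_mean_const[of n a] by simp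

text \<open>\<open>h\<close> is continuous in \<open>t\<close> only for each fixed \<open>u\<close>.
  Strict monotonicity in \<open>u\<close> makes up for it: the signs of \<open>h\<close> at
  \<open>c t0 - e\<close> and \<open>c t0 + e\<close> persist for \<open>t\<close> near
  \<open>t0\<close> and trap the root.\<close>

lemma continuous_root:
  fixes h :: "real \<Rightarrow> real \<Rightarrow> real" and c :: "real \<Rightarrow> real"
  assumes cont: "\<And>u. continuous_on UNIV (\<lambda>t. h t u)"
    and anti: "\<And>t u v. u < v \<Longrightarrow> h t v < h t u"
    and root: "\<And>t. h t (c t) = 0"
  shows "continuous_on UNIV c"
proof (rule continuous_at_imp_continuous_on, rule ballI)
  fix t0
  have "\<forall>\<^sub>F t in at t0. \<bar>c t - c t0\<bar> < e" if e: "e > 0" for e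
  proof -
    have pos: "h t0 (c t0 - e) > 0" and neg: "h t0 (c t0 + e) < 0"
      using anti[of "c t0 - e" "c t0" t0] anti[of "c t0" "c t0 + e" t0] root[of t0] e by auto
    have lim: "((\<lambda>t. h t u) \<longlongrightarrow> h t0 u) (at t0)" for u
      using cont[of u] by (simp add: continuous_on_def)
    from order_tendstoD(1)[OF lim pos] order_tendstoD(2)[OF lim neg]
    show ?thesis
    proof eventually_elim
      case (elim t)
      have "c t0 - e < c t"
        using anti[of "c t" "c t0 - e" t] root[of t] elim(1) by (cases "c t" "c t0 - e" rule: linorder_cases) auto
      moreover have "c t < c t0 + e"
        using anti[of "c t0 + e" "c t" t] root[of t] elim(2) by (cases "c t" "c t0 + e" rule: linorder_cases) auto
      ultimately show ?case
        by (simp add: abs_less_iff)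
    qed
  qed
  then show "isCont c t0"
    unfolding isCont_def tendsto_iff by (simp add: dist_real_def)
qed

context divergence_generator
begin

text \<open>The maximizer of \<open>sample_mean n (w * y)\<close> over reweightings \<open>w\<close> of the sample with divergence at
  most \<open>\<delta>\<close> solves \<open>\<phi>' w = t y - c\<close> with multipliers \<open>t\<close> and \<open>c\<close>. They are found by two applications
  of the intermediate value theorem: first \<open>c\<close> for given \<open>t\<close>, to have total mass 1, then \<open>t\<close>, to
  have divergence exactly \<open>\<delta>\<close>.\<close>

lemma optimal_weights:
  assumes B: "B > 0" and s0: "s0 > 0" and eta: "\<eta> > 0"
  shows "\<exists>\<delta>0>0. \<forall>\<delta> n y. 0 < \<delta> \<and> \<delta> < \<delta>0 \<and> n \<ge> 1 \<and> (\<forall>i\<in>{1..n}. \<bar>y i\<bar> \<le> B) \<and> sample_var n y \<ge> s0 \<longrightarrow>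
    (\<exists>W::real\<Rightarrow>real. continuous_on UNIV W \<and> (\<forall>i\<in>{1..n}. 1 / 2 \<le> W (y i)) \<and>
       sample_mean n (\<lambda>i. W (y i)) = 1 \<and> (\<Sum>i=1..n. \<phi> (W (y i))) \<le> ennreal (real n * \<delta>) \<and>
       (\<forall>i\<in>{1..n}. \<bar>W (y i) - 1 - sqrt (\<kappa> * \<delta>) * (y i - sample_mean n y) / sqrt (sample_var n y)\<bar> \<le> \<eta> * sqrt \<delta>) \<and>
       (\<forall>w. sample_mean n w = 1 \<and> (\<Sum>i=1..n. \<phi> (w i)) \<le> ennreal (real n * \<delta>) \<longrightarrow>
          sample_mean n (\<lambda>i. w i * y i) \<le> sample_mean n (\<lambda>i. W (y i) * y i)))"
proof -
  obtain \<psi> \<tau> where psi: "strict_mono \<psi>" "continuous_on UNIV \<psi>" "\<psi> 0 = 0" and tau: "\<tau> > 0"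
    and psi_half: "\<And>y. \<bar>y\<bar> \<le> \<tau> \<Longrightarrow> \<bar>\<psi> y\<bar> \<le> 1 / 2"
    and psi_inv: "\<And>y. \<bar>y\<bar> \<le> \<tau> \<Longrightarrow> deriv p (1 + \<psi> y) = y"
    and psi_bd: "\<And>y. \<bar>y\<bar> \<le> \<tau> \<Longrightarrow> \<bar>\<psi> y\<bar> \<le> \<kappa> * \<bar>y\<bar>"
    and psi_tan: "\<And>y t. \<bar>y\<bar> \<le> \<tau> \<Longrightarrow> ennreal (p (1 + \<psi> y) + y * (t - (1 + \<psi> y))) \<le> \<phi> t"
    and psi_fin: "\<And>y. \<bar>y\<bar> \<le> \<tau> \<Longrightarrow> \<phi> (1 + \<psi> y) = ennreal (p (1 + \<psi> y))"
    and psi_cont: "continuous_on {-\<tau>..\<tau>} (\<lambda>y. p (1 + \<psi> y))"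
    using deriv_inverse by blast
  \<comment> \<open>The uniform error of the density will come out as
    \<open>C1 * \<eta>' * t\<close>, where \<open>t\<close> is the multiplier of the loss;
    \<open>t \<le> C2 * sqrt \<delta>\<close> then converts it to the required scale.\<close>
  define C1 where "C1 = 2 * \<kappa>\<^sup>2 * B + 40 * \<kappa>\<^sup>2 * B ^ 3 / s0"
  define C2 where "C2 = sqrt (8 / (\<kappa> * s0))"
  have C: "C1 > 0" "C2 > 0"
    using kappa_pos B s0 by (auto simp: C1_def C2_def intro!: add_pos_pos)
  \<comment> \<open>The first bound makes the error of the quadratic approximation to the divergence
    at most half of its leading term, the second one yields the final error
    \<open>\<eta> * sqrt \<delta>\<close>.\<close>
  define \<eta>' where "\<eta>' = min (s0 / (80 * \<kappa> * B\<^sup>2)) (\<eta> / (C1 * C2))"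
  have eta': "\<eta>' > 0" "\<eta>' \<le> s0 / (80 * \<kappa> * B\<^sup>2)" "\<eta>' * (C1 * C2) \<le> \<eta>"
  proof -
    show "\<eta>' > 0" "\<eta>' \<le> s0 / (80 * \<kappa> * B\<^sup>2)"
      using kappa_pos B s0 eta C by (auto simp: \<eta>'_def)
    have "\<eta>' \<le> \<eta> / (C1 * C2)"
      by (simp add: \<eta>'_def)
    then show "\<eta>' * (C1 * C2) \<le> \<eta>"
      using C by (simp add: pos_le_divide_eq)
  qed
  obtain r where r: "r > 0"
    "\<And>q. \<bar>q\<bar> \<le> r \<Longrightarrow> \<bar>deriv p (1 + q) - 2 * q / \<kappa>\<bar> \<le> \<eta>' * \<bar>q\<bar>"
    "\<And>q. \<bar>q\<bar> \<le> r \<Longrightarrow> \<bar>p (1 + q) - q\<^sup>2 / \<kappa>\<bar> \<le> \<eta>' * q\<^sup>2"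
    using p_expansion[OF eta'(1)] by blast
  \<comment> \<open>The arguments \<open>t * y i - c t\<close> are at most \<open>2 * t * B\<close>
    in absolute value. For \<open>t \<le> t0\<close> they stay in the domain
    \<open>[-\<tau>, \<tau>]\<close> of the inverse, and the resulting perturbations stay in the
    range \<open>r\<close> of the expansion.\<close>
  define t0 where "t0 = min (\<tau> / (2 * B)) (r / (2 * \<kappa> * B))"
  have t0: "t0 > 0" "2 * t0 * B \<le> \<tau>" "\<kappa> * (2 * t0 * B) \<le> r"
  proof -
    show "t0 > 0"
      using tau r B kappa_pos by (simp add: t0_def)
    have "t0 \<le> \<tau> / (2 * B)" "t0 \<le> r / (2 * \<kappa> * B)"
      by (simp_all add: t0_def)
    then show "2 * t0 * B \<le> \<tau>" "\<kappa> * (2 * t0 * B) \<le> r"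
      using B kappa_pos by (simp_all add: pos_le_divide_eq mult_ac)
  qed
  \<comment> \<open>\<open>e * t\<close> bounds the error of linearizing \<open>\<psi>\<close> at a
    sample point. In \<open>e1\<close>, which measures the error of the divergence, 6 of the 10
    parts come from this linearization and 4 from the expansion of \<open>p\<close>.\<close>
  define e where "e = \<kappa>\<^sup>2 * B * \<eta>'"
  define e1 where "e1 = 10 * \<kappa>\<^sup>2 * B\<^sup>2 * \<eta>'"
  have e: "e > 0" "e1 > 0" "e1 \<le> \<kappa> * s0 / 8"
  proof -
    show "e > 0" "e1 > 0"
      using kappa_pos B eta' by (simp_all add: e_def e1_def)
    have "10 * \<kappa>\<^sup>2 * B\<^sup>2 * \<eta>' \<le> 10 * \<kappa>\<^sup>2 * B\<^sup>2 * (s0 / (80 * \<kappa> * B\<^sup>2))"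
      using eta'(2) by (intro mult_left_mono) auto
    also have "\<dots> = \<kappa> * s0 / 8"
      using B kappa_pos by (simp add: field_simps power2_eq_square)
    finally show "e1 \<le> \<kappa> * s0 / 8"
      by (simp add: e1_def)
  qed
  show ?thesis
  \<comment> \<open>This is the lower bound \<open>DD_low\<close> for the divergence at
    \<open>t0\<close>, so every smaller \<open>\<delta>\<close> is attained for some
    \<open>t\<close> in \<open>[0, t0]\<close>.\<close>
  proof (intro exI[of _ "\<kappa> * t0\<^sup>2 * s0 / 8"] conjI allI impI; (elim conjE)?)
    show "\<kappa> * t0\<^sup>2 * s0 / 8 > 0"
      using kappa_pos t0 s0 by simp
  next
    fix \<delta> n y
    assume del: "0 < \<delta>" "\<delta> < \<kappa> * t0\<^sup>2 * s0 / 8" and n: "1 \<le> n"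
      and y: "\<forall>i\<in>{1..n}. \<bar>y i\<bar> \<le> B" and var: "s0 \<le> sample_var n y"
    define m where "m = sample_mean n y"
    define s where "s = sqrt (sample_var n y)"
    have s: "s > 0" "s\<^sup>2 = sample_var n y" "sqrt s0 \<le> s"
      using var s0 by (auto simp: s_def)
    have m: "\<bar>m\<bar> \<le> B"
      unfolding m_def using n y by (intro abs_sample_mean_le_const) auto
    \<comment> \<open>The excess of the total mass over 1 for the multipliers \<open>t\<close> and
      \<open>c\<close>.\<close>
    define h where "h t c = sample_mean n (\<lambda>i. \<psi> (t * y i - c))" for t c
    have psi_le: "\<psi> a \<le> \<psi> b \<longleftrightarrow> a \<le> b" "\<psi> a < \<psi> b \<longleftrightarrow> a < b" for a b
      using psi(1) by (simp_all add: strict_mono_less_eq strict_mono_less)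
    have h_cont_t: "continuous_on UNIV (\<lambda>t. h t u)" for u
      unfolding h_def sample_mean_def divide_inverse
      by (intro continuous_intros continuous_on_compose2[OF psi(2)]) auto
    have h_cont_c: "continuous_on UNIV (\<lambda>u. h t u)" for t
      unfolding h_def sample_mean_def divide_inverse
      by (intro continuous_intros continuous_on_compose2[OF psi(2)]) auto
    have h_anti: "h t v < h t u" if "u < v" for t u v
      unfolding h_def sample_mean_def
      using n that by (intro divide_strict_right_mono sum_strict_mono) (auto simp: psi_le)
    have tyB: "\<bar>t * y i\<bar> \<le> \<bar>t\<bar> * B" if "i \<in> {1..n}" for i t
      using y that by (auto simp: abs_mult intro: mult_left_mono)
    have h_lo: "0 \<le> h t (- (\<bar>t\<bar> * B))" for t
      unfolding h_def
    proof (rule sample_mean_nonneg)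
      fix i assume "i \<in> {1..n}"
      then show "0 \<le> \<psi> (t * y i - - (\<bar>t\<bar> * B))"
        using tyB[of i t] psi_le(1)[of 0 "t * y i - - (\<bar>t\<bar> * B)"] psi(3) by linarith
    qed
    have h_hi: "h t (\<bar>t\<bar> * B) \<le> 0" for t
    proof -
      have "0 \<le> sample_mean n (\<lambda>i. - 1 * \<psi> (t * y i - \<bar>t\<bar> * B))"
      proof (rule sample_mean_nonneg)
        fix i assume "i \<in> {1..n}"
        then show "0 \<le> - 1 * \<psi> (t * y i - \<bar>t\<bar> * B)"
          using tyB[of i t] psi_le(1)[of "t * y i - \<bar>t\<bar> * B" 0] psi(3) by linarith
      qed
      then show ?thesis
        by (simp only: sample_mean_cmult h_def)
    qed
    have "\<exists>c. - (\<bar>t\<bar> * B) \<le> c \<and> c \<le> \<bar>t\<bar> * B \<and> h t c = 0" for t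
      by (rule IVT2'[where f = "h t", OF h_hi h_lo])
        (use B in \<open>auto intro: continuous_on_subset[OF h_cont_c]\<close>)
    then obtain c where c: "\<And>t. - (\<bar>t\<bar> * B) \<le> c t" "\<And>t. c t \<le> \<bar>t\<bar> * B" "\<And>t. h t (c t) = 0"
      by metis
    have c_cont: "continuous_on UNIV c"
      by (rule continuous_root[where h = h, OF h_cont_t h_anti c(3)])
    define z where "z t i = t * y i - c t" for t i
    have z_bd: "\<bar>z t i\<bar> \<le> 2 * t * B" if "i \<in> {1..n}" "0 \<le> t" for t i
      using tyB[OF that(1), of t] c(1,2)[of t] that(2) unfolding z_def by (simp add: abs_le_iff)
    have z_tau: "\<bar>z t i\<bar> \<le> \<tau>" if "i \<in> {1..n}" "0 \<le> t" "t \<le> t0" for t i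
    proof -
      have "2 * t * B \<le> 2 * t0 * B"
        using that B by simp
      then show ?thesis
        using z_bd[OF that(1,2)] t0(2) by linarith
    qed
    have z_tau': "z t i \<in> {-\<tau>..\<tau>}" if "i \<in> {1..n}" "0 \<le> t" "t \<le> t0" for t i
      using z_tau[OF that] by (simp add: abs_le_iff)
    define q where "q t i = \<psi> (z t i)" for t i
    define DD where "DD t = sample_mean n (\<lambda>i. p (1 + q t i))" for t
    have z_cont: "continuous_on T (\<lambda>t. z t i)" for T i
      unfolding z_def by (intro continuous_intros continuous_on_subset[OF c_cont]) auto
    have DD_cont: "continuous_on {0..t0} DD"
      unfolding DD_def sample_mean_def divide_inverse q_def
      by (intro continuous_intros continuous_on_compose2[OF psi_cont] z_cont)
        (use z_tau' in auto)
    have DD0: "DD 0 = 0"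
    proof -
      have "c 0 = 0"
        using c(1,2)[of 0] by simp
      then show ?thesis
        by (simp add: DD_def q_def z_def psi(3) phi_one sample_mean_def)
    qed
    have q_sum: "sample_mean n (q t) = 0" for t
      using c(3)[of t] by (simp add: h_def q_def[abs_def] z_def)
    have qs: "\<bar>q t i\<bar> \<le> 2 * \<kappa> * t * B" "\<bar>q t i\<bar> \<le> r" "\<bar>q t i - \<kappa> / 2 * z t i\<bar> \<le> e * t"
      if i: "i \<in> {1..n}" and t: "0 \<le> t" "t \<le> t0" for t i
    proof -
      have "\<bar>q t i\<bar> \<le> \<kappa> * \<bar>z t i\<bar>"
        unfolding q_def using psi_bd z_tau that by blast
      also have "\<dots> \<le> \<kappa> * (2 * t * B)"
        using z_bd i t kappa_pos by (intro mult_left_mono) auto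
      finally have 1: "\<bar>q t i\<bar> \<le> \<kappa> * (2 * t * B)" .
      then show "\<bar>q t i\<bar> \<le> 2 * \<kappa> * t * B"
        by (simp add: mult_ac)
      have "\<kappa> * (2 * t * B) \<le> \<kappa> * (2 * t0 * B)"
        using t B kappa_pos by simp
      then show r': "\<bar>q t i\<bar> \<le> r"
        using 1 t0(3) by linarith
      have "\<bar>z t i - 2 * q t i / \<kappa>\<bar> \<le> \<eta>' * \<bar>q t i\<bar>"
        using r(2)[OF r'] psi_inv[OF z_tau[OF that]] by (simp add: q_def)
      also have "\<dots> \<le> \<eta>' * (\<kappa> * (2 * t * B))"
        using 1 eta' by (intro mult_left_mono) auto
      finally have "\<kappa> / 2 * \<bar>z t i - 2 * q t i / \<kappa>\<bar> \<le> \<kappa> / 2 * (\<eta>' * (\<kappa> * (2 * t * B)))"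
        using kappa_pos by (intro mult_left_mono) auto
      moreover have "\<kappa> / 2 * \<bar>z t i - 2 * q t i / \<kappa>\<bar> = \<bar>q t i - \<kappa> / 2 * z t i\<bar>"
      proof -
        have "\<kappa> / 2 * \<bar>z t i - 2 * q t i / \<kappa>\<bar> = \<bar>\<kappa> / 2 * (z t i - 2 * q t i / \<kappa>)\<bar>"
          using kappa_pos by (simp add: abs_mult)
        also have "\<kappa> / 2 * (z t i - 2 * q t i / \<kappa>) = - (q t i - \<kappa> / 2 * z t i)"
          using kappa_pos by (simp add: field_simps)
        finally show ?thesis
          by (simp only: abs_minus_cancel)
      qed
      moreover have "\<kappa> / 2 * (\<eta>' * (\<kappa> * (2 * t * B))) = e * t"
        by (simp add: e_def power2_eq_square mult_ac)
      ultimately show "\<bar>q t i - \<kappa> / 2 * z t i\<bar> \<le> e * t"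
        by (simp only:)
    qed
    \<comment> \<open>The shift \<open>c t\<close> is eliminated by averaging: the perturbations
      have mean zero, so \<open>\<kappa> / 2 * (t * m - c t)\<close> is itself bounded by the
      linearization error, whence the factor 2.\<close>
    have q_lin: "\<bar>q t i - \<kappa> / 2 * t * (y i - m)\<bar> \<le> 2 * e * t"
      if i: "i \<in> {1..n}" and t: "0 \<le> t" "t \<le> t0" for t i
    proof -
      have "sample_mean n (\<lambda>i. q t i - \<kappa> / 2 * z t i) = - (\<kappa> / 2 * (t * m - c t))"
        unfolding sample_mean_diff sample_mean_cmult q_sum z_def
        using n by (simp add: sample_mean_const m_def)
      moreover have "\<bar>sample_mean n (\<lambda>i. q t i - \<kappa> / 2 * z t i)\<bar> \<le> e * t"
        using n qs(3) t by (intro abs_sample_mean_le_const) auto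
      ultimately have "\<bar>\<kappa> / 2 * (t * m - c t)\<bar> \<le> e * t"
        by simp
      moreover have "q t i - \<kappa> / 2 * t * (y i - m) = (q t i - \<kappa> / 2 * z t i) + \<kappa> / 2 * (t * m - c t)"
        by (simp add: z_def field_simps)
      ultimately show ?thesis
        using qs(3)[OF that] by (simp add: abs_le_iff)
    qed
    have DD_est: "\<bar>DD t - \<kappa> * t\<^sup>2 * s\<^sup>2 / 4\<bar> \<le> e1 * t\<^sup>2" if t: "0 \<le> t" "t \<le> t0" for t
    proof -
      define a where "a i = \<kappa> / 2 * t * (y i - m)" for i
      have am: "sample_mean n (\<lambda>i. (a i)\<^sup>2) / \<kappa> = \<kappa> * t\<^sup>2 * s\<^sup>2 / 4"
      proof -
        have "sample_mean n (\<lambda>i. (a i)\<^sup>2) = (\<kappa> / 2 * t)\<^sup>2 * s\<^sup>2"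
          unfolding a_def power_mult_distrib[of "\<kappa> / 2 * t"] sample_mean_cmult s(2) sample_var_def m_def ..
        then show ?thesis
          using kappa_pos by (simp add: power2_eq_square field_simps)
      qed
      have "\<bar>sample_mean n (\<lambda>i. p (1 + q t i) - (a i)\<^sup>2 / \<kappa>)\<bar> \<le> e1 * t\<^sup>2"
      proof (rule abs_sample_mean_le_const[OF n])
        fix i assume i: "i \<in> {1..n}"
        have "\<bar>y i - m\<bar> \<le> 2 * B"
          using y i m by fastforce
        then have "\<kappa> / 2 * t * \<bar>y i - m\<bar> \<le> \<kappa> / 2 * t * (2 * B)"
          using t kappa_pos by (intro mult_left_mono) auto
        then have ab: "\<bar>a i\<bar> \<le> \<kappa> * t * B"
          using t kappa_pos by (simp add: a_def abs_mult mult_ac)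
        have d: "\<bar>q t i - a i\<bar> \<le> 2 * e * t"
          unfolding a_def by (rule q_lin[OF i t])
        have "\<bar>(q t i)\<^sup>2 - (a i)\<^sup>2\<bar> = \<bar>q t i - a i\<bar> * \<bar>q t i + a i\<bar>"
          by (simp add: abs_mult[symmetric] power2_eq_square algebra_simps)
        also have "\<dots> \<le> (2 * e * t) * (3 * \<kappa> * t * B)"
          using d ab qs(1)[OF i t] e(1) t by (intro mult_mono) (auto simp: abs_le_iff)
        finally have "\<bar>(q t i)\<^sup>2 - (a i)\<^sup>2\<bar> / \<kappa> \<le> (2 * e * t) * (3 * \<kappa> * t * B) / \<kappa>"
          using kappa_pos by (intro divide_right_mono) auto
        moreover have "\<bar>(q t i)\<^sup>2 - (a i)\<^sup>2\<bar> / \<kappa> = \<bar>(q t i)\<^sup>2 / \<kappa> - (a i)\<^sup>2 / \<kappa>\<bar>"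
          using kappa_pos by (simp add: abs_divide diff_divide_distrib[symmetric])
        moreover have "(2 * e * t) * (3 * \<kappa> * t * B) / \<kappa> = 6 * \<kappa>\<^sup>2 * B\<^sup>2 * \<eta>' * t\<^sup>2"
          using kappa_pos by (simp add: e_def power2_eq_square field_simps)
        ultimately have 1: "\<bar>(q t i)\<^sup>2 / \<kappa> - (a i)\<^sup>2 / \<kappa>\<bar> \<le> 6 * \<kappa>\<^sup>2 * B\<^sup>2 * \<eta>' * t\<^sup>2"
          by simp
        have "\<bar>p (1 + q t i) - (q t i)\<^sup>2 / \<kappa>\<bar> \<le> \<eta>' * (q t i)\<^sup>2"
          by (rule r(3)[OF qs(2)[OF i t]])
        also have "(q t i)\<^sup>2 \<le> (2 * \<kappa> * t * B)\<^sup>2"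
          using qs(1)[OF i t] by (intro abs_le_square_iff[THEN iffD1]) auto
        also have "\<eta>' * (2 * \<kappa> * t * B)\<^sup>2 = 4 * \<kappa>\<^sup>2 * B\<^sup>2 * \<eta>' * t\<^sup>2"
          by (simp add: power2_eq_square mult_ac)
        finally have 2: "\<bar>p (1 + q t i) - (q t i)\<^sup>2 / \<kappa>\<bar> \<le> 4 * \<kappa>\<^sup>2 * B\<^sup>2 * \<eta>' * t\<^sup>2"
          using eta' by (simp add: mult_left_mono)
        have "e1 * t\<^sup>2 = 6 * \<kappa>\<^sup>2 * B\<^sup>2 * \<eta>' * t\<^sup>2 + 4 * \<kappa>\<^sup>2 * B\<^sup>2 * \<eta>' * t\<^sup>2"
          by (simp add: e1_def)
        then show "\<bar>p (1 + q t i) - (a i)\<^sup>2 / \<kappa>\<bar> \<le> e1 * t\<^sup>2"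
          using 1 2 by linarith
      qed
      also have "sample_mean n (\<lambda>i. p (1 + q t i) - (a i)\<^sup>2 / \<kappa>) = DD t - \<kappa> * t\<^sup>2 * s\<^sup>2 / 4"
        unfolding sample_mean_diff DD_def am[symmetric] by (simp add: divide_inverse sample_mean_multc)
      finally show ?thesis .
    qed
    have DD_low: "\<kappa> * t\<^sup>2 * s0 / 8 \<le> DD t" if t: "0 \<le> t" "t \<le> t0" for t
    proof -
      have "e1 * t\<^sup>2 \<le> \<kappa> * s0 / 8 * t\<^sup>2"
        using e by (intro mult_right_mono) auto
      moreover have "\<kappa> * t\<^sup>2 * s0 \<le> \<kappa> * t\<^sup>2 * s\<^sup>2"
        using var s(2) kappa_pos by (intro mult_left_mono) auto
      moreover have "\<kappa> * s0 / 8 * t\<^sup>2 = \<kappa> * t\<^sup>2 * s0 / 8"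
        by simp
      ultimately show ?thesis
        using abs_le_D2[OF DD_est[OF t]] by linarith
    qed
    have "\<exists>t\<ge>0. t \<le> t0 \<and> DD t = \<delta>"
      by (rule IVT'[OF _ _ _ DD_cont]) (use DD0 del DD_low[of t0] t0 in auto)
    then obtain t where t: "0 \<le> t" "t \<le> t0" "DD t = \<delta>"
      by blast
    have t_pos: "t > 0"
      using t DD0 del by (cases "t = 0") auto
    define W where "W u = 1 + \<psi> (t * u - c t)" for u
    have Wq: "W (y i) = 1 + q t i" for i
      by (simp add: W_def q_def z_def)
    have W_cont: "continuous_on UNIV W"
      unfolding W_def[abs_def] by (intro continuous_intros continuous_on_compose2[OF psi(2)]) auto
    have W_mean: "sample_mean n (\<lambda>i. W (y i)) = 1"
      unfolding Wq sample_mean_add q_sum using n by (simp add: sample_mean_const)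
    have n0: "real n > 0"
      using n by simp
    have W_sum: "(\<Sum>i=1..n. p (W (y i))) = real n * \<delta>"
      using t(3) n0 unfolding DD_def sample_mean_def Wq by (simp add: field_simps)
    have W_phi: "\<phi> (W (y i)) = ennreal (p (W (y i)))" if "i \<in> {1..n}" for i
      using psi_fin[OF z_tau[OF that t(1,2)]] by (simp add: Wq q_def)
    have W_div: "(\<Sum>i=1..n. \<phi> (W (y i))) = ennreal (real n * \<delta>)"
    proof -
      have "(\<Sum>i=1..n. \<phi> (W (y i))) = (\<Sum>i=1..n. ennreal (p (W (y i))))"
        by (rule sum.cong) (auto intro: W_phi)
      also have "\<dots> = ennreal (\<Sum>i=1..n. p (W (y i)))"
        by (rule sum_ennreal) auto
      finally show ?thesis
        by (simp only: W_sum)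
    qed
    have W_half: "1 / 2 \<le> W (y i)" if "i \<in> {1..n}" for i
      using psi_half[OF z_tau[OF that t(1,2)]] by (simp add: Wq q_def abs_le_iff)
    \<comment> \<open>Weak duality. Summing the tangent inequalities at \<open>W (y i)\<close> with
      slopes \<open>z t i\<close>, and using that \<open>W\<close> exhausts the divergence budget,
      shows that the mean of \<open>z t i * (w i - W (y i))\<close> is at most 0. The multiplier
      \<open>c t\<close> cancels because both weights have mean 1, and \<open>t > 0\<close> is
      divided out.\<close>
    have opt: "sample_mean n (\<lambda>i. w i * y i) \<le> sample_mean n (\<lambda>i. W (y i) * y i)"
      if w: "sample_mean n w = 1" "(\<Sum>i=1..n. \<phi> (w i)) \<le> ennreal (real n * \<delta>)" for w
    proof -
      have fin: "ennreal (p (w i)) = \<phi> (w i)" if "i \<in> {1..n}" for i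
      proof -
        have "(\<Sum>i=1..n. \<phi> (w i)) < \<top>"
          using w(2) by (rule le_less_trans) simp
        then have "\<phi> (w i) < \<top>"
          using that by (auto simp: less_top)
        then show ?thesis
          by (simp add: less_top)
      qed
      have ptw: "p (w i) \<ge> p (W (y i)) + z t i * (w i - W (y i))" if i: "i \<in> {1..n}" for i
      proof -
        have "ennreal (p (W (y i)) + z t i * (w i - W (y i))) \<le> ennreal (p (w i))"
          using psi_tan[OF z_tau[OF i t(1,2)], of "w i"] fin[OF i] by (simp add: Wq q_def)
        then show ?thesis
          by (simp add: ennreal_le_iff)
      qed
      have "ennreal (\<Sum>i=1..n. p (w i)) = (\<Sum>i=1..n. \<phi> (w i))"
        by (subst sum_ennreal[symmetric]) (auto simp: fin intro!: sum.cong)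
      then have "ennreal (\<Sum>i=1..n. p (w i)) \<le> ennreal (real n * \<delta>)"
        using w(2) by simp
      then have "(\<Sum>i=1..n. p (w i)) \<le> real n * \<delta>"
        using del by (subst (asm) ennreal_le_iff) auto
      moreover have "(\<Sum>i=1..n. p (W (y i)) + z t i * (w i - W (y i))) \<le> (\<Sum>i=1..n. p (w i))"
        by (intro sum_mono ptw)
      ultimately have "(\<Sum>i=1..n. z t i * (w i - W (y i))) \<le> 0"
        using W_sum unfolding sum.distrib by linarith
      then have "sample_mean n (\<lambda>i. z t i * (w i - W (y i))) \<le> 0"
        unfolding sample_mean_def by (simp add: divide_nonpos_nonneg)
      moreover have "sample_mean n (\<lambda>i. z t i * (w i - W (y i)))
          = sample_mean n (\<lambda>i. (t * (w i * y i) - t * (W (y i) * y i)) - (c t * w i - c t * W (y i)))"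
        by (rule sample_mean_cong) (simp add: z_def algebra_simps)
      moreover have "\<dots> = t * (sample_mean n (\<lambda>i. w i * y i) - sample_mean n (\<lambda>i. W (y i) * y i))"
        unfolding sample_mean_diff sample_mean_cmult w(1) W_mean by (simp add: algebra_simps)
      ultimately show ?thesis
        using t_pos by (simp add: mult_le_0_iff)
    qed
    have approx: "\<bar>W (y i) - 1 - sqrt (\<kappa> * \<delta>) * (y i - m) / s\<bar> \<le> \<eta> * sqrt \<delta>" if i: "i \<in> {1..n}" for i
    proof -
      \<comment> \<open>The square of \<open>b\<close> is the leading term of the divergence
        \<open>DD t\<close>, so \<open>b\<close> approximates \<open>sqrt \<delta>\<close>;
        exchanging the two turns the coefficient \<open>\<kappa> / 2 * t\<close> into
        \<open>sqrt (\<kappa> * \<delta>) / s\<close>.\<close>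
      define b where "b = sqrt \<kappa> * s * t / 2"
      have b: "b > 0"
        using kappa_pos s t_pos by (simp add: b_def)
      have b2: "b\<^sup>2 = \<kappa> * t\<^sup>2 * s\<^sup>2 / 4"
        using kappa_pos by (simp add: b_def power_mult_distrib power_divide)
      have "\<bar>sqrt \<delta> - b\<bar> * b \<le> \<bar>sqrt \<delta> - b\<bar> * (sqrt \<delta> + b)"
        using del b by (intro mult_left_mono) auto
      also have "\<dots> = \<bar>(sqrt \<delta>)\<^sup>2 - b\<^sup>2\<bar>"
      proof -
        have "(sqrt \<delta>)\<^sup>2 - b\<^sup>2 = (sqrt \<delta> - b) * (sqrt \<delta> + b)"
          by (simp only: power2_eq_square square_diff_square_factored mult.commute)
        moreover have "\<bar>sqrt \<delta> + b\<bar> = sqrt \<delta> + b"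
          using del b by simp
        ultimately show ?thesis
          by (simp only: abs_mult)
      qed
      also have "\<dots> \<le> e1 * t\<^sup>2"
        using DD_est[OF t(1,2)] del by (simp add: t(3) b2)
      finally have d1: "\<bar>sqrt \<delta> - b\<bar> * b \<le> e1 * t\<^sup>2" .
      have "\<bar>sqrt \<delta> - b\<bar> * (sqrt \<kappa> / s) \<le> 2 * e1 * t / s0"
      proof -
        have "\<bar>sqrt \<delta> - b\<bar> * (sqrt \<kappa> / s) = \<bar>sqrt \<delta> - b\<bar> * b * (2 / (s\<^sup>2 * t))"
          using s(1) t_pos by (simp add: b_def power2_eq_square)
        also have "\<dots> \<le> e1 * t\<^sup>2 * (2 / (s\<^sup>2 * t))"
          using d1 s(1) t_pos by (intro mult_right_mono) auto
        also have "\<dots> = 2 * e1 * t / s\<^sup>2"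
          using t_pos by (simp add: power2_eq_square)
        also have "\<dots> \<le> 2 * e1 * t / s0"
          using var s0 e t_pos by (intro divide_left_mono) (auto simp: s(2))
        finally show ?thesis .
      qed
      then have d2: "\<bar>sqrt \<delta> - b\<bar> * (sqrt \<kappa> / s) * \<bar>y i - m\<bar> \<le> 2 * e1 * t / s0 * (2 * B)"
        using y i m e t_pos s0 kappa_pos s(1) by (intro mult_mono) (fastforce intro!: divide_nonneg_nonneg mult_nonneg_nonneg)+
      have "\<bar>W (y i) - 1 - sqrt (\<kappa> * \<delta>) * (y i - m) / s\<bar> =
          \<bar>(q t i - \<kappa> / 2 * t * (y i - m)) - (sqrt \<delta> - b) * (sqrt \<kappa> / s) * (y i - m)\<bar>"
      proof -
        have "b * (sqrt \<kappa> / s) = \<kappa> / 2 * t"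
          using s(1) kappa_pos by (simp add: b_def)
        moreover have "sqrt \<delta> * (sqrt \<kappa> / s) = sqrt (\<kappa> * \<delta>) / s"
          by (simp add: real_sqrt_mult mult.commute)
        ultimately have "(sqrt \<delta> - b) * (sqrt \<kappa> / s) = sqrt (\<kappa> * \<delta>) / s - \<kappa> / 2 * t"
          by (simp only: left_diff_distrib)
        then show ?thesis
          by (simp add: Wq left_diff_distrib)
      qed
      also have "\<dots> \<le> \<bar>q t i - \<kappa> / 2 * t * (y i - m)\<bar> + \<bar>(sqrt \<delta> - b) * (sqrt \<kappa> / s) * (y i - m)\<bar>"
        by (rule abs_triangle_ineq4)
      also have "\<bar>(sqrt \<delta> - b) * (sqrt \<kappa> / s) * (y i - m)\<bar> = \<bar>sqrt \<delta> - b\<bar> * (sqrt \<kappa> / s) * \<bar>y i - m\<bar>"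
        using s(1) kappa_pos by (simp add: abs_mult)
      also have "\<bar>q t i - \<kappa> / 2 * t * (y i - m)\<bar> + \<dots> \<le> 2 * e * t + 2 * e1 * t / s0 * (2 * B)"
        using q_lin[OF i t(1,2)] d2 by linarith
      also have "\<dots> = C1 * \<eta>' * t"
        using s0 by (simp add: C1_def e_def e1_def field_simps power2_eq_square power3_eq_cube)
      also have "\<dots> \<le> C1 * \<eta>' * (C2 * sqrt \<delta>)"
      proof -
        have "t\<^sup>2 \<le> 8 / (\<kappa> * s0) * \<delta>"
          using DD_low[OF t(1,2)] t(3) kappa_pos s0 by (simp add: field_simps)
        then have "sqrt (t\<^sup>2) \<le> sqrt (8 / (\<kappa> * s0) * \<delta>)"
          by (rule real_sqrt_le_mono)
        then have "t \<le> C2 * sqrt \<delta>"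
          using t_pos unfolding C2_def real_sqrt_mult[symmetric] by simp
        then show ?thesis
          using C eta' by (intro mult_left_mono) auto
      qed
      also have "\<dots> = \<eta>' * (C1 * C2) * sqrt \<delta>"
        by (simp add: mult_ac)
      also have "\<dots> \<le> \<eta> * sqrt \<delta>"
        using eta'(3) del by (intro mult_right_mono) auto
      finally show ?thesis .
    qed
    show "\<exists>W::real\<Rightarrow>real. continuous_on UNIV W \<and> (\<forall>i\<in>{1..n}. 1 / 2 \<le> W (y i)) \<and>
       sample_mean n (\<lambda>i. W (y i)) = 1 \<and> (\<Sum>i=1..n. \<phi> (W (y i))) \<le> ennreal (real n * \<delta>) \<and>
       (\<forall>i\<in>{1..n}. \<bar>W (y i) - 1 - sqrt (\<kappa> * \<delta>) * (y i - sample_mean n y) / sqrt (sample_var n y)\<bar> \<le> \<eta> * sqrt \<delta>) \<and>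
       (\<forall>w. sample_mean n w = 1 \<and> (\<Sum>i=1..n. \<phi> (w i)) \<le> ennreal (real n * \<delta>) \<longrightarrow>
          sample_mean n (\<lambda>i. w i * y i) \<le> sample_mean n (\<lambda>i. W (y i) * y i))"
      using W_cont W_half W_mean W_div approx opt unfolding m_def s_def
      by (intro exI[of _ W]) auto
  qed
qed

end

section \<open>The robust loss of an empirical measure\<close>

lemma sets_empirical: "sets (empirical_measure P xs n) = sets P"
  by (simp add: empirical_measure_def)

lemma measurable_empirical: "borel_measurable (empirical_measure P xs n) = borel_measurable P"
  by (intro measurable_cong_sets sets_empirical refl)

context
  fixes P :: "'x measure" and xs :: "nat \<Rightarrow> 'x" and n :: nat
  assumes xs: "xs \<in> {1..n} \<rightarrow> space P" and n: "n \<ge> 1"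
begin

lemma xs_measurable: "xs \<in> measurable (uniform_count_measure {1..n}) P"
  using xs by (auto intro: measurable_count_space_eq1[THEN iffD2]
      simp: measurable_cong_sets[OF sets_uniform_count_measure_count_space refl])

lemma prob_space_empirical: "prob_space (empirical_measure P xs n)"
  unfolding empirical_measure_def
  by (intro prob_space.prob_space_distr prob_space_uniform_count_measure xs_measurable) (use n in auto)

lemma integral_empirical:
  fixes f :: "'x \<Rightarrow> real"
  assumes "f \<in> borel_measurable P"
  shows "(\<integral>x. f x \<partial>empirical_measure P xs n) = sample_mean n (\<lambda>i. f (xs i))"
  unfolding empirical_measure_def sample_mean_def
  by (subst integral_distr[OF xs_measurable assms]) (simp add: integral_uniform_count_measure)

text \<open>Each sample point carries mass at least \<open>1 / n\<close>, so a null set of the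
  empirical measure contains none of them.\<close>

lemma AE_empirical:
  assumes "AE x in empirical_measure P xs n. Q x" and i: "i \<in> {1..n}"
  shows "Q (xs i)"
proof -
  obtain N where N: "N \<in> null_sets (empirical_measure P xs n)" "{x \<in> space P. \<not> Q x} \<subseteq> N"
    using assms(1) unfolding eventually_ae_filter by (auto simp: empirical_measure_def)
  have Ns: "N \<in> sets P"
    using null_setsD2[OF N(1)] by (simp add: sets_empirical)
  have "0 = emeasure (empirical_measure P xs n) N"
    using N(1) by auto
  also have "\<dots> = emeasure (uniform_count_measure {1..n}) (xs -` N \<inter> {1..n})"
    unfolding empirical_measure_def
    by (subst emeasure_distr[OF xs_measurable Ns]) (simp add: space_uniform_count_measure)
  also have "\<dots> = ennreal (real (card (xs -` N \<inter> {1..n})) / real n)"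
    by (subst emeasure_uniform_count_measure) auto
  finally have "xs -` N \<inter> {1..n} = {}"
    using n by (simp add: divide_le_0_iff)
  then have "xs i \<notin> N"
    using i by blast
  then show ?thesis
    using N(2) xs i by blast
qed

lemma nn_integral_empirical:
  assumes f: "f \<in> borel_measurable P"
  shows "(\<integral>\<^sup>+x. f x \<partial>empirical_measure P xs n) = (\<Sum>i=1..n. f (xs i)) / ennreal (real n)"
proof -
  have "(\<integral>\<^sup>+x. f x \<partial>empirical_measure P xs n) = (\<integral>\<^sup>+i. f (xs i) \<partial>uniform_count_measure {1..n})"
    unfolding empirical_measure_def by (rule nn_integral_distr[OF xs_measurable]) (simp add: f)
  also have "\<dots> = (\<Sum>i=1..n. ennreal (1 / real n) * f (xs i))"
    unfolding uniform_count_measure_def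
    by (subst nn_integral_point_measure_finite) (auto simp: mult.commute)
  also have "\<dots> = (\<Sum>i=1..n. f (xs i)) / ennreal (real n)"
    using n by (subst sum_distrib_left[symmetric])
      (simp add: divide_ennreal_def inverse_ennreal inverse_eq_divide mult.commute)
  finally show ?thesis .
qed

end

context divergence_generator
begin

text \<open>Sublevel sets of a convex function on the line are intervals, hence Borel sets.\<close>

lemma borel_measurable_phi: "\<phi> \<in> borel_measurable borel"
proof (rule borel_measurableI_le)
  fix a
  have "is_interval {t. \<phi> t \<le> a}"
    unfolding is_interval_convex_1
  proof (rule convexI)
    fix x y :: real and u v :: real
    assume xy: "x \<in> {t. \<phi> t \<le> a}" "y \<in> {t. \<phi> t \<le> a}" and uv: "0 \<le> u" "0 \<le> v" "u + v = 1"
    have v: "v = 1 - u"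
      using uv by simp
    have "\<phi> (u * x + (1 - u) * y) \<le> ennreal u * \<phi> x + ennreal (1 - u) * \<phi> y"
      using phi_convex uv by (auto simp: ennreal_convex_def)
    also have "\<dots> \<le> ennreal u * a + ennreal (1 - u) * a"
      using xy by (intro add_mono mult_left_mono) auto
    also have "\<dots> = ennreal (u + (1 - u)) * a"
      using uv by (subst ennreal_plus) (auto simp: distrib_right)
    finally show "u *\<^sub>R x + v *\<^sub>R y \<in> {t. \<phi> t \<le> a}"
      by (simp add: v)
  qed
  then show "{x \<in> space borel. \<phi> x \<le> a} \<in> sets borel"
    using real_interval_borel_measurable by simp
qed

text \<open>Only the values of the density at the sample points enter the divergence. Multiplying
  the constraint by \<open>n\<close> avoids division in \<open>ennreal\<close>.\<close>

lemma phi_divergence_empirical: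
  assumes xs: "xs \<in> {1..n} \<rightarrow> space P" and n: "n \<ge> 1"
    and w: "\<And>i. i \<in> {1..n} \<Longrightarrow> enn2real (RN_deriv (empirical_measure P xs n) Q (xs i)) = w i"
    and delta: "\<delta> \<ge> 0"
  shows "phi_divergence \<phi> Q (empirical_measure P xs n) \<le> ennreal \<delta> \<longleftrightarrow>
    (\<Sum>i=1..n. \<phi> (w i)) \<le> ennreal (real n * \<delta>)"
proof -
  let ?R = "empirical_measure P xs n"
  have "(\<lambda>x. \<phi> (enn2real (RN_deriv ?R Q x))) \<in> borel_measurable ?R"
    by (rule measurable_compose[OF _ borel_measurable_phi]) measurable
  then have m: "(\<lambda>x. \<phi> (enn2real (RN_deriv ?R Q x))) \<in> borel_measurable P"
    using measurable_empirical by blast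
  have "phi_divergence \<phi> Q ?R = (\<Sum>i=1..n. \<phi> (w i)) / ennreal (real n)"
    unfolding phi_divergence_def nn_integral_empirical[OF xs n m]
    by (intro arg_cong2[where f = divide] sum.cong) (auto simp: w)
  moreover have "ennreal (real n * \<delta>) = ennreal \<delta> * ennreal (real n)"
    using delta by (simp add: ennreal_mult mult.commute)
  moreover have "a / ennreal (real n) \<le> ennreal \<delta> \<longleftrightarrow> a \<le> ennreal \<delta> * ennreal (real n)" for a
    using n delta by (cases a)
      (auto simp: divide_ennreal ennreal_mult[symmetric] field_simps ennreal_top_divide ennreal_mult_less_top top_unique)
  ultimately show ?thesis
    by simp
qed

text \<open>The weights are the values of the Radon-Nikodym derivative at the sample points. It is
  finite almost everywhere with respect to the empirical measure, so passing to real values loses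
  nothing.\<close>

lemma ambiguity_set_weights:
  assumes xs: "xs \<in> {1..n} \<rightarrow> space P" and n: "n \<ge> 1" and delta: "\<delta> \<ge> 0"
    and Q: "Q \<in> ambiguity_set \<phi> \<delta> (empirical_measure P xs n)"
  obtains w where "sample_mean n w = 1" "(\<Sum>i=1..n. \<phi> (w i)) \<le> ennreal (real n * \<delta>)"
    "\<And>f. f \<in> borel_measurable P \<Longrightarrow> (\<integral>x. f x \<partial>Q) = sample_mean n (\<lambda>i. w i * f (xs i))"
proof -
  let ?R = "empirical_measure P xs n"
  interpret R: prob_space ?R
    by (rule prob_space_empirical[OF xs n])
  have Q': "prob_space Q" "sets Q = sets ?R" "absolutely_continuous ?R Q" "phi_divergence \<phi> Q ?R \<le> ennreal \<delta>"
    using Q by (auto simp: ambiguity_set_def)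
  interpret Q: prob_space Q by fact
  define w where "w x = enn2real (RN_deriv ?R Q x)" for x
  have wm: "w \<in> borel_measurable ?R"
    unfolding w_def by measurable
  have "Q = density ?R (RN_deriv ?R Q)"
    using R.density_RN_deriv Q' by simp
  also have "\<dots> = density ?R (\<lambda>x. ennreal (w x))"
    using R.RN_deriv_finite[OF Q.sigma_finite_measure_axioms Q'(3,2)] wm
    by (intro density_cong) (auto simp: w_def less_top elim!: eventually_mono)
  finally have Qd: "Q = density ?R (\<lambda>x. ennreal (w x))" .
  have int: "(\<integral>x. f x \<partial>Q) = sample_mean n (\<lambda>i. w (xs i) * f (xs i))" if f: "f \<in> borel_measurable P" for f
  proof -
    have fR: "f \<in> borel_measurable ?R"
      using f measurable_empirical by blast
    have "(\<lambda>x. w x * f x) \<in> borel_measurable ?R"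
      using fR wm by measurable
    then have wf: "(\<lambda>x. w x * f x) \<in> borel_measurable P"
      using measurable_empirical by blast
    have "(\<integral>x. f x \<partial>Q) = (\<integral>x. w x * f x \<partial>?R)"
      by (subst Qd, subst integral_real_density) (use fR wm in \<open>auto simp: w_def\<close>)
    then show ?thesis
      using integral_empirical[OF xs n wf] by simp
  qed
  show ?thesis
  proof (rule that[of "\<lambda>i. w (xs i)"])
    show "sample_mean n (\<lambda>i. w (xs i)) = 1"
      using int[of "\<lambda>_. 1"] Q.prob_space by simp
    show "(\<Sum>i=1..n. \<phi> (w (xs i))) \<le> ennreal (real n * \<delta>)"
      using phi_divergence_empirical[OF xs n _ delta, of Q "\<lambda>i. w (xs i)"] Q'(4) by (simp add: w_def)
  qed (rule int)
qed

text \<open>The converse takes weights that are a function of the point, not of the index: if two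
  sample points coincide, weights chosen separately would not define a density. For this reason the
  optimal weights come as a function \<open>W\<close> of the loss value.\<close>

lemma weights_ambiguity_set:
  assumes xs: "xs \<in> {1..n} \<rightarrow> space P" and n: "n \<ge> 1" and delta: "\<delta> \<ge> 0"
    and wm: "w \<in> borel_measurable P" and w0: "\<And>x. 0 \<le> w x"
    and w1: "sample_mean n (\<lambda>i. w (xs i)) = 1"
    and wphi: "(\<Sum>i=1..n. \<phi> (w (xs i))) \<le> ennreal (real n * \<delta>)"
  obtains Q where "Q \<in> ambiguity_set \<phi> \<delta> (empirical_measure P xs n)"
    "\<And>f. f \<in> borel_measurable P \<Longrightarrow> (\<integral>x. f x \<partial>Q) = sample_mean n (\<lambda>i. w (xs i) * f (xs i))"
proof -
  let ?R = "empirical_measure P xs n"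
  interpret R: prob_space ?R
    by (rule prob_space_empirical[OF xs n])
  define Q where "Q = density ?R (\<lambda>x. ennreal (w x))"
  have wR: "w \<in> borel_measurable ?R"
    using wm measurable_empirical by blast
  have setsQ: "sets Q = sets ?R"
    by (simp add: Q_def)
  have "emeasure Q (space Q) = (\<integral>\<^sup>+x. ennreal (w x) \<partial>?R)"
    unfolding Q_def using wR by (subst emeasure_density) (auto intro!: nn_integral_cong)
  also have "\<dots> = (\<Sum>i=1..n. ennreal (w (xs i))) / ennreal (real n)"
    by (rule nn_integral_empirical[OF xs n]) (use wm in measurable)
  also have "(\<Sum>i=1..n. ennreal (w (xs i))) = ennreal (\<Sum>i=1..n. w (xs i))"
    using w0 by (intro sum_ennreal) auto
  also have "(\<Sum>i=1..n. w (xs i)) = real n"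
    using w1 n by (simp add: sample_mean_def)
  also have "ennreal (real n) / ennreal (real n) = 1"
    using n by (intro ennreal_divide_self) auto
  finally have pQ: "prob_space Q"
    by (rule prob_spaceI)
  have "AE x in ?R. ennreal (w x) = RN_deriv ?R Q x"
    by (rule R.RN_deriv_unique) (use wR in \<open>auto simp: Q_def\<close>)
  then have RN: "enn2real (RN_deriv ?R Q (xs i)) = w (xs i)" if "i \<in> {1..n}" for i
    using AE_empirical[OF xs n, of "\<lambda>x. ennreal (w x) = RN_deriv ?R Q x" i] that w0
    by (metis enn2real_ennreal)
  show ?thesis
  proof (rule that[of Q])
    have "absolutely_continuous ?R Q"
      unfolding Q_def by (rule absolutely_continuousI_density) (use wR in measurable)
    then show "Q \<in> ambiguity_set \<phi> \<delta> ?R"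
      using pQ setsQ phi_divergence_empirical[OF xs n RN delta] wphi by (auto simp: ambiguity_set_def)
    fix f :: "'a \<Rightarrow> real" assume f: "f \<in> borel_measurable P"
    have fR: "f \<in> borel_measurable ?R"
      using f measurable_empirical by blast
    have wf: "(\<lambda>x. w x * f x) \<in> borel_measurable P"
      using f wm by measurable
    have "(\<integral>x. f x \<partial>Q) = (\<integral>x. w x * f x \<partial>?R)"
      unfolding Q_def by (subst integral_real_density) (use fR wR w0 in auto)
    then show "(\<integral>x. f x \<partial>Q) = sample_mean n (\<lambda>i. w (xs i) * f (xs i))"
      using integral_empirical[OF xs n wf] by simp
  qed
qed

text \<open>Tangents with slopes \<open>sqrt \<delta>\<close> and \<open>- sqrt \<delta>\<close>
  give \<open>sqrt \<delta> * \<bar>w i - 1\<bar> \<le> p (w i) + \<kappa> * \<delta>\<close>.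
  Averaging against the budget \<open>\<delta>\<close> and dividing by \<open>sqrt \<delta>\<close>
  yields the bound, for every admissible reweighting and not only for the optimal one.\<close>

lemma weights_deviation:
  obtains \<delta>0 where "\<delta>0 > 0"
    "\<And>\<delta> n w. \<lbrakk>0 < \<delta>; \<delta> < \<delta>0; n \<ge> 1; (\<Sum>i=1..n. \<phi> (w i)) \<le> ennreal (real n * \<delta>)\<rbrakk> \<Longrightarrow>
       sample_mean n (\<lambda>i. \<bar>w i - 1\<bar>) \<le> (1 + \<kappa>) * sqrt \<delta>"
proof -
  obtain \<psi> \<tau> where tau: "\<tau> > 0"
    and psi_bd: "\<And>y. \<bar>y\<bar> \<le> \<tau> \<Longrightarrow> \<bar>\<psi> y\<bar> \<le> \<kappa> * \<bar>y\<bar>"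
    and psi_tan: "\<And>y t. \<bar>y\<bar> \<le> \<tau> \<Longrightarrow> ennreal (p (1 + \<psi> y) + y * (t - (1 + \<psi> y))) \<le> \<phi> t"
    using deriv_inverse by metis
  show ?thesis
  proof (rule that[of "\<tau>\<^sup>2"])
    show "\<tau>\<^sup>2 > 0" using tau by simp
    fix \<delta> :: real and n :: nat and w
    assume d: "0 < \<delta>" "\<delta> < \<tau>\<^sup>2" and n: "n \<ge> 1" and w: "(\<Sum>i=1..n. \<phi> (w i)) \<le> ennreal (real n * \<delta>)"
    define s where "s = sqrt \<delta>"
    have s: "s > 0" "s\<^sup>2 = \<delta>" "s \<le> \<tau>"
      using d tau by (auto simp: s_def intro: real_le_lsqrt)
    have tan: "y * (t - 1) - \<kappa> * s\<^sup>2 \<le> p t" if y: "\<bar>y\<bar> = s" and fin: "\<phi> t < \<top>" for y t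
    proof -
      have "ennreal (p (1 + \<psi> y) + y * (t - (1 + \<psi> y))) \<le> ennreal (p t)"
        using psi_tan[of y t] y s fin by simp
      then have "p (1 + \<psi> y) + y * (t - (1 + \<psi> y)) \<le> p t"
        by (simp add: ennreal_le_iff)
      moreover have "0 \<le> p (1 + \<psi> y)"
        by simp
      moreover have "y * \<psi> y \<le> \<kappa> * s\<^sup>2"
      proof -
        have "y * \<psi> y \<le> \<bar>y\<bar> * \<bar>\<psi> y\<bar>"
          by (metis abs_ge_self abs_mult)
        also have "\<dots> \<le> s * (\<kappa> * s)"
          using psi_bd[of y] y s by (intro mult_mono) auto
        finally show ?thesis
          by (simp add: power2_eq_square mult_ac)
      qed
      moreover have "y * (t - (1 + \<psi> y)) = y * (t - 1) - y * \<psi> y"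
        by (simp add: algebra_simps)
      ultimately show ?thesis
        by linarith
    qed
    have fin: "\<phi> (w i) < \<top>" if "i \<in> {1..n}" for i
    proof -
      have "(\<Sum>i=1..n. \<phi> (w i)) < \<top>"
        using w by (rule le_less_trans) simp
      then show ?thesis
        using that by (auto simp: less_top)
    qed
    have "ennreal (\<Sum>i=1..n. p (w i)) = (\<Sum>i=1..n. \<phi> (w i))"
      by (subst sum_ennreal[symmetric]) (use fin in \<open>auto intro!: sum.cong\<close>)
    then have "ennreal (\<Sum>i=1..n. p (w i)) \<le> ennreal (real n * \<delta>)"
      using w by simp
    then have "(\<Sum>i=1..n. p (w i)) \<le> real n * \<delta>"
      using d by (subst (asm) ennreal_le_iff) auto
    then have pm: "sample_mean n (\<lambda>i. p (w i)) \<le> \<delta>"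
      using n by (simp add: sample_mean_def field_simps)
    have "s * \<bar>w i - 1\<bar> \<le> p (w i) + \<kappa> * s\<^sup>2" if "i \<in> {1..n}" for i
      using tan[OF _ fin[OF that], of s] tan[OF _ fin[OF that], of "-s"] s(1)
      by (cases "w i \<ge> 1") (auto simp: right_diff_distrib)
    then have "sample_mean n (\<lambda>i. s * \<bar>w i - 1\<bar>) \<le> sample_mean n (\<lambda>i. p (w i) + \<kappa> * s\<^sup>2)"
      by (rule sample_mean_mono)
    then have "s * sample_mean n (\<lambda>i. \<bar>w i - 1\<bar>) \<le> s * ((1 + \<kappa>) * s)"
      using pm s(2) n by (simp add: sample_mean_cmult sample_mean_add sample_mean_const algebra_simps power2_eq_square)
    then show "sample_mean n (\<lambda>i. \<bar>w i - 1\<bar>) \<le> (1 + \<kappa>) * sqrt \<delta>"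
      using s(1) by (simp add: s_def)
  qed
qed

text \<open>These two rules replace the supremum over measures by weights: an upper bound is tested
  against all admissible weights, a lower bound needs a single one that is a function on the data
  space.\<close>

lemma
  assumes xs: "xs \<in> {1..n} \<rightarrow> space P" and n: "n \<ge> 1" and delta: "\<delta> > 0"
    and lm: "(\<lambda>x. l x \<theta>) \<in> borel_measurable P"
  shows robust_loss_upper: "(\<And>w. sample_mean n w = 1 \<Longrightarrow> (\<Sum>i=1..n. \<phi> (w i)) \<le> ennreal (real n * \<delta>) \<Longrightarrow>
        sample_mean n (\<lambda>i. w i * l (xs i) \<theta>) \<le> a) \<Longrightarrow> robust_loss \<phi> l (empirical_measure P xs n) \<delta> \<theta> \<le> a"
    and robust_loss_lower: "\<lbrakk>w \<in> borel_measurable P; \<And>x. 0 \<le> w x; sample_mean n (\<lambda>i. w (xs i)) = 1;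
        (\<Sum>i=1..n. \<phi> (w (xs i))) \<le> ennreal (real n * \<delta>)\<rbrakk> \<Longrightarrow>
        sample_mean n (\<lambda>i. w (xs i) * l (xs i) \<theta>) \<le> robust_loss \<phi> l (empirical_measure P xs n) \<delta> \<theta>"
proof -
  let ?R = "empirical_measure P xs n"
  have d0: "\<delta> \<ge> 0" using delta by simp
  \<comment> \<open>The density 1 is admissible since \<open>\<phi> 1 = 0\<close>, so the supremum
    is over a nonempty set.\<close>
  obtain Q0 where Q0: "Q0 \<in> ambiguity_set \<phi> \<delta> ?R"
    by (rule weights_ambiguity_set[OF xs n d0, of "\<lambda>_. 1"]) (use n in \<open>auto simp: sample_mean_const phi_one\<close>)
  show "robust_loss \<phi> l ?R \<delta> \<theta> \<le> a"
    if a: "\<And>w. sample_mean n w = 1 \<Longrightarrow> (\<Sum>i=1..n. \<phi> (w i)) \<le> ennreal (real n * \<delta>) \<Longrightarrow>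
        sample_mean n (\<lambda>i. w i * l (xs i) \<theta>) \<le> a"
    unfolding robust_loss_def
  proof (rule cSUP_least)
    show "ambiguity_set \<phi> \<delta> ?R \<noteq> {}" using Q0 by blast
    fix Q assume "Q \<in> ambiguity_set \<phi> \<delta> ?R"
    from ambiguity_set_weights[OF xs n d0 this] obtain w where w: "sample_mean n w = 1"
      "(\<Sum>i=1..n. \<phi> (w i)) \<le> ennreal (real n * \<delta>)"
      "\<And>f. f \<in> borel_measurable P \<Longrightarrow> (\<integral>x. f x \<partial>Q) = sample_mean n (\<lambda>i. w i * f (xs i))"
      by metis
    show "loss_mean Q l \<theta> \<le> a"
      unfolding loss_mean_def w(3)[OF lm] by (rule a[OF w(1,2)])
  qed
  \<comment> \<open>A real supremum is meaningful only for a set bounded above. The weights are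
    nonnegative, because \<open>\<phi>\<close> is infinite on negative arguments, and have mean 1,
    so the sum of all absolute losses is a bound.\<close>
  have "bdd_above ((\<lambda>Q. loss_mean Q l \<theta>) ` ambiguity_set \<phi> \<delta> ?R)"
  proof (rule bdd_aboveI2)
    fix Q assume "Q \<in> ambiguity_set \<phi> \<delta> ?R"
    from ambiguity_set_weights[OF xs n d0 this] obtain w where w: "sample_mean n w = 1"
      "(\<Sum>i=1..n. \<phi> (w i)) \<le> ennreal (real n * \<delta>)"
      "\<And>f. f \<in> borel_measurable P \<Longrightarrow> (\<integral>x. f x \<partial>Q) = sample_mean n (\<lambda>i. w i * f (xs i))"
      by metis
    define b where "b = (\<Sum>i=1..n. \<bar>l (xs i) \<theta>\<bar>)"
    have "(\<Sum>i=1..n. \<phi> (w i)) < \<top>"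
      using w(2) by (rule le_less_trans) simp
    then have w0: "0 \<le> w i" if "i \<in> {1..n}" for i
      using that phi_neg[of "w i"] by (cases "w i < 0") (auto simp: less_top[symmetric])
    have "loss_mean Q l \<theta> = sample_mean n (\<lambda>i. w i * l (xs i) \<theta>)"
      unfolding loss_mean_def by (rule w(3)[OF lm])
    also have "\<dots> \<le> sample_mean n (\<lambda>i. w i * b)"
    proof (intro sample_mean_mono mult_left_mono w0)
      fix i assume "i \<in> {1..n}"
      then have "\<bar>l (xs i) \<theta>\<bar> \<le> b"
        unfolding b_def by (intro member_le_sum) auto
      then show "l (xs i) \<theta> \<le> b" by simp
    qed
    finally show "loss_mean Q l \<theta> \<le> (\<Sum>i=1..n. \<bar>l (xs i) \<theta>\<bar>)"
      by (simp add: sample_mean_multc w(1) b_def)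
  qed
  note bdd = this
  show "sample_mean n (\<lambda>i. w (xs i) * l (xs i) \<theta>) \<le> robust_loss \<phi> l ?R \<delta> \<theta>"
    if "w \<in> borel_measurable P" "\<And>x. 0 \<le> w x" "sample_mean n (\<lambda>i. w (xs i)) = 1"
      "(\<Sum>i=1..n. \<phi> (w (xs i))) \<le> ennreal (real n * \<delta>)"
  proof -
    from weights_ambiguity_set[OF xs n d0 that] obtain Q where Q: "Q \<in> ambiguity_set \<phi> \<delta> ?R"
      "\<And>f. f \<in> borel_measurable P \<Longrightarrow> (\<integral>x. f x \<partial>Q) = sample_mean n (\<lambda>i. w (xs i) * f (xs i))"
      by metis
    have "sample_mean n (\<lambda>i. w (xs i) * l (xs i) \<theta>) = loss_mean Q l \<theta>"
      unfolding loss_mean_def by (rule Q(2)[OF lm, symmetric])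
    also have "\<dots> \<le> robust_loss \<phi> l ?R \<delta> \<theta>"
      unfolding robust_loss_def by (rule cSUP_upper[OF Q(1) bdd])
    finally show ?thesis .
  qed
qed

text \<open>On average the weights deviate from 1 by \<open>O(sqrt \<delta>)\<close>, and the loss
  is at most \<open>B\<close>. The bound holds without a lower bound on the variance, hence at
  parameters far from the minimizer as well, as consistency requires.\<close>

lemma robust_loss_near_mean:
  assumes B: "B > 0"
  obtains \<delta>0 where "\<delta>0 > 0"
    "\<And>\<delta> n xs (P :: 'x measure) (l :: 'x \<Rightarrow> 'p \<Rightarrow> real) \<theta>. \<lbrakk>0 < \<delta>; \<delta> < \<delta>0; n \<ge> 1; xs \<in> {1..n} \<rightarrow> space P;
        (\<lambda>x. l x \<theta>) \<in> borel_measurable P; \<And>i. i \<in> {1..n} \<Longrightarrow> \<bar>l (xs i) \<theta>\<bar> \<le> B\<rbrakk> \<Longrightarrow>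
       \<bar>robust_loss \<phi> l (empirical_measure P xs n) \<delta> \<theta> - sample_mean n (\<lambda>i. l (xs i) \<theta>)\<bar>
         \<le> B * (1 + \<kappa>) * sqrt \<delta>"
proof -
  obtain \<delta>0 where d0: "\<delta>0 > 0"
    "\<And>\<delta> n w. \<lbrakk>0 < \<delta>; \<delta> < \<delta>0; n \<ge> 1; (\<Sum>i=1..n. \<phi> (w i)) \<le> ennreal (real n * \<delta>)\<rbrakk> \<Longrightarrow>
       sample_mean n (\<lambda>i. \<bar>w i - 1\<bar>) \<le> (1 + \<kappa>) * sqrt \<delta>"
    using weights_deviation by blast
  show ?thesis
  proof (rule that[OF d0(1)])
    fix \<delta> :: real and n :: nat and xs and P :: "'x measure" and l :: "'x \<Rightarrow> 'p \<Rightarrow> real" and \<theta>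
    assume d: "0 < \<delta>" "\<delta> < \<delta>0" and n: "n \<ge> 1" and xs: "xs \<in> {1..n} \<rightarrow> space P"
      and lm: "(\<lambda>x. l x \<theta>) \<in> borel_measurable P" and lB: "\<And>i. i \<in> {1..n} \<Longrightarrow> \<bar>l (xs i) \<theta>\<bar> \<le> B"
    let ?F = "robust_loss \<phi> l (empirical_measure P xs n) \<delta> \<theta>" and ?m = "sample_mean n (\<lambda>i. l (xs i) \<theta>)"
    have "sample_mean n (\<lambda>i. 1 * l (xs i) \<theta>) \<le> ?F"
      by (rule robust_loss_lower[where l = l, OF xs n d(1) lm, where w = "\<lambda>_. 1"])
        (use n in \<open>auto simp: sample_mean_const phi_one\<close>)
    moreover have "?F \<le> ?m + B * (1 + \<kappa>) * sqrt \<delta>"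
    proof (rule robust_loss_upper[where l = l, OF xs n d(1) lm])
      fix w assume w: "sample_mean n w = 1" "(\<Sum>i=1..n. \<phi> (w i)) \<le> ennreal (real n * \<delta>)"
      have "sample_mean n (\<lambda>i. w i * l (xs i) \<theta>) - ?m = sample_mean n (\<lambda>i. (w i - 1) * l (xs i) \<theta>)"
        by (simp add: sample_mean_diff[symmetric] algebra_simps)
      also have "\<dots> \<le> sample_mean n (\<lambda>i. \<bar>w i - 1\<bar> * B)"
      proof (rule sample_mean_mono)
        fix i assume "i \<in> {1..n}"
        then have "\<bar>(w i - 1) * l (xs i) \<theta>\<bar> \<le> \<bar>w i - 1\<bar> * B"
          unfolding abs_mult using lB by (intro mult_left_mono) auto
        then show "(w i - 1) * l (xs i) \<theta> \<le> \<bar>w i - 1\<bar> * B" by simp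
      qed
      also have "\<dots> \<le> (1 + \<kappa>) * sqrt \<delta> * B"
        unfolding sample_mean_multc using B d0(2)[OF d n w(2)] by (intro mult_right_mono) auto
      finally show "sample_mean n (\<lambda>i. w i * l (xs i) \<theta>) \<le> ?m + B * (1 + \<kappa>) * sqrt \<delta>"
        by (simp add: mult_ac)
    qed
    ultimately show "\<bar>?F - ?m\<bar> \<le> B * (1 + \<kappa>) * sqrt \<delta>"
      using B d kappa_pos by (simp add: abs_le_iff)
  qed
qed

text \<open>The optimal weights \<open>1 + q\<close> at \<open>\<theta>\<close> attain the robust
  loss there and are admissible at \<open>\<theta>'\<close>, so the difference of the two robust
  losses is at most an average of loss increments. One \<open>q\<close> serves all
  \<open>\<theta>'\<close>.\<close>

lemma robust_loss_increment:
  assumes B: "B > 0" and s0: "s0 > 0" and eta: "\<eta> > 0"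
  obtains \<delta>0 where "\<delta>0 > 0"
    "\<And>\<delta> n xs (P :: 'x measure) (l :: 'x \<Rightarrow> 'p \<Rightarrow> real) \<theta>. \<lbrakk>0 < \<delta>; \<delta> < \<delta>0; n \<ge> 1; xs \<in> {1..n} \<rightarrow> space P;
        (\<lambda>x. l x \<theta>) \<in> borel_measurable P; \<And>i. i \<in> {1..n} \<Longrightarrow> \<bar>l (xs i) \<theta>\<bar> \<le> B;
        sample_var n (\<lambda>i. l (xs i) \<theta>) \<ge> s0\<rbrakk> \<Longrightarrow>
       \<exists>q. (\<forall>i\<in>{1..n}. \<bar>q i - sqrt (\<kappa> * \<delta>) * (l (xs i) \<theta> - sample_mean n (\<lambda>i. l (xs i) \<theta>))
               / sqrt (sample_var n (\<lambda>i. l (xs i) \<theta>))\<bar> \<le> \<eta> * sqrt \<delta>) \<and>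
         (\<forall>\<theta>'. (\<lambda>x. l x \<theta>') \<in> borel_measurable P \<longrightarrow>
            robust_loss \<phi> l (empirical_measure P xs n) \<delta> \<theta> - robust_loss \<phi> l (empirical_measure P xs n) \<delta> \<theta>'
              \<le> sample_mean n (\<lambda>i. (1 + q i) * (l (xs i) \<theta> - l (xs i) \<theta>')))"
proof -
  obtain \<delta>0 where d0: "\<delta>0 > 0" and opt: "\<And>\<delta> n y. 0 < \<delta> \<Longrightarrow> \<delta> < \<delta>0 \<Longrightarrow> n \<ge> 1 \<Longrightarrow> \<forall>i\<in>{1..n}. \<bar>y i\<bar> \<le> B \<Longrightarrow> sample_var n y \<ge> s0 \<Longrightarrow>
    (\<exists>W::real\<Rightarrow>real. continuous_on UNIV W \<and> (\<forall>i\<in>{1..n}. 1 / 2 \<le> W (y i)) \<and>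
       sample_mean n (\<lambda>i. W (y i)) = 1 \<and> (\<Sum>i=1..n. \<phi> (W (y i))) \<le> ennreal (real n * \<delta>) \<and>
       (\<forall>i\<in>{1..n}. \<bar>W (y i) - 1 - sqrt (\<kappa> * \<delta>) * (y i - sample_mean n y) / sqrt (sample_var n y)\<bar> \<le> \<eta> * sqrt \<delta>) \<and>
       (\<forall>w. sample_mean n w = 1 \<and> (\<Sum>i=1..n. \<phi> (w i)) \<le> ennreal (real n * \<delta>) \<longrightarrow>
          sample_mean n (\<lambda>i. w i * y i) \<le> sample_mean n (\<lambda>i. W (y i) * y i)))"
    using optimal_weights[OF B s0 eta] by blast
  show ?thesis
  proof (rule that[OF d0])
    fix \<delta> :: real and n :: nat and xs and P :: "'x measure" and l :: "'x \<Rightarrow> 'p \<Rightarrow> real" and \<theta>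
    assume d: "0 < \<delta>" "\<delta> < \<delta>0" and n: "n \<ge> 1" and xs: "xs \<in> {1..n} \<rightarrow> space P"
      and lm: "(\<lambda>x. l x \<theta>) \<in> borel_measurable P" and lB: "\<And>i. i \<in> {1..n} \<Longrightarrow> \<bar>l (xs i) \<theta>\<bar> \<le> B"
      and var: "sample_var n (\<lambda>i. l (xs i) \<theta>) \<ge> s0"
    define y where "y i = l (xs i) \<theta>" for i
    have yB: "\<forall>i\<in>{1..n}. \<bar>y i\<bar> \<le> B" and yv: "sample_var n y \<ge> s0"
      using lB var by (simp_all add: y_def[abs_def])
    obtain W where W: "continuous_on UNIV W" "\<And>i. i \<in> {1..n} \<Longrightarrow> 1 / 2 \<le> W (y i)"
       "sample_mean n (\<lambda>i. W (y i)) = 1" "(\<Sum>i=1..n. \<phi> (W (y i))) \<le> ennreal (real n * \<delta>)"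
       "\<And>i. i \<in> {1..n} \<Longrightarrow> \<bar>W (y i) - 1 - sqrt (\<kappa> * \<delta>) * (y i - sample_mean n y) / sqrt (sample_var n y)\<bar> \<le> \<eta> * sqrt \<delta>"
       "\<And>w. sample_mean n w = 1 \<Longrightarrow> (\<Sum>i=1..n. \<phi> (w i)) \<le> ennreal (real n * \<delta>) \<Longrightarrow>
          sample_mean n (\<lambda>i. w i * y i) \<le> sample_mean n (\<lambda>i. W (y i) * y i)"
      using opt[OF d n yB yv] by blast
    \<comment> \<open>\<open>W\<close> is known to be positive only at the values taken on the
      sample. Truncation makes it a density everywhere and does not change it there.\<close>
    define w where "w x = max 0 (W (l x \<theta>))" for x
    have "W \<in> borel_measurable borel"
      using W(1) by (rule borel_measurable_continuous_onI)
    then have wm: "w \<in> borel_measurable P"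
      unfolding w_def[abs_def] using lm by measurable
    have wxs: "w (xs i) = W (y i)" if "i \<in> {1..n}" for i
      using W(2)[OF that] by (simp add: w_def y_def)
    have w1: "sample_mean n (\<lambda>i. w (xs i)) = 1"
      using W(3) sample_mean_cong[of n "\<lambda>i. w (xs i)" "\<lambda>i. W (y i)"] wxs by simp
    have wphi: "(\<Sum>i=1..n. \<phi> (w (xs i))) \<le> ennreal (real n * \<delta>)"
      using W(4) by (simp add: wxs)
    let ?F = "robust_loss \<phi> l (empirical_measure P xs n) \<delta>"
    have up: "?F \<theta> \<le> sample_mean n (\<lambda>i. W (y i) * y i)"
      by (rule robust_loss_upper[where l = l, OF xs n d(1) lm]) (use W(6) in \<open>simp add: y_def\<close>)
    have lo: "sample_mean n (\<lambda>i. W (y i) * l (xs i) \<theta>') \<le> ?F \<theta>'"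
      if lm': "(\<lambda>x. l x \<theta>') \<in> borel_measurable P" for \<theta>'
    proof -
      have "sample_mean n (\<lambda>i. W (y i) * l (xs i) \<theta>') = sample_mean n (\<lambda>i. w (xs i) * l (xs i) \<theta>')"
        by (rule sample_mean_cong) (simp add: wxs)
      also have "\<dots> \<le> ?F \<theta>'"
        by (rule robust_loss_lower[where l = l, OF xs n d(1) lm' wm _ w1 wphi]) (simp add: w_def)
      finally show ?thesis .
    qed
    have "?F \<theta> - ?F \<theta>' \<le> sample_mean n (\<lambda>i. (1 + (W (y i) - 1)) * (l (xs i) \<theta> - l (xs i) \<theta>'))"
      if "(\<lambda>x. l x \<theta>') \<in> borel_measurable P" for \<theta>'
      using up lo[OF that] by (simp add: right_diff_distrib sample_mean_diff y_def)
    then show "\<exists>q. (\<forall>i\<in>{1..n}. \<bar>q i - sqrt (\<kappa> * \<delta>) * (l (xs i) \<theta> - sample_mean n (\<lambda>i. l (xs i) \<theta>))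
               / sqrt (sample_var n (\<lambda>i. l (xs i) \<theta>))\<bar> \<le> \<eta> * sqrt \<delta>) \<and>
         (\<forall>\<theta>'. (\<lambda>x. l x \<theta>') \<in> borel_measurable P \<longrightarrow>
            ?F \<theta> - ?F \<theta>' \<le> sample_mean n (\<lambda>i. (1 + q i) * (l (xs i) \<theta> - l (xs i) \<theta>')))"
      using W(5) unfolding y_def[abs_def] by (intro exI[of _ "\<lambda>i. W (l (xs i) \<theta>) - 1"]) blast
  qed
qed

end

section \<open>Events of probability tending to one\<close>

text \<open>The property \<open>E n\<close> need not be measurable.\<close>

definition (in prob_space) whp :: "(nat \<Rightarrow> 'a \<Rightarrow> bool) \<Rightarrow> bool" where
  "whp E \<longleftrightarrow> (\<forall>\<epsilon>>0. \<forall>\<^sub>F n in sequentially. \<exists>A\<in>events. prob A \<ge> 1 - \<epsilon> \<and> (\<forall>\<omega>\<in>A. E n \<omega>))"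

context prob_space
begin

lemma whpD:
  assumes "whp E" "\<epsilon> > 0"
  shows "\<forall>\<^sub>F n in sequentially. \<exists>A\<in>events. prob A \<ge> 1 - \<epsilon> \<and> (\<forall>\<omega>\<in>A. E n \<omega>)"
  using assms by (simp add: whp_def)

lemma whp_mono_eventually:
  assumes "whp E" "\<forall>\<^sub>F n in sequentially. \<forall>\<omega>\<in>space M. E n \<omega> \<longrightarrow> E' n \<omega>"
  shows "whp E'"
  unfolding whp_def
proof (intro allI impI)
  fix \<epsilon> :: real assume "\<epsilon> > 0"
  from whpD[OF assms(1) this] assms(2)
  show "\<forall>\<^sub>F n in sequentially. \<exists>A\<in>events. prob A \<ge> 1 - \<epsilon> \<and> (\<forall>\<omega>\<in>A. E' n \<omega>)"
  proof eventually_elim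
    case (elim n)
    then obtain A where "A \<in> events" "prob A \<ge> 1 - \<epsilon>" "\<forall>\<omega>\<in>A. E n \<omega>" by blast
    then show ?case
      using elim sets.sets_into_space[of A M] by (intro bexI[of _ A]) auto
  qed
qed

lemma whp_mono:
  assumes "whp E" "\<And>n \<omega>. \<omega> \<in> space M \<Longrightarrow> E n \<omega> \<Longrightarrow> E' n \<omega>"
  shows "whp E'"
  by (rule whp_mono_eventually[OF assms(1)]) (use assms(2) in auto)

lemma whp_eventually:
  assumes "\<forall>\<^sub>F n in sequentially. \<forall>\<omega>\<in>space M. E n \<omega>"
  shows "whp E"
  unfolding whp_def
proof (intro allI impI)
  fix \<epsilon> :: real assume e: "\<epsilon> > 0"
  from assms show "\<forall>\<^sub>F n in sequentially. \<exists>A\<in>events. prob A \<ge> 1 - \<epsilon> \<and> (\<forall>\<omega>\<in>A. E n \<omega>)"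
    by eventually_elim (use e prob_space in \<open>auto intro!: bexI[of _ "space M"]\<close>)
qed

lemma whp_conj:
  assumes "whp E" "whp E'"
  shows "whp (\<lambda>n \<omega>. E n \<omega> \<and> E' n \<omega>)"
  unfolding whp_def
proof (intro allI impI)
  fix \<epsilon> :: real assume "\<epsilon> > 0"
  then have "\<epsilon> / 2 > 0" by simp
  from whpD[OF assms(1) this] whpD[OF assms(2) this]
  show "\<forall>\<^sub>F n in sequentially. \<exists>A\<in>events. prob A \<ge> 1 - \<epsilon> \<and> (\<forall>\<omega>\<in>A. E n \<omega> \<and> E' n \<omega>)"
  proof eventually_elim
    case (elim n)
    then obtain A A' where A: "A \<in> events" "prob A \<ge> 1 - \<epsilon> / 2" "\<forall>\<omega>\<in>A. E n \<omega>"
      "A' \<in> events" "prob A' \<ge> 1 - \<epsilon> / 2" "\<forall>\<omega>\<in>A'. E' n \<omega>" by blast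
    have "prob (A \<union> A') = prob A + prob A' - prob (A \<inter> A')"
      using A(1,4) by (intro measure_Un3) (auto simp: fmeasurable_eq_sets)
    moreover have "prob (A \<union> A') \<le> 1"
      by simp
    ultimately show ?case
      using A by (intro bexI[of _ "A \<inter> A'"]) auto
  qed
qed

lemma whp_ball:
  assumes "finite I" "\<And>i. i \<in> I \<Longrightarrow> whp (E i)"
  shows "whp (\<lambda>n \<omega>. \<forall>i\<in>I. E i n \<omega>)"
  using assms
proof (induction I rule: finite_induct)
  case empty
  then show ?case
    by (intro whp_eventually) auto
next
  case (insert i I)
  have "whp (\<lambda>n \<omega>. E i n \<omega> \<and> (\<forall>i\<in>I. E i n \<omega>))"
    using insert by (intro whp_conj) auto
  then show ?case
    by (rule whp_mono) auto
qed

lemma whp_AE: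
  assumes "AE \<omega> in M. \<forall>n. E n \<omega>"
  shows "whp E"
proof -
  obtain N where N: "N \<in> null_sets M" "{\<omega> \<in> space M. \<not> (\<forall>n. E n \<omega>)} \<subseteq> N"
    using assms unfolding eventually_ae_filter by blast
  have "prob (space M - N) = 1"
    using N(1) by (subst prob_compl) (auto simp: measure_eq_0_null_sets)
  then show ?thesis
    unfolding whp_def using N
    by (intro allI impI always_eventually bexI[of _ "space M - N"]) auto
qed

lemma whp_bad_events:
  assumes "(\<lambda>n. b n) \<longlonglongrightarrow> 0"
    and "\<forall>\<^sub>F n in sequentially. \<exists>A\<in>events. prob A \<le> b n \<and> (\<forall>\<omega>\<in>space M - A. E n \<omega>)"
  shows "whp E"
  unfolding whp_def
proof (intro allI impI)
  fix \<epsilon> :: real assume "\<epsilon> > 0"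
  from order_tendstoD(2)[OF assms(1) this] assms(2)
  show "\<forall>\<^sub>F n in sequentially. \<exists>A\<in>events. prob A \<ge> 1 - \<epsilon> \<and> (\<forall>\<omega>\<in>A. E n \<omega>)"
  proof eventually_elim
    case (elim n)
    then obtain A where A: "A \<in> events" "prob A \<le> b n" "\<forall>\<omega>\<in>space M - A. E n \<omega>"
      by blast
    then show ?case
      using elim(1) prob_compl[OF A(1)] by (intro bexI[of _ "space M - A"]) auto
  qed
qed

text \<open>A family of events indexed by a threshold \<open>K\<close> plays the role of boundedness in probability.\<close>

lemma whp_of_bounded:
  assumes "\<And>\<epsilon>. \<epsilon> > 0 \<Longrightarrow> \<exists>K. \<forall>\<^sub>F n in sequentially. \<exists>A\<in>events. prob A \<le> \<epsilon> \<and> (\<forall>\<omega>\<in>space M - A. B K n \<omega>)"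
    and "\<And>K. whp (\<lambda>n \<omega>. B K n \<omega> \<longrightarrow> E n \<omega>)"
  shows "whp E"
  unfolding whp_def
proof (intro allI impI)
  fix \<epsilon> :: real assume "\<epsilon> > 0"
  then have e: "\<epsilon> / 2 > 0" by simp
  from assms(1)[OF this] obtain K where
    K: "\<forall>\<^sub>F n in sequentially. \<exists>A\<in>events. prob A \<le> \<epsilon> / 2 \<and> (\<forall>\<omega>\<in>space M - A. B K n \<omega>)"
    by blast
  from K whpD[OF assms(2)[of K] e]
  show "\<forall>\<^sub>F n in sequentially. \<exists>A\<in>events. prob A \<ge> 1 - \<epsilon> \<and> (\<forall>\<omega>\<in>A. E n \<omega>)"
  proof eventually_elim
    case (elim n)
    then obtain A A' where A: "A \<in> events" "prob A \<le> \<epsilon> / 2" "\<forall>\<omega>\<in>space M - A. B K n \<omega>"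
      "A' \<in> events" "prob A' \<ge> 1 - \<epsilon> / 2" "\<forall>\<omega>\<in>A'. B K n \<omega> \<longrightarrow> E n \<omega>"
      by blast
    have "prob (A' - A) = prob A' - prob (A' \<inter> A)"
      using A by (intro finite_measure_Diff') auto
    moreover have "prob (A' \<inter> A) \<le> prob A"
      using A by (intro finite_measure_mono) auto
    ultimately show ?case
      using A sets.sets_into_space[OF A(4)] by (intro bexI[of _ "A' - A"]) auto
  qed
qed

end

section \<open>Averages over an i.i.d. sample\<close>

locale iid_sample = prob_space M + P: prob_space P
  for M :: "'w measure" and P :: "'x measure" +
  fixes X :: "nat \<Rightarrow> 'w \<Rightarrow> 'x"
  assumes X_indep: "indep_vars (\<lambda>_. P) X {1..}"
    and X_distr: "\<And>i. i \<ge> 1 \<Longrightarrow> distr M P (X i) = P"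
begin

lemma X_measurable: "i \<ge> 1 \<Longrightarrow> X i \<in> measurable M P"
  using X_indep by (auto simp: indep_vars_def)

lemma X_space: "\<omega> \<in> space M \<Longrightarrow> (\<lambda>i. X i \<omega>) \<in> {1..n} \<rightarrow> space P"
  by (rule Pi_I) (auto intro: measurable_space[OF X_measurable])

abbreviation emp :: "nat \<Rightarrow> ('x \<Rightarrow> real) \<Rightarrow> 'w \<Rightarrow> real" where
  "emp n g \<omega> \<equiv> sample_mean n (\<lambda>i. g (X i \<omega>))"

lemma AE_X:
  assumes "AE x in P. Q x"
  shows "AE \<omega> in M. \<forall>i\<ge>1. Q (X i \<omega>)"
proof -
  have "AE \<omega> in M. Q (X i \<omega>)" if "i \<ge> 1" for i
  proof -
    have "AE x in distr M P (X i). Q x"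
      by (subst X_distr[OF that]) (rule assms)
    then show ?thesis
      by (rule AE_distrD[OF X_measurable[OF that]])
  qed
  then have "AE \<omega> in M. i \<ge> 1 \<longrightarrow> Q (X i \<omega>)" for i
    by (cases "i \<ge> 1") auto
  then show ?thesis
    by (simp add: AE_all_countable)
qed

lemma integrable_X:
  fixes g :: "'x \<Rightarrow> real"
  assumes "i \<ge> 1" "integrable P g"
  shows "integrable M (\<lambda>\<omega>. g (X i \<omega>))" "(\<integral>\<omega>. g (X i \<omega>) \<partial>M) = (\<integral>x. g x \<partial>P)"
proof -
  have "g \<in> borel_measurable P"
    using assms(2) by simp
  with assms show "integrable M (\<lambda>\<omega>. g (X i \<omega>))" "(\<integral>\<omega>. g (X i \<omega>) \<partial>M) = (\<integral>x. g x \<partial>P)"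
    using integrable_distr_eq[OF X_measurable[OF assms(1)], of g]
      integral_distr[OF X_measurable[OF assms(1)], of g] by (auto simp: X_distr)
qed

lemma emp_measurable: "g \<in> borel_measurable P \<Longrightarrow> emp n g \<in> borel_measurable M"
  unfolding sample_mean_def
  by (intro borel_measurable_divide borel_measurable_sum measurable_compose[OF X_measurable]) auto

lemma emp_expectation:
  assumes "integrable P g" "n \<ge> 1"
  shows "integrable M (emp n g)" "expectation (emp n g) = (\<integral>x. g x \<partial>P)"
proof -
  show "integrable M (emp n g)"
    unfolding sample_mean_def
    by (intro Bochner_Integration.integrable_divide_zero Bochner_Integration.integrable_sum integrable_X assms(1)) auto
  show "expectation (emp n g) = (\<integral>x. g x \<partial>P)"
    unfolding sample_mean_def using assms
    by (subst Bochner_Integration.integral_divide_zero, subst Bochner_Integration.integral_sum)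
      (auto simp: integrable_X)
qed

lemma square_integrable_P:
  fixes g :: "'x \<Rightarrow> real"
  assumes "g \<in> borel_measurable P" "integrable P (\<lambda>x. (g x)\<^sup>2)"
  shows "integrable P g"
  using P.square_integrable_imp_integrable[OF assms] .

text \<open>The cross term vanishes: the new summand is independent of the partial sum and has mean
  zero.\<close>

lemma sum_second_moment:
  assumes g: "g \<in> borel_measurable P" "integrable P (\<lambda>x. (g x)\<^sup>2)" and g0: "(\<integral>x. g x \<partial>P) = 0"
  shows "integrable M (\<lambda>\<omega>. (\<Sum>i=1..n. g (X i \<omega>))\<^sup>2) \<and>
    (\<integral>\<omega>. (\<Sum>i=1..n. g (X i \<omega>))\<^sup>2 \<partial>M) = real n * (\<integral>x. (g x)\<^sup>2 \<partial>P)"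
proof (induction n)
  case (Suc n)
  have gi: "integrable P g"
    by (rule square_integrable_P[OF g])
  define S where "S \<omega> = (\<Sum>i=1..n. g (X i \<omega>))" for \<omega>
  have Si: "integrable M S"
    unfolding S_def by (intro Bochner_Integration.integrable_sum integrable_X gi) auto
  have "indep_vars (\<lambda>_. borel) (\<lambda>i \<omega>. g (X i \<omega>)) (insert (Suc n) {1..n})"
    by (rule indep_vars_compose2[OF indep_vars_subset[OF X_indep]]) (use g in auto)
  then have "indep_var borel (\<lambda>\<omega>. g (X (Suc n) \<omega>)) borel S"
    unfolding S_def by (intro indep_vars_sum) auto
  then have cross: "integrable M (\<lambda>\<omega>. g (X (Suc n) \<omega>) * S \<omega>)"
      "(\<integral>\<omega>. g (X (Suc n) \<omega>) * S \<omega> \<partial>M) = (\<integral>\<omega>. g (X (Suc n) \<omega>) \<partial>M) * (\<integral>\<omega>. S \<omega> \<partial>M)"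
    by (auto intro!: indep_var_integrable indep_var_lebesgue_integral Si integrable_X(1)[OF _ gi])
  have sq: "(\<lambda>\<omega>. (\<Sum>i=1..Suc n. g (X i \<omega>))\<^sup>2) = (\<lambda>\<omega>. (S \<omega>)\<^sup>2 + 2 * (g (X (Suc n) \<omega>) * S \<omega>) + (g (X (Suc n) \<omega>))\<^sup>2)"
    by (auto simp: S_def power2_eq_square algebra_simps)
  have IH: "integrable M (\<lambda>\<omega>. (S \<omega>)\<^sup>2)" "(\<integral>\<omega>. (S \<omega>)\<^sup>2 \<partial>M) = real n * (\<integral>x. (g x)\<^sup>2 \<partial>P)"
    using Suc.IH by (auto simp: S_def)
  have i2: "integrable M (\<lambda>\<omega>. (g (X (Suc n) \<omega>))\<^sup>2)" "(\<integral>\<omega>. (g (X (Suc n) \<omega>))\<^sup>2 \<partial>M) = (\<integral>x. (g x)\<^sup>2 \<partial>P)"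
    using integrable_X[OF _ g(2), of "Suc n"] by auto
  have c0: "(\<integral>\<omega>. g (X (Suc n) \<omega>) \<partial>M) = 0"
    using integrable_X(2)[OF _ gi, of "Suc n"] g0 by simp
  show ?case
    unfolding sq using IH i2 cross c0 by (simp add: distrib_right)
qed simp

text \<open>The variance is bounded by the raw second moment, the quantity for which the remainder
  of the loss has an explicit estimate.\<close>

lemma emp_chebyshev:
  assumes g: "g \<in> borel_measurable P" "integrable P (\<lambda>x. (g x)\<^sup>2)" and n: "n \<ge> 1" and t: "t > 0"
  shows "prob {\<omega> \<in> space M. \<bar>emp n g \<omega> - (\<integral>x. g x \<partial>P)\<bar> \<ge> t} \<le> (\<integral>x. (g x)\<^sup>2 \<partial>P) / (real n * t\<^sup>2)"
proof -
  define m where "m = (\<integral>x. g x \<partial>P)"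
  define h where "h x = g x - m" for x
  have gi: "integrable P g"
    by (rule square_integrable_P[OF g])
  have h: "h \<in> borel_measurable P" "integrable P (\<lambda>x. (h x)\<^sup>2)" "(\<integral>x. h x \<partial>P) = 0"
    "(\<integral>x. (h x)\<^sup>2 \<partial>P) \<le> (\<integral>x. (g x)\<^sup>2 \<partial>P)"
  proof -
    have eq: "(\<lambda>x. (h x)\<^sup>2) = (\<lambda>x. (g x)\<^sup>2 - 2 * m * g x + m\<^sup>2)"
      by (auto simp: h_def power2_eq_square algebra_simps)
    show "h \<in> borel_measurable P"
      unfolding h_def[abs_def] using g by measurable
    show "integrable P (\<lambda>x. (h x)\<^sup>2)"
      unfolding eq using g gi by auto
    show "(\<integral>x. h x \<partial>P) = 0"
      unfolding h_def using gi by (simp add: P.prob_space m_def)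
    have "(\<integral>x. (h x)\<^sup>2 \<partial>P) = (\<integral>x. (g x)\<^sup>2 \<partial>P) - 2 * m * m + m\<^sup>2"
      unfolding eq using g gi by (simp add: P.prob_space m_def[symmetric])
    also have "\<dots> \<le> (\<integral>x. (g x)\<^sup>2 \<partial>P)"
      by (simp add: power2_eq_square)
    finally show "(\<integral>x. (h x)\<^sup>2 \<partial>P) \<le> (\<integral>x. (g x)\<^sup>2 \<partial>P)" .
  qed
  note sm = sum_second_moment[OF h(1,2,3), of n]
  have eq: "emp n g \<omega> - m = (\<Sum>i=1..n. h (X i \<omega>)) / real n" for \<omega>
    using n by (simp add: sample_mean_def h_def sum_subtractf field_simps)
  have "{\<omega> \<in> space M. \<bar>emp n g \<omega> - m\<bar> \<ge> t} = {\<omega> \<in> space M. (\<Sum>i=1..n. h (X i \<omega>))\<^sup>2 \<ge> (real n * t)\<^sup>2}"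
  proof -
    have "t \<le> \<bar>a / real n\<bar> \<longleftrightarrow> (real n * t)\<^sup>2 \<le> a\<^sup>2" for a
    proof -
      have "t \<le> \<bar>a / real n\<bar> \<longleftrightarrow> real n * t \<le> \<bar>a\<bar>"
        using n by (simp add: pos_le_divide_eq mult.commute)
      also have "\<dots> \<longleftrightarrow> \<bar>real n * t\<bar> \<le> \<bar>a\<bar>"
        using t by simp
      finally show ?thesis
        by (simp only: abs_le_square_iff)
    qed
    then show ?thesis
      by (simp add: eq)
  qed
  note set_eq = this
  have "prob {\<omega> \<in> space M. \<bar>emp n g \<omega> - m\<bar> \<ge> t} \<le> (\<integral>\<omega>. (\<Sum>i=1..n. h (X i \<omega>))\<^sup>2 \<partial>M) / (real n * t)\<^sup>2"
    using n t conjunct1[OF sm] by (subst set_eq, intro integral_Markov_inequality_measure[where A = "{}"]) auto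
  also have "\<dots> = (\<integral>x. (h x)\<^sup>2 \<partial>P) / (real n * t\<^sup>2)"
    unfolding conjunct2[OF sm] using n by (simp add: power_mult_distrib power2_eq_square[of "real n"])
  also have "\<dots> \<le> (\<integral>x. (g x)\<^sup>2 \<partial>P) / (real n * t\<^sup>2)"
    using h(4) n by (intro divide_right_mono) auto
  finally show ?thesis
    by (simp add: m_def)
qed

lemma whp_weak_law:
  assumes g: "g \<in> borel_measurable P" "integrable P (\<lambda>x. (g x)\<^sup>2)" and t: "t > 0"
  shows "whp (\<lambda>n \<omega>. \<bar>emp n g \<omega> - (\<integral>x. g x \<partial>P)\<bar> < t)"
proof (rule whp_bad_events)
  show "(\<lambda>n. (\<integral>x. (g x)\<^sup>2 \<partial>P) / (real n * t\<^sup>2)) \<longlonglongrightarrow> 0"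
    using lim_const_over_n[of "(\<integral>x. (g x)\<^sup>2 \<partial>P) / t\<^sup>2"] by (simp add: mult.commute)
  show "\<forall>\<^sub>F n in sequentially. \<exists>A\<in>events. prob A \<le> (\<integral>x. (g x)\<^sup>2 \<partial>P) / (real n * t\<^sup>2) \<and>
      (\<forall>\<omega>\<in>space M - A. \<bar>emp n g \<omega> - (\<integral>x. g x \<partial>P)\<bar> < t)"
    using eventually_ge_at_top[of 1]
  proof eventually_elim
    case (elim n)
    have "{\<omega> \<in> space M. \<bar>emp n g \<omega> - (\<integral>x. g x \<partial>P)\<bar> \<ge> t} \<in> events"
      using emp_measurable[OF g(1), of n] by measurable
    then show ?case
      using emp_chebyshev[OF g elim t]
      by (intro bexI[of _ "{\<omega> \<in> space M. \<bar>emp n g \<omega> - (\<integral>x. g x \<partial>P)\<bar> \<ge> t}"]) auto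
  qed
qed

text \<open>Markov's inequality asks for a first moment only. It serves for the product of
  \<open>Lip x\<close> and \<open>norm (G\<^sub>0 x)\<close>, which is integrable but may lack the
  second moment that Chebyshev's inequality needs.\<close>

lemma emp_bounded:
  assumes g: "integrable P g" "\<And>x. 0 \<le> g x" and e: "\<epsilon> > 0" and n: "n \<ge> 1"
  shows "\<exists>A\<in>events. prob A \<le> \<epsilon> \<and> (\<forall>\<omega>\<in>space M - A. emp n g \<omega> \<le> (1 + (\<integral>x. g x \<partial>P)) / \<epsilon>)"
proof -
  \<comment> \<open>The summand 1 makes \<open>K\<close> positive also if the integral
    vanishes.\<close>
  define K where "K = (1 + (\<integral>x. g x \<partial>P)) / \<epsilon>"
  have i0: "0 \<le> (\<integral>x. g x \<partial>P)"
    using g by (intro integral_nonneg_AE) auto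
  have K: "K > 0"
    using i0 e by (simp add: K_def)
  let ?A = "{\<omega> \<in> space M. emp n g \<omega> \<ge> K}"
  have "emp n g \<in> borel_measurable M"
    by (rule emp_measurable) (use g in simp)
  then have A: "?A \<in> events"
    by measurable
  have "prob ?A \<le> expectation (emp n g) / K"
    by (rule integral_Markov_inequality_measure[where A = "{}"])
      (use emp_expectation[OF g(1) n] K g in \<open>auto intro!: sample_mean_nonneg\<close>)
  also have "\<dots> = (\<integral>x. g x \<partial>P) / K"
    by (simp add: emp_expectation[OF g(1) n])
  also have "\<dots> \<le> \<epsilon>"
    using i0 e by (simp add: K_def field_simps)
  finally show ?thesis
    using A unfolding K_def[symmetric] by (intro bexI[of _ ?A]) auto
qed

end

section \<open>Uniform bound for the first order remainder\<close>

lemma power2_add_le: "((a::real) + b)\<^sup>2 \<le> 2 * a\<^sup>2 + 2 * b\<^sup>2"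
  using sum_squares_bound[of a b] by (simp add: power2_sum)

text \<open>Smoothness of the loss is used only through \<open>l_regular\<close>: the first order remainder of the
  loss at \<open>\<theta>\<^sub>0\<close> has Lipschitz constant at most \<open>\<Psi> x\<close> times the distance to \<open>\<theta>\<^sub>0\<close>. The functions
  \<open>l x\<close> are evaluated on \<open>\<Theta>\<close> only.\<close>

locale loss_model = iid_sample M P X
  for M :: "'w measure" and P :: "'x measure" and X +
  fixes \<Theta> :: "'p::euclidean_space set" and \<theta>\<^sub>0 :: 'p and l :: "'x \<Rightarrow> 'p \<Rightarrow> real" and G\<^sub>0 :: "'x \<Rightarrow> 'p"
    and \<Psi> :: "'x \<Rightarrow> real" and r\<^sub>0 B :: real
  assumes compact_Theta: "compact \<Theta>" and theta0: "\<theta>\<^sub>0 \<in> \<Theta>" and r0: "r\<^sub>0 > 0" and B: "B > 0"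
    and l_measurable: "\<theta> \<in> \<Theta> \<Longrightarrow> (\<lambda>x. l x \<theta>) \<in> borel_measurable P"
    and G0_measurable: "G\<^sub>0 \<in> borel_measurable P" and G0_sq: "integrable P (\<lambda>x. (norm (G\<^sub>0 x))\<^sup>2)"
    and Psi_measurable: "\<Psi> \<in> borel_measurable P" and Psi_nonneg: "0 \<le> \<Psi> x"
    and Psi_sq: "integrable P (\<lambda>x. (\<Psi> x)\<^sup>2)"
    and l_bounded: "AE x in P. \<forall>\<theta>\<in>\<Theta>. \<bar>l x \<theta>\<bar> \<le> B"
    and l_regular: "AE x in P. \<forall>\<theta>\<in>\<Theta> \<inter> ball \<theta>\<^sub>0 r\<^sub>0. \<forall>\<theta>'\<in>\<Theta> \<inter> ball \<theta>\<^sub>0 r\<^sub>0.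
        \<bar>l x \<theta> - l x \<theta>' - G\<^sub>0 x \<bullet> (\<theta> - \<theta>')\<bar> \<le> \<Psi> x * max (norm (\<theta> - \<theta>\<^sub>0)) (norm (\<theta>' - \<theta>\<^sub>0)) * norm (\<theta> - \<theta>')"
    and l_equicontinuous: "\<epsilon> > 0 \<Longrightarrow> \<exists>K\<in>sets P. measure P K \<ge> 1 - \<epsilon> \<and> (\<exists>\<rho>>0. \<forall>x\<in>K. \<forall>\<theta>\<in>\<Theta>. \<forall>\<theta>'\<in>\<Theta>.
        norm (\<theta> - \<theta>') < \<rho> \<longrightarrow> \<bar>l x \<theta> - l x \<theta>'\<bar> \<le> \<epsilon>)"
begin

text \<open>The almost sure properties of a single data point, collected so that one exceptional
  event serves all parameters and all sample indices.\<close>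

definition regular :: "'x \<Rightarrow> bool" where
  "regular x \<longleftrightarrow> (\<forall>\<theta>\<in>\<Theta>. \<bar>l x \<theta>\<bar> \<le> B) \<and>
    (\<forall>\<theta>\<in>\<Theta> \<inter> ball \<theta>\<^sub>0 r\<^sub>0. \<forall>\<theta>'\<in>\<Theta> \<inter> ball \<theta>\<^sub>0 r\<^sub>0.
        \<bar>l x \<theta> - l x \<theta>' - G\<^sub>0 x \<bullet> (\<theta> - \<theta>')\<bar> \<le> \<Psi> x * max (norm (\<theta> - \<theta>\<^sub>0)) (norm (\<theta>' - \<theta>\<^sub>0)) * norm (\<theta> - \<theta>'))"

definition rem :: "'p \<Rightarrow> 'x \<Rightarrow> real" where
  "rem \<theta> x = l x \<theta> - l x \<theta>\<^sub>0 - G\<^sub>0 x \<bullet> (\<theta> - \<theta>\<^sub>0)"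

abbreviation f :: "'p \<Rightarrow> real" where "f \<equiv> loss_mean P l"

text \<open>A Lipschitz constant of \<open>l x\<close> on the part of \<open>\<Theta>\<close> within
  \<open>r\<^sub>0\<close> of \<open>\<theta>\<^sub>0\<close>, made of the linear part and the
  remainder; see \<open>l_Lip\<close>.\<close>

definition Lip :: "'x \<Rightarrow> real" where "Lip x = norm (G\<^sub>0 x) + r\<^sub>0 * \<Psi> x"

text \<open>The centred second order noise. Together with the first order noise
  \<open>grad_dev\<close> it accounts for the whole difference between empirical and expected
  increments of the loss from \<open>\<theta>\<^sub>0\<close>.\<close>

definition R :: "nat \<Rightarrow> 'w \<Rightarrow> 'p \<Rightarrow> real" where
  "R n \<omega> \<theta> = emp n (rem \<theta>) \<omega> - (\<integral>x. rem \<theta> x \<partial>P)"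

definition grad_dev :: "nat \<Rightarrow> 'w \<Rightarrow> 'p" where
  "grad_dev n \<omega> = (\<Sum>i=1..n. G\<^sub>0 (X i \<omega>)) /\<^sub>R real n - (\<integral>x. G\<^sub>0 x \<partial>P)"

lemma AE_regular: "AE x in P. regular x"
  using l_bounded l_regular by eventually_elim (simp add: regular_def)

lemma AE_regular_sample: "AE \<omega> in M. \<forall>n. \<forall>i\<ge>1. regular (X i \<omega>)"
  using AE_X[OF AE_regular] by simp

lemma whp_regular: "whp (\<lambda>n \<omega>. \<forall>i\<ge>1. regular (X i \<omega>))"
  by (rule whp_AE[OF AE_regular_sample])

lemma regular_bounded: "regular x \<Longrightarrow> \<theta> \<in> \<Theta> \<Longrightarrow> \<bar>l x \<theta>\<bar> \<le> B"
  by (simp add: regular_def)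

lemma rem_measurable: "\<theta> \<in> \<Theta> \<Longrightarrow> rem \<theta> \<in> borel_measurable P"
  unfolding rem_def[abs_def] using l_measurable[of \<theta>] l_measurable[OF theta0] G0_measurable
  by measurable

lemma rem_theta0: "rem \<theta>\<^sub>0 x = 0"
  by (simp add: rem_def)

lemma rem_diff_bound:
  assumes "regular x" "\<theta> \<in> \<Theta>" "\<theta>' \<in> \<Theta>" "norm (\<theta> - \<theta>\<^sub>0) < r\<^sub>0" "norm (\<theta>' - \<theta>\<^sub>0) < r\<^sub>0"
    "norm (\<theta> - \<theta>\<^sub>0) \<le> s" "norm (\<theta>' - \<theta>\<^sub>0) \<le> s"
  shows "\<bar>rem \<theta> x - rem \<theta>' x\<bar> \<le> \<Psi> x * s * norm (\<theta> - \<theta>')"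
proof -
  have "\<theta> \<in> \<Theta> \<inter> ball \<theta>\<^sub>0 r\<^sub>0" "\<theta>' \<in> \<Theta> \<inter> ball \<theta>\<^sub>0 r\<^sub>0"
    using assms by (auto simp: dist_norm norm_minus_commute)
  then have "\<bar>l x \<theta> - l x \<theta>' - G\<^sub>0 x \<bullet> (\<theta> - \<theta>')\<bar>
      \<le> \<Psi> x * max (norm (\<theta> - \<theta>\<^sub>0)) (norm (\<theta>' - \<theta>\<^sub>0)) * norm (\<theta> - \<theta>')"
    using assms(1) by (auto simp: regular_def)
  also have "\<dots> \<le> \<Psi> x * s * norm (\<theta> - \<theta>')"
    using assms Psi_nonneg by (intro mult_right_mono mult_left_mono) auto
  also have "l x \<theta> - l x \<theta>' - G\<^sub>0 x \<bullet> (\<theta> - \<theta>') = rem \<theta> x - rem \<theta>' x"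
    by (simp add: rem_def inner_diff_right)
  finally show ?thesis .
qed

lemma rem_bound:
  assumes "regular x" "\<theta> \<in> \<Theta>" "norm (\<theta> - \<theta>\<^sub>0) < r\<^sub>0" "norm (\<theta> - \<theta>\<^sub>0) \<le> s"
  shows "\<bar>rem \<theta> x\<bar> \<le> \<Psi> x * s\<^sup>2"
proof -
  have s: "0 \<le> s"
    using assms(4) norm_ge_zero order_trans by blast
  have "\<bar>rem \<theta> x - rem \<theta>\<^sub>0 x\<bar> \<le> \<Psi> x * s * norm (\<theta> - \<theta>\<^sub>0)"
    by (rule rem_diff_bound) (use assms theta0 r0 s in auto)
  also have "\<dots> \<le> \<Psi> x * s * s"
    using assms(4) s Psi_nonneg by (intro mult_left_mono) auto
  finally show ?thesis
    by (simp add: rem_theta0 power2_eq_square mult.assoc)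
qed

lemma Lip_nonneg: "0 \<le> Lip x"
  using Psi_nonneg[of x] r0 by (simp add: Lip_def)

lemma l_Lip:
  assumes "regular x" "\<theta> \<in> \<Theta>" "\<theta>' \<in> \<Theta>" "norm (\<theta> - \<theta>\<^sub>0) < r\<^sub>0" "norm (\<theta>' - \<theta>\<^sub>0) < r\<^sub>0"
  shows "\<bar>l x \<theta> - l x \<theta>'\<bar> \<le> Lip x * norm (\<theta> - \<theta>')"
proof -
  have "\<bar>rem \<theta> x - rem \<theta>' x\<bar> \<le> \<Psi> x * r\<^sub>0 * norm (\<theta> - \<theta>')"
    by (rule rem_diff_bound) (use assms in auto)
  moreover have "\<bar>G\<^sub>0 x \<bullet> (\<theta> - \<theta>')\<bar> \<le> norm (G\<^sub>0 x) * norm (\<theta> - \<theta>')"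
    by (rule Cauchy_Schwarz_ineq2)
  moreover have "l x \<theta> - l x \<theta>' = (rem \<theta> x - rem \<theta>' x) + G\<^sub>0 x \<bullet> (\<theta> - \<theta>')"
    by (simp add: rem_def inner_diff_right)
  ultimately show ?thesis
    unfolding Lip_def distrib_right by (simp add: mult.commute[of r\<^sub>0])
qed

lemma l_integrable:
  assumes "\<theta> \<in> \<Theta>"
  shows "integrable P (\<lambda>x. l x \<theta>)" "integrable P (\<lambda>x. (l x \<theta>)\<^sup>2)"
proof -
  show "integrable P (\<lambda>x. l x \<theta>)"
    by (rule P.integrable_const_bound[where B = B])
      (use l_bounded l_measurable[OF assms] assms in \<open>auto elim!: eventually_mono\<close>)
  show "integrable P (\<lambda>x. (l x \<theta>)\<^sup>2)"
  proof (rule P.integrable_const_bound[where B = "B\<^sup>2"])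
    show "AE x in P. norm ((l x \<theta>)\<^sup>2) \<le> B\<^sup>2"
      using l_bounded
    proof eventually_elim
      case (elim x)
      then have "\<bar>l x \<theta>\<bar> \<le> \<bar>B\<bar>"
        using assms B by auto
      then show ?case
        by (simp add: abs_le_square_iff)
    qed
  qed (use l_measurable[OF assms] in measurable)
qed

lemma Psi_integrable: "integrable P \<Psi>"
  by (rule square_integrable_P[OF Psi_measurable Psi_sq])

lemma norm_G0_integrable: "integrable P (\<lambda>x. norm (G\<^sub>0 x))"
  by (rule square_integrable_P[OF _ G0_sq]) (use G0_measurable in measurable)

lemma G0_integrable: "integrable P G\<^sub>0"
  using norm_G0_integrable G0_measurable by (simp add: integrable_norm_iff)

lemma Lip_measurable: "Lip \<in> borel_measurable P"
  unfolding Lip_def[abs_def] using G0_measurable Psi_measurable by measurable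

lemma Lip_sq: "integrable P (\<lambda>x. (Lip x)\<^sup>2)"
proof (rule Bochner_Integration.integrable_bound)
  show "integrable P (\<lambda>x. 2 * (norm (G\<^sub>0 x))\<^sup>2 + 2 * r\<^sub>0\<^sup>2 * (\<Psi> x)\<^sup>2)"
    using G0_sq Psi_sq by auto
  show "AE x in P. norm ((Lip x)\<^sup>2) \<le> norm (2 * (norm (G\<^sub>0 x))\<^sup>2 + 2 * r\<^sub>0\<^sup>2 * (\<Psi> x)\<^sup>2)"
  proof (rule AE_I2)
    fix x
    have "(Lip x)\<^sup>2 \<le> 2 * (norm (G\<^sub>0 x))\<^sup>2 + 2 * (r\<^sub>0 * \<Psi> x)\<^sup>2"
      unfolding Lip_def by (rule power2_add_le)
    then show "norm ((Lip x)\<^sup>2) \<le> norm (2 * (norm (G\<^sub>0 x))\<^sup>2 + 2 * r\<^sub>0\<^sup>2 * (\<Psi> x)\<^sup>2)"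
      by (simp add: power_mult_distrib)
  qed
qed (use Lip_measurable in measurable)

lemma Lip_G0_integrable: "integrable P (\<lambda>x. Lip x * norm (G\<^sub>0 x))"
proof (rule Bochner_Integration.integrable_bound)
  show "integrable P (\<lambda>x. (Lip x)\<^sup>2 + (norm (G\<^sub>0 x))\<^sup>2)"
    using G0_sq Lip_sq by auto
  show "AE x in P. norm (Lip x * norm (G\<^sub>0 x)) \<le> norm ((Lip x)\<^sup>2 + (norm (G\<^sub>0 x))\<^sup>2)"
  proof (rule AE_I2)
    fix x
    have "2 * (Lip x * norm (G\<^sub>0 x)) \<le> (Lip x)\<^sup>2 + (norm (G\<^sub>0 x))\<^sup>2"
      using sum_squares_bound[of "Lip x" "norm (G\<^sub>0 x)"] by simp
    moreover have "0 \<le> Lip x * norm (G\<^sub>0 x)"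
      using Lip_nonneg by simp
    ultimately show "norm (Lip x * norm (G\<^sub>0 x)) \<le> norm ((Lip x)\<^sup>2 + (norm (G\<^sub>0 x))\<^sup>2)"
      by simp
  qed
qed (use Lip_measurable G0_measurable in measurable)

lemma rem_integrable:
  assumes "\<theta> \<in> \<Theta>"
  shows "integrable P (rem \<theta>)"
  unfolding rem_def[abs_def] using l_integrable(1)[OF assms] l_integrable(1)[OF theta0] G0_integrable
  by (auto intro!: Bochner_Integration.integrable_diff)

lemma rem_sq:
  assumes "\<theta> \<in> \<Theta>" "norm (\<theta> - \<theta>\<^sub>0) < r\<^sub>0" "norm (\<theta> - \<theta>\<^sub>0) \<le> s"
  shows "integrable P (\<lambda>x. (rem \<theta> x)\<^sup>2)" "(\<integral>x. (rem \<theta> x)\<^sup>2 \<partial>P) \<le> s ^ 4 * (\<integral>x. (\<Psi> x)\<^sup>2 \<partial>P)"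
proof -
  have i: "integrable P (\<lambda>x. s ^ 4 * (\<Psi> x)\<^sup>2)"
    using Psi_sq by simp
  have ae: "AE x in P. (rem \<theta> x)\<^sup>2 \<le> s ^ 4 * (\<Psi> x)\<^sup>2"
    using AE_regular
  proof eventually_elim
    case (elim x)
    have "\<bar>rem \<theta> x\<bar> \<le> \<Psi> x * s\<^sup>2"
      by (rule rem_bound[OF elim assms])
    then have "(rem \<theta> x)\<^sup>2 \<le> (\<Psi> x * s\<^sup>2)\<^sup>2"
      by (intro abs_le_square_iff[THEN iffD1]) auto
    also have "(\<Psi> x * s\<^sup>2)\<^sup>2 = s ^ 4 * (\<Psi> x)\<^sup>2"
      by (simp add: power_mult_distrib mult.commute flip: power_mult)
    finally show ?case .
  qed
  show i': "integrable P (\<lambda>x. (rem \<theta> x)\<^sup>2)"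
    by (rule Bochner_Integration.integrable_bound[OF i])
      (use ae rem_measurable[OF assms(1)] in \<open>auto elim!: eventually_mono\<close>)
  have "(\<integral>x. (rem \<theta> x)\<^sup>2 \<partial>P) \<le> (\<integral>x. s ^ 4 * (\<Psi> x)\<^sup>2 \<partial>P)"
    by (rule integral_mono_AE[OF i' i ae])
  then show "(\<integral>x. (rem \<theta> x)\<^sup>2 \<partial>P) \<le> s ^ 4 * (\<integral>x. (\<Psi> x)\<^sup>2 \<partial>P)"
    by simp
qed

lemma integral_rem:
  assumes "\<theta> \<in> \<Theta>"
  shows "(\<integral>x. rem \<theta> x \<partial>P) = f \<theta> - f \<theta>\<^sub>0 - (\<integral>x. G\<^sub>0 x \<partial>P) \<bullet> (\<theta> - \<theta>\<^sub>0)"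
  unfolding rem_def loss_mean_def
  using l_integrable(1)[OF assms] l_integrable(1)[OF theta0] G0_integrable by simp

lemma emp_loss_expansion:
  assumes "\<theta> \<in> \<Theta>"
  shows "emp n (\<lambda>x. l x \<theta>) \<omega> - emp n (\<lambda>x. l x \<theta>\<^sub>0) \<omega> = f \<theta> - f \<theta>\<^sub>0 + grad_dev n \<omega> \<bullet> (\<theta> - \<theta>\<^sub>0) + R n \<omega> \<theta>"
proof -
  have "emp n (rem \<theta>) \<omega> = emp n (\<lambda>x. l x \<theta>) \<omega> - emp n (\<lambda>x. l x \<theta>\<^sub>0) \<omega> - emp n (\<lambda>x. G\<^sub>0 x \<bullet> (\<theta> - \<theta>\<^sub>0)) \<omega>"
    by (simp add: rem_def sample_mean_diff)
  moreover have "emp n (\<lambda>x. G\<^sub>0 x \<bullet> (\<theta> - \<theta>\<^sub>0)) \<omega> = ((\<Sum>i=1..n. G\<^sub>0 (X i \<omega>)) /\<^sub>R real n) \<bullet> (\<theta> - \<theta>\<^sub>0)"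
    by (simp add: sample_mean_def inner_sum_left divide_inverse mult.commute)
  ultimately show ?thesis
    using integral_rem[OF assms] by (simp add: R_def grad_dev_def inner_diff_left)
qed

text \<open>Rescaling a net of the unit ball makes the index set independent of the radius. Net
  points must lie in \<open>\<Theta>\<close>, where the loss lives, so each index selects a point of
  \<open>\<Theta>\<close> near \<open>\<theta>\<^sub>0 + s *\<^sub>R j\<close>; this doubles the
  mesh \<open>\<epsilon> / 2\<close>.\<close>

lemma scaled_net:
  assumes "\<epsilon> > 0"
  obtains J :: "'p set" and \<pi> :: "real \<Rightarrow> 'p \<Rightarrow> 'p" where "finite J"
    "\<And>s j. s > 0 \<Longrightarrow> \<pi> s j \<in> \<Theta> \<and> norm (\<pi> s j - \<theta>\<^sub>0) \<le> s"
    "\<And>s \<theta>. \<lbrakk>s > 0; \<theta> \<in> \<Theta>; norm (\<theta> - \<theta>\<^sub>0) \<le> s\<rbrakk> \<Longrightarrow> \<exists>j\<in>J. norm (\<theta> - \<pi> s j) \<le> s * \<epsilon>"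
proof -
  obtain J where J: "finite J" "cball (0::'p) 1 \<subseteq> (\<Union>j\<in>J. ball j (\<epsilon> / 2))"
    using compact_eq_totally_bounded[THEN iffD1, OF compact_cball[of "0::'p" 1]] assms
    by (meson half_gt_zero)
  define ok where "ok s j \<theta> \<longleftrightarrow> \<theta> \<in> \<Theta> \<and> norm (\<theta> - \<theta>\<^sub>0) \<le> s \<and> norm ((\<theta> - \<theta>\<^sub>0) - s *\<^sub>R j) \<le> s * (\<epsilon> / 2)" for s j \<theta>
  \<comment> \<open>If no point qualifies, \<open>\<theta>\<^sub>0\<close> is taken, which lies in
    \<open>\<Theta>\<close> and in every ball.\<close>
  define \<pi> where "\<pi> s j = (if \<exists>\<theta>. ok s j \<theta> then SOME \<theta>. ok s j \<theta> else \<theta>\<^sub>0)" for s j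
  have pi_ok: "ok s j (\<pi> s j)" if "ok s j \<theta>" for s j \<theta>
    using that someI[of "ok s j" \<theta>] by (auto simp: \<pi>_def)
  show ?thesis
  proof (rule that[of J \<pi>, OF J(1)])
    show "\<pi> s j \<in> \<Theta> \<and> norm (\<pi> s j - \<theta>\<^sub>0) \<le> s" if "s > 0" for s j
    proof (cases "\<exists>\<theta>. ok s j \<theta>")
      case True
      then show ?thesis
        using pi_ok by (auto simp: ok_def)
    next
      case False
      then show ?thesis
        using that theta0 by (simp add: \<pi>_def)
    qed
    show "\<exists>j\<in>J. norm (\<theta> - \<pi> s j) \<le> s * \<epsilon>" if s: "s > 0" and th: "\<theta> \<in> \<Theta>" "norm (\<theta> - \<theta>\<^sub>0) \<le> s" for s \<theta>
    proof -
      have "(\<theta> - \<theta>\<^sub>0) /\<^sub>R s \<in> cball 0 1"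
        using s th by (simp add: divide_inverse_commute[symmetric])
      then obtain j where j: "j \<in> J" "norm ((\<theta> - \<theta>\<^sub>0) /\<^sub>R s - j) < \<epsilon> / 2"
        using J(2) unfolding subset_iff mem_cball UN_iff mem_ball dist_norm
        by (metis norm_minus_commute)
      have "(\<theta> - \<theta>\<^sub>0) - s *\<^sub>R j = s *\<^sub>R ((\<theta> - \<theta>\<^sub>0) /\<^sub>R s - j)"
        using s by (simp add: scaleR_diff_right)
      then have "norm ((\<theta> - \<theta>\<^sub>0) - s *\<^sub>R j) = s * norm ((\<theta> - \<theta>\<^sub>0) /\<^sub>R s - j)"
        using s by simp
      also have "\<dots> \<le> s * (\<epsilon> / 2)"
        using s j by (intro mult_left_mono) auto
      finally have *: "norm ((\<theta> - \<theta>\<^sub>0) - s *\<^sub>R j) \<le> s * (\<epsilon> / 2)" .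
      then have "ok s j \<theta>"
        using th by (simp add: ok_def)
      from pi_ok[OF this] have "norm ((\<pi> s j - \<theta>\<^sub>0) - s *\<^sub>R j) \<le> s * (\<epsilon> / 2)"
        by (simp add: ok_def)
      with * have "norm (((\<theta> - \<theta>\<^sub>0) - s *\<^sub>R j) - ((\<pi> s j - \<theta>\<^sub>0) - s *\<^sub>R j)) \<le> s * (\<epsilon> / 2) + s * (\<epsilon> / 2)"
        by (rule order_trans[OF norm_triangle_ineq4 add_mono])
      then show ?thesis
        using j(1) by (intro bexI[of _ j]) (auto simp: field_simps)
    qed
  qed
qed

text \<open>Chebyshev's inequality is applied at the points of a net in the ball of radius \<open>s\<close> around
  \<open>\<theta>\<^sub>0\<close>, for all \<open>s\<close> in a grid of mesh \<open>1 / sqrt n\<close>. The cardinality of the net does not depend on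
  \<open>s\<close> and the exceptional probability at each of its points is \<open>O(1 / n)\<close>, because the remainder
  has second moment \<open>O(s^4)\<close> there; as there are \<open>O(sqrt n)\<close> radii, the union bound suffices and
  no chaining is needed.\<close>

lemma whp_remainder:
  assumes eta: "\<eta> > 0"
  shows "whp (\<lambda>n \<omega>. \<forall>\<theta>\<in>\<Theta>. norm (\<theta> - \<theta>\<^sub>0) < r\<^sub>0 / 2 \<longrightarrow> \<bar>R n \<omega> \<theta>\<bar> \<le> \<eta> * ((norm (\<theta> - \<theta>\<^sub>0))\<^sup>2 + 1 / real n))"
proof -
  define \<mu> where "\<mu> = (\<integral>x. \<Psi> x \<partial>P)"
  have mu: "\<mu> \<ge> 0"
    unfolding \<mu>_def using Psi_nonneg by (intro integral_nonneg_AE) auto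
  \<comment> \<open>Moving to a net point costs \<open>(\<mu> + 1) * \<epsilon> * s^2\<close> in the
    sample average and \<open>\<mu> * \<epsilon> * s^2\<close> in the expectation; with
    \<open>\<eta> / 4 * s^2\<close> at the net point itself the total is
    \<open>\<eta> / 2 * s^2\<close>.\<close>
  define \<epsilon> where "\<epsilon> = \<eta> / 4 / (2 * \<mu> + 1)"
  have eps: "\<epsilon> > 0" "(2 * \<mu> + 1) * \<epsilon> = \<eta> / 4"
  proof -
    have *: "(c::real) * (e / c) = e" if "c > 0" for c e
      using that by simp
    show "\<epsilon> > 0"
      unfolding \<epsilon>_def using eta mu by (intro divide_pos_pos) simp_all
    show "(2 * \<mu> + 1) * \<epsilon> = \<eta> / 4"
      unfolding \<epsilon>_def using mu by (intro *) simp
  qed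
  obtain J and \<pi> :: "real \<Rightarrow> 'p \<Rightarrow> 'p" where J: "finite J"
    and pi: "\<And>s j. s > 0 \<Longrightarrow> \<pi> s j \<in> \<Theta> \<and> norm (\<pi> s j - \<theta>\<^sub>0) \<le> s"
    and net: "\<And>s \<theta>. \<lbrakk>s > 0; \<theta> \<in> \<Theta>; norm (\<theta> - \<theta>\<^sub>0) \<le> s\<rbrakk> \<Longrightarrow> \<exists>j\<in>J. norm (\<theta> - \<pi> s j) \<le> s * \<epsilon>"
    using scaled_net[OF eps(1)] by metis
  define \<nu> where "\<nu> = (\<integral>x. (\<Psi> x)\<^sup>2 \<partial>P)"
  have nu: "\<nu> \<ge> 0"
    unfolding \<nu>_def by simp
  define sc where "sc n k = real k / sqrt (real n)" for n k :: nat
  \<comment> \<open>Indices up to \<open>n\<close> suffice: radii below \<open>r\<^sub>0\<close>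
    have \<open>k < r\<^sub>0 * sqrt n\<close>, which is at most \<open>n\<close> once
    \<open>r\<^sub>0 \<le> sqrt n\<close>.\<close>
  define I where "I n = {k \<in> {1..n}. sc n k < r\<^sub>0}" for n
  define bad where "bad n k j = {\<omega> \<in> space M. \<bar>emp n (rem (\<pi> (sc n k) j)) \<omega> - (\<integral>x. rem (\<pi> (sc n k) j) x \<partial>P)\<bar>
      \<ge> \<eta> / 4 * (sc n k)\<^sup>2}" for n k j
  have whp_net: "whp (\<lambda>n \<omega>. \<forall>k\<in>I n. \<forall>j\<in>J. \<bar>R n \<omega> (\<pi> (sc n k) j)\<bar> < \<eta> / 4 * (sc n k)\<^sup>2)"
  proof (rule whp_bad_events)
    have "(\<lambda>n. r\<^sub>0 * real (card J) * (16 * \<nu> / \<eta>\<^sup>2) / sqrt (real n)) \<longlonglongrightarrow> 0"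
      by (intro tendsto_divide_0[OF tendsto_const] filterlim_at_top_imp_at_infinity
          filterlim_compose[OF sqrt_at_top filterlim_real_sequentially])
    then show "(\<lambda>n. r\<^sub>0 * real (card J) * (16 * \<nu> / \<eta>\<^sup>2) / sqrt (real n)) \<longlonglongrightarrow> 0" .
    show "\<forall>\<^sub>F n in sequentially. \<exists>A\<in>events. prob A \<le> r\<^sub>0 * real (card J) * (16 * \<nu> / \<eta>\<^sup>2) / sqrt (real n) \<and>
      (\<forall>\<omega>\<in>space M - A. \<forall>k\<in>I n. \<forall>j\<in>J. \<bar>R n \<omega> (\<pi> (sc n k) j)\<bar> < \<eta> / 4 * (sc n k)\<^sup>2)"
      using eventually_ge_at_top[of 1]
    proof eventually_elim
      case (elim n)
      have finI: "finite (I n)"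
        by (simp add: I_def)
      have sc_pos: "sc n k > 0" if "k \<in> I n" for k
        using that elim by (auto simp: I_def sc_def)
      have bad_ev: "bad n k j \<in> events" if "k \<in> I n" for k j
      proof -
        have "emp n (rem (\<pi> (sc n k) j)) \<in> borel_measurable M"
          using pi[OF sc_pos[OF that]] by (intro emp_measurable rem_measurable) auto
        then show ?thesis
          unfolding bad_def by measurable
      qed
      have bad_prob: "prob (bad n k j) \<le> 16 * \<nu> / \<eta>\<^sup>2 / real n" if k: "k \<in> I n" for k j
      proof -
        let ?s = "sc n k" and ?t = "\<pi> (sc n k) j"
        have t: "?t \<in> \<Theta>" "norm (?t - \<theta>\<^sub>0) \<le> ?s" "norm (?t - \<theta>\<^sub>0) < r\<^sub>0"
          using pi[OF sc_pos[OF k], of j] k by (auto simp: I_def)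
        have "prob (bad n k j) \<le> (\<integral>x. (rem ?t x)\<^sup>2 \<partial>P) / (real n * (\<eta> / 4 * ?s\<^sup>2)\<^sup>2)"
          unfolding bad_def using elim eta sc_pos[OF k]
          by (intro emp_chebyshev rem_measurable rem_sq(1)[OF t(1,3,2)] t) auto
        also have "\<dots> \<le> (?s ^ 4 * \<nu>) / (real n * (\<eta> / 4 * ?s\<^sup>2)\<^sup>2)"
          using rem_sq(2)[OF t(1,3,2)] by (intro divide_right_mono) (auto simp: \<nu>_def)
        \<comment> \<open>The fourth power of the radius cancels against the squared threshold, so
          the bound is the same for all radii.\<close>
        also have "\<dots> = 16 * \<nu> / \<eta>\<^sup>2 / real n"
          using sc_pos[OF k] by (simp add: power_mult_distrib power_divide field_simps flip: power_mult)
        finally show ?thesis .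
      qed
      have cardI: "real (card (I n)) \<le> r\<^sub>0 * sqrt (real n)"
      proof -
        have "I n \<subseteq> {1..nat \<lfloor>r\<^sub>0 * sqrt (real n)\<rfloor>}"
        proof
          fix k assume "k \<in> I n"
          then have "k \<ge> 1" "real k < r\<^sub>0 * sqrt (real n)"
            using elim by (auto simp: I_def sc_def pos_divide_less_eq)
          then show "k \<in> {1..nat \<lfloor>r\<^sub>0 * sqrt (real n)\<rfloor>}"
            by (auto simp: le_nat_floor)
        qed
        from card_mono[OF _ this] have "card (I n) \<le> nat \<lfloor>r\<^sub>0 * sqrt (real n)\<rfloor>"
          by simp
        also have "real (nat \<lfloor>r\<^sub>0 * sqrt (real n)\<rfloor>) \<le> r\<^sub>0 * sqrt (real n)"
          using r0 by (intro of_nat_floor) auto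
        finally show ?thesis
          by simp
      qed
      let ?A = "\<Union>(k, j)\<in>I n \<times> J. bad n k j"
      have A: "?A \<in> events"
        using finI J bad_ev by (intro sets.finite_UN) auto
      have "prob ?A \<le> (\<Sum>(k, j)\<in>I n \<times> J. prob (bad n k j))"
        unfolding case_prod_unfold
        by (rule finite_measure_subadditive_finite) (use finI J bad_ev in auto)
      also have "\<dots> \<le> (\<Sum>(k, j)\<in>I n \<times> J. 16 * \<nu> / \<eta>\<^sup>2 / real n)"
        by (rule sum_mono) (use bad_prob in auto)
      also have "\<dots> = real (card (I n)) * (real (card J) * (16 * \<nu> / \<eta>\<^sup>2 / real n))"
        by (simp add: case_prod_unfold card_cartesian_product)
      also have "\<dots> \<le> r\<^sub>0 * sqrt (real n) * (real (card J) * (16 * \<nu> / \<eta>\<^sup>2 / real n))"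
        using cardI nu by (intro mult_right_mono) auto
      also have "\<dots> = r\<^sub>0 * real (card J) * (16 * \<nu> / \<eta>\<^sup>2) / sqrt (real n)"
      proof -
        have "sqrt (real n) / real n = 1 / sqrt (real n)"
          using elim by (simp add: divide_simps)
        then show ?thesis
          by (simp add: divide_inverse mult_ac)
      qed
      finally have "prob ?A \<le> r\<^sub>0 * real (card J) * (16 * \<nu> / \<eta>\<^sup>2) / sqrt (real n)" .
      then show ?case
        using A by (intro bexI[of _ ?A]) (auto simp: bad_def R_def not_le)
    qed
  qed
  have "whp (\<lambda>n \<omega>. \<bar>emp n \<Psi> \<omega> - \<mu>\<bar> < 1)"
    unfolding \<mu>_def by (rule whp_weak_law[OF Psi_measurable Psi_sq]) simp
  from whp_conj[OF whp_regular whp_conj[OF this whp_net]] show ?thesis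
  proof (rule whp_mono_eventually, goal_cases)
    case 1
    have "\<forall>\<^sub>F n in sequentially. 1 / sqrt (real n) < r\<^sub>0 / 2"
    proof -
      have "(\<lambda>n. 1 / sqrt (real n)) \<longlonglongrightarrow> 0"
        by (intro tendsto_divide_0[OF tendsto_const] filterlim_at_top_imp_at_infinity
          filterlim_compose[OF sqrt_at_top filterlim_real_sequentially])
      from order_tendstoD(2)[OF this, of "r\<^sub>0 / 2"] r0 show ?thesis
        by simp
    qed
    moreover have "\<forall>\<^sub>F n in sequentially. r\<^sub>0 \<le> sqrt (real n)"
      using filterlim_compose[OF sqrt_at_top filterlim_real_sequentially] by (simp add: filterlim_at_top)
    ultimately show ?case
      using eventually_ge_at_top[of 1]
    proof (eventually_elim, intro ballI impI, elim conjE)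
      fix n \<omega> \<theta>
      assume n: "1 / sqrt (real n) < r\<^sub>0 / 2" "r\<^sub>0 \<le> sqrt (real n)" "1 \<le> n"
        and reg: "\<forall>i\<ge>1. regular (X i \<omega>)" and psi: "\<bar>emp n \<Psi> \<omega> - \<mu>\<bar> < 1"
        and nt: "\<forall>k\<in>I n. \<forall>j\<in>J. \<bar>R n \<omega> (\<pi> (sc n k) j)\<bar> < \<eta> / 4 * (sc n k)\<^sup>2"
        and th: "\<theta> \<in> \<Theta>" "norm (\<theta> - \<theta>\<^sub>0) < r\<^sub>0 / 2"
      define d where "d = norm (\<theta> - \<theta>\<^sub>0)"
      \<comment> \<open>The smallest positive grid radius that is not below \<open>d\<close>. The
        lower cut at index 1 is the origin of the summand \<open>1 / n\<close> in the final
        bound.\<close>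
      define k where "k = max 1 (nat \<lceil>sqrt (real n) * d\<rceil>)"
      define s where "s = sc n k"
      have d: "0 \<le> d" "d < r\<^sub>0 / 2"
        using th by (auto simp: d_def)
      have sn: "sqrt (real n) > 0"
        using n by simp
      have k1: "real k \<le> sqrt (real n) * d + 1"
      proof (cases "nat \<lceil>sqrt (real n) * d\<rceil> \<le> 1")
        case True
        then show ?thesis
          using sn d by (simp add: k_def max_def)
      next
        case False
        have "0 \<le> sqrt (real n) * d"
          using sn d by simp
        then have "real (nat \<lceil>sqrt (real n) * d\<rceil>) \<le> sqrt (real n) * d + 1"
          by simp
        then show ?thesis
          using False by (simp add: k_def max_def)
      qed
      have k2: "sqrt (real n) * d \<le> real k"
        unfolding k_def by (meson le_max_iff_disj of_nat_le_iff order_trans real_nat_ceiling_ge max.cobounded2)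
      have s: "d \<le> s" "s \<le> d + 1 / sqrt (real n)" "s > 0"
      proof -
        show "d \<le> s"
          using k2 sn by (simp add: s_def sc_def pos_le_divide_eq mult.commute)
        show "s \<le> d + 1 / sqrt (real n)"
          using k1 sn by (simp add: s_def sc_def field_simps)
        show "s > 0"
          using sn by (simp add: s_def sc_def k_def)
      qed
      have sr: "s < r\<^sub>0"
        using s d n by linarith
      have kI: "k \<in> I n"
      proof -
        have "real k < r\<^sub>0 * sqrt (real n)"
          using sr sn by (simp add: s_def sc_def pos_divide_less_eq)
        also have "\<dots> \<le> sqrt (real n) * sqrt (real n)"
          using n by (intro mult_right_mono) auto
        finally have "k \<le> n"
          by simp
        moreover have "1 \<le> k"
          by (simp add: k_def)
        ultimately show ?thesis
          using sr by (simp add: I_def s_def)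
      qed
      obtain j where j: "j \<in> J" "norm (\<theta> - \<pi> s j) \<le> s * \<epsilon>"
        using net[OF s(3) th(1)] s(1) by (auto simp: d_def)
      define t where "t = \<pi> s j"
      have t: "t \<in> \<Theta>" "norm (t - \<theta>\<^sub>0) \<le> s"
        using pi[OF s(3), of j] by (auto simp: t_def)
      have Rt: "\<bar>R n \<omega> t\<bar> \<le> \<eta> / 4 * s\<^sup>2"
        using nt kI j(1) by (force simp: t_def s_def)
      have diff: "\<bar>rem \<theta> x - rem t x\<bar> \<le> \<Psi> x * (s\<^sup>2 * \<epsilon>)" if "regular x" for x
      proof -
        have "\<bar>rem \<theta> x - rem t x\<bar> \<le> \<Psi> x * s * norm (\<theta> - t)"
          by (rule rem_diff_bound) (use that th t s sr in \<open>auto simp: d_def\<close>)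
        also have "\<dots> \<le> \<Psi> x * s * (s * \<epsilon>)"
          using j(2) s Psi_nonneg by (intro mult_left_mono) (auto simp: t_def)
        finally show ?thesis
          by (simp add: power2_eq_square mult_ac)
      qed
      have "\<bar>sample_mean n (\<lambda>i. rem \<theta> (X i \<omega>) - rem t (X i \<omega>))\<bar> \<le> sample_mean n (\<lambda>i. \<Psi> (X i \<omega>) * (s\<^sup>2 * \<epsilon>))"
        by (rule abs_sample_mean_le) (use diff reg in auto)
      also have "\<dots> = emp n \<Psi> \<omega> * (s\<^sup>2 * \<epsilon>)"
        by (rule sample_mean_multc)
      also have "\<dots> \<le> (\<mu> + 1) * (s\<^sup>2 * \<epsilon>)"
        using psi eps by (intro mult_right_mono) auto
      finally have 1: "\<bar>emp n (rem \<theta>) \<omega> - emp n (rem t) \<omega>\<bar> \<le> (\<mu> + 1) * (s\<^sup>2 * \<epsilon>)"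
        by (simp add: sample_mean_diff)
      have "\<bar>\<integral>x. rem \<theta> x - rem t x \<partial>P\<bar> \<le> (\<integral>x. \<Psi> x * (s\<^sup>2 * \<epsilon>) \<partial>P)"
      proof -
        have "\<bar>\<integral>x. rem \<theta> x - rem t x \<partial>P\<bar> \<le> (\<integral>x. \<bar>rem \<theta> x - rem t x\<bar> \<partial>P)"
          by (rule integral_abs_bound)
        also have "\<dots> \<le> (\<integral>x. \<Psi> x * (s\<^sup>2 * \<epsilon>) \<partial>P)"
          by (rule integral_mono_AE)
            (use rem_integrable[OF th(1)] rem_integrable[OF t(1)] Psi_integrable AE_regular diff
             in \<open>auto elim!: eventually_mono\<close>)
        finally show ?thesis .
      qed
      then have 2: "\<bar>(\<integral>x. rem \<theta> x \<partial>P) - (\<integral>x. rem t x \<partial>P)\<bar> \<le> \<mu> * (s\<^sup>2 * \<epsilon>)"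
        using rem_integrable[OF th(1)] rem_integrable[OF t(1)] by (simp add: \<mu>_def)
      have "\<bar>R n \<omega> \<theta>\<bar> \<le> \<bar>R n \<omega> t\<bar> + (\<mu> + 1) * (s\<^sup>2 * \<epsilon>) + \<mu> * (s\<^sup>2 * \<epsilon>)"
        using 1 2 unfolding R_def by linarith
      also have "\<dots> \<le> \<eta> / 4 * s\<^sup>2 + ((2 * \<mu> + 1) * \<epsilon>) * s\<^sup>2"
        using Rt by (simp add: algebra_simps)
      also have "\<dots> = \<eta> / 2 * s\<^sup>2"
        by (simp add: eps(2))
      also have "s\<^sup>2 \<le> (d + 1 / sqrt (real n))\<^sup>2"
        using s by (intro power_mono) auto
      also have "\<dots> \<le> 2 * d\<^sup>2 + 2 * (1 / sqrt (real n))\<^sup>2"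
        by (rule power2_add_le)
      finally have "\<bar>R n \<omega> \<theta>\<bar> \<le> \<eta> / 2 * (2 * d\<^sup>2 + 2 * (1 / sqrt (real n))\<^sup>2)"
        using eta by (simp add: mult_left_mono)
      then show "\<bar>R n \<omega> \<theta>\<bar> \<le> \<eta> * ((norm (\<theta> - \<theta>\<^sub>0))\<^sup>2 + 1 / real n)"
        using n by (simp add: d_def power_divide algebra_simps)
    qed
  qed
qed

end

section \<open>Laws of large numbers for the loss and its gradient\<close>

lemma sample_var_eq:
  assumes "n \<ge> 1"
  shows "sample_var n y = sample_mean n (\<lambda>i. (y i)\<^sup>2) - (sample_mean n y)\<^sup>2"
proof -
  have "sample_var n y = sample_mean n (\<lambda>i. (y i)\<^sup>2 - (2 * sample_mean n y) * y i + (sample_mean n y)\<^sup>2)"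
    unfolding sample_var_def by (rule sample_mean_cong) (simp add: power2_diff)
  also have "\<dots> = sample_mean n (\<lambda>i. (y i)\<^sup>2) - 2 * sample_mean n y * sample_mean n y + (sample_mean n y)\<^sup>2"
    using assms by (simp only: sample_mean_add sample_mean_diff sample_mean_cmult sample_mean_const)
  finally show ?thesis
    by (simp add: power2_eq_square)
qed

lemma pos_mult_divide_cancel: "c > 0 \<Longrightarrow> (c::real) * (e / c) = e"
  by simp

lemma abs_square_diff_le:
  fixes a b :: real
  assumes "\<bar>a\<bar> \<le> B" "\<bar>b\<bar> \<le> B"
  shows "\<bar>a\<^sup>2 - b\<^sup>2\<bar> \<le> 2 * B * \<bar>a - b\<bar>"
proof -
  have "\<bar>a\<^sup>2 - b\<^sup>2\<bar> = \<bar>a + b\<bar> * \<bar>a - b\<bar>"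
    by (simp add: power2_eq_square square_diff_square_factored abs_mult)
  also have "\<dots> \<le> 2 * B * \<bar>a - b\<bar>"
    using assms by (intro mult_right_mono) auto
  finally show ?thesis .
qed

context loss_model
begin

text \<open>Equicontinuity holds for \<open>x\<close> in a set \<open>K\<close> of large probability
  only; elsewhere boundedness of the loss gives \<open>2 * B\<close>.\<close>

lemma l_oscillation:
  assumes "\<epsilon> > 0"
  obtains K \<rho> where "K \<in> sets P" "measure P K \<ge> 1 - \<epsilon>" "\<rho> > 0"
    "\<And>x \<theta> \<theta>'. \<lbrakk>regular x; x \<in> space P; \<theta> \<in> \<Theta>; \<theta>' \<in> \<Theta>; norm (\<theta> - \<theta>') < \<rho>\<rbrakk> \<Longrightarrow>
       \<bar>l x \<theta> - l x \<theta>'\<bar> \<le> \<epsilon> + 2 * B * indicator (space P - K) x"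
proof -
  obtain K \<rho> where K: "K \<in> sets P" "measure P K \<ge> 1 - \<epsilon>" "\<rho> > 0"
    "\<forall>x\<in>K. \<forall>\<theta>\<in>\<Theta>. \<forall>\<theta>'\<in>\<Theta>. norm (\<theta> - \<theta>') < \<rho> \<longrightarrow> \<bar>l x \<theta> - l x \<theta>'\<bar> \<le> \<epsilon>"
    using l_equicontinuous[OF assms] by blast
  show ?thesis
  proof (rule that[OF K(1-3)])
    fix x \<theta> \<theta>'
    assume x: "regular x" "x \<in> space P" and th: "\<theta> \<in> \<Theta>" "\<theta>' \<in> \<Theta>" "norm (\<theta> - \<theta>') < \<rho>"
    show "\<bar>l x \<theta> - l x \<theta>'\<bar> \<le> \<epsilon> + 2 * B * indicator (space P - K) x"
    proof (cases "x \<in> K")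
      case True
      then show ?thesis
        using K(4) th by auto
    next
      case False
      then show ?thesis
        using regular_bounded[OF x(1) th(1)] regular_bounded[OF x(1) th(2)] x(2) assms
        by (simp add: indicator_def)
    qed
  qed
qed

lemma f_oscillation:
  assumes K: "K \<in> sets P" "measure P K \<ge> 1 - \<epsilon>" and th: "\<theta> \<in> \<Theta>" "\<theta>' \<in> \<Theta>"
    and osc: "\<And>x. \<lbrakk>regular x; x \<in> space P\<rbrakk> \<Longrightarrow> \<bar>l x \<theta> - l x \<theta>'\<bar> \<le> \<epsilon> + 2 * B * indicator (space P - K) x"
  shows "\<bar>f \<theta> - f \<theta>'\<bar> \<le> \<epsilon> + 2 * B * \<epsilon>"
proof -
  have ii: "integrable P (\<lambda>x. indicator (space P - K) x :: real)"
    using K by (intro integrable_real_indicator) (auto simp: P.emeasure_eq_measure)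
  have "\<bar>f \<theta> - f \<theta>'\<bar> = \<bar>\<integral>x. l x \<theta> - l x \<theta>' \<partial>P\<bar>"
    using l_integrable(1)[OF th(1)] l_integrable(1)[OF th(2)] by (simp add: loss_mean_def)
  also have "\<dots> \<le> (\<integral>x. \<bar>l x \<theta> - l x \<theta>'\<bar> \<partial>P)"
    by (rule integral_abs_bound)
  also have "\<dots> \<le> (\<integral>x. \<epsilon> + 2 * B * indicator (space P - K) x \<partial>P)"
  proof (rule integral_mono_AE)
    show "AE x in P. \<bar>l x \<theta> - l x \<theta>'\<bar> \<le> \<epsilon> + 2 * B * indicator (space P - K) x"
      using AE_regular AE_space by eventually_elim (rule osc)
  qed (use l_integrable(1)[OF th(1)] l_integrable(1)[OF th(2)] ii in auto)
  also have "\<dots> = \<epsilon> + 2 * B * measure P (space P - K)"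
    using ii K by (simp add: P.prob_space)
  also have "\<dots> \<le> \<epsilon> + 2 * B * \<epsilon>"
    using K B by (simp add: P.prob_compl)
  finally show ?thesis .
qed

lemma continuous_on_f: "continuous_on \<Theta> f"
  unfolding continuous_on_iff
proof (intro ballI allI impI)
  fix \<theta> e :: real and \<theta>1 assume th: "\<theta>1 \<in> \<Theta>" and e: "(0::real) < e"
  define \<epsilon> where "\<epsilon> = e / 2 / (1 + 2 * B)"
  have eps: "\<epsilon> > 0" "(1 + 2 * B) * \<epsilon> = e / 2"
    unfolding \<epsilon>_def using e B by (simp add: add_pos_pos, intro pos_mult_divide_cancel, simp add: add_pos_pos)
  obtain K \<rho> where K: "K \<in> sets P" "measure P K \<ge> 1 - \<epsilon>" "\<rho> > 0"
    "\<And>x \<theta> \<theta>'. \<lbrakk>regular x; x \<in> space P; \<theta> \<in> \<Theta>; \<theta>' \<in> \<Theta>; norm (\<theta> - \<theta>') < \<rho>\<rbrakk> \<Longrightarrow>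
       \<bar>l x \<theta> - l x \<theta>'\<bar> \<le> \<epsilon> + 2 * B * indicator (space P - K) x"
    using l_oscillation[OF eps(1)] by metis
  have "dist (f \<theta>') (f \<theta>1) < e" if "\<theta>' \<in> \<Theta>" "dist \<theta>' \<theta>1 < \<rho>" for \<theta>'
  proof -
    have "\<bar>f \<theta>' - f \<theta>1\<bar> \<le> \<epsilon> + 2 * B * \<epsilon>"
      using f_oscillation[OF K(1,2) that(1) th] K(4) th that by (simp add: dist_norm)
    also have "\<dots> = e / 2"
      using eps(2) by (simp add: distrib_right)
    finally show ?thesis
      using e by (simp add: dist_real_def)
  qed
  then show "\<exists>d>0. \<forall>\<theta>'\<in>\<Theta>. dist \<theta>' \<theta>1 < d \<longrightarrow> dist (f \<theta>') (f \<theta>1) < e"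
    using K(3) by blast
qed

text \<open>Finitely many centres cover \<open>\<Theta>\<close>. The weak law is applied at the
  centres and to the fraction of the sample outside \<open>K\<close>, and the oscillation bound
  transfers it to all parameters.\<close>

lemma whp_uniform_law:
  assumes eta: "\<eta> > 0"
  shows "whp (\<lambda>n \<omega>. \<forall>\<theta>\<in>\<Theta>. \<bar>emp n (\<lambda>x. l x \<theta>) \<omega> - f \<theta>\<bar> \<le> \<eta>)"
proof -
  \<comment> \<open>The contributions are \<open>\<epsilon> + 4 * B * \<epsilon>\<close> from the
    sample average, \<open>\<epsilon> + 2 * B * \<epsilon>\<close> from \<open>f\<close>, and
    \<open>\<epsilon>\<close> at the centre.\<close>
  define \<epsilon> where "\<epsilon> = \<eta> / (3 + 6 * B)"
  have eps: "\<epsilon> > 0" "3 * \<epsilon> + 6 * B * \<epsilon> = \<eta>"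
  proof -
    show "\<epsilon> > 0"
      using eta B by (simp add: \<epsilon>_def add_pos_pos)
    have "(3 + 6 * B) * \<epsilon> = \<eta>"
      unfolding \<epsilon>_def using B by (intro pos_mult_divide_cancel) (simp add: add_pos_pos)
    then show "3 * \<epsilon> + 6 * B * \<epsilon> = \<eta>"
      by (simp add: distrib_right)
  qed
  obtain K \<rho> where K: "K \<in> sets P" "measure P K \<ge> 1 - \<epsilon>" "\<rho> > 0"
    and osc: "\<And>x \<theta> \<theta>'. \<lbrakk>regular x; x \<in> space P; \<theta> \<in> \<Theta>; \<theta>' \<in> \<Theta>; norm (\<theta> - \<theta>') < \<rho>\<rbrakk> \<Longrightarrow>
       \<bar>l x \<theta> - l x \<theta>'\<bar> \<le> \<epsilon> + 2 * B * indicator (space P - K) x"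
    using l_oscillation[OF eps(1)] by metis
  obtain F where F: "F \<subseteq> \<Theta>" "finite F" "\<Theta> \<subseteq> (\<Union>t\<in>F. ball t \<rho>)"
    by (rule compactE_image[OF compact_Theta, of \<Theta> "\<lambda>t. ball t \<rho>"]) (use K(3) in auto)
  define ind where "ind x = (indicator (space P - K) x :: real)" for x
  have indm: "ind \<in> borel_measurable P"
    unfolding ind_def[abs_def] using K by measurable
  have ind2: "integrable P (\<lambda>x. (ind x)\<^sup>2)"
  proof (rule P.integrable_const_bound[where B = 1])
    show "AE x in P. norm ((ind x)\<^sup>2) \<le> 1"
      by (simp add: ind_def indicator_def)
  qed (use indm in measurable)
  have indi: "(\<integral>x. ind x \<partial>P) \<le> \<epsilon>"
    using K by (simp add: ind_def[abs_def] P.prob_compl)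
  have w1: "whp (\<lambda>n \<omega>. \<bar>emp n ind \<omega> - (\<integral>x. ind x \<partial>P)\<bar> < \<epsilon>)"
    by (rule whp_weak_law[OF indm ind2 eps(1)])
  have w2: "whp (\<lambda>n \<omega>. \<forall>t\<in>F. \<bar>emp n (\<lambda>x. l x t) \<omega> - f t\<bar> < \<epsilon>)"
    unfolding loss_mean_def
    using F by (intro whp_ball whp_weak_law l_measurable l_integrable eps) auto
  show ?thesis
  proof (rule whp_mono_eventually[OF whp_conj[OF whp_regular whp_conj[OF w1 w2]]], goal_cases)
    case 1
    show ?case
      using eventually_ge_at_top[of 1]
    proof (eventually_elim, intro ballI impI, elim conjE)
      fix n \<omega> \<theta>
      assume n: "1 \<le> n" and om: "\<omega> \<in> space M" and reg: "\<forall>i\<ge>1. regular (X i \<omega>)"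
        and i: "\<bar>emp n ind \<omega> - (\<integral>x. ind x \<partial>P)\<bar> < \<epsilon>" and Ft: "\<forall>t\<in>F. \<bar>emp n (\<lambda>x. l x t) \<omega> - f t\<bar> < \<epsilon>"
        and th: "\<theta> \<in> \<Theta>"
      obtain t where t: "t \<in> F" "norm (\<theta> - t) < \<rho>"
        using F(3) th by (auto simp: dist_norm norm_minus_commute)
      have tT: "t \<in> \<Theta>"
        using t F by auto
      have xs: "X i \<omega> \<in> space P" if "i \<in> {1..n}" for i
        using X_space[OF om, of n] that by auto
      have "\<bar>sample_mean n (\<lambda>i. l (X i \<omega>) \<theta> - l (X i \<omega>) t)\<bar> \<le> sample_mean n (\<lambda>i. \<epsilon> + 2 * B * ind (X i \<omega>))"
        unfolding ind_def using osc[OF _ _ th tT t(2)] reg xs by (intro abs_sample_mean_le) auto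
      also have "\<dots> = \<epsilon> + 2 * B * emp n ind \<omega>"
        using n by (simp add: sample_mean_add sample_mean_cmult sample_mean_const)
      also have "\<dots> \<le> \<epsilon> + 2 * B * (2 * \<epsilon>)"
        using i indi B by (intro add_left_mono mult_left_mono) auto
      finally have 1: "\<bar>emp n (\<lambda>x. l x \<theta>) \<omega> - emp n (\<lambda>x. l x t) \<omega>\<bar> \<le> \<epsilon> + 4 * B * \<epsilon>"
        by (simp add: sample_mean_diff)
      have 2: "\<bar>f \<theta> - f t\<bar> \<le> \<epsilon> + 2 * B * \<epsilon>"
        by (rule f_oscillation[OF K(1,2) th tT]) (rule osc[OF _ _ th tT t(2)])
      have "\<bar>emp n (\<lambda>x. l x t) \<omega> - f t\<bar> < \<epsilon>"
        using Ft t by blast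
      then show "\<bar>emp n (\<lambda>x. l x \<theta>) \<omega> - f \<theta>\<bar> \<le> \<eta>"
        using 1 2 eps(2) by linarith
    qed
  qed
qed

section \<open>Averages of random vectors and of second order quantities\<close>

definition vec_mean :: "nat \<Rightarrow> ('x \<Rightarrow> 'p) \<Rightarrow> 'w \<Rightarrow> 'p" where
  "vec_mean n v \<omega> = (\<Sum>i=1..n. v (X i \<omega>)) /\<^sub>R real n"

lemma vec_mean_inner: "vec_mean n v \<omega> \<bullet> h = emp n (\<lambda>x. v x \<bullet> h) \<omega>"
  by (simp add: vec_mean_def sample_mean_def inner_sum_left divide_inverse mult.commute)

lemma component_square_integrable:
  fixes v :: "'x \<Rightarrow> 'p"
  assumes "v \<in> borel_measurable P" "integrable P (\<lambda>x. (norm (v x))\<^sup>2)"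
  shows "integrable P (\<lambda>x. (v x \<bullet> b)\<^sup>2)"
proof (rule Bochner_Integration.integrable_bound)
  show "integrable P (\<lambda>x. (norm b)\<^sup>2 * (norm (v x))\<^sup>2)"
    using assms by simp
  show "AE x in P. norm ((v x \<bullet> b)\<^sup>2) \<le> norm ((norm b)\<^sup>2 * (norm (v x))\<^sup>2)"
  proof (rule AE_I2)
    fix x
    have "\<bar>v x \<bullet> b\<bar> \<le> \<bar>norm (v x) * norm b\<bar>"
      using Cauchy_Schwarz_ineq2[of "v x" b] by simp
    then have "(v x \<bullet> b)\<^sup>2 \<le> (norm (v x) * norm b)\<^sup>2"
      by (simp only: abs_le_square_iff)
    then show "norm ((v x \<bullet> b)\<^sup>2) \<le> norm ((norm b)\<^sup>2 * (norm (v x))\<^sup>2)"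
      by (simp add: power_mult_distrib mult.commute)
  qed
qed (use assms in measurable)

lemma vec_integrable:
  fixes v :: "'x \<Rightarrow> 'p"
  assumes "v \<in> borel_measurable P" "integrable P (\<lambda>x. (norm (v x))\<^sup>2)"
  shows "integrable P v"
proof -
  have "integrable P (\<lambda>x. norm (v x))"
    by (rule square_integrable_P[OF _ assms(2)]) (use assms in measurable)
  then show ?thesis
    using assms by (simp add: integrable_norm_iff)
qed

lemma vec_mean_component:
  assumes "v \<in> borel_measurable P" "integrable P (\<lambda>x. (norm (v x))\<^sup>2)"
  shows "(vec_mean n v \<omega> - (\<integral>x. v x \<partial>P)) \<bullet> b = emp n (\<lambda>x. v x \<bullet> b) \<omega> - (\<integral>x. v x \<bullet> b \<partial>P)"
  using vec_integrable[OF assms] by (simp add: inner_diff_left vec_mean_inner)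

lemma whp_weak_law_vec:
  assumes v: "v \<in> borel_measurable P" "integrable P (\<lambda>x. (norm (v x))\<^sup>2)" and t: "t > 0"
  shows "whp (\<lambda>n \<omega>. norm (vec_mean n v \<omega> - (\<integral>x. v x \<partial>P)) < t)"
proof -
  define t' where "t' = t / (2 * real DIM('p))"
  have t': "t' > 0"
    using t by (simp add: t'_def)
  have "whp (\<lambda>n \<omega>. \<forall>b\<in>Basis. \<bar>emp n (\<lambda>x. v x \<bullet> b) \<omega> - (\<integral>x. v x \<bullet> b \<partial>P)\<bar> < t')"
    by (intro whp_ball whp_weak_law component_square_integrable v t') (use v in auto)
  then show ?thesis
  proof (rule whp_mono)
    fix n \<omega>
    assume b: "\<forall>b\<in>Basis. \<bar>emp n (\<lambda>x. v x \<bullet> b) \<omega> - (\<integral>x. v x \<bullet> b \<partial>P)\<bar> < t'"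
    have "norm (vec_mean n v \<omega> - (\<integral>x. v x \<partial>P)) \<le> (\<Sum>b\<in>Basis. \<bar>(vec_mean n v \<omega> - (\<integral>x. v x \<partial>P)) \<bullet> b\<bar>)"
      by (rule norm_le_l1)
    also have "\<dots> \<le> (\<Sum>b\<in>(Basis :: 'p set). t')"
      by (intro sum_mono) (use b vec_mean_component[OF v] in force)
    also have "\<dots> = t / 2"
      by (simp add: t'_def)
    finally show "norm (vec_mean n v \<omega> - (\<integral>x. v x \<partial>P)) < t"
      using t by simp
  qed
qed

lemma grad_dev_eq: "grad_dev n \<omega> = vec_mean n G\<^sub>0 \<omega> - (\<integral>x. G\<^sub>0 x \<partial>P)"
  by (simp add: grad_dev_def vec_mean_def)

lemma grad_dev_measurable: "grad_dev n \<in> borel_measurable M"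
  unfolding grad_dev_def
  by (intro borel_measurable_diff borel_measurable_scaleR borel_measurable_sum
      measurable_compose[OF X_measurable G0_measurable]) auto

lemma grad_dev_bounded:
  assumes e: "\<epsilon> > 0"
  obtains K where "\<And>n. n \<ge> 1 \<Longrightarrow> \<exists>A\<in>events. prob A \<le> \<epsilon> \<and> (\<forall>\<omega>\<in>space M - A. sqrt (real n) * norm (grad_dev n \<omega>) \<le> K)"
proof -
  define S where "S = (\<integral>x. (norm (G\<^sub>0 x))\<^sup>2 \<partial>P)"
  have S: "S \<ge> 0"
    by (simp add: S_def)
  \<comment> \<open>Chebyshev's inequality spends at most \<open>\<epsilon> / DIM('p)\<close> in
    each coordinate; \<open>S + 1\<close> in place of \<open>S\<close> keeps \<open>K\<close>
    positive for vanishing gradients.\<close>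
  define K where "K = sqrt (real DIM('p) * (S + 1) / \<epsilon>)"
  have K: "K > 0" "K\<^sup>2 = real DIM('p) * (S + 1) / \<epsilon>"
    using e S by (auto simp: K_def)
  show ?thesis
  proof (rule that[of "real DIM('p) * K"])
    fix n :: nat assume n: "n \<ge> 1"
    define bad where "bad b = {\<omega> \<in> space M. \<bar>emp n (\<lambda>x. G\<^sub>0 x \<bullet> b) \<omega> - (\<integral>x. G\<^sub>0 x \<bullet> b \<partial>P)\<bar> \<ge> K / sqrt (real n)}" for b
    have bad_ev: "bad b \<in> events" for b
    proof -
      have "emp n (\<lambda>x. G\<^sub>0 x \<bullet> b) \<in> borel_measurable M"
        by (rule emp_measurable) (use G0_measurable in measurable)
      then show ?thesis
        unfolding bad_def by measurable
    qed
    have sn: "sqrt (real n) > 0"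
      using n by simp
    have bad_prob: "prob (bad b) \<le> S / K\<^sup>2" if b: "b \<in> Basis" for b
    proof -
      have "prob (bad b) \<le> (\<integral>x. (G\<^sub>0 x \<bullet> b)\<^sup>2 \<partial>P) / (real n * (K / sqrt (real n))\<^sup>2)"
        unfolding bad_def using K n sn
        by (intro emp_chebyshev component_square_integrable G0_measurable G0_sq)
          (use G0_measurable in \<open>auto\<close>)
      also have "real n * (K / sqrt (real n))\<^sup>2 = K\<^sup>2"
        using n by (simp add: power_divide)
      also have "(\<integral>x. (G\<^sub>0 x \<bullet> b)\<^sup>2 \<partial>P) / K\<^sup>2 \<le> S / K\<^sup>2"
        unfolding S_def
      proof (intro divide_right_mono integral_mono component_square_integrable G0_measurable G0_sq)
        fix x
        have "\<bar>G\<^sub>0 x \<bullet> b\<bar> \<le> \<bar>norm (G\<^sub>0 x)\<bar>"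
          using Basis_le_norm[OF b, of "G\<^sub>0 x"] by simp
        then show "(G\<^sub>0 x \<bullet> b)\<^sup>2 \<le> (norm (G\<^sub>0 x))\<^sup>2"
          by (simp only: abs_le_square_iff)
      qed simp
      finally show ?thesis .
    qed
    let ?A = "\<Union>b\<in>Basis. bad b"
    have "prob ?A \<le> (\<Sum>b\<in>Basis. prob (bad b))"
      by (rule finite_measure_subadditive_finite) (use bad_ev in auto)
    also have "\<dots> \<le> (\<Sum>b\<in>(Basis :: 'p set). S / K\<^sup>2)"
      by (intro sum_mono bad_prob)
    also have "\<dots> = real DIM('p) * S / (real DIM('p) * (S + 1) / \<epsilon>)"
      by (simp add: K(2))
    also have "\<dots> = \<epsilon> * (S / (S + 1))"
      using e S by simp
    also have "\<dots> \<le> \<epsilon> * 1"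
      using e S by (intro mult_left_mono) auto
    finally have prob: "prob ?A \<le> \<epsilon>"
      by simp
    have "sqrt (real n) * norm (grad_dev n \<omega>) \<le> real DIM('p) * K" if om: "\<omega> \<in> space M - ?A" for \<omega>
    proof -
      have "norm (grad_dev n \<omega>) \<le> (\<Sum>b\<in>Basis. \<bar>grad_dev n \<omega> \<bullet> b\<bar>)"
        by (rule norm_le_l1)
      also have "\<dots> \<le> (\<Sum>b\<in>(Basis :: 'p set). K / sqrt (real n))"
      proof (rule sum_mono)
        fix b :: 'p assume "b \<in> Basis"
        then have "\<omega> \<notin> bad b"
          using om by blast
        then show "\<bar>grad_dev n \<omega> \<bullet> b\<bar> \<le> K / sqrt (real n)"
          using om unfolding grad_dev_eq vec_mean_component[OF G0_measurable G0_sq] bad_def by auto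
      qed
      also have "\<dots> = real DIM('p) * K / sqrt (real n)"
        by simp
      finally show ?thesis
        using sn by (simp add: pos_le_divide_eq mult.commute)
    qed
    then show "\<exists>A\<in>events. prob A \<le> \<epsilon> \<and> (\<forall>\<omega>\<in>space M - A. sqrt (real n) * norm (grad_dev n \<omega>) \<le> real DIM('p) * K)"
      using prob bad_ev by (intro bexI[of _ ?A]) auto
  qed
qed

lemma loss_var_eq: "\<theta> \<in> \<Theta> \<Longrightarrow> loss_var P l \<theta> = (\<integral>x. (l x \<theta>)\<^sup>2 \<partial>P) - (f \<theta>)\<^sup>2"
proof -
  assume th: "\<theta> \<in> \<Theta>"
  have "loss_var P l \<theta> = (\<integral>x. (l x \<theta>)\<^sup>2 - 2 * f \<theta> * l x \<theta> + (f \<theta>)\<^sup>2 \<partial>P)"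
    unfolding loss_var_def by (intro Bochner_Integration.integral_cong) (auto simp: power2_diff mult_ac)
  also have "\<dots> = (\<integral>x. (l x \<theta>)\<^sup>2 \<partial>P) - 2 * f \<theta> * (\<integral>x. l x \<theta> \<partial>P) + (f \<theta>)\<^sup>2"
    using l_integrable[OF th] by (simp add: P.prob_space)
  finally show ?thesis
    by (simp add: loss_mean_def power2_eq_square)
qed

lemma whp_Lip: "whp (\<lambda>n \<omega>. emp n Lip \<omega> < (\<integral>x. Lip x \<partial>P) + 1)"
  by (rule whp_mono[OF whp_weak_law[OF Lip_measurable Lip_sq zero_less_one]]) linarith

lemma whp_Psi: "whp (\<lambda>n \<omega>. emp n \<Psi> \<omega> < (\<integral>x. \<Psi> x \<partial>P) + 1)"
  by (rule whp_mono[OF whp_weak_law[OF Psi_measurable Psi_sq zero_less_one]]) linarith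

lemma whp_norm_G0: "whp (\<lambda>n \<omega>. emp n (\<lambda>x. norm (G\<^sub>0 x)) \<omega> < (\<integral>x. norm (G\<^sub>0 x) \<partial>P) + 1)"
proof (rule whp_mono[OF whp_weak_law[OF _ G0_sq zero_less_one]])
  show "(\<lambda>x. norm (G\<^sub>0 x)) \<in> borel_measurable P"
    using G0_measurable by measurable
qed linarith

text \<open>The weak law handles the variance at \<open>\<theta>\<^sub>0\<close>. Other parameters
  are compared with it through the sample average of \<open>Lip\<close>, so the radius
  \<open>\<rho>\<close> need not shrink with \<open>n\<close>.\<close>

lemma whp_sample_var:
  assumes eta: "\<eta> > 0"
  obtains \<rho> where "\<rho> > 0"
    "whp (\<lambda>n \<omega>. \<forall>\<theta>\<in>\<Theta>. norm (\<theta> - \<theta>\<^sub>0) < \<rho> \<longrightarrow> \<bar>sample_var n (\<lambda>i. l (X i \<omega>) \<theta>) - loss_var P l \<theta>\<^sub>0\<bar> \<le> \<eta>)"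
proof -
  define cL where "cL = (\<integral>x. Lip x \<partial>P) + 1"
  have cL: "cL > 0"
    unfolding cL_def using integral_nonneg_AE[of Lip P] Lip_nonneg by (simp add: add_nonneg_pos)
  define \<rho> where "\<rho> = min r\<^sub>0 (\<eta> / (8 * B * cL))"
  have rho: "\<rho> > 0" "\<rho> \<le> r\<^sub>0" "4 * B * (cL * \<rho>) \<le> \<eta> / 2"
  proof -
    show "\<rho> > 0" "\<rho> \<le> r\<^sub>0"
      using eta r0 B cL by (auto simp: \<rho>_def)
    have "4 * B * (cL * \<rho>) \<le> 4 * B * (cL * (\<eta> / (8 * B * cL)))"
      using B cL by (intro mult_left_mono) (auto simp: \<rho>_def)
    also have "\<dots> = \<eta> / 2"
      using B cL by simp
    finally show "4 * B * (cL * \<rho>) \<le> \<eta> / 2" .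
  qed
  define \<tau> where "\<tau> = \<eta> / 4 / (1 + 2 * B)"
  have "1 + 2 * B > 0"
    using B by simp
  then have tau: "\<tau> > 0" "(1 + 2 * B) * \<tau> = \<eta> / 4"
    using eta unfolding \<tau>_def by (simp, intro pos_mult_divide_cancel)
  have w1: "whp (\<lambda>n \<omega>. \<bar>emp n (\<lambda>x. l x \<theta>\<^sub>0) \<omega> - f \<theta>\<^sub>0\<bar> < \<tau>)"
    unfolding loss_mean_def by (intro whp_weak_law l_measurable l_integrable theta0 tau)
  have l2m: "(\<lambda>x. (l x \<theta>\<^sub>0)\<^sup>2) \<in> borel_measurable P"
    using l_measurable[OF theta0] by measurable
  have l4: "integrable P (\<lambda>x. ((l x \<theta>\<^sub>0)\<^sup>2)\<^sup>2)"
  proof (rule P.integrable_const_bound[where B = "(B\<^sup>2)\<^sup>2"])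
    show "AE x in P. norm (((l x \<theta>\<^sub>0)\<^sup>2)\<^sup>2) \<le> (B\<^sup>2)\<^sup>2"
      using AE_regular
    proof eventually_elim
      case (elim x)
      have "(l x \<theta>\<^sub>0)\<^sup>2 \<le> B\<^sup>2"
        using regular_bounded[OF elim theta0] B by (intro abs_le_square_iff[THEN iffD1]) simp
      from power_mono[OF this, of 2] show ?case
        by simp
    qed
  qed (use l2m in measurable)
  have w2: "whp (\<lambda>n \<omega>. \<bar>emp n (\<lambda>x. (l x \<theta>\<^sub>0)\<^sup>2) \<omega> - (\<integral>x. (l x \<theta>\<^sub>0)\<^sup>2 \<partial>P)\<bar> < \<tau>)"
    by (rule whp_weak_law[OF l2m l4 tau(1)])
  show ?thesis
  proof (rule that[OF rho(1)])
    show "whp (\<lambda>n \<omega>. \<forall>\<theta>\<in>\<Theta>. norm (\<theta> - \<theta>\<^sub>0) < \<rho> \<longrightarrow> \<bar>sample_var n (\<lambda>i. l (X i \<omega>) \<theta>) - loss_var P l \<theta>\<^sub>0\<bar> \<le> \<eta>)"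
    proof (rule whp_mono_eventually[OF whp_conj[OF whp_regular whp_conj[OF whp_Lip whp_conj[OF w1 w2]]]])
      show "\<forall>\<^sub>F n in sequentially. \<forall>\<omega>\<in>space M. (\<forall>i\<ge>1. regular (X i \<omega>)) \<and> emp n Lip \<omega> < (\<integral>x. Lip x \<partial>P) + 1 \<and>
          \<bar>emp n (\<lambda>x. l x \<theta>\<^sub>0) \<omega> - f \<theta>\<^sub>0\<bar> < \<tau> \<and> \<bar>emp n (\<lambda>x. (l x \<theta>\<^sub>0)\<^sup>2) \<omega> - (\<integral>x. (l x \<theta>\<^sub>0)\<^sup>2 \<partial>P)\<bar> < \<tau> \<longrightarrow>
          (\<forall>\<theta>\<in>\<Theta>. norm (\<theta> - \<theta>\<^sub>0) < \<rho> \<longrightarrow> \<bar>sample_var n (\<lambda>i. l (X i \<omega>) \<theta>) - loss_var P l \<theta>\<^sub>0\<bar> \<le> \<eta>)"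
        using eventually_ge_at_top[of 1]
      proof (eventually_elim, intro ballI impI, elim conjE)
        fix n \<omega> \<theta>
        assume n: "1 \<le> n" and reg: "\<forall>i\<ge>1. regular (X i \<omega>)" and L: "emp n Lip \<omega> < (\<integral>x. Lip x \<partial>P) + 1"
          and e1: "\<bar>emp n (\<lambda>x. l x \<theta>\<^sub>0) \<omega> - f \<theta>\<^sub>0\<bar> < \<tau>"
          and e2: "\<bar>emp n (\<lambda>x. (l x \<theta>\<^sub>0)\<^sup>2) \<omega> - (\<integral>x. (l x \<theta>\<^sub>0)\<^sup>2 \<partial>P)\<bar> < \<tau>"
          and th: "\<theta> \<in> \<Theta>" "norm (\<theta> - \<theta>\<^sub>0) < \<rho>"
        define y z where "y i = l (X i \<omega>) \<theta>" and "z i = l (X i \<omega>) \<theta>\<^sub>0" for i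
        have yz: "\<bar>y i - z i\<bar> \<le> Lip (X i \<omega>) * \<rho>" "\<bar>y i\<bar> \<le> B" "\<bar>z i\<bar> \<le> B" if "i \<in> {1..n}" for i
        proof -
          have r: "regular (X i \<omega>)"
            using reg that by simp
          show "\<bar>y i\<bar> \<le> B" "\<bar>z i\<bar> \<le> B"
            unfolding y_def z_def using regular_bounded[OF r] th theta0 by auto
          have "\<bar>y i - z i\<bar> \<le> Lip (X i \<omega>) * norm (\<theta> - \<theta>\<^sub>0)"
            unfolding y_def z_def by (rule l_Lip[OF r th(1) theta0]) (use th rho r0 in auto)
          also have "\<dots> \<le> Lip (X i \<omega>) * \<rho>"
            using th(2) Lip_nonneg by (intro mult_left_mono) auto
          finally show "\<bar>y i - z i\<bar> \<le> Lip (X i \<omega>) * \<rho>" .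
        qed
        have LL: "emp n Lip \<omega> * \<rho> \<le> cL * \<rho>"
          using L rho by (intro mult_right_mono) (auto simp: cL_def)
        have m: "\<bar>sample_mean n y - sample_mean n z\<bar> \<le> cL * \<rho>"
        proof -
          have "\<bar>sample_mean n (\<lambda>i. y i - z i)\<bar> \<le> sample_mean n (\<lambda>i. Lip (X i \<omega>) * \<rho>)"
            by (rule abs_sample_mean_le) (rule yz(1))
          then show ?thesis
            using LL by (simp add: sample_mean_diff sample_mean_multc)
        qed
        have sq: "\<bar>sample_mean n (\<lambda>i. (y i)\<^sup>2) - sample_mean n (\<lambda>i. (z i)\<^sup>2)\<bar> \<le> 2 * B * (cL * \<rho>)"
        proof -
          have "\<bar>sample_mean n (\<lambda>i. (y i)\<^sup>2 - (z i)\<^sup>2)\<bar> \<le> sample_mean n (\<lambda>i. 2 * B * (Lip (X i \<omega>) * \<rho>))"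
          proof (rule abs_sample_mean_le)
            fix i assume i: "i \<in> {1..n}"
            have "\<bar>(y i)\<^sup>2 - (z i)\<^sup>2\<bar> \<le> 2 * B * \<bar>y i - z i\<bar>"
              by (rule abs_square_diff_le[OF yz(2,3)[OF i]])
            also have "\<dots> \<le> 2 * B * (Lip (X i \<omega>) * \<rho>)"
              using yz(1)[OF i] B by (intro mult_left_mono) auto
            finally show "\<bar>(y i)\<^sup>2 - (z i)\<^sup>2\<bar> \<le> 2 * B * (Lip (X i \<omega>) * \<rho>)" .
          qed
          also have "\<dots> = 2 * B * (emp n Lip \<omega> * \<rho>)"
            by (simp add: sample_mean_cmult sample_mean_multc)
          also have "\<dots> \<le> 2 * B * (cL * \<rho>)"
            using LL B by (intro mult_left_mono) auto
          finally show ?thesis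
            by (simp add: sample_mean_diff)
        qed
        have mb: "\<bar>sample_mean n y\<bar> \<le> B" "\<bar>sample_mean n z\<bar> \<le> B"
          using n yz by (auto intro!: abs_sample_mean_le_const)
        have "\<bar>(sample_mean n y)\<^sup>2 - (sample_mean n z)\<^sup>2\<bar> \<le> 2 * B * \<bar>sample_mean n y - sample_mean n z\<bar>"
          by (rule abs_square_diff_le[OF mb])
        also have "\<dots> \<le> 2 * B * (cL * \<rho>)"
          using m B by (intro mult_left_mono) auto
        finally have msq: "\<bar>(sample_mean n y)\<^sup>2 - (sample_mean n z)\<^sup>2\<bar> \<le> 2 * B * (cL * \<rho>)" .
        have fb: "\<bar>f \<theta>\<^sub>0\<bar> \<le> B"
        proof -
          have "\<bar>f \<theta>\<^sub>0\<bar> \<le> (\<integral>x. \<bar>l x \<theta>\<^sub>0\<bar> \<partial>P)"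
            unfolding loss_mean_def by (rule integral_abs_bound)
          also have "\<dots> \<le> (\<integral>x. B \<partial>P)"
            using AE_regular l_integrable(1)[OF theta0] regular_bounded[OF _ theta0]
            by (intro integral_mono_AE) (auto elim!: eventually_mono)
          finally show ?thesis
            by (simp add: P.prob_space)
        qed
        have "\<bar>(sample_mean n z)\<^sup>2 - (f \<theta>\<^sub>0)\<^sup>2\<bar> \<le> 2 * B * \<bar>sample_mean n z - f \<theta>\<^sub>0\<bar>"
          by (rule abs_square_diff_le[OF mb(2) fb])
        also have "\<dots> \<le> 2 * B * \<tau>"
          using e1 B by (intro mult_left_mono) (auto simp: z_def[abs_def])
        finally have fsq: "\<bar>(sample_mean n z)\<^sup>2 - (f \<theta>\<^sub>0)\<^sup>2\<bar> \<le> 2 * B * \<tau>" .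
        have e2': "\<bar>sample_mean n (\<lambda>i. (z i)\<^sup>2) - (\<integral>x. (l x \<theta>\<^sub>0)\<^sup>2 \<partial>P)\<bar> < \<tau>"
          using e2 by (simp add: z_def)
        have tau': "\<tau> + 2 * B * \<tau> = \<eta> / 4"
          using tau(2) by (simp add: distrib_right)
        have rho': "2 * B * (cL * \<rho>) + 2 * B * (cL * \<rho>) \<le> \<eta> / 2"
          using rho(3) by linarith
        show "\<bar>sample_var n (\<lambda>i. l (X i \<omega>) \<theta>) - loss_var P l \<theta>\<^sub>0\<bar> \<le> \<eta>"
          unfolding loss_var_eq[OF theta0] sample_var_eq[OF n] y_def[symmetric]
          using sq msq fsq e2' tau' rho' eta by linarith
      qed
    qed
  qed
qed

end

section \<open>The gradient of the standard deviation\<close>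

context loss_model
begin

text \<open>The covariance of loss and gradient at \<open>\<theta>\<^sub>0\<close>, which is half
  the gradient of the variance.\<close>

definition cov_grad :: 'p where
  "cov_grad = (\<integral>x. (l x \<theta>\<^sub>0 - f \<theta>\<^sub>0) *\<^sub>R G\<^sub>0 x \<partial>P)"

lemma lG_measurable: "(\<lambda>x. l x \<theta>\<^sub>0 *\<^sub>R G\<^sub>0 x) \<in> borel_measurable P"
  using l_measurable[OF theta0] G0_measurable by measurable

lemma lG_sq: "integrable P (\<lambda>x. (norm (l x \<theta>\<^sub>0 *\<^sub>R G\<^sub>0 x))\<^sup>2)"
proof (rule Bochner_Integration.integrable_bound)
  show "integrable P (\<lambda>x. B\<^sup>2 * (norm (G\<^sub>0 x))\<^sup>2)"
    using G0_sq by simp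
  show "AE x in P. norm ((norm (l x \<theta>\<^sub>0 *\<^sub>R G\<^sub>0 x))\<^sup>2) \<le> norm (B\<^sup>2 * (norm (G\<^sub>0 x))\<^sup>2)"
    using AE_regular
  proof eventually_elim
    case (elim x)
    have "(l x \<theta>\<^sub>0)\<^sup>2 \<le> B\<^sup>2"
      using regular_bounded[OF elim theta0] B by (intro abs_le_square_iff[THEN iffD1]) simp
    then show ?case
      by (simp add: power_mult_distrib mult_right_mono)
  qed
qed (use lG_measurable in measurable)

lemma lG_integrable: "integrable P (\<lambda>x. l x \<theta>\<^sub>0 *\<^sub>R G\<^sub>0 x)"
  by (rule vec_integrable[OF lG_measurable lG_sq])

lemma cov_grad_eq: "cov_grad = (\<integral>x. l x \<theta>\<^sub>0 *\<^sub>R G\<^sub>0 x \<partial>P) - f \<theta>\<^sub>0 *\<^sub>R (\<integral>x. G\<^sub>0 x \<partial>P)"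
  unfolding cov_grad_def scaleR_diff_left using lG_integrable G0_integrable by simp

lemma abs_f_le: "\<theta> \<in> \<Theta> \<Longrightarrow> \<bar>f \<theta>\<bar> \<le> B"
proof -
  assume th: "\<theta> \<in> \<Theta>"
  have "\<bar>f \<theta>\<bar> \<le> (\<integral>x. \<bar>l x \<theta>\<bar> \<partial>P)"
    unfolding loss_mean_def by (rule integral_abs_bound)
  also have "\<dots> \<le> (\<integral>x. B \<partial>P)"
    using AE_regular l_integrable(1)[OF th] regular_bounded[OF _ th]
    by (intro integral_mono_AE) (auto elim!: eventually_mono)
  finally show ?thesis
    by (simp add: P.prob_space)
qed

text \<open>Let \<open>u\<close> be the loss increment, \<open>w\<close> the centred loss and
  \<open>e\<close> the increment of \<open>f\<close>. The variance changes by twice the mean of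
  \<open>w * u\<close>, which carries the linear part, plus the variance of \<open>u\<close>, which
  is quadratic because \<open>u\<close> is at most \<open>Lip\<close> times the distance.\<close>

lemma loss_var_expansion:
  obtains C where "C \<ge> 0"
    "\<And>\<theta>. \<lbrakk>\<theta> \<in> \<Theta>; norm (\<theta> - \<theta>\<^sub>0) < r\<^sub>0\<rbrakk> \<Longrightarrow>
       \<bar>loss_var P l \<theta> - loss_var P l \<theta>\<^sub>0 - 2 * (cov_grad \<bullet> (\<theta> - \<theta>\<^sub>0))\<bar> \<le> C * (norm (\<theta> - \<theta>\<^sub>0))\<^sup>2"
proof -
  define C where "C = (\<integral>x. (Lip x)\<^sup>2 \<partial>P) + 2 * (2 * B) * (\<integral>x. \<Psi> x \<partial>P)"
  have psi: "0 \<le> (\<integral>x. \<Psi> x \<partial>P)"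
    using Psi_nonneg by (intro integral_nonneg_AE) auto
  show ?thesis
  proof (rule that[of C])
    show "C \<ge> 0"
      using psi B by (simp add: C_def)
    fix \<theta> assume th: "\<theta> \<in> \<Theta>" "norm (\<theta> - \<theta>\<^sub>0) < r\<^sub>0"
    define d where "d = norm (\<theta> - \<theta>\<^sub>0)"
    define u where "u x = l x \<theta> - l x \<theta>\<^sub>0" for x
    define w where "w x = l x \<theta>\<^sub>0 - f \<theta>\<^sub>0" for x
    have um: "u \<in> borel_measurable P" and wm: "w \<in> borel_measurable P"
      unfolding u_def[abs_def] w_def[abs_def]
      by (rule borel_measurable_diff[OF l_measurable[OF th(1)] l_measurable[OF theta0]])
        (rule borel_measurable_diff[OF l_measurable[OF theta0] borel_measurable_const])
    have ub: "\<bar>u x\<bar> \<le> 2 * B" and wb: "\<bar>w x\<bar> \<le> 2 * B" and uL: "\<bar>u x\<bar> \<le> Lip x * d"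
      and wr: "\<bar>w x * rem \<theta> x\<bar> \<le> 2 * B * (\<Psi> x * d\<^sup>2)" if "regular x" for x
    proof -
      show "\<bar>u x\<bar> \<le> 2 * B" "\<bar>w x\<bar> \<le> 2 * B"
        using regular_bounded[OF that th(1)] regular_bounded[OF that theta0] abs_f_le[OF theta0]
        by (auto simp: u_def w_def)
      then show "\<bar>w x * rem \<theta> x\<bar> \<le> 2 * B * (\<Psi> x * d\<^sup>2)"
        unfolding abs_mult using rem_bound[OF that th, of d] B by (intro mult_mono) (auto simp: d_def)
      show "\<bar>u x\<bar> \<le> Lip x * d"
        unfolding u_def d_def by (rule l_Lip[OF that th(1) theta0 th(2)]) (use r0 in simp)
    qed
    have int_bd: "integrable P g" if "g \<in> borel_measurable P" "\<And>x. regular x \<Longrightarrow> \<bar>g x\<bar> \<le> b" for g and b :: real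
    proof (rule P.integrable_const_bound[where B = b, OF _ that(1)])
      show "AE x in P. norm (g x) \<le> b"
        using AE_regular by eventually_elim (simp add: that(2))
    qed
    have u2: "integrable P (\<lambda>x. (u x)\<^sup>2)"
    proof (rule int_bd[of _ "(2 * B)\<^sup>2"])
      show "\<bar>(u x)\<^sup>2\<bar> \<le> (2 * B)\<^sup>2" if "regular x" for x
        using ub[OF that] B abs_le_square_iff[of "u x" "2 * B"] by simp
    qed (use um in measurable)
    have wu: "integrable P (\<lambda>x. w x * u x)"
    proof (rule int_bd[of _ "2 * B * (2 * B)"])
      show "\<bar>w x * u x\<bar> \<le> 2 * B * (2 * B)" if "regular x" for x
        unfolding abs_mult using ub[OF that] wb[OF that] B by (intro mult_mono) auto
    qed (use um wm in measurable)
    have ui: "integrable P u" and wi: "integrable P w"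
      using int_bd[OF um ub] int_bd[OF wm wb] by blast+
    have w2: "integrable P (\<lambda>x. (w x)\<^sup>2)"
    proof (rule int_bd[of _ "(2 * B)\<^sup>2"])
      show "\<bar>(w x)\<^sup>2\<bar> \<le> (2 * B)\<^sup>2" if "regular x" for x
        using wb[OF that] B abs_le_square_iff[of "w x" "2 * B"] by simp
    qed (use wm in measurable)
    have Eu: "(\<integral>x. u x \<partial>P) = f \<theta> - f \<theta>\<^sub>0"
      unfolding u_def using l_integrable(1)[OF th(1)] l_integrable(1)[OF theta0] by (simp add: loss_mean_def)
    have Ew: "(\<integral>x. w x \<partial>P) = 0"
      unfolding w_def using l_integrable(1)[OF theta0] by (simp add: loss_mean_def P.prob_space)
    define e where "e = f \<theta> - f \<theta>\<^sub>0"
    have "loss_var P l \<theta> = (\<integral>x. (w x)\<^sup>2 + 2 * (w x * u x) + (u x)\<^sup>2 - 2 * e * u x - 2 * e * w x + e\<^sup>2 \<partial>P)"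
      unfolding loss_var_def
      by (rule Bochner_Integration.integral_cong[OF refl]) (simp add: w_def u_def e_def power2_eq_square algebra_simps)
    also have "\<dots> = loss_var P l \<theta>\<^sub>0 + 2 * (\<integral>x. w x * u x \<partial>P) + (\<integral>x. (u x)\<^sup>2 \<partial>P) - e\<^sup>2"
      using u2 wu ui wi w2 Eu Ew
      by (simp add: P.prob_space e_def[symmetric] loss_var_def w_def[symmetric] power2_eq_square)
    finally have var: "loss_var P l \<theta> = loss_var P l \<theta>\<^sub>0 + 2 * (\<integral>x. w x * u x \<partial>P) + (\<integral>x. (u x)\<^sup>2 \<partial>P) - e\<^sup>2" .
    \<comment> \<open>Jensen's inequality, read off from the nonnegative variance of
      \<open>u\<close>.\<close>
    have e2: "e\<^sup>2 \<le> (\<integral>x. (u x)\<^sup>2 \<partial>P)"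
    proof -
      have "0 \<le> (\<integral>x. (u x - e)\<^sup>2 \<partial>P)"
        by simp
      also have "\<dots> = (\<integral>x. (u x)\<^sup>2 - 2 * e * u x + e\<^sup>2 \<partial>P)"
        by (rule Bochner_Integration.integral_cong[OF refl]) (simp add: power2_eq_square algebra_simps)
      also have "\<dots> = (\<integral>x. (u x)\<^sup>2 \<partial>P) - 2 * e * e + e\<^sup>2"
        using u2 ui Eu by (simp add: P.prob_space e_def[symmetric])
      finally show ?thesis
        by (simp add: power2_eq_square)
    qed
    have u2b: "(\<integral>x. (u x)\<^sup>2 \<partial>P) \<le> (\<integral>x. (Lip x)\<^sup>2 \<partial>P) * d\<^sup>2"
    proof -
      have "(\<integral>x. (u x)\<^sup>2 \<partial>P) \<le> (\<integral>x. (Lip x)\<^sup>2 * d\<^sup>2 \<partial>P)"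
      proof (rule integral_mono_AE[OF u2])
        show "AE x in P. (u x)\<^sup>2 \<le> (Lip x)\<^sup>2 * d\<^sup>2"
          using AE_regular
        proof eventually_elim
          case (elim x)
          have "\<bar>u x\<bar> \<le> \<bar>Lip x * d\<bar>"
            using uL[OF elim] by simp
          then show ?case
            by (simp only: abs_le_square_iff power_mult_distrib)
        qed
      qed (use Lip_sq in simp)
      then show ?thesis
        by simp
    qed
    have wG: "integrable P (\<lambda>x. w x *\<^sub>R G\<^sub>0 x)"
      unfolding w_def scaleR_diff_left using lG_integrable G0_integrable by simp
    have wri: "integrable P (\<lambda>x. w x * rem \<theta> x)"
    proof (rule Bochner_Integration.integrable_bound)
      show "integrable P (\<lambda>x. 2 * B * (\<Psi> x * d\<^sup>2))"
        using Psi_integrable by simp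
      show "AE x in P. norm (w x * rem \<theta> x) \<le> norm (2 * B * (\<Psi> x * d\<^sup>2))"
        using AE_regular by eventually_elim (use wr in force)
    qed (use wm rem_measurable[OF th(1)] in measurable)
    have "(\<integral>x. w x * u x \<partial>P) = (\<integral>x. (w x *\<^sub>R G\<^sub>0 x) \<bullet> (\<theta> - \<theta>\<^sub>0) + w x * rem \<theta> x \<partial>P)"
      by (rule Bochner_Integration.integral_cong[OF refl]) (simp add: u_def rem_def algebra_simps)
    also have "\<dots> = cov_grad \<bullet> (\<theta> - \<theta>\<^sub>0) + (\<integral>x. w x * rem \<theta> x \<partial>P)"
      using wG wri by (simp add: cov_grad_def w_def[symmetric] del: inner_scaleR_left)
    finally have wu': "(\<integral>x. w x * u x \<partial>P) = cov_grad \<bullet> (\<theta> - \<theta>\<^sub>0) + (\<integral>x. w x * rem \<theta> x \<partial>P)" .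
    have "\<bar>\<integral>x. w x * rem \<theta> x \<partial>P\<bar> \<le> (\<integral>x. \<bar>w x * rem \<theta> x\<bar> \<partial>P)"
      by (rule integral_abs_bound)
    also have "\<dots> \<le> (\<integral>x. 2 * B * (\<Psi> x * d\<^sup>2) \<partial>P)"
    proof (rule integral_mono_AE)
      show "AE x in P. \<bar>w x * rem \<theta> x\<bar> \<le> 2 * B * (\<Psi> x * d\<^sup>2)"
        using AE_regular by eventually_elim (rule wr)
    qed (use wri Psi_integrable in auto)
    finally have "\<bar>\<integral>x. w x * rem \<theta> x \<partial>P\<bar> \<le> 2 * B * (\<integral>x. \<Psi> x \<partial>P) * d\<^sup>2"
      by simp
    moreover have "C * d\<^sup>2 = (\<integral>x. (Lip x)\<^sup>2 \<partial>P) * d\<^sup>2 + 2 * (2 * B * (\<integral>x. \<Psi> x \<partial>P) * d\<^sup>2)"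
      by (simp add: C_def distrib_right)
    moreover have "0 \<le> e\<^sup>2"
      by simp
    ultimately show "\<bar>loss_var P l \<theta> - loss_var P l \<theta>\<^sub>0 - 2 * (cov_grad \<bullet> (\<theta> - \<theta>\<^sub>0))\<bar> \<le> C * (norm (\<theta> - \<theta>\<^sub>0))\<^sup>2"
      using var wu' e2 u2b unfolding d_def[symmetric] by linarith
  qed
qed

lemma loss_sd_gradient:
  assumes "loss_var P l \<theta>\<^sub>0 > 0"
  shows "has_gradient_within (loss_sd P l) (cov_grad /\<^sub>R loss_sd P l \<theta>\<^sub>0) \<theta>\<^sub>0 \<Theta>"
proof -
  obtain C where C: "C \<ge> 0" "\<And>\<theta>. \<lbrakk>\<theta> \<in> \<Theta>; norm (\<theta> - \<theta>\<^sub>0) < r\<^sub>0\<rbrakk> \<Longrightarrow>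
       \<bar>loss_var P l \<theta> - loss_var P l \<theta>\<^sub>0 - 2 * (cov_grad \<bullet> (\<theta> - \<theta>\<^sub>0))\<bar> \<le> C * (norm (\<theta> - \<theta>\<^sub>0))\<^sup>2"
    using loss_var_expansion by blast
  have "(loss_var P l has_derivative (\<lambda>h. 2 * (cov_grad \<bullet> h))) (at \<theta>\<^sub>0 within \<Theta>)"
  proof (rule has_derivativeI_sandwich[OF r0, where H = "\<lambda>y. C * norm (y - \<theta>\<^sub>0)"])
    show "bounded_linear (\<lambda>h. 2 * (cov_grad \<bullet> h))"
      by (intro bounded_linear_intros)
    show "norm (loss_var P l y - loss_var P l \<theta>\<^sub>0 - 2 * (cov_grad \<bullet> (y - \<theta>\<^sub>0))) / norm (y - \<theta>\<^sub>0) \<le> C * norm (y - \<theta>\<^sub>0)"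
      if "y \<in> \<Theta>" "y \<noteq> \<theta>\<^sub>0" "dist y \<theta>\<^sub>0 < r\<^sub>0" for y
      using C(2)[of y] that by (simp add: dist_norm divide_le_eq power2_eq_square mult.assoc)
    have "((\<lambda>y. C * norm (y - \<theta>\<^sub>0)) \<longlongrightarrow> C * norm (\<theta>\<^sub>0 - \<theta>\<^sub>0)) (at \<theta>\<^sub>0 within \<Theta>)"
      by (intro tendsto_intros)
    then show "((\<lambda>y. C * norm (y - \<theta>\<^sub>0)) \<longlongrightarrow> 0) (at \<theta>\<^sub>0 within \<Theta>)"
      by simp
  qed
  from has_derivative_real_sqrt[OF assms this] show ?thesis
    unfolding has_gradient_within_def loss_sd_def[abs_def]
    by (rule has_derivative_eq_rhs) (auto simp: fun_eq_iff inverse_eq_divide field_simps)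
qed

text \<open>On a general \<open>\<Theta>\<close> a relative gradient is not unique, but along
  \<open>\<Theta>\<close> two of them differ by a small multiple of the distance. Thus the explicit
  gradient from \<open>loss_sd_gradient\<close> may be exchanged for an arbitrary one.\<close>

lemma gradients_agree:
  assumes "has_gradient_within g \<gamma> \<theta>\<^sub>0 \<Theta>" "has_gradient_within g \<gamma>' \<theta>\<^sub>0 \<Theta>" "\<eta> > 0"
  obtains \<rho> where "\<rho> > 0" "\<And>\<theta>. \<lbrakk>\<theta> \<in> \<Theta>; norm (\<theta> - \<theta>\<^sub>0) < \<rho>\<rbrakk> \<Longrightarrow> \<bar>(\<gamma>' - \<gamma>) \<bullet> (\<theta> - \<theta>\<^sub>0)\<bar> \<le> \<eta> * norm (\<theta> - \<theta>\<^sub>0)"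
proof -
  have "\<eta> / 2 > 0"
    using assms by simp
  then obtain \<rho>1 \<rho>2 where r: "\<rho>1 > 0" "\<rho>2 > 0"
    "\<forall>y\<in>\<Theta>. norm (y - \<theta>\<^sub>0) < \<rho>1 \<longrightarrow> norm (g y - g \<theta>\<^sub>0 - \<gamma> \<bullet> (y - \<theta>\<^sub>0)) \<le> \<eta> / 2 * norm (y - \<theta>\<^sub>0)"
    "\<forall>y\<in>\<Theta>. norm (y - \<theta>\<^sub>0) < \<rho>2 \<longrightarrow> norm (g y - g \<theta>\<^sub>0 - \<gamma>' \<bullet> (y - \<theta>\<^sub>0)) \<le> \<eta> / 2 * norm (y - \<theta>\<^sub>0)"
    using assms(1,2) unfolding has_gradient_within_def has_derivative_within_alt by metis
  show ?thesis
  proof (rule that[of "min \<rho>1 \<rho>2"])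
    fix \<theta> assume th: "\<theta> \<in> \<Theta>" "norm (\<theta> - \<theta>\<^sub>0) < min \<rho>1 \<rho>2"
    have "\<bar>g \<theta> - g \<theta>\<^sub>0 - \<gamma> \<bullet> (\<theta> - \<theta>\<^sub>0)\<bar> \<le> \<eta> / 2 * norm (\<theta> - \<theta>\<^sub>0)"
      "\<bar>g \<theta> - g \<theta>\<^sub>0 - \<gamma>' \<bullet> (\<theta> - \<theta>\<^sub>0)\<bar> \<le> \<eta> / 2 * norm (\<theta> - \<theta>\<^sub>0)"
      using r(3,4) th by auto
    moreover have "\<eta> * norm (\<theta> - \<theta>\<^sub>0) = \<eta> / 2 * norm (\<theta> - \<theta>\<^sub>0) + \<eta> / 2 * norm (\<theta> - \<theta>\<^sub>0)"
      by simp
    ultimately show "\<bar>(\<gamma>' - \<gamma>) \<bullet> (\<theta> - \<theta>\<^sub>0)\<bar> \<le> \<eta> * norm (\<theta> - \<theta>\<^sub>0)"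
      unfolding inner_diff_left by linarith
  qed (use r in auto)
qed

lemma whp_sample_cov:
  assumes tau: "\<tau> > 0"
  shows "whp (\<lambda>n \<omega>. norm (vec_mean n (\<lambda>x. l x \<theta>\<^sub>0 *\<^sub>R G\<^sub>0 x) \<omega> - emp n (\<lambda>x. l x \<theta>\<^sub>0) \<omega> *\<^sub>R vec_mean n G\<^sub>0 \<omega> - cov_grad) \<le> \<tau>)"
proof -
  define g where "g = (\<integral>x. G\<^sub>0 x \<partial>P)"
  define t where "t = \<tau> / (1 + B + norm g)"
  have "1 + B + norm g > 0"
    using B by (simp add: add_pos_nonneg)
  then have t: "t > 0" "(1 + B + norm g) * t = \<tau>"
    using tau unfolding t_def by (simp, intro pos_mult_divide_cancel)
  have w1: "whp (\<lambda>n \<omega>. \<bar>emp n (\<lambda>x. l x \<theta>\<^sub>0) \<omega> - f \<theta>\<^sub>0\<bar> < t)"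
    unfolding loss_mean_def by (intro whp_weak_law l_measurable l_integrable theta0 t)
  have w2: "whp (\<lambda>n \<omega>. norm (vec_mean n (\<lambda>x. l x \<theta>\<^sub>0 *\<^sub>R G\<^sub>0 x) \<omega> - (\<integral>x. l x \<theta>\<^sub>0 *\<^sub>R G\<^sub>0 x \<partial>P)) < t)"
    by (rule whp_weak_law_vec[OF lG_measurable lG_sq t(1)])
  have w3: "whp (\<lambda>n \<omega>. norm (vec_mean n G\<^sub>0 \<omega> - g) < t)"
    unfolding g_def by (rule whp_weak_law_vec[OF G0_measurable G0_sq t(1)])
  show ?thesis
  proof (rule whp_mono_eventually[OF whp_conj[OF whp_regular whp_conj[OF w1 whp_conj[OF w2 w3]]]])
    show "\<forall>\<^sub>F n in sequentially. \<forall>\<omega>\<in>space M. (\<forall>i\<ge>1. regular (X i \<omega>)) \<and> \<bar>emp n (\<lambda>x. l x \<theta>\<^sub>0) \<omega> - f \<theta>\<^sub>0\<bar> < t \<and>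
        norm (vec_mean n (\<lambda>x. l x \<theta>\<^sub>0 *\<^sub>R G\<^sub>0 x) \<omega> - (\<integral>x. l x \<theta>\<^sub>0 *\<^sub>R G\<^sub>0 x \<partial>P)) < t \<and> norm (vec_mean n G\<^sub>0 \<omega> - g) < t \<longrightarrow>
        norm (vec_mean n (\<lambda>x. l x \<theta>\<^sub>0 *\<^sub>R G\<^sub>0 x) \<omega> - emp n (\<lambda>x. l x \<theta>\<^sub>0) \<omega> *\<^sub>R vec_mean n G\<^sub>0 \<omega> - cov_grad) \<le> \<tau>"
      using eventually_ge_at_top[of 1]
    proof (eventually_elim, intro ballI impI, elim conjE)
      fix n :: nat and \<omega>
      assume n: "1 \<le> n" and reg: "\<forall>i\<ge>1. regular (X i \<omega>)"
      define m A v where "m = emp n (\<lambda>x. l x \<theta>\<^sub>0) \<omega>" and "A = vec_mean n (\<lambda>x. l x \<theta>\<^sub>0 *\<^sub>R G\<^sub>0 x) \<omega>"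
        and "v = vec_mean n G\<^sub>0 \<omega>"
      define A0 where "A0 = (\<integral>x. l x \<theta>\<^sub>0 *\<^sub>R G\<^sub>0 x \<partial>P)"
      assume "\<bar>emp n (\<lambda>x. l x \<theta>\<^sub>0) \<omega> - f \<theta>\<^sub>0\<bar> < t"
        and "norm (vec_mean n (\<lambda>x. l x \<theta>\<^sub>0 *\<^sub>R G\<^sub>0 x) \<omega> - (\<integral>x. l x \<theta>\<^sub>0 *\<^sub>R G\<^sub>0 x \<partial>P)) < t"
        and "norm (vec_mean n G\<^sub>0 \<omega> - g) < t"
      then have h: "\<bar>m - f \<theta>\<^sub>0\<bar> < t" "norm (A - A0) < t" "norm (v - g) < t"
        by (simp_all add: m_def A_def v_def A0_def)
      have mB: "\<bar>m\<bar> \<le> B"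
        unfolding m_def using n reg regular_bounded[OF _ theta0] by (intro abs_sample_mean_le_const) auto
      have "A - m *\<^sub>R v - cov_grad = (A - A0) - (m *\<^sub>R (v - g) + (m - f \<theta>\<^sub>0) *\<^sub>R g)"
        by (simp add: cov_grad_eq A0_def g_def algebra_simps)
      also have "norm \<dots> \<le> norm (A - A0) + (norm (m *\<^sub>R (v - g)) + norm ((m - f \<theta>\<^sub>0) *\<^sub>R g))"
        by (intro order_trans[OF norm_triangle_ineq4] add_left_mono norm_triangle_ineq)
      also have "\<dots> \<le> t + (B * t + t * norm g)"
        using h mB t(1) by (auto intro!: add_mono mult_mono)
      also have "\<dots> = \<tau>"
        using t(2) by (simp add: algebra_simps)
      finally show "norm (vec_mean n (\<lambda>x. l x \<theta>\<^sub>0 *\<^sub>R G\<^sub>0 x) \<omega> - emp n (\<lambda>x. l x \<theta>\<^sub>0) \<omega> *\<^sub>R vec_mean n G\<^sub>0 \<omega> - cov_grad) \<le> \<tau>"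
        by (simp add: A_def m_def v_def)
    qed
  qed
qed

text \<open>Two replacements, each at cost \<open>O(s^2)\<close>: the loss increment by its linear
  part (error \<open>S1\<close>), and the centred loss at \<open>\<theta>1\<close> by the one at
  \<open>\<theta>\<^sub>0\<close>, where an error of order \<open>s\<close> meets an increment of
  order \<open>s\<close> (\<open>S2\<close> and \<open>S3\<close>). What is left, \<open>S4\<close>,
  is the sample covariance of loss and gradient at \<open>\<theta>\<^sub>0\<close>.\<close>

lemma sample_cov_increment:
  assumes n: "n \<ge> 1" and reg: "\<And>i. i \<in> {1..n} \<Longrightarrow> regular (X i \<omega>)"
    and th: "\<theta>1 \<in> \<Theta>" "\<theta>2 \<in> \<Theta>" "norm (\<theta>1 - \<theta>\<^sub>0) \<le> s" "norm (\<theta>2 - \<theta>\<^sub>0) \<le> s" "s < r\<^sub>0"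
    and cL: "emp n Lip \<omega> \<le> cL" and cP: "emp n \<Psi> \<omega> \<le> cP" and cG: "emp n (\<lambda>x. norm (G\<^sub>0 x)) \<omega> \<le> cG"
    and cLG: "emp n (\<lambda>x. Lip x * norm (G\<^sub>0 x)) \<omega> \<le> cLG"
  shows "\<bar>sample_mean n (\<lambda>i. (l (X i \<omega>) \<theta>1 - emp n (\<lambda>x. l x \<theta>1) \<omega>) * (l (X i \<omega>) \<theta>1 - l (X i \<omega>) \<theta>2))
     - (vec_mean n (\<lambda>x. l x \<theta>\<^sub>0 *\<^sub>R G\<^sub>0 x) \<omega> - emp n (\<lambda>x. l x \<theta>\<^sub>0) \<omega> *\<^sub>R vec_mean n G\<^sub>0 \<omega>) \<bullet> (\<theta>1 - \<theta>2)\<bar>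
     \<le> (4 * B * cP + 2 * (cLG + cL * cG)) * s\<^sup>2"
proof -
  define h where "h = \<theta>1 - \<theta>2"
  have hs: "norm h \<le> 2 * s"
  proof -
    have "norm ((\<theta>1 - \<theta>\<^sub>0) - (\<theta>2 - \<theta>\<^sub>0)) \<le> s + s"
      by (rule order_trans[OF norm_triangle_ineq4 add_mono[OF th(3,4)]])
    then show ?thesis
      by (simp add: h_def)
  qed
  have s: "0 \<le> s"
    using th(3) norm_ge_zero order_trans by blast
  define x where "x i = X i \<omega>" for i
  define y z m1 m0 where "y i = l (x i) \<theta>1" and "z i = l (x i) \<theta>\<^sub>0" and "m1 = sample_mean n y" and "m0 = sample_mean n z" for i
  have rg: "regular (x i)" if "i \<in> {1..n}" for i
    using reg[OF that] by (simp add: x_def)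
  have lt: "norm (\<theta>1 - \<theta>\<^sub>0) < r\<^sub>0" "norm (\<theta>2 - \<theta>\<^sub>0) < r\<^sub>0" "norm (\<theta>\<^sub>0 - \<theta>\<^sub>0) < r\<^sub>0"
    using th r0 by auto
  have yB: "\<bar>y i\<bar> \<le> B" if "i \<in> {1..n}" for i
    unfolding y_def using regular_bounded[OF rg[OF that] th(1)] .
  have m1B: "\<bar>m1\<bar> \<le> B"
    unfolding m1_def by (rule abs_sample_mean_le_const[OF n yB])
  have yz: "\<bar>y i - z i\<bar> \<le> Lip (x i) * s" if "i \<in> {1..n}" for i
  proof -
    have "\<bar>y i - z i\<bar> \<le> Lip (x i) * norm (\<theta>1 - \<theta>\<^sub>0)"
      unfolding y_def z_def by (rule l_Lip[OF rg[OF that] th(1) theta0 lt(1,3)])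
    also have "\<dots> \<le> Lip (x i) * s"
      using th(3) Lip_nonneg by (intro mult_left_mono) auto
    finally show ?thesis .
  qed
  have m10: "\<bar>m1 - m0\<bar> \<le> cL * s"
  proof -
    have "\<bar>sample_mean n (\<lambda>i. y i - z i)\<bar> \<le> sample_mean n (\<lambda>i. Lip (x i) * s)"
      by (rule abs_sample_mean_le) (rule yz)
    also have "\<dots> = emp n Lip \<omega> * s"
      by (simp add: sample_mean_multc x_def)
    also have "\<dots> \<le> cL * s"
      using cL s by (intro mult_right_mono)
    finally show ?thesis
      by (simp add: sample_mean_diff m1_def m0_def)
  qed
  define S1 S2 S3 S4 where
    "S1 = sample_mean n (\<lambda>i. (y i - m1) * (rem \<theta>1 (x i) - rem \<theta>2 (x i)))"
    and "S2 = sample_mean n (\<lambda>i. (y i - z i) * (G\<^sub>0 (x i) \<bullet> h))"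
    and "S3 = (m1 - m0) * sample_mean n (\<lambda>i. G\<^sub>0 (x i) \<bullet> h)"
    and "S4 = sample_mean n (\<lambda>i. (z i - m0) * (G\<^sub>0 (x i) \<bullet> h))"
  have split: "sample_mean n (\<lambda>i. (y i - m1) * (y i - l (x i) \<theta>2)) = S1 + (S2 - S3) + S4"
  proof -
    have "(y i - m1) * (y i - l (x i) \<theta>2) = (y i - m1) * (rem \<theta>1 (x i) - rem \<theta>2 (x i))
        + ((y i - z i) * (G\<^sub>0 (x i) \<bullet> h) - (m1 - m0) * (G\<^sub>0 (x i) \<bullet> h)) + (z i - m0) * (G\<^sub>0 (x i) \<bullet> h)" for i
    proof -
      have "y i - l (x i) \<theta>2 = rem \<theta>1 (x i) - rem \<theta>2 (x i) + G\<^sub>0 (x i) \<bullet> h"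
        by (simp add: y_def rem_def h_def inner_diff_right)
      then show ?thesis
        unfolding \<open>y i - l (x i) \<theta>2 = _\<close> by (simp add: algebra_simps)
    qed
    then show ?thesis
      unfolding S1_def S2_def S3_def S4_def by (simp add: sample_mean_add sample_mean_diff sample_mean_cmult)
  qed
  have b1: "\<bar>S1\<bar> \<le> 4 * B * cP * s\<^sup>2"
  proof -
    have "\<bar>S1\<bar> \<le> sample_mean n (\<lambda>i. 4 * B * s\<^sup>2 * \<Psi> (x i))"
      unfolding S1_def
    proof (rule abs_sample_mean_le)
      fix i assume i: "i \<in> {1..n}"
      have "\<bar>rem \<theta>1 (x i) - rem \<theta>2 (x i)\<bar> \<le> \<Psi> (x i) * s * norm h"
        unfolding h_def by (rule rem_diff_bound[OF rg[OF i] th(1,2) lt(1,2) th(3,4)])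
      also have "\<dots> \<le> \<Psi> (x i) * s * (2 * s)"
        using hs s Psi_nonneg by (intro mult_left_mono) auto
      finally have "\<bar>rem \<theta>1 (x i) - rem \<theta>2 (x i)\<bar> \<le> \<Psi> (x i) * s * (2 * s)" .
      moreover have "\<bar>y i - m1\<bar> \<le> 2 * B"
        using yB[OF i] m1B by linarith
      ultimately have "\<bar>(y i - m1) * (rem \<theta>1 (x i) - rem \<theta>2 (x i))\<bar> \<le> 2 * B * (\<Psi> (x i) * s * (2 * s))"
        unfolding abs_mult using B by (intro mult_mono) auto
      then show "\<bar>(y i - m1) * (rem \<theta>1 (x i) - rem \<theta>2 (x i))\<bar> \<le> 4 * B * s\<^sup>2 * \<Psi> (x i)"
        by (simp add: power2_eq_square mult_ac)
    qed
    also have "\<dots> = 4 * B * s\<^sup>2 * emp n \<Psi> \<omega>"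
      by (simp add: sample_mean_cmult x_def)
    also have "\<dots> \<le> 4 * B * s\<^sup>2 * cP"
      using cP B by (intro mult_left_mono) auto
    finally show ?thesis
      by (simp add: mult_ac)
  qed
  have b2: "\<bar>S2\<bar> \<le> 2 * cLG * s\<^sup>2"
  proof -
    have "\<bar>S2\<bar> \<le> sample_mean n (\<lambda>i. 2 * s\<^sup>2 * (Lip (x i) * norm (G\<^sub>0 (x i))))"
      unfolding S2_def
    proof (rule abs_sample_mean_le)
      fix i assume i: "i \<in> {1..n}"
      have "\<bar>G\<^sub>0 (x i) \<bullet> h\<bar> \<le> norm (G\<^sub>0 (x i)) * norm h"
        by (rule Cauchy_Schwarz_ineq2)
      also have "\<dots> \<le> norm (G\<^sub>0 (x i)) * (2 * s)"
        using hs by (intro mult_left_mono) auto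
      finally have "\<bar>(y i - z i) * (G\<^sub>0 (x i) \<bullet> h)\<bar> \<le> Lip (x i) * s * (norm (G\<^sub>0 (x i)) * (2 * s))"
        unfolding abs_mult using yz[OF i] Lip_nonneg s by (intro mult_mono) auto
      then show "\<bar>(y i - z i) * (G\<^sub>0 (x i) \<bullet> h)\<bar> \<le> 2 * s\<^sup>2 * (Lip (x i) * norm (G\<^sub>0 (x i)))"
        by (simp add: power2_eq_square mult_ac)
    qed
    also have "\<dots> = 2 * s\<^sup>2 * emp n (\<lambda>x. Lip x * norm (G\<^sub>0 x)) \<omega>"
      by (simp add: sample_mean_cmult x_def)
    also have "\<dots> \<le> 2 * s\<^sup>2 * cLG"
      using cLG by (intro mult_left_mono) auto
    finally show ?thesis
      by (simp add: mult_ac)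
  qed
  have b3: "\<bar>S3\<bar> \<le> 2 * (cL * cG) * s\<^sup>2"
  proof -
    have "\<bar>sample_mean n (\<lambda>i. G\<^sub>0 (x i) \<bullet> h)\<bar> \<le> sample_mean n (\<lambda>i. norm (G\<^sub>0 (x i)) * norm h)"
      by (rule abs_sample_mean_le) (rule Cauchy_Schwarz_ineq2)
    also have "\<dots> = emp n (\<lambda>x. norm (G\<^sub>0 x)) \<omega> * norm h"
      by (simp add: sample_mean_multc x_def)
    also have "\<dots> \<le> cG * (2 * s)"
      using cG hs order_trans[OF sample_mean_nonneg cG] by (intro mult_mono) auto
    finally have "\<bar>S3\<bar> \<le> cL * s * (cG * (2 * s))"
      unfolding S3_def abs_mult using m10 by (intro mult_mono) auto
    then show ?thesis
      by (simp add: power2_eq_square mult_ac)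
  qed
  have S4: "S4 = (vec_mean n (\<lambda>x. l x \<theta>\<^sub>0 *\<^sub>R G\<^sub>0 x) \<omega> - emp n (\<lambda>x. l x \<theta>\<^sub>0) \<omega> *\<^sub>R vec_mean n G\<^sub>0 \<omega>) \<bullet> (\<theta>1 - \<theta>2)"
    unfolding S4_def inner_diff_left[of "vec_mean n (\<lambda>x. l x \<theta>\<^sub>0 *\<^sub>R G\<^sub>0 x) \<omega>"] inner_scaleR_left vec_mean_inner
    by (simp add: left_diff_distrib sample_mean_diff sample_mean_cmult z_def[abs_def] x_def m0_def h_def)
  have eq: "sample_mean n (\<lambda>i. (l (X i \<omega>) \<theta>1 - emp n (\<lambda>x. l x \<theta>1) \<omega>) * (l (X i \<omega>) \<theta>1 - l (X i \<omega>) \<theta>2))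
     = sample_mean n (\<lambda>i. (y i - m1) * (y i - l (x i) \<theta>2))"
    by (simp add: y_def[abs_def] x_def m1_def)
  have C: "(4 * B * cP + 2 * (cLG + cL * cG)) * s\<^sup>2 = 4 * B * cP * s\<^sup>2 + 2 * cLG * s\<^sup>2 + 2 * (cL * cG) * s\<^sup>2"
    by (simp add: algebra_simps)
  show ?thesis
    unfolding eq split S4[symmetric] C using b1 b2 b3 by linarith
qed

text \<open>The average of the standardized loss against a loss increment is what the leading term
  of the worst-case density contributes. Its error \<open>o(a n)\<close> turns into
  \<open>o(a n ^ 2)\<close> after multiplication by
  \<open>sqrt (\<kappa> * \<delta> n)\<close>.\<close>

lemma whp_sd_increment:
  assumes var: "loss_var P l \<theta>\<^sub>0 > 0" and grad: "has_gradient_within (loss_sd P l) \<gamma> \<theta>\<^sub>0 \<Theta>"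
    and a: "\<And>n. a n \<ge> 0" "a \<longlonglongrightarrow> 0" and K: "K > 0" and eta: "\<eta> > 0"
  shows "whp (\<lambda>n \<omega>. \<forall>\<theta>1\<in>\<Theta>. \<forall>\<theta>2\<in>\<Theta>. norm (\<theta>1 - \<theta>\<^sub>0) \<le> K * a n \<longrightarrow> norm (\<theta>2 - \<theta>\<^sub>0) \<le> K * a n \<longrightarrow>
    \<bar>sample_mean n (\<lambda>i. (l (X i \<omega>) \<theta>1 - emp n (\<lambda>x. l x \<theta>1) \<omega>) * (l (X i \<omega>) \<theta>1 - l (X i \<omega>) \<theta>2))
       / sqrt (sample_var n (\<lambda>i. l (X i \<omega>) \<theta>1)) - \<gamma> \<bullet> (\<theta>1 - \<theta>2)\<bar> \<le> \<eta> * a n)"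
proof -
  define sd where "sd = loss_sd P l \<theta>\<^sub>0"
  have sd: "sd > 0" "sd = sqrt (loss_var P l \<theta>\<^sub>0)"
    using var by (simp_all add: sd_def loss_sd_def)
  \<comment> \<open>Bounds the reciprocal of the sample standard deviation once that is within
    \<open>\<tau>1 \<le> 1\<close> of \<open>1 / sd\<close>.\<close>
  define D where "D = 1 / sd + 1"
  have D: "D > 0"
    using sd by (simp add: D_def add_pos_pos)
  define c0 where "c0 = cov_grad"
  \<comment> \<open>Four errors share \<open>\<eta> * a n\<close> in quarters: the quadratic one
    from \<open>sample_cov_increment\<close>, the sample covariance (\<open>\<tau>\<close>), the
    reciprocal standard deviation (\<open>\<tau>1\<close>) and the choice of the gradient
    (\<open>\<tau>3\<close>).\<close>
  define \<tau> where "\<tau> = \<eta> / (8 * K * D)"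
  define \<tau>1 where "\<tau>1 = min 1 (\<eta> / (8 * K * (norm c0 + 1)))"
  define \<tau>3 where "\<tau>3 = \<eta> / (8 * K)"
  have nc: "norm c0 + 1 > 0"
    by (simp add: add_nonneg_pos)
  have tau: "\<tau> > 0" "D * (2 * K * \<tau>) = \<eta> / 4" and tau1: "\<tau>1 > 0" "\<tau>1 \<le> 1" "2 * K * norm c0 * \<tau>1 \<le> \<eta> / 4"
    and tau3: "\<tau>3 > 0" "2 * K * \<tau>3 = \<eta> / 4"
  proof -
    show "\<tau> > 0" "D * (2 * K * \<tau>) = \<eta> / 4" "\<tau>3 > 0" "2 * K * \<tau>3 = \<eta> / 4"
      using eta K D by (simp_all add: \<tau>_def \<tau>3_def)
    show "\<tau>1 > 0" "\<tau>1 \<le> 1"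
      using eta K nc by (simp_all add: \<tau>1_def)
    have "2 * K * norm c0 * \<tau>1 \<le> 2 * K * (norm c0 + 1) * (\<eta> / (8 * K * (norm c0 + 1)))"
      using K eta nc by (intro mult_mono) (auto simp: \<tau>1_def)
    also have "\<dots> = \<eta> / 4"
    proof -
      have "2 * K * c * (\<eta> / (8 * K * c)) = \<eta> / 4" if "c > 0" for c
        using that K by simp
      from this[OF nc] show ?thesis .
    qed
    finally show "2 * K * norm c0 * \<tau>1 \<le> \<eta> / 4" .
  qed
  obtain \<tau>2 where tau2: "\<tau>2 > 0" "\<And>v. \<bar>v - loss_var P l \<theta>\<^sub>0\<bar> \<le> \<tau>2 \<Longrightarrow> v > 0 \<and> \<bar>1 / sqrt v - 1 / sd\<bar> \<le> \<tau>1"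
  proof -
    have "isCont (\<lambda>v. 1 / sqrt v) (loss_var P l \<theta>\<^sub>0)"
      using var by (intro continuous_intros) auto
    then obtain d where d: "d > 0" "\<And>v. \<bar>v - loss_var P l \<theta>\<^sub>0\<bar> < d \<Longrightarrow> \<bar>1 / sqrt v - 1 / sd\<bar> < \<tau>1"
      using tau1(1) unfolding continuous_at_eps_delta dist_real_def sd(2) by metis
    show ?thesis
    proof (rule that[of "min (d / 2) (loss_var P l \<theta>\<^sub>0 / 2)"])
      fix v assume v: "\<bar>v - loss_var P l \<theta>\<^sub>0\<bar> \<le> min (d / 2) (loss_var P l \<theta>\<^sub>0 / 2)"
      have v': "\<bar>v - loss_var P l \<theta>\<^sub>0\<bar> \<le> d / 2" "\<bar>v - loss_var P l \<theta>\<^sub>0\<bar> \<le> loss_var P l \<theta>\<^sub>0 / 2"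
        using v by (simp_all only: min.bounded_iff)
      have "\<bar>v - loss_var P l \<theta>\<^sub>0\<bar> < d"
        using v'(1) d(1) by linarith
      moreover have "v > 0"
        using v'(2) var by linarith
      ultimately show "v > 0 \<and> \<bar>1 / sqrt v - 1 / sd\<bar> \<le> \<tau>1"
        using d(2)[of v] by simp
    qed (use d var in auto)
  qed
  obtain \<rho>1 where rho1: "\<rho>1 > 0" and w_var:
    "whp (\<lambda>n \<omega>. \<forall>\<theta>\<in>\<Theta>. norm (\<theta> - \<theta>\<^sub>0) < \<rho>1 \<longrightarrow> \<bar>sample_var n (\<lambda>i. l (X i \<omega>) \<theta>) - loss_var P l \<theta>\<^sub>0\<bar> \<le> \<tau>2)"
    using whp_sample_var[OF tau2(1)] by blast
  obtain \<rho>2 where rho2: "\<rho>2 > 0"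
    "\<And>\<theta>. \<lbrakk>\<theta> \<in> \<Theta>; norm (\<theta> - \<theta>\<^sub>0) < \<rho>2\<rbrakk> \<Longrightarrow> \<bar>(\<gamma> - c0 /\<^sub>R sd) \<bullet> (\<theta> - \<theta>\<^sub>0)\<bar> \<le> \<tau>3 * norm (\<theta> - \<theta>\<^sub>0)"
    using gradients_agree[OF loss_sd_gradient[OF var] grad tau3(1)] unfolding c0_def sd_def by blast
  define cL cP cG where "cL = (\<integral>x. Lip x \<partial>P) + 1" and "cP = (\<integral>x. \<Psi> x \<partial>P) + 1"
    and "cG = (\<integral>x. norm (G\<^sub>0 x) \<partial>P) + 1"
  show ?thesis
  \<comment> \<open>The average of \<open>Lip x * norm (G\<^sub>0 x)\<close> is controlled by a
    first moment only, so its bound depends on the probability allowed for failure.\<close>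
  proof (rule whp_of_bounded[where B = "\<lambda>cLG n \<omega>. emp n (\<lambda>x. Lip x * norm (G\<^sub>0 x)) \<omega> \<le> cLG"])
    fix \<epsilon> :: real assume "\<epsilon> > 0"
    then show "\<exists>cLG. \<forall>\<^sub>F n in sequentially. \<exists>A\<in>events. prob A \<le> \<epsilon> \<and>
        (\<forall>\<omega>\<in>space M - A. emp n (\<lambda>x. Lip x * norm (G\<^sub>0 x)) \<omega> \<le> cLG)"
      using emp_bounded[OF Lip_G0_integrable] Lip_nonneg
      by (intro exI eventually_mono[OF eventually_ge_at_top[of 1]]) auto
  next
    fix cLG
    define C where "C = (4 * B * cP + 2 * (cLG + cL * cG)) * K\<^sup>2"
    from whp_conj[OF whp_regular whp_conj[OF whp_Lip whp_conj[OF whp_Psi whp_conj[OF whp_norm_G0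
          whp_conj[OF w_var whp_sample_cov[OF tau(1)]]]]]]
    show "whp (\<lambda>n \<omega>. emp n (\<lambda>x. Lip x * norm (G\<^sub>0 x)) \<omega> \<le> cLG \<longrightarrow>
      (\<forall>\<theta>1\<in>\<Theta>. \<forall>\<theta>2\<in>\<Theta>. norm (\<theta>1 - \<theta>\<^sub>0) \<le> K * a n \<longrightarrow> norm (\<theta>2 - \<theta>\<^sub>0) \<le> K * a n \<longrightarrow>
      \<bar>sample_mean n (\<lambda>i. (l (X i \<omega>) \<theta>1 - emp n (\<lambda>x. l x \<theta>1) \<omega>) * (l (X i \<omega>) \<theta>1 - l (X i \<omega>) \<theta>2))
       / sqrt (sample_var n (\<lambda>i. l (X i \<omega>) \<theta>1)) - \<gamma> \<bullet> (\<theta>1 - \<theta>2)\<bar> \<le> \<eta> * a n))"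
    proof (rule whp_mono_eventually, goal_cases)
    case 1
      have lim: "(\<lambda>n. K * a n) \<longlonglongrightarrow> 0" "(\<lambda>n. D * C * a n) \<longlonglongrightarrow> 0"
        using tendsto_mult_left[OF a(2), of K] tendsto_mult_left[OF a(2), of "D * C"] by simp_all
      have ev: "\<forall>\<^sub>F n in sequentially. K * a n < min r\<^sub>0 (min \<rho>1 \<rho>2)" "\<forall>\<^sub>F n in sequentially. D * C * a n < \<eta> / 4"
        by (rule order_tendstoD(2)[OF lim(1)], use r0 rho1 rho2 in simp)
          (rule order_tendstoD(2)[OF lim(2)], use eta in simp)
      from ev eventually_ge_at_top[of 1]
      show ?case
      proof (eventually_elim, intro ballI impI, elim conjE)
        fix n \<omega> \<theta>1 \<theta>2
        assume small: "K * a n < min r\<^sub>0 (min \<rho>1 \<rho>2)" "D * C * a n < \<eta> / 4" and n: "1 \<le> n"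
          and reg: "\<forall>i\<ge>1. regular (X i \<omega>)"
          and bL: "emp n Lip \<omega> < (\<integral>x. Lip x \<partial>P) + 1" and bP: "emp n \<Psi> \<omega> < (\<integral>x. \<Psi> x \<partial>P) + 1"
          and bG: "emp n (\<lambda>x. norm (G\<^sub>0 x)) \<omega> < (\<integral>x. norm (G\<^sub>0 x) \<partial>P) + 1"
          and bv: "\<forall>\<theta>\<in>\<Theta>. norm (\<theta> - \<theta>\<^sub>0) < \<rho>1 \<longrightarrow> \<bar>sample_var n (\<lambda>i. l (X i \<omega>) \<theta>) - loss_var P l \<theta>\<^sub>0\<bar> \<le> \<tau>2"
          and bc: "norm (vec_mean n (\<lambda>x. l x \<theta>\<^sub>0 *\<^sub>R G\<^sub>0 x) \<omega> - emp n (\<lambda>x. l x \<theta>\<^sub>0) \<omega> *\<^sub>R vec_mean n G\<^sub>0 \<omega> - cov_grad) \<le> \<tau>"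
          and bLG: "emp n (\<lambda>x. Lip x * norm (G\<^sub>0 x)) \<omega> \<le> cLG"
          and th: "\<theta>1 \<in> \<Theta>" "\<theta>2 \<in> \<Theta>" "norm (\<theta>1 - \<theta>\<^sub>0) \<le> K * a n" "norm (\<theta>2 - \<theta>\<^sub>0) \<le> K * a n"
        define A where "A = sample_mean n (\<lambda>i. (l (X i \<omega>) \<theta>1 - emp n (\<lambda>x. l x \<theta>1) \<omega>) * (l (X i \<omega>) \<theta>1 - l (X i \<omega>) \<theta>2))"
        define v where "v = vec_mean n (\<lambda>x. l x \<theta>\<^sub>0 *\<^sub>R G\<^sub>0 x) \<omega> - emp n (\<lambda>x. l x \<theta>\<^sub>0) \<omega> *\<^sub>R vec_mean n G\<^sub>0 \<omega>"
        define h where "h = \<theta>1 - \<theta>2"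
        define i1 where "i1 = 1 / sqrt (sample_var n (\<lambda>i. l (X i \<omega>) \<theta>1))"
        have an: "a n \<ge> 0" by (rule a(1))
        have hs: "norm h \<le> 2 * (K * a n)"
        proof -
          have "norm ((\<theta>1 - \<theta>\<^sub>0) - (\<theta>2 - \<theta>\<^sub>0)) \<le> K * a n + K * a n"
            by (rule order_trans[OF norm_triangle_ineq4 add_mono[OF th(3,4)]])
          then show ?thesis
            by (simp add: h_def)
        qed
        have "\<bar>A - v \<bullet> h\<bar> \<le> (4 * B * cP + 2 * (cLG + cL * cG)) * (K * a n)\<^sup>2"
          unfolding A_def v_def h_def
          by (rule sample_cov_increment[OF n _ th]) (use small reg bL bP bG bLG in \<open>auto simp: cL_def cP_def cG_def\<close>)
        also have "\<dots> = C * (a n)\<^sup>2"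
          by (simp add: C_def power_mult_distrib)
        finally have A1: "\<bar>A - v \<bullet> h\<bar> \<le> C * (a n)\<^sup>2" .
        have "\<bar>(v - c0) \<bullet> h\<bar> \<le> norm (v - c0) * norm h"
          by (rule Cauchy_Schwarz_ineq2)
        also have "\<dots> \<le> \<tau> * (2 * (K * a n))"
          using bc hs tau by (intro mult_mono) (auto simp: v_def c0_def)
        finally have A2: "\<bar>A - c0 \<bullet> h\<bar> \<le> C * (a n)\<^sup>2 + \<tau> * (2 * (K * a n))"
          using A1 by (simp add: inner_diff_left)
        have i1: "\<bar>i1 - 1 / sd\<bar> \<le> \<tau>1"
          unfolding i1_def using tau2(2) bv th small by auto
        have i1D: "\<bar>i1\<bar> \<le> D"
        proof -
          have "\<bar>1 / sd\<bar> = 1 / sd"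
            using sd by simp
          then show ?thesis
            using i1 tau1(2) unfolding D_def by linarith
        qed
        have "\<bar>(A - c0 \<bullet> h) * i1\<bar> \<le> (C * (a n)\<^sup>2 + \<tau> * (2 * (K * a n))) * D"
          unfolding abs_mult using A2 i1D by (intro mult_mono) auto
        also have "\<dots> = (D * C * a n) * a n + (D * (2 * K * \<tau>)) * a n"
          by (simp add: power2_eq_square algebra_simps)
        also have "\<dots> \<le> \<eta> / 4 * a n + \<eta> / 4 * a n"
          unfolding tau(2) using small(2) an by (intro add_mono mult_right_mono) auto
        finally have t1: "\<bar>(A - c0 \<bullet> h) * i1\<bar> \<le> \<eta> / 4 * a n + \<eta> / 4 * a n" .
        have "\<bar>(c0 \<bullet> h) * (i1 - 1 / sd)\<bar> \<le> (norm c0 * (2 * (K * a n))) * \<tau>1"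
          unfolding abs_mult using i1 hs Cauchy_Schwarz_ineq2[of c0 h] K an
          by (intro mult_mono) (auto intro: order_trans[OF _ mult_left_mono])
        also have "\<dots> = (2 * K * norm c0 * \<tau>1) * a n"
          by (simp add: mult_ac)
        also have "\<dots> \<le> \<eta> / 4 * a n"
          using tau1(3) an by (intro mult_right_mono)
        finally have t2: "\<bar>(c0 \<bullet> h) * (i1 - 1 / sd)\<bar> \<le> \<eta> / 4 * a n" .
        have g: "\<bar>(\<gamma> - c0 /\<^sub>R sd) \<bullet> (\<theta> - \<theta>\<^sub>0)\<bar> \<le> \<tau>3 * (K * a n)" if "\<theta> \<in> \<Theta>" "norm (\<theta> - \<theta>\<^sub>0) \<le> K * a n" for \<theta>
        proof -
          have "\<bar>(\<gamma> - c0 /\<^sub>R sd) \<bullet> (\<theta> - \<theta>\<^sub>0)\<bar> \<le> \<tau>3 * norm (\<theta> - \<theta>\<^sub>0)"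
            by (rule rho2(2)[OF that(1)]) (use that small in auto)
          also have "\<dots> \<le> \<tau>3 * (K * a n)"
            using that tau3 by (intro mult_left_mono) auto
          finally show ?thesis .
        qed
        have "h = (\<theta>1 - \<theta>\<^sub>0) - (\<theta>2 - \<theta>\<^sub>0)"
          by (simp add: h_def)
        then have "\<bar>(\<gamma> - c0 /\<^sub>R sd) \<bullet> h\<bar> \<le> \<tau>3 * (K * a n) + \<tau>3 * (K * a n)"
          using g[OF th(1,3)] g[OF th(2,4)] by (simp only: inner_diff_right[of _ "\<theta>1 - \<theta>\<^sub>0"])
        also have "\<dots> = (2 * K * \<tau>3) * a n"
          by simp
        finally have t3: "\<bar>(\<gamma> - c0 /\<^sub>R sd) \<bullet> h\<bar> \<le> \<eta> / 4 * a n"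
          unfolding tau3(2) .
        have "A * i1 - \<gamma> \<bullet> h = (A - c0 \<bullet> h) * i1 + (c0 \<bullet> h) * (i1 - 1 / sd) - (\<gamma> - c0 /\<^sub>R sd) \<bullet> h"
          by (simp add: inner_diff_left divide_inverse algebra_simps)
        then have "\<bar>A * i1 - \<gamma> \<bullet> h\<bar> \<le> \<eta> / 4 * a n + \<eta> / 4 * a n + \<eta> / 4 * a n + \<eta> / 4 * a n"
          using t1 t2 t3 by linarith
        then have "\<bar>A * i1 - \<gamma> \<bullet> h\<bar> \<le> \<eta> * a n"
          by simp
        then show "\<bar>sample_mean n (\<lambda>i. (l (X i \<omega>) \<theta>1 - emp n (\<lambda>x. l x \<theta>1) \<omega>) * (l (X i \<omega>) \<theta>1 - l (X i \<omega>) \<theta>2))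
           / sqrt (sample_var n (\<lambda>i. l (X i \<omega>) \<theta>1)) - \<gamma> \<bullet> (\<theta>1 - \<theta>2)\<bar> \<le> \<eta> * a n"
          by (simp add: A_def i1_def h_def)
      qed
    qed
  qed
qed

end

section \<open>Comparison of the estimator with a tilted problem\<close>

text \<open>The rate \<open>a\<close> is a parameter, so that all regimes are instances:
  \<open>1 / sqrt n\<close> if \<open>\<delta> n\<close> is at most of order \<open>1 / n\<close>,
  and \<open>sqrt (\<delta> n)\<close> if it dominates. \<open>\<gamma>\<close> stands for any
  gradient of the standard deviation relative to \<open>\<Theta>\<close>.\<close>

locale robust_estimation = loss_model M P X \<Theta> \<theta>\<^sub>0 l G\<^sub>0 \<Psi> r\<^sub>0 B + divergence_generator \<phi> \<kappa>
  for M :: "'w measure" and P :: "'x measure" and X and \<Theta> :: "'p::euclidean_space set" and \<theta>\<^sub>0 l G\<^sub>0 \<Psi> r\<^sub>0 B \<phi> \<kappa> +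
  fixes \<delta> :: "nat \<Rightarrow> real" and \<theta>bar :: "nat \<Rightarrow> 'w \<Rightarrow> 'p" and \<theta>sol :: "'p \<Rightarrow> 'p" and V :: "'p set"
    and c Ca :: real and a :: "nat \<Rightarrow> real" and \<gamma> :: 'p
  assumes delta_pos: "\<And>n. \<delta> n > 0" and delta_lim: "\<delta> \<longlonglongrightarrow> 0"
    and theta_bar: "AE \<omega> in M. \<forall>n\<ge>1. \<theta>bar n \<omega> \<in> \<Theta> \<and> (\<forall>\<theta>\<in>\<Theta>.
        robust_loss \<phi> l (empirical_measure P (\<lambda>i. X i \<omega>) n) (\<delta> n) (\<theta>bar n \<omega>)
          \<le> robust_loss \<phi> l (empirical_measure P (\<lambda>i. X i \<omega>) n) (\<delta> n) \<theta>)"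
    and f_min: "\<And>\<theta>. \<theta> \<in> \<Theta> \<Longrightarrow> \<theta> \<noteq> \<theta>\<^sub>0 \<Longrightarrow> loss_mean P l \<theta>\<^sub>0 < loss_mean P l \<theta>"
    and V: "\<theta>\<^sub>0 \<in> interior V" and c: "c > 0" and sol_zero: "\<theta>sol 0 = \<theta>\<^sub>0"
    and growth: "\<forall>\<^sub>F v in nhds 0. \<theta>sol v \<in> \<Theta> \<and> \<theta>sol v \<in> V \<and> (\<forall>\<theta>\<in>\<Theta> \<inter> V.
        loss_mean P l \<theta> + v \<bullet> (\<theta> - \<theta>sol v) \<ge> loss_mean P l (\<theta>sol v) + c * (norm (\<theta> - \<theta>sol v))\<^sup>2)"
    and var_pos: "loss_var P l \<theta>\<^sub>0 > 0" and gradient: "has_gradient_within (loss_sd P l) \<gamma> \<theta>\<^sub>0 \<Theta>"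
    and a_nonneg: "\<And>n. a n \<ge> 0" and a_lim: "a \<longlonglongrightarrow> 0" and Ca: "Ca > 0"
    and rates: "\<forall>\<^sub>F n in sequentially. 1 / sqrt (real n) \<le> Ca * a n \<and> sqrt (\<delta> n) \<le> Ca * a n"
begin

definition F :: "nat \<Rightarrow> 'w \<Rightarrow> 'p \<Rightarrow> real" where
  "F n \<omega> \<theta> = robust_loss \<phi> l (empirical_measure P (\<lambda>i. X i \<omega>) n) (\<delta> n) \<theta>"

definition \<zeta> :: "nat \<Rightarrow> 'w \<Rightarrow> 'p" where
  "\<zeta> n \<omega> = grad_dev n \<omega> + sqrt (\<kappa> * \<delta> n) *\<^sub>R \<gamma>"

text \<open>The density \<open>1 + q\<close> is fixed before the competitor
  \<open>\<theta>'\<close>. The lower bound on the sample variance is recorded as well, because it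
  controls the size of \<open>q\<close>.\<close>

definition worst_case_bound :: "real \<Rightarrow> nat \<Rightarrow> 'w \<Rightarrow> 'p \<Rightarrow> bool" where
  "worst_case_bound \<eta> n \<omega> \<theta>1 \<longleftrightarrow> loss_var P l \<theta>\<^sub>0 / 2 \<le> sample_var n (\<lambda>i. l (X i \<omega>) \<theta>1) \<and>
       (\<exists>q. (\<forall>i\<in>{1..n}. \<bar>q i - sqrt (\<kappa> * \<delta> n) * (l (X i \<omega>) \<theta>1 - emp n (\<lambda>x. l x \<theta>1) \<omega>)
               / sqrt (sample_var n (\<lambda>i. l (X i \<omega>) \<theta>1))\<bar> \<le> \<eta> * sqrt (\<delta> n)) \<and>
         (\<forall>\<theta>'\<in>\<Theta>. F n \<omega> \<theta>1 - F n \<omega> \<theta>' \<le> sample_mean n (\<lambda>i. (1 + q i) * (l (X i \<omega>) \<theta>1 - l (X i \<omega>) \<theta>'))))"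

lemma whp_theta_bar: "whp (\<lambda>n \<omega>. n \<ge> 1 \<longrightarrow> \<theta>bar n \<omega> \<in> \<Theta> \<and> (\<forall>\<theta>\<in>\<Theta>. F n \<omega> (\<theta>bar n \<omega>) \<le> F n \<omega> \<theta>))"
  by (rule whp_AE) (use theta_bar in \<open>simp add: F_def\<close>)

lemma eventually_delta_less: "\<delta>0 > 0 \<Longrightarrow> \<forall>\<^sub>F n in sequentially. \<delta> n < \<delta>0"
  by (rule order_tendstoD(2)[OF delta_lim])

text \<open>By compactness \<open>f\<close> exceeds its minimum by some \<open>g\<close> away from
  \<open>\<theta>\<^sub>0\<close>. The robust loss is uniformly within \<open>g / 4\<close> of
  \<open>f\<close>: half of this is due to sampling, half to reweighting.\<close>

lemma consistency:
  assumes rho: "\<rho> > 0"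
  shows "whp (\<lambda>n \<omega>. norm (\<theta>bar n \<omega> - \<theta>\<^sub>0) < \<rho>)"
proof -
  define T where "T = \<Theta> - ball \<theta>\<^sub>0 \<rho>"
  have T: "compact T"
    unfolding T_def by (rule compact_diff[OF compact_Theta open_ball])
  obtain g where g: "g > 0" "\<And>\<theta>. \<theta> \<in> \<Theta> \<Longrightarrow> norm (\<theta> - \<theta>\<^sub>0) \<ge> \<rho> \<Longrightarrow> f \<theta>\<^sub>0 + g \<le> f \<theta>"
  proof (cases "T = {}")
    case True
    show ?thesis
      by (rule that[of 1]) (use True in \<open>auto simp: T_def dist_norm norm_minus_commute\<close>)
  next
    case False
    have "continuous_on T f"
      by (rule continuous_on_subset[OF continuous_on_f]) (auto simp: T_def)
    from continuous_attains_inf[OF T False this] obtain t where t: "t \<in> T" "\<And>\<theta>. \<theta> \<in> T \<Longrightarrow> f t \<le> f \<theta>"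
      by blast
    have "f \<theta>\<^sub>0 < f t"
      using t(1) rho by (intro f_min) (auto simp: T_def)
    then show ?thesis
      using t(2) by (intro that[of "f t - f \<theta>\<^sub>0"]) (auto simp: T_def dist_norm norm_minus_commute)
  qed
  have "g / 8 > 0"
    using g by simp
  note w1 = whp_uniform_law[OF this]
  obtain \<delta>0 where d0: "\<delta>0 > 0"
    "\<And>\<delta>' n xs (P' :: 'x measure) (L :: 'x \<Rightarrow> 'p \<Rightarrow> real) t. \<lbrakk>0 < \<delta>'; \<delta>' < \<delta>0; n \<ge> 1; xs \<in> {1..n} \<rightarrow> space P';
        (\<lambda>x. L x t) \<in> borel_measurable P'; \<And>i. i \<in> {1..n} \<Longrightarrow> \<bar>L (xs i) t\<bar> \<le> B\<rbrakk> \<Longrightarrow>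
       \<bar>robust_loss \<phi> L (empirical_measure P' xs n) \<delta>' t - sample_mean n (\<lambda>i. L (xs i) t)\<bar>
         \<le> B * (1 + \<kappa>) * sqrt \<delta>'"
    using robust_loss_near_mean[OF B] by metis
  have "(\<lambda>n. B * (1 + \<kappa>) * sqrt (\<delta> n)) \<longlonglongrightarrow> 0"
    using tendsto_mult_left[OF tendsto_real_sqrt[OF delta_lim], of "B * (1 + \<kappa>)"] by simp
  from order_tendstoD(2)[OF this \<open>g / 8 > 0\<close>]
  have ev: "\<forall>\<^sub>F n in sequentially. B * (1 + \<kappa>) * sqrt (\<delta> n) < g / 8" .
  show ?thesis
  proof (rule whp_mono_eventually[OF whp_conj[OF whp_regular whp_conj[OF w1 whp_theta_bar]]], goal_cases)
    case 1
    show ?case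
      using ev eventually_delta_less[OF d0(1)] eventually_ge_at_top[of 1]
    proof (eventually_elim, intro ballI impI, elim conjE)
      fix n \<omega>
      assume e: "B * (1 + \<kappa>) * sqrt (\<delta> n) < g / 8" and d: "\<delta> n < \<delta>0" and n: "1 \<le> n" and om: "\<omega> \<in> space M"
        and reg: "\<forall>i\<ge>1. regular (X i \<omega>)" and u: "\<forall>\<theta>\<in>\<Theta>. \<bar>emp n (\<lambda>x. l x \<theta>) \<omega> - f \<theta>\<bar> \<le> g / 8"
        and bar: "1 \<le> n \<longrightarrow> \<theta>bar n \<omega> \<in> \<Theta> \<and> (\<forall>\<theta>\<in>\<Theta>. F n \<omega> (\<theta>bar n \<omega>) \<le> F n \<omega> \<theta>)"
      have near: "\<bar>F n \<omega> \<theta> - f \<theta>\<bar> \<le> g / 4" if th: "\<theta> \<in> \<Theta>" for \<theta>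
      proof -
        have "\<bar>F n \<omega> \<theta> - sample_mean n (\<lambda>i. l (X i \<omega>) \<theta>)\<bar> \<le> B * (1 + \<kappa>) * sqrt (\<delta> n)"
          unfolding F_def
          by (rule d0(2)[of "\<delta> n" n "\<lambda>i. X i \<omega>" P l \<theta>, OF delta_pos d n X_space[OF om] l_measurable[OF th]])
            (use reg regular_bounded[OF _ th] in auto)
        then show ?thesis
          using bspec[OF u th] e by linarith
      qed
      have b: "\<theta>bar n \<omega> \<in> \<Theta>" "F n \<omega> (\<theta>bar n \<omega>) \<le> F n \<omega> \<theta>\<^sub>0"
        using bar n theta0 by auto
      have "f (\<theta>bar n \<omega>) < f \<theta>\<^sub>0 + g"
        using near[OF b(1)] near[OF theta0] b(2) g(1) unfolding abs_le_iff by linarith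
      then show "norm (\<theta>bar n \<omega> - \<theta>\<^sub>0) < \<rho>"
        using g(2)[OF b(1)] by fastforce
    qed
  qed
qed

text \<open>Near \<open>\<theta>\<^sub>0\<close> the sample variance is, with high probability, at
  least half the true variance at \<open>\<theta>\<^sub>0\<close>; this is the condition of the
  deterministic estimate \<open>robust_loss_increment\<close>.\<close>

lemma whp_robust_increment:
  assumes eta: "\<eta> > 0"
  obtains \<rho> where "\<rho> > 0"
    "whp (\<lambda>n \<omega>. \<forall>\<theta>1\<in>\<Theta>. norm (\<theta>1 - \<theta>\<^sub>0) < \<rho> \<longrightarrow> worst_case_bound \<eta> n \<omega> \<theta>1)"
proof -
  define s0 where "s0 = loss_var P l \<theta>\<^sub>0 / 2"
  have s0: "s0 > 0"
    using var_pos by (simp add: s0_def)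
  obtain \<delta>0 where d0: "\<delta>0 > 0"
    "\<And>\<delta>' n xs (P' :: 'x measure) (L :: 'x \<Rightarrow> 'p \<Rightarrow> real) t. \<lbrakk>0 < \<delta>'; \<delta>' < \<delta>0; n \<ge> 1; xs \<in> {1..n} \<rightarrow> space P';
        (\<lambda>x. L x t) \<in> borel_measurable P'; \<And>i. i \<in> {1..n} \<Longrightarrow> \<bar>L (xs i) t\<bar> \<le> B;
        sample_var n (\<lambda>i. L (xs i) t) \<ge> s0\<rbrakk> \<Longrightarrow>
       \<exists>q. (\<forall>i\<in>{1..n}. \<bar>q i - sqrt (\<kappa> * \<delta>') * (L (xs i) t - sample_mean n (\<lambda>i. L (xs i) t))
               / sqrt (sample_var n (\<lambda>i. L (xs i) t))\<bar> \<le> \<eta> * sqrt \<delta>') \<and>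
         (\<forall>t'. (\<lambda>x. L x t') \<in> borel_measurable P' \<longrightarrow>
            robust_loss \<phi> L (empirical_measure P' xs n) \<delta>' t - robust_loss \<phi> L (empirical_measure P' xs n) \<delta>' t'
              \<le> sample_mean n (\<lambda>i. (1 + q i) * (L (xs i) t - L (xs i) t')))"
    using robust_loss_increment[OF B s0 eta] by blast
  obtain \<rho> where rho: "\<rho> > 0" and w:
    "whp (\<lambda>n \<omega>. \<forall>\<theta>\<in>\<Theta>. norm (\<theta> - \<theta>\<^sub>0) < \<rho> \<longrightarrow> \<bar>sample_var n (\<lambda>i. l (X i \<omega>) \<theta>) - loss_var P l \<theta>\<^sub>0\<bar> \<le> s0)"
    using whp_sample_var[OF s0] by blast
  show ?thesis
  proof (rule that[OF rho], rule whp_mono_eventually[OF whp_conj[OF whp_regular w]], goal_cases)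
    case 1
    show ?case
      using eventually_delta_less[OF d0(1)] eventually_ge_at_top[of 1]
    proof (eventually_elim, intro ballI impI, elim conjE)
      fix n \<omega> \<theta>1
      assume d: "\<delta> n < \<delta>0" and n: "1 \<le> n" and om: "\<omega> \<in> space M" and reg: "\<forall>i\<ge>1. regular (X i \<omega>)"
        and v: "\<forall>\<theta>\<in>\<Theta>. norm (\<theta> - \<theta>\<^sub>0) < \<rho> \<longrightarrow> \<bar>sample_var n (\<lambda>i. l (X i \<omega>) \<theta>) - loss_var P l \<theta>\<^sub>0\<bar> \<le> s0"
        and th: "\<theta>1 \<in> \<Theta>" "norm (\<theta>1 - \<theta>\<^sub>0) < \<rho>"
      have vs: "s0 \<le> sample_var n (\<lambda>i. l (X i \<omega>) \<theta>1)"
        using v[rule_format, OF th] unfolding s0_def by linarith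
      have lB: "\<bar>l (X i \<omega>) \<theta>1\<bar> \<le> B" if "i \<in> {1..n}" for i
        using reg regular_bounded[OF _ th(1)] that by auto
      from d0(2)[of "\<delta> n" n "\<lambda>i. X i \<omega>" P l \<theta>1, OF delta_pos d n X_space[OF om] l_measurable[OF th(1)] lB vs]
      show "worst_case_bound \<eta> n \<omega> \<theta>1"
        using vs l_measurable unfolding worst_case_bound_def F_def s0_def by blast
    qed
  qed
qed

lemma V_ball:
  obtains \<rho> where "\<rho> > 0" "\<And>\<theta>. norm (\<theta> - \<theta>\<^sub>0) < \<rho> \<Longrightarrow> \<theta> \<in> V"
proof -
  obtain \<rho> where "\<rho> > 0" "ball \<theta>\<^sub>0 \<rho> \<subseteq> V"
    using V mem_interior by blast
  then show ?thesis
    by (intro that[of \<rho>]) (auto simp: dist_norm norm_minus_commute)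
qed

lemma quadratic_growth:
  assumes "\<theta> \<in> \<Theta>" "\<theta> \<in> V"
  shows "f \<theta>\<^sub>0 + c * (norm (\<theta> - \<theta>\<^sub>0))\<^sup>2 \<le> f \<theta>"
  using eventually_nhds_x_imp_x[OF growth] assms by (auto simp: sol_zero)

text \<open>Growth at \<open>\<theta>sol v\<close>, tested at \<open>\<theta>\<^sub>0\<close>, and
  minimality of \<open>f \<theta>\<^sub>0\<close> give \<open>c * d^2 \<le> norm v * d\<close> for
  the distance \<open>d\<close>.\<close>

lemma solution_Lipschitz:
  obtains \<rho> where "\<rho> > 0" "\<And>v. norm v < \<rho> \<Longrightarrow> \<theta>sol v \<in> \<Theta>" "\<And>v. norm v < \<rho> \<Longrightarrow> norm (\<theta>sol v - \<theta>\<^sub>0) \<le> norm v / c"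
    "\<And>v \<theta>. norm v < \<rho> \<Longrightarrow> \<theta> \<in> \<Theta> \<Longrightarrow> \<theta> \<in> V \<Longrightarrow>
       f (\<theta>sol v) + c * (norm (\<theta> - \<theta>sol v))\<^sup>2 \<le> f \<theta> + v \<bullet> (\<theta> - \<theta>sol v)"
proof -
  obtain \<rho> where r: "\<rho> > 0" "\<And>v. norm v < \<rho> \<Longrightarrow> \<theta>sol v \<in> \<Theta> \<and> \<theta>sol v \<in> V \<and> (\<forall>\<theta>\<in>\<Theta> \<inter> V.
        f \<theta> + v \<bullet> (\<theta> - \<theta>sol v) \<ge> f (\<theta>sol v) + c * (norm (\<theta> - \<theta>sol v))\<^sup>2)"
    using growth unfolding eventually_nhds_metric by auto
  show ?thesis
  proof (rule that[OF r(1)])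
    fix v :: 'p assume v: "norm v < \<rho>"
    show "\<theta>sol v \<in> \<Theta>"
      using r(2)[OF v] by blast
    have "\<theta>\<^sub>0 \<in> V"
      using V interior_subset by blast
    then have "f (\<theta>sol v) + c * (norm (\<theta>\<^sub>0 - \<theta>sol v))\<^sup>2 \<le> f \<theta>\<^sub>0 + v \<bullet> (\<theta>\<^sub>0 - \<theta>sol v)"
      using r(2)[OF v] theta0 by blast
    moreover have "f \<theta>\<^sub>0 \<le> f (\<theta>sol v)"
      using f_min[of "\<theta>sol v"] r(2)[OF v] by (cases "\<theta>sol v = \<theta>\<^sub>0") auto
    moreover have "v \<bullet> (\<theta>\<^sub>0 - \<theta>sol v) \<le> norm v * norm (\<theta>\<^sub>0 - \<theta>sol v)"
      by (rule norm_cauchy_schwarz)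
    ultimately have "(c * norm (\<theta>\<^sub>0 - \<theta>sol v)) * norm (\<theta>\<^sub>0 - \<theta>sol v) \<le> norm v * norm (\<theta>\<^sub>0 - \<theta>sol v)"
      by (simp add: power2_eq_square mult.assoc)
    then have "c * norm (\<theta>\<^sub>0 - \<theta>sol v) \<le> norm v"
      by (cases "norm (\<theta>\<^sub>0 - \<theta>sol v) = 0") (auto simp: mult_le_cancel_right)
    then show "norm (\<theta>sol v - \<theta>\<^sub>0) \<le> norm v / c"
      using c by (simp add: pos_le_divide_eq mult.commute norm_minus_commute)
  next
    fix v \<theta> :: 'p assume "norm v < \<rho>" "\<theta> \<in> \<Theta>" "\<theta> \<in> V"
    then show "f (\<theta>sol v) + c * (norm (\<theta> - \<theta>sol v))\<^sup>2 \<le> f \<theta> + v \<bullet> (\<theta> - \<theta>sol v)"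
      using r(2) by blast
  qed
qed

text \<open>Since \<open>\<theta>2\<close> has the smaller robust loss, the weighted average of
  increments is nonnegative. Its part with weight 1 is split into drift and noise by
  \<open>emp_loss_expansion\<close>, and the part with weight \<open>q\<close> remains on the
  right.\<close>

lemma basic_inequality:
  assumes th: "\<theta>1 \<in> \<Theta>" "\<theta>2 \<in> \<Theta>" and le: "F n \<omega> \<theta>2 \<le> F n \<omega> \<theta>1"
    and inc: "F n \<omega> \<theta>1 - F n \<omega> \<theta>2 \<le> sample_mean n (\<lambda>i. (1 + q i) * (l (X i \<omega>) \<theta>1 - l (X i \<omega>) \<theta>2))"
  shows "f \<theta>2 - f \<theta>1 + grad_dev n \<omega> \<bullet> (\<theta>2 - \<theta>1) + R n \<omega> \<theta>2 - R n \<omega> \<theta>1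
     \<le> sample_mean n (\<lambda>i. q i * (l (X i \<omega>) \<theta>1 - l (X i \<omega>) \<theta>2))"
proof -
  have "0 \<le> sample_mean n (\<lambda>i. (1 + q i) * (l (X i \<omega>) \<theta>1 - l (X i \<omega>) \<theta>2))"
    using le inc by linarith
  also have "\<dots> = emp n (\<lambda>x. l x \<theta>1) \<omega> - emp n (\<lambda>x. l x \<theta>2) \<omega> + sample_mean n (\<lambda>i. q i * (l (X i \<omega>) \<theta>1 - l (X i \<omega>) \<theta>2))"
    by (simp add: distrib_right sample_mean_add sample_mean_diff)
  finally show ?thesis
    using emp_loss_expansion[OF th(1), of n \<omega>] emp_loss_expansion[OF th(2), of n \<omega>]
    by (simp add: inner_diff_right)
qed

text \<open>Here only the size of the density matters, so tolerance 1 in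
  \<open>worst_case_bound\<close> suffices:
  \<open>\<bar>q i\<bar> \<le> Cq * sqrt (\<delta> n)\<close> bounds the right-hand side of the
  basic inequality by a multiple of \<open>a n\<close> times the distance \<open>d\<close> to
  \<open>\<theta>\<^sub>0\<close>, and growth gives a quadratic inequality for
  \<open>d\<close>.\<close>

lemma rate_of_convergence:
  assumes K: "K \<ge> 0"
  obtains K' where "K' > 0"
    "whp (\<lambda>n \<omega>. sqrt (real n) * norm (grad_dev n \<omega>) \<le> K \<longrightarrow> norm (\<theta>bar n \<omega> - \<theta>\<^sub>0) \<le> K' * a n)"
proof -
  define s0 where "s0 = loss_var P l \<theta>\<^sub>0 / 2"
  have s0: "s0 > 0"
    using var_pos by (simp add: s0_def)
  define cL where "cL = (\<integral>x. Lip x \<partial>P) + 1"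
  have cL: "cL > 0"
    unfolding cL_def using integral_nonneg_AE[of Lip P] Lip_nonneg by (simp add: add_nonneg_pos)
  define Cq where "Cq = sqrt \<kappa> * (2 * B) / sqrt s0 + 1"
  have Cq: "Cq > 0"
    using kappa_pos B s0 by (simp add: Cq_def add_pos_pos)
  define E where "E = Cq * cL * Ca + K * Ca"
  have E: "E > 0"
    using Cq cL Ca K by (simp add: E_def add_pos_nonneg)
  \<comment> \<open>Solves \<open>d^2 \<le> 2 * E / c * a n * d + (Ca * a n)^2\<close>: either
    \<open>d \<le> Ca * a n\<close>, or one factor \<open>Ca * a n\<close> of the last term may be
    replaced by \<open>d\<close>.\<close>
  define K' where "K' = 2 * E / c + Ca"
  have K': "K' > 0" "Ca \<le> K'"
    using E c Ca by (simp_all add: K'_def add_pos_pos)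
  obtain \<rho> where rho: "\<rho> > 0" and winc:
    "whp (\<lambda>n \<omega>. \<forall>\<theta>1\<in>\<Theta>. norm (\<theta>1 - \<theta>\<^sub>0) < \<rho> \<longrightarrow> worst_case_bound 1 n \<omega> \<theta>1)"
    using whp_robust_increment[OF zero_less_one] by blast
  obtain \<rho>V where rhoV: "\<rho>V > 0" "\<And>\<theta>. norm (\<theta> - \<theta>\<^sub>0) < \<rho>V \<Longrightarrow> \<theta> \<in> V"
    using V_ball by blast
  have wc: "whp (\<lambda>n \<omega>. norm (\<theta>bar n \<omega> - \<theta>\<^sub>0) < min (r\<^sub>0 / 2) \<rho>V)"
    by (rule consistency) (use r0 rhoV in simp)
  \<comment> \<open>With the factor \<open>c / 2\<close>, half of the quadratic growth absorbs the
    second order noise.\<close>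
  have wR: "whp (\<lambda>n \<omega>. \<forall>\<theta>\<in>\<Theta>. norm (\<theta> - \<theta>\<^sub>0) < r\<^sub>0 / 2 \<longrightarrow> \<bar>R n \<omega> \<theta>\<bar> \<le> c / 2 * ((norm (\<theta> - \<theta>\<^sub>0))\<^sup>2 + 1 / real n))"
    by (rule whp_remainder) (use c in simp)
  note ws = whp_conj[OF whp_regular whp_conj[OF whp_Lip whp_conj[OF whp_theta_bar whp_conj[OF winc whp_conj[OF wc wR]]]]]
  show ?thesis
  proof (rule that[OF K'(1)], rule whp_mono_eventually[OF ws], goal_cases)
    case 1
    show ?case
      using rates eventually_ge_at_top[of 1]
    proof (eventually_elim, intro ballI impI, elim conjE)
      fix n \<omega>
      assume ra: "1 / sqrt (real n) \<le> Ca * a n" "sqrt (\<delta> n) \<le> Ca * a n" and n: "1 \<le> n"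
        and reg: "\<forall>i\<ge>1. regular (X i \<omega>)" and L: "emp n Lip \<omega> < (\<integral>x. Lip x \<partial>P) + 1"
        and bar: "1 \<le> n \<longrightarrow> \<theta>bar n \<omega> \<in> \<Theta> \<and> (\<forall>\<theta>\<in>\<Theta>. F n \<omega> (\<theta>bar n \<omega>) \<le> F n \<omega> \<theta>)"
        and inc: "\<forall>\<theta>1\<in>\<Theta>. norm (\<theta>1 - \<theta>\<^sub>0) < \<rho> \<longrightarrow> worst_case_bound 1 n \<omega> \<theta>1"
        and close: "norm (\<theta>bar n \<omega> - \<theta>\<^sub>0) < min (r\<^sub>0 / 2) \<rho>V"
        and Rb: "\<forall>\<theta>\<in>\<Theta>. norm (\<theta> - \<theta>\<^sub>0) < r\<^sub>0 / 2 \<longrightarrow> \<bar>R n \<omega> \<theta>\<bar> \<le> c / 2 * ((norm (\<theta> - \<theta>\<^sub>0))\<^sup>2 + 1 / real n)"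
        and gK: "sqrt (real n) * norm (grad_dev n \<omega>) \<le> K"
      define t where "t = \<theta>bar n \<omega>"
      define d where "d = norm (t - \<theta>\<^sub>0)"
      define y m s where "y i = l (X i \<omega>) \<theta>\<^sub>0" and "m = emp n (\<lambda>x. l x \<theta>\<^sub>0) \<omega>" and "s = sample_var n (\<lambda>i. l (X i \<omega>) \<theta>\<^sub>0)" for i
      have t: "t \<in> \<Theta>" "F n \<omega> t \<le> F n \<omega> \<theta>\<^sub>0" "t \<in> V" "d < r\<^sub>0 / 2"
        using bar n theta0 close rhoV(2)[of t] by (auto simp: t_def d_def)
      have d: "d \<ge> 0"
        by (simp add: d_def)
      have lt0: "norm (\<theta>\<^sub>0 - \<theta>\<^sub>0) < \<rho>"
        using rho by simp
      obtain q where s: "s0 \<le> s" and q: "\<And>i. i \<in> {1..n} \<Longrightarrow> \<bar>q i - sqrt (\<kappa> * \<delta> n) * (y i - m) / sqrt s\<bar> \<le> 1 * sqrt (\<delta> n)"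
        "F n \<omega> \<theta>\<^sub>0 - F n \<omega> t \<le> sample_mean n (\<lambda>i. (1 + q i) * (l (X i \<omega>) \<theta>\<^sub>0 - l (X i \<omega>) t))"
        using inc[rule_format, OF theta0 lt0] t(1) unfolding worst_case_bound_def y_def m_def s_def s0_def by blast
      have yB: "\<bar>y i\<bar> \<le> B" if "i \<in> {1..n}" for i
        unfolding y_def using reg that by (intro regular_bounded theta0) auto
      have mB: "\<bar>m\<bar> \<le> B"
        using abs_sample_mean_le_const[OF n yB] by (simp add: m_def y_def)
      have sd: "sqrt (\<delta> n) > 0"
        using delta_pos by simp
      have qb: "\<bar>q i\<bar> \<le> Cq * sqrt (\<delta> n)" if i: "i \<in> {1..n}" for i
      proof -
        have "\<bar>sqrt (\<kappa> * \<delta> n) * (y i - m) / sqrt s\<bar> = sqrt \<kappa> * sqrt (\<delta> n) * \<bar>y i - m\<bar> / sqrt s"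
          using kappa_pos sd s s0 by (simp add: abs_mult real_sqrt_mult)
        also have "\<dots> \<le> sqrt \<kappa> * sqrt (\<delta> n) * (2 * B) / sqrt s0"
          using kappa_pos sd s s0 yB[OF i] mB by (intro frac_le mult_left_mono) auto
        finally have "\<bar>sqrt (\<kappa> * \<delta> n) * (y i - m) / sqrt s\<bar> \<le> sqrt \<kappa> * (2 * B) / sqrt s0 * sqrt (\<delta> n)"
          by (simp add: mult_ac)
        moreover have "Cq * sqrt (\<delta> n) = sqrt \<kappa> * (2 * B) / sqrt s0 * sqrt (\<delta> n) + 1 * sqrt (\<delta> n)"
          by (simp add: Cq_def distrib_right)
        ultimately show ?thesis
          using q(1)[OF i] by linarith
      qed
      have "\<bar>sample_mean n (\<lambda>i. q i * (l (X i \<omega>) \<theta>\<^sub>0 - l (X i \<omega>) t))\<bar> \<le> sample_mean n (\<lambda>i. Cq * sqrt (\<delta> n) * d * Lip (X i \<omega>))"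
      proof (rule abs_sample_mean_le)
        fix i assume i: "i \<in> {1..n}"
        have "\<bar>l (X i \<omega>) \<theta>\<^sub>0 - l (X i \<omega>) t\<bar> \<le> Lip (X i \<omega>) * norm (\<theta>\<^sub>0 - t)"
          by (rule l_Lip[OF _ theta0 t(1)]) (use reg i t(4) r0 in \<open>auto simp: d_def\<close>)
        then have "\<bar>q i * (l (X i \<omega>) \<theta>\<^sub>0 - l (X i \<omega>) t)\<bar> \<le> (Cq * sqrt (\<delta> n)) * (Lip (X i \<omega>) * d)"
          unfolding abs_mult using qb[OF i] Cq sd by (intro mult_mono) (auto simp: d_def norm_minus_commute)
        then show "\<bar>q i * (l (X i \<omega>) \<theta>\<^sub>0 - l (X i \<omega>) t)\<bar> \<le> Cq * sqrt (\<delta> n) * d * Lip (X i \<omega>)"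
          by (simp add: mult_ac)
      qed
      also have "\<dots> = Cq * sqrt (\<delta> n) * d * emp n Lip \<omega>"
        by (rule sample_mean_cmult)
      also have "\<dots> \<le> Cq * (Ca * a n) * d * cL"
        using L ra(2) Cq d cL sd Lip_nonneg Ca a_nonneg[of n]
        by (intro mult_mono mult_nonneg_nonneg) (auto simp: cL_def intro!: sample_mean_nonneg)
      finally have 1: "sample_mean n (\<lambda>i. q i * (l (X i \<omega>) \<theta>\<^sub>0 - l (X i \<omega>) t)) \<le> Cq * (Ca * a n) * d * cL"
        by simp
      have gn: "norm (grad_dev n \<omega>) \<le> K * (Ca * a n)"
      proof -
        have "norm (grad_dev n \<omega>) \<le> K * (1 / sqrt (real n))"
          using gK n by (simp add: pos_le_divide_eq mult.commute)
        also have "\<dots> \<le> K * (Ca * a n)"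
          using ra(1) K by (intro mult_left_mono)
        finally show ?thesis .
      qed
      have "\<bar>grad_dev n \<omega> \<bullet> (t - \<theta>\<^sub>0)\<bar> \<le> norm (grad_dev n \<omega>) * d"
        unfolding d_def by (rule Cauchy_Schwarz_ineq2)
      also have "\<dots> \<le> K * (Ca * a n) * d"
        using gn d by (intro mult_right_mono)
      finally have 2: "- (grad_dev n \<omega> \<bullet> (t - \<theta>\<^sub>0)) \<le> K * (Ca * a n) * d"
        by linarith
      have R0: "R n \<omega> \<theta>\<^sub>0 = 0"
        by (simp add: R_def rem_theta0[abs_def] sample_mean_def)
      have n1: "1 / real n \<le> (Ca * a n)\<^sup>2"
      proof -
        have "(1 / sqrt (real n))\<^sup>2 \<le> (Ca * a n)\<^sup>2"
          using ra(1) by (intro power_mono) auto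
        then show ?thesis
          using n by (simp add: power_divide)
      qed
      have "\<bar>R n \<omega> t\<bar> \<le> c / 2 * (d\<^sup>2 + 1 / real n)"
        using Rb t by (auto simp: d_def)
      also have "\<dots> \<le> c / 2 * (d\<^sup>2 + (Ca * a n)\<^sup>2)"
        using n1 c by (intro mult_left_mono add_left_mono) auto
      finally have 3: "- R n \<omega> t \<le> c / 2 * d\<^sup>2 + c / 2 * (Ca * a n)\<^sup>2"
        by (simp add: distrib_left)
      have "c * d\<^sup>2 \<le> f t - f \<theta>\<^sub>0"
        using quadratic_growth[OF t(1,3)] by (simp add: d_def)
      also have "\<dots> \<le> Cq * (Ca * a n) * d * cL + K * (Ca * a n) * d + (c / 2 * d\<^sup>2 + c / 2 * (Ca * a n)\<^sup>2)"
        using basic_inequality[OF theta0 t(1,2) q(2)] 1 2 3 R0 by linarith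
      also have "\<dots> = E * a n * d + (c / 2 * d\<^sup>2 + c / 2 * (Ca * a n)\<^sup>2)"
        by (simp add: E_def algebra_simps)
      finally have "c / 2 * d\<^sup>2 \<le> E * a n * d + c / 2 * (Ca * a n)\<^sup>2"
        by simp
      then have main: "d\<^sup>2 \<le> 2 * E / c * a n * d + (Ca * a n)\<^sup>2"
        using c by (simp add: field_simps)
      show "norm (\<theta>bar n \<omega> - \<theta>\<^sub>0) \<le> K' * a n"
      proof (cases "d \<le> Ca * a n")
        case True
        also have "Ca * a n \<le> K' * a n"
          using K'(2) a_nonneg by (rule mult_right_mono)
        finally show ?thesis
          by (simp add: d_def t_def)
      next
        case False
        have "0 \<le> Ca * a n"
          using Ca a_nonneg[of n] by simp
        then have d0: "d > 0"
          using False by linarith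
        have "(Ca * a n)\<^sup>2 \<le> (Ca * a n) * d"
          unfolding power2_eq_square using False Ca a_nonneg[of n] by (intro mult_left_mono) auto
        then have "d * d \<le> (K' * a n) * d"
          using main by (simp add: K'_def power2_eq_square distrib_right)
        then have "d \<le> K' * a n"
          using d0 by simp
        then show ?thesis
          by (simp add: d_def t_def)
      qed
    qed
  qed
qed

text \<open>The worst case is taken at the tilted solution \<open>t1\<close> and tested at the
  estimator \<open>t\<close>. The tilt consists of exactly the terms linear in \<open>t - t1\<close>
  that this produces: first order noise and increment of the standard deviation. They cancel against
  the growth inequality at \<open>t1\<close>, and the squared distance is left with errors
  \<open>o(a n ^ 2)\<close>.\<close>

lemma solution_comparison:
  assumes K: "K \<ge> 0" and eta: "\<eta> > 0"
  shows "whp (\<lambda>n \<omega>. sqrt (real n) * norm (grad_dev n \<omega>) \<le> K \<longrightarrow> norm (\<theta>bar n \<omega> - \<theta>sol (\<zeta> n \<omega>)) \<le> \<eta> * a n)"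
proof -
  obtain K' where K': "K' > 0" and wrate:
    "whp (\<lambda>n \<omega>. sqrt (real n) * norm (grad_dev n \<omega>) \<le> K \<longrightarrow> norm (\<theta>bar n \<omega> - \<theta>\<^sub>0) \<le> K' * a n)"
    using rate_of_convergence[OF K] by blast
  define cL where "cL = (\<integral>x. Lip x \<partial>P) + 1"
  have cL: "cL > 0"
    unfolding cL_def using integral_nonneg_AE[of Lip P] Lip_nonneg by (simp add: add_nonneg_pos)
  \<comment> \<open>\<open>K1 * a n\<close> bounds the tilt, and \<open>K2 * a n\<close> the
    distance of both estimator and tilted solution from \<open>\<theta>\<^sub>0\<close>.\<close>
  define K1 where "K1 = K * Ca + sqrt \<kappa> * Ca * norm \<gamma>"
  have K1: "K1 \<ge> 0"
    using K Ca kappa_pos by (simp add: K1_def)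
  define K2 where "K2 = max K' (K1 / c)"
  have K2: "K2 > 0" "K' \<le> K2" "K1 / c \<le> K2"
    using K' by (auto simp: K2_def)
  \<comment> \<open>Three errors of size \<open>\<tau> * (a n)^2\<close> add up to
    \<open>c * (\<eta> * a n)^2\<close>: from the increment of the standard deviation
    (\<open>\<eta>1\<close>), from the density (\<open>\<eta>2\<close>) and from the second order
    noise (\<open>\<eta>3\<close>).\<close>
  define \<tau> where "\<tau> = c * \<eta>\<^sup>2 / 3"
  define \<eta>1 \<eta>2 \<eta>3 where "\<eta>1 = \<tau> / (sqrt \<kappa> * Ca)" and "\<eta>2 = \<tau> / (Ca * cL * (2 * K2))"
    and "\<eta>3 = \<tau> / (2 * (K2\<^sup>2 + Ca\<^sup>2))"
  have tau: "\<tau> > 0"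
    using c eta by (simp add: \<tau>_def)
  have pos: "sqrt \<kappa> * Ca > 0" "Ca * cL * (2 * K2) > 0" "2 * (K2\<^sup>2 + Ca\<^sup>2) > 0"
    using kappa_pos Ca cL K2 by (auto intro!: mult_pos_pos add_pos_pos)
  have etas: "\<eta>1 > 0" "\<eta>2 > 0" "\<eta>3 > 0"
    unfolding \<eta>1_def \<eta>2_def \<eta>3_def using tau pos by (auto intro!: divide_pos_pos)
  have eta_eqs: "sqrt \<kappa> * Ca * \<eta>1 = \<tau>" "Ca * cL * (2 * K2) * \<eta>2 = \<tau>" "2 * (K2\<^sup>2 + Ca\<^sup>2) * \<eta>3 = \<tau>"
    unfolding \<eta>1_def \<eta>2_def \<eta>3_def by (intro pos_mult_divide_cancel pos)+
  obtain \<rho> where rho: "\<rho> > 0" and winc: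
    "whp (\<lambda>n \<omega>. \<forall>\<theta>1\<in>\<Theta>. norm (\<theta>1 - \<theta>\<^sub>0) < \<rho> \<longrightarrow> worst_case_bound \<eta>2 n \<omega> \<theta>1)"
    using whp_robust_increment[OF etas(2)] by blast
  obtain \<rho>V where rhoV: "\<rho>V > 0" "\<And>\<theta>. norm (\<theta> - \<theta>\<^sub>0) < \<rho>V \<Longrightarrow> \<theta> \<in> V"
    using V_ball by blast
  obtain \<rho>s where rhos: "\<rho>s > 0" "\<And>v. norm v < \<rho>s \<Longrightarrow> \<theta>sol v \<in> \<Theta>" "\<And>v. norm v < \<rho>s \<Longrightarrow> norm (\<theta>sol v - \<theta>\<^sub>0) \<le> norm v / c"
    "\<And>v \<theta>. norm v < \<rho>s \<Longrightarrow> \<theta> \<in> \<Theta> \<Longrightarrow> \<theta> \<in> V \<Longrightarrow>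
       f (\<theta>sol v) + c * (norm (\<theta> - \<theta>sol v))\<^sup>2 \<le> f \<theta> + v \<bullet> (\<theta> - \<theta>sol v)"
    using solution_Lipschitz by blast
  have wR: "whp (\<lambda>n \<omega>. \<forall>\<theta>\<in>\<Theta>. norm (\<theta> - \<theta>\<^sub>0) < r\<^sub>0 / 2 \<longrightarrow> \<bar>R n \<omega> \<theta>\<bar> \<le> \<eta>3 * ((norm (\<theta> - \<theta>\<^sub>0))\<^sup>2 + 1 / real n))"
    by (rule whp_remainder[OF etas(3)])
  note wsd = whp_sd_increment[OF var_pos gradient a_nonneg a_lim K2(1) etas(1)]
  note ws = whp_conj[OF whp_regular whp_conj[OF whp_Lip whp_conj[OF whp_theta_bar whp_conj[OF winc whp_conj[OF wrate whp_conj[OF wR wsd]]]]]]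
  show ?thesis
  proof (rule whp_mono_eventually[OF ws], goal_cases)
    case 1
    have lim: "(\<lambda>n. K1 * a n) \<longlonglongrightarrow> 0" "(\<lambda>n. K2 * a n) \<longlonglongrightarrow> 0"
      using tendsto_mult_left[OF a_lim, of K1] tendsto_mult_left[OF a_lim, of K2] by simp_all
    have ev: "\<forall>\<^sub>F n in sequentially. K1 * a n < \<rho>s" "\<forall>\<^sub>F n in sequentially. K2 * a n < min (r\<^sub>0 / 2) (min \<rho> \<rho>V)"
      by (rule order_tendstoD(2)[OF lim(1) rhos(1)])
        (rule order_tendstoD(2)[OF lim(2)], use r0 rho rhoV in simp)
    show ?case
      using rates ev eventually_ge_at_top[of 1]
    proof (eventually_elim, intro ballI impI, elim conjE)
      fix n \<omega>
      assume ra: "1 / sqrt (real n) \<le> Ca * a n" "sqrt (\<delta> n) \<le> Ca * a n"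
        and small: "K1 * a n < \<rho>s" "K2 * a n < min (r\<^sub>0 / 2) (min \<rho> \<rho>V)" and n: "1 \<le> n"
        and reg: "\<forall>i\<ge>1. regular (X i \<omega>)" and L: "emp n Lip \<omega> < (\<integral>x. Lip x \<partial>P) + 1"
        and bar: "1 \<le> n \<longrightarrow> \<theta>bar n \<omega> \<in> \<Theta> \<and> (\<forall>\<theta>\<in>\<Theta>. F n \<omega> (\<theta>bar n \<omega>) \<le> F n \<omega> \<theta>)"
        and inc: "\<forall>\<theta>1\<in>\<Theta>. norm (\<theta>1 - \<theta>\<^sub>0) < \<rho> \<longrightarrow> worst_case_bound \<eta>2 n \<omega> \<theta>1"
        and rt: "sqrt (real n) * norm (grad_dev n \<omega>) \<le> K \<longrightarrow> norm (\<theta>bar n \<omega> - \<theta>\<^sub>0) \<le> K' * a n"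
        and Rb: "\<forall>\<theta>\<in>\<Theta>. norm (\<theta> - \<theta>\<^sub>0) < r\<^sub>0 / 2 \<longrightarrow> \<bar>R n \<omega> \<theta>\<bar> \<le> \<eta>3 * ((norm (\<theta> - \<theta>\<^sub>0))\<^sup>2 + 1 / real n)"
        and sdi: "\<forall>\<theta>1\<in>\<Theta>. \<forall>\<theta>2\<in>\<Theta>. norm (\<theta>1 - \<theta>\<^sub>0) \<le> K2 * a n \<longrightarrow> norm (\<theta>2 - \<theta>\<^sub>0) \<le> K2 * a n \<longrightarrow>
          \<bar>sample_mean n (\<lambda>i. (l (X i \<omega>) \<theta>1 - emp n (\<lambda>x. l x \<theta>1) \<omega>) * (l (X i \<omega>) \<theta>1 - l (X i \<omega>) \<theta>2))
            / sqrt (sample_var n (\<lambda>i. l (X i \<omega>) \<theta>1)) - \<gamma> \<bullet> (\<theta>1 - \<theta>2)\<bar> \<le> \<eta>1 * a n"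
        and gK: "sqrt (real n) * norm (grad_dev n \<omega>) \<le> K"
      have an: "0 \<le> a n" by (rule a_nonneg)
      have can: "0 \<le> Ca * a n"
        using Ca an by simp
      define z where "z = \<zeta> n \<omega>"
      define t t1 where "t = \<theta>bar n \<omega>" and "t1 = \<theta>sol z"
      have gn: "norm (grad_dev n \<omega>) \<le> K * (Ca * a n)"
      proof -
        have "norm (grad_dev n \<omega>) \<le> K * (1 / sqrt (real n))"
          using gK n by (simp add: pos_le_divide_eq mult.commute)
        also have "\<dots> \<le> K * (Ca * a n)"
          using ra(1) K by (intro mult_left_mono)
        finally show ?thesis .
      qed
      have skd: "sqrt (\<kappa> * \<delta> n) \<le> sqrt \<kappa> * (Ca * a n)" "0 \<le> sqrt (\<kappa> * \<delta> n)"
        using ra(2) kappa_pos delta_pos[of n] by (simp_all add: real_sqrt_mult mult_left_mono)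
      have zb: "norm z \<le> K1 * a n"
      proof -
        have "norm z \<le> norm (grad_dev n \<omega>) + sqrt (\<kappa> * \<delta> n) * norm \<gamma>"
          unfolding z_def \<zeta>_def using norm_triangle_ineq[of "grad_dev n \<omega>" "sqrt (\<kappa> * \<delta> n) *\<^sub>R \<gamma>"] skd(2) by simp
        also have "\<dots> \<le> K * (Ca * a n) + sqrt \<kappa> * (Ca * a n) * norm \<gamma>"
          using gn skd by (intro add_mono mult_right_mono) auto
        finally show ?thesis
          by (simp add: K1_def algebra_simps)
      qed
      then have zs: "norm z < \<rho>s"
        using small(1) by linarith
      have t: "t \<in> \<Theta>" "F n \<omega> t \<le> F n \<omega> \<theta>" if "\<theta> \<in> \<Theta>" for \<theta>
        using bar n that by (auto simp: t_def)
      have tT: "t \<in> \<Theta>"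
        using t(1)[OF theta0] .
      have td: "norm (t - \<theta>\<^sub>0) \<le> K2 * a n"
      proof -
        have "norm (t - \<theta>\<^sub>0) \<le> K' * a n"
          using rt gK by (simp add: t_def)
        also have "\<dots> \<le> K2 * a n"
          using K2(2) an by (rule mult_right_mono)
        finally show ?thesis .
      qed
      have tV: "t \<in> V"
        by (rule rhoV(2)) (use td small(2) in simp)
      have t1T: "t1 \<in> \<Theta>"
        unfolding t1_def by (rule rhos(2)[OF zs])
      have t1d: "norm (t1 - \<theta>\<^sub>0) \<le> K2 * a n"
      proof -
        have "norm (t1 - \<theta>\<^sub>0) \<le> norm z / c"
          unfolding t1_def by (rule rhos(3)[OF zs])
        also have "\<dots> \<le> (K1 * a n) / c"
          using zb c by (intro divide_right_mono) auto
        also have "\<dots> = K1 / c * a n"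
          by simp
        also have "\<dots> \<le> K2 * a n"
          using K2(3) an by (rule mult_right_mono)
        finally show ?thesis .
      qed
      have lt: "norm (t - \<theta>\<^sub>0) < r\<^sub>0 / 2" "norm (t1 - \<theta>\<^sub>0) < r\<^sub>0 / 2" "norm (t1 - \<theta>\<^sub>0) < \<rho>"
        using td t1d small(2) by simp_all
      define h where "h = norm (t - t1)"
      have h: "0 \<le> h" "h \<le> 2 * K2 * a n"
      proof -
        have "norm ((t - \<theta>\<^sub>0) - (t1 - \<theta>\<^sub>0)) \<le> K2 * a n + K2 * a n"
          by (rule order_trans[OF norm_triangle_ineq4 add_mono[OF td t1d]])
        then show "h \<le> 2 * K2 * a n"
          by (simp add: h_def)
      qed (simp add: h_def)
      define y m s where "y i = l (X i \<omega>) t1" and "m = emp n (\<lambda>x. l x t1) \<omega>" and "s = sample_var n (\<lambda>i. l (X i \<omega>) t1)" for i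
      obtain q where q: "\<And>i. i \<in> {1..n} \<Longrightarrow> \<bar>q i - sqrt (\<kappa> * \<delta> n) * (y i - m) / sqrt s\<bar> \<le> \<eta>2 * sqrt (\<delta> n)"
        "F n \<omega> t1 - F n \<omega> t \<le> sample_mean n (\<lambda>i. (1 + q i) * (l (X i \<omega>) t1 - l (X i \<omega>) t))"
        using inc[rule_format, OF t1T lt(3)] tT unfolding worst_case_bound_def y_def m_def s_def by blast
      \<comment> \<open>\<open>q\<close> splits into its explicit leading term, which produces the
        covariance \<open>A\<close>, and a deviation of uniform size
        \<open>\<eta>2 * sqrt (\<delta> n)\<close>.\<close>
      define e where "e i = q i - sqrt (\<kappa> * \<delta> n) * (y i - m) / sqrt s" for i
      define A where "A = sample_mean n (\<lambda>i. (y i - m) * (y i - l (X i \<omega>) t))"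
      have split: "sample_mean n (\<lambda>i. q i * (l (X i \<omega>) t1 - l (X i \<omega>) t))
          = sample_mean n (\<lambda>i. e i * (y i - l (X i \<omega>) t)) + sqrt (\<kappa> * \<delta> n) * (A / sqrt s)"
      proof -
        have "sample_mean n (\<lambda>i. q i * (l (X i \<omega>) t1 - l (X i \<omega>) t))
          = sample_mean n (\<lambda>i. e i * (y i - l (X i \<omega>) t) + sqrt (\<kappa> * \<delta> n) / sqrt s * ((y i - m) * (y i - l (X i \<omega>) t)))"
        proof (rule sample_mean_cong)
          fix i
          define u where "u = y i - l (X i \<omega>) t"
          have "e i * u + sqrt (\<kappa> * \<delta> n) / sqrt s * ((y i - m) * u) = q i * u"
            by (simp add: e_def left_diff_distrib)
          then show "q i * (l (X i \<omega>) t1 - l (X i \<omega>) t) = e i * (y i - l (X i \<omega>) t)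
              + sqrt (\<kappa> * \<delta> n) / sqrt s * ((y i - m) * (y i - l (X i \<omega>) t))"
            by (simp add: u_def y_def)
        qed
        then show ?thesis
          unfolding sample_mean_add sample_mean_cmult A_def by simp
      qed
      have eb: "sample_mean n (\<lambda>i. e i * (y i - l (X i \<omega>) t)) \<le> \<tau> * (a n)\<^sup>2"
      proof -
        have "\<bar>sample_mean n (\<lambda>i. e i * (y i - l (X i \<omega>) t))\<bar> \<le> sample_mean n (\<lambda>i. \<eta>2 * sqrt (\<delta> n) * h * Lip (X i \<omega>))"
        proof (rule abs_sample_mean_le)
          fix i assume i: "i \<in> {1..n}"
          have "\<bar>y i - l (X i \<omega>) t\<bar> \<le> Lip (X i \<omega>) * norm (t1 - t)"
            unfolding y_def by (rule l_Lip[OF _ t1T tT]) (use reg i lt r0 in auto)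
          then have "\<bar>e i * (y i - l (X i \<omega>) t)\<bar> \<le> (\<eta>2 * sqrt (\<delta> n)) * (Lip (X i \<omega>) * h)"
            unfolding abs_mult e_def using q(1)[OF i] etas delta_pos[of n]
            by (intro mult_mono) (auto simp: h_def norm_minus_commute)
          then show "\<bar>e i * (y i - l (X i \<omega>) t)\<bar> \<le> \<eta>2 * sqrt (\<delta> n) * h * Lip (X i \<omega>)"
            by (simp add: mult_ac)
        qed
        also have "\<dots> = \<eta>2 * sqrt (\<delta> n) * h * emp n Lip \<omega>"
          by (rule sample_mean_cmult)
        also have "\<dots> \<le> \<eta>2 * (Ca * a n) * (2 * K2 * a n) * cL"
          using L ra(2) etas h cL can delta_pos[of n] Lip_nonneg Ca an K2(1)
          by (intro mult_mono mult_nonneg_nonneg) (auto simp: cL_def intro!: sample_mean_nonneg)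
        also have "\<dots> = Ca * cL * (2 * K2) * \<eta>2 * (a n)\<^sup>2"
          by (simp add: power2_eq_square mult_ac)
        finally show ?thesis
          unfolding eta_eqs by simp
      qed
      have Ab: "sqrt (\<kappa> * \<delta> n) * (A / sqrt s - \<gamma> \<bullet> (t1 - t)) \<le> \<tau> * (a n)\<^sup>2"
      proof -
        have "\<bar>A / sqrt s - \<gamma> \<bullet> (t1 - t)\<bar> \<le> \<eta>1 * a n"
          using sdi[rule_format, OF t1T tT t1d td] by (simp add: A_def y_def m_def s_def)
        then have "\<bar>sqrt (\<kappa> * \<delta> n) * (A / sqrt s - \<gamma> \<bullet> (t1 - t))\<bar> \<le> (sqrt \<kappa> * (Ca * a n)) * (\<eta>1 * a n)"
          unfolding abs_mult using skd kappa_pos can by (intro mult_mono) auto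
        also have "\<dots> = sqrt \<kappa> * Ca * \<eta>1 * (a n)\<^sup>2"
          by (simp add: power2_eq_square mult_ac)
        finally show ?thesis
          unfolding eta_eqs by simp
      qed
      have n1: "1 / real n \<le> (Ca * a n)\<^sup>2"
      proof -
        have "(1 / sqrt (real n))\<^sup>2 \<le> (Ca * a n)\<^sup>2"
          using ra(1) by (intro power_mono) auto
        then show ?thesis
          using n by (simp add: power_divide)
      qed
      have Rbd: "\<bar>R n \<omega> \<theta>\<bar> \<le> \<eta>3 * (K2\<^sup>2 + Ca\<^sup>2) * (a n)\<^sup>2"
        if "\<theta> \<in> \<Theta>" "norm (\<theta> - \<theta>\<^sub>0) < r\<^sub>0 / 2" "norm (\<theta> - \<theta>\<^sub>0) \<le> K2 * a n" for \<theta>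
      proof -
        have "\<bar>R n \<omega> \<theta>\<bar> \<le> \<eta>3 * ((norm (\<theta> - \<theta>\<^sub>0))\<^sup>2 + 1 / real n)"
          using Rb that by blast
        also have "\<dots> \<le> \<eta>3 * ((K2 * a n)\<^sup>2 + (Ca * a n)\<^sup>2)"
          using that(3) n1 etas by (intro mult_left_mono add_mono power_mono) auto
        finally show ?thesis
          by (simp add: power_mult_distrib algebra_simps)
      qed
      have Rs: "R n \<omega> t1 - R n \<omega> t \<le> \<tau> * (a n)\<^sup>2"
      proof -
        have "R n \<omega> t1 - R n \<omega> t \<le> \<eta>3 * (K2\<^sup>2 + Ca\<^sup>2) * (a n)\<^sup>2 + \<eta>3 * (K2\<^sup>2 + Ca\<^sup>2) * (a n)\<^sup>2"
          using Rbd[OF t1T lt(2) t1d] Rbd[OF tT lt(1) td] by linarith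
        also have "\<dots> = 2 * (K2\<^sup>2 + Ca\<^sup>2) * \<eta>3 * (a n)\<^sup>2"
          by (simp add: algebra_simps)
        finally show ?thesis
          unfolding eta_eqs .
      qed
      have gr: "f t1 + c * h\<^sup>2 \<le> f t + z \<bullet> (t - t1)"
        unfolding t1_def h_def by (rule rhos(4)[OF zs tT tV])
      have zi: "z \<bullet> (t - t1) = grad_dev n \<omega> \<bullet> (t - t1) - sqrt (\<kappa> * \<delta> n) * (\<gamma> \<bullet> (t1 - t))"
        by (simp add: z_def \<zeta>_def inner_add_left inner_diff_right algebra_simps)
      have bas: "f t - f t1 + grad_dev n \<omega> \<bullet> (t - t1) + R n \<omega> t - R n \<omega> t1
          \<le> sample_mean n (\<lambda>i. e i * (y i - l (X i \<omega>) t)) + sqrt (\<kappa> * \<delta> n) * (A / sqrt s)"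
        unfolding split[symmetric] by (rule basic_inequality[OF t1T tT t(2)[OF t1T] q(2)])
      have "sqrt (\<kappa> * \<delta> n) * (A / sqrt s - \<gamma> \<bullet> (t1 - t)) = sqrt (\<kappa> * \<delta> n) * (A / sqrt s) - sqrt (\<kappa> * \<delta> n) * (\<gamma> \<bullet> (t1 - t))"
        by (rule right_diff_distrib)
      then have "c * h\<^sup>2 \<le> \<tau> * (a n)\<^sup>2 + \<tau> * (a n)\<^sup>2 + \<tau> * (a n)\<^sup>2"
        using gr zi bas eb Ab Rs by linarith
      also have "\<dots> = c * (\<eta> * a n)\<^sup>2"
        by (simp add: \<tau>_def power_mult_distrib)
      finally have "h\<^sup>2 \<le> (\<eta> * a n)\<^sup>2"
        by (rule mult_left_le_imp_le[OF _ c])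
      then have "h \<le> \<eta> * a n"
        by (rule power2_le_imp_le) (use eta an in auto)
      then show "norm (\<theta>bar n \<omega> - \<theta>sol (\<zeta> n \<omega>)) \<le> \<eta> * a n"
        by (simp add: h_def t_def t1_def z_def)
    qed
  qed
qed

end

section \<open>Convergence in distribution of random vectors\<close>

text \<open>Integrals of these functions are governed by the characteristic function. The product
  formulas for sine and cosine make the class an algebra, as Stone-Weierstrass requires.\<close>

inductive trig_poly :: "('a::real_inner \<Rightarrow> real) \<Rightarrow> bool" where
  cos: "trig_poly (\<lambda>x. a * cos (t \<bullet> x))"
| sin: "trig_poly (\<lambda>x. a * sin (t \<bullet> x))"
| add: "trig_poly f \<Longrightarrow> trig_poly g \<Longrightarrow> trig_poly (\<lambda>x. f x + g x)"

lemma trig_poly_const: "trig_poly (\<lambda>x::'a::real_inner. a)"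
  using trig_poly.cos[of a "0::'a"] by simp

lemma trig_poly_mult_cos_sin:
  assumes "trig_poly f"
  shows "trig_poly (\<lambda>x. f x * (b * cos (s \<bullet> x))) \<and> trig_poly (\<lambda>x. f x * (b * sin (s \<bullet> x)))"
  using assms
proof (induction rule: trig_poly.induct)
  case (cos a t)
  have "(\<lambda>x. a * cos (t \<bullet> x) * (b * cos (s \<bullet> x))) =
      (\<lambda>x. (a * b / 2) * cos ((t - s) \<bullet> x) + (a * b / 2) * cos ((t + s) \<bullet> x))"
    by (auto simp: inner_add_left inner_diff_left cos_add cos_diff field_simps)
  moreover have "(\<lambda>x. a * cos (t \<bullet> x) * (b * sin (s \<bullet> x))) =
      (\<lambda>x. (a * b / 2) * sin ((t + s) \<bullet> x) + (- (a * b / 2)) * sin ((t - s) \<bullet> x))"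
    by (auto simp: inner_add_left inner_diff_left sin_add sin_diff field_simps)
  ultimately show ?case
    by (simp only:) (intro conjI trig_poly.intros)
next
  case (sin a t)
  have "(\<lambda>x. a * sin (t \<bullet> x) * (b * cos (s \<bullet> x))) =
      (\<lambda>x. (a * b / 2) * sin ((t + s) \<bullet> x) + (a * b / 2) * sin ((t - s) \<bullet> x))"
    by (auto simp: inner_add_left inner_diff_left sin_add sin_diff field_simps)
  moreover have "(\<lambda>x. a * sin (t \<bullet> x) * (b * sin (s \<bullet> x))) =
      (\<lambda>x. (a * b / 2) * cos ((t - s) \<bullet> x) + (- (a * b / 2)) * cos ((t + s) \<bullet> x))"
    by (auto simp: inner_add_left inner_diff_left cos_add cos_diff field_simps)
  ultimately show ?case
    by (simp only:) (intro conjI trig_poly.intros)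
next
  case (add f g)
  then show ?case
    by (simp add: distrib_right trig_poly.add)
qed

lemma trig_poly_mult:
  assumes "trig_poly g" "trig_poly f"
  shows "trig_poly (\<lambda>x. f x * g x)"
  using assms(1)
proof (induction rule: trig_poly.induct)
  case (add g1 g2)
  then show ?case
    by (simp add: distrib_left trig_poly.add)
qed (use trig_poly_mult_cos_sin[OF assms(2)] in blast)+

text \<open>The function \<open>h\<close> is replaced by a function on a torus that agrees with it on a ball and
  satisfies the same bound: \<open>2 * arctan (s / (1 + c))\<close> recovers the angle of the point \<open>(c, s)\<close> of the unit
  circle if \<open>c \<ge> 0\<close>, and with the denominator cut off at 1 it is defined and continuous on the
  whole plane. Stone--Weierstrass on the torus then yields trigonometric polynomials.\<close>

lemma trig_poly_approximation:
  fixes h :: "'a::euclidean_space \<Rightarrow> real"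
  assumes h: "continuous_on UNIV h" "\<And>x. \<bar>h x\<bar> \<le> C" and K: "K > 0" and e: "e > 0"
  obtains H p where "trig_poly p" "\<And>x. \<bar>H x - p x\<bar> < e" "\<And>x. \<bar>H x\<bar> \<le> C" "\<And>x. norm x \<le> K \<Longrightarrow> H x = h x"
proof -
  \<comment> \<open>Scales coordinates of size at most \<open>K\<close> to angles in
    \<open>[- pi / 2, pi / 2]\<close>, where the cosine is nonnegative.\<close>
  define w where "w = pi / (2 * K)"
  have w: "w > 0"
    using K by (simp add: w_def)
  define T where "T = {z :: 'a \<times> 'a. \<forall>b\<in>Basis. (fst z \<bullet> b)\<^sup>2 + (snd z \<bullet> b)\<^sup>2 = 1}"
  define E where "E x = (\<Sum>b\<in>Basis. cos (w * (x \<bullet> b)) *\<^sub>R b, \<Sum>b\<in>Basis. sin (w * (x \<bullet> b)) *\<^sub>R b)" for x :: 'a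
  define g where "g z = (\<Sum>b\<in>Basis. (2 / w * arctan ((snd z \<bullet> b) / max 1 (1 + fst z \<bullet> b))) *\<^sub>R b)" for z :: "'a \<times> 'a"
  have E_T: "E x \<in> T" for x
    by (simp add: E_def T_def)
  have E_inner: "fst (E x) \<bullet> b = cos (w * (x \<bullet> b))" "snd (E x) \<bullet> b = sin (w * (x \<bullet> b))" if "b \<in> Basis" for x b
    using that by (simp_all add: E_def)
  have "T = (\<Inter>b\<in>Basis. {z. (fst z \<bullet> b)\<^sup>2 + (snd z \<bullet> b)\<^sup>2 = 1})"
    by (auto simp: T_def)
  moreover have "closed (\<Inter>b\<in>Basis. {z :: 'a \<times> 'a. (fst z \<bullet> b)\<^sup>2 + (snd z \<bullet> b)\<^sup>2 = 1})"
    by (intro closed_INT ballI closed_Collect_eq continuous_intros)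
  ultimately have "closed T"
    by simp
  moreover have "bounded T"
    unfolding bounded_iff
  proof (intro exI ballI)
    fix z assume z: "z \<in> T"
    have b: "\<bar>fst z \<bullet> b\<bar> \<le> 1" "\<bar>snd z \<bullet> b\<bar> \<le> 1" if "b \<in> Basis" for b
    proof -
      have "(fst z \<bullet> b)\<^sup>2 + (snd z \<bullet> b)\<^sup>2 = 1"
        using z that by (auto simp: T_def)
      then have "(fst z \<bullet> b)\<^sup>2 \<le> 1\<^sup>2" "(snd z \<bullet> b)\<^sup>2 \<le> 1\<^sup>2"
        using zero_le_power2[of "fst z \<bullet> b"] zero_le_power2[of "snd z \<bullet> b"] unfolding one_power2 by linarith+
      then show "\<bar>fst z \<bullet> b\<bar> \<le> 1" "\<bar>snd z \<bullet> b\<bar> \<le> 1"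
        by (simp_all only: abs_le_square_iff[symmetric] abs_one)
    qed
    have "norm z \<le> norm (fst z) + norm (snd z)"
      by (metis norm_Pair_le prod.collapse)
    also have "\<dots> \<le> (\<Sum>b\<in>(Basis::'a set). 1) + (\<Sum>b\<in>(Basis::'a set). 1)"
      by (intro add_mono order_trans[OF norm_le_l1] sum_mono b)
    finally show "norm z \<le> (\<Sum>b\<in>(Basis::'a set). 1) + (\<Sum>b\<in>(Basis::'a set). 1)" .
  qed
  ultimately have compact: "compact T"
    by (simp add: compact_eq_bounded_closed)
  have g_cont: "continuous_on S g" for S
  proof -
    have "max 1 (1 + fst z \<bullet> b) \<noteq> 0" for z :: "'a \<times> 'a" and b
      by (simp add: max_def)
    then show ?thesis
      unfolding g_def by (intro continuous_intros) blast
  qed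
  have hg_cont: "continuous_on T (\<lambda>z. h (g z))"
    by (rule continuous_on_compose2[OF h(1) g_cont]) simp
  have gE: "g (E x) = x" if x: "norm x \<le> K" for x
  proof (rule euclidean_eqI)
    fix b :: 'a assume b: "b \<in> Basis"
    define y where "y = w * (x \<bullet> b)"
    have "\<bar>x \<bullet> b\<bar> \<le> K"
      using Basis_le_norm[OF b, of x] x by linarith
    then have "\<bar>y\<bar> \<le> w * K"
      using w by (simp add: y_def abs_mult)
    also have "w * K = pi / 2"
      using K by (simp add: w_def)
    finally have y: "\<bar>y\<bar> \<le> pi / 2" .
    then have "cos y \<ge> 0"
      by (intro cos_ge_zero) auto
    then have "sin y / max 1 (1 + cos y) = sin (2 * (y / 2)) / (cos (2 * (y / 2)) + 1)"
      by (simp add: max_def add.commute)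
    also have "\<dots> = tan (y / 2)"
      by (rule tan_half[symmetric])
    finally have "arctan (sin y / max 1 (1 + cos y)) = arctan (tan (y / 2))"
      by simp
    also have "\<dots> = y / 2"
      using y pi_gt_zero by (intro arctan_tan) linarith+
    finally have "2 / w * arctan (sin y / max 1 (1 + cos y)) = 2 / w * (y / 2)"
      by (rule arg_cong)
    also have "\<dots> = x \<bullet> b"
      using w by (simp add: y_def)
    finally have "2 / w * arctan (sin y / max 1 (1 + cos y)) = x \<bullet> b" .
    then show "g (E x) \<bullet> b = x \<bullet> b"
      using b by (simp add: g_def E_inner y_def)
  qed
  have tp: "trig_poly (\<lambda>x. fst (E x) \<bullet> b)" "trig_poly (\<lambda>x. snd (E x) \<bullet> b)" if b: "b \<in> Basis" for b
    using trig_poly.cos[of 1 "w *\<^sub>R b"] trig_poly.sin[of 1 "w *\<^sub>R b"]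
    by (simp_all add: E_inner[OF b] inner_commute[of b])
  \<comment> \<open>The algebra consists of the continuous functions on the torus whose pullback
    along \<open>E\<close> is a trigonometric polynomial. It separates points through the coordinate
    functions.\<close>
  obtain q where q: "continuous_on T q \<and> trig_poly (\<lambda>x. q (E x))" "\<forall>z\<in>T. \<bar>h (g z) - q z\<bar> < e"
  proof -
    have "\<exists>q. (continuous_on T q \<and> trig_poly (\<lambda>x. q (E x))) \<and> (\<forall>z\<in>T. \<bar>h (g z) - q z\<bar> < e)"
    proof (rule Stone_Weierstrass_HOL[OF compact, where P = "\<lambda>q. continuous_on T q \<and> trig_poly (\<lambda>x. q (E x))"])
      show "\<exists>f. (continuous_on T f \<and> trig_poly (\<lambda>x. f (E x))) \<and> f y \<noteq> f z"
        if yz: "y \<in> T \<and> z \<in> T \<and> y \<noteq> z" for y z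
      proof -
        have "fst y \<noteq> fst z \<or> snd y \<noteq> snd z"
          using yz by (simp add: prod_eq_iff)
        then obtain b where b: "b \<in> Basis" "fst y \<bullet> b \<noteq> fst z \<bullet> b \<or> snd y \<bullet> b \<noteq> snd z \<bullet> b"
          using euclidean_eqI[of "fst y" "fst z"] euclidean_eqI[of "snd y" "snd z"] by blast
        from b(2) show ?thesis
        proof
          assume "fst y \<bullet> b \<noteq> fst z \<bullet> b"
          then show ?thesis
            using tp(1)[OF b(1)] by (intro exI[of _ "\<lambda>z. fst z \<bullet> b"]) (auto intro!: continuous_intros)
        next
          assume "snd y \<bullet> b \<noteq> snd z \<bullet> b"
          then show ?thesis
            using tp(2)[OF b(1)] by (intro exI[of _ "\<lambda>z. snd z \<bullet> b"]) (auto intro!: continuous_intros)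
        qed
      qed
    qed (use hg_cont e in \<open>auto intro: continuous_intros trig_poly_const trig_poly.add trig_poly_mult\<close>)
    then show ?thesis
      using that by blast
  qed
  show ?thesis
    by (rule that[of "\<lambda>x. q (E x)" "\<lambda>x. h (g (E x))"]) (use q E_T h(2) gE in auto)
qed

lemma bounded_continuous_integrable:
  fixes h :: "'a::euclidean_space \<Rightarrow> real"
  assumes "prob_space M" "Y \<in> borel_measurable M" "h \<in> borel_measurable borel" "\<And>x. \<bar>h x\<bar> \<le> C"
  shows "integrable M (\<lambda>\<omega>. h (Y \<omega>))"
proof -
  interpret prob_space M by fact
  show ?thesis
    by (rule integrable_const_bound[where B = C])
      (use assms in \<open>auto intro: measurable_compose[OF assms(2)]\<close>)
qed

lemma expectation_close:
  fixes u v :: "'w \<Rightarrow> real"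
  assumes "prob_space M" "integrable M u" "integrable M v" and A: "A \<in> sets M" "measure M A \<ge> 1 - \<epsilon>"
    and close: "\<And>\<omega>. \<omega> \<in> A \<Longrightarrow> \<bar>u \<omega> - v \<omega>\<bar> \<le> e" and e: "e \<ge> 0"
    and bd: "\<And>\<omega>. \<bar>u \<omega>\<bar> \<le> C" "\<And>\<omega>. \<bar>v \<omega>\<bar> \<le> C"
  shows "\<bar>(\<integral>\<omega>. u \<omega> \<partial>M) - (\<integral>\<omega>. v \<omega> \<partial>M)\<bar> \<le> e + 2 * C * \<epsilon>"
proof -
  interpret prob_space M by fact
  have C: "0 \<le> C"
    using bd(1) abs_ge_zero order_trans by blast
  have "\<bar>(\<integral>\<omega>. u \<omega> \<partial>M) - (\<integral>\<omega>. v \<omega> \<partial>M)\<bar> = \<bar>\<integral>\<omega>. u \<omega> - v \<omega> \<partial>M\<bar>"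
    using assms by simp
  also have "\<dots> \<le> (\<integral>\<omega>. \<bar>u \<omega> - v \<omega>\<bar> \<partial>M)"
    by (rule integral_abs_bound)
  also have "\<dots> \<le> (\<integral>\<omega>. e + 2 * C * indicator (space M - A) \<omega> \<partial>M)"
  proof (rule integral_mono)
    fix \<omega> assume "\<omega> \<in> space M"
    then show "\<bar>u \<omega> - v \<omega>\<bar> \<le> e + 2 * C * indicator (space M - A) \<omega>"
      using close[of \<omega>] bd[of \<omega>] e by (cases "\<omega> \<in> A") (auto simp: indicator_def)
  qed (use assms A in \<open>auto simp: emeasure_eq_measure\<close>)
  also have "\<dots> = e + 2 * C * prob (space M - A)"
    using A by (simp add: prob_space emeasure_eq_measure)
  also have "\<dots> \<le> e + 2 * C * \<epsilon>"
    using A C by (intro add_left_mono mult_left_mono) (auto simp: prob_compl)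
  finally show ?thesis .
qed

lemma prob_space_tight:
  fixes W :: "'z \<Rightarrow> 'a::euclidean_space"
  assumes "prob_space N" "W \<in> borel_measurable N" and e: "\<epsilon> > 0"
  obtains K where "K > 0" "measure N {\<omega> \<in> space N. norm (W \<omega>) \<le> K} \<ge> 1 - \<epsilon>"
proof -
  interpret prob_space N by fact
  define A where "A k = {\<omega> \<in> space N. norm (W \<omega>) \<le> real k}" for k
  have A: "A k \<in> events" for k
    unfolding A_def using assms(2) by measurable
  have "(\<lambda>k. prob (A k)) \<longlonglongrightarrow> prob (\<Union>k. A k)"
    by (rule finite_Lim_measure_incseq) (use A in \<open>auto simp: incseq_def A_def\<close>)
  moreover have "(\<Union>k. A k) = space N"
    by (auto simp: A_def real_arch_simple)
  ultimately have "(\<lambda>k. prob (A k)) \<longlonglongrightarrow> 1"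
    by (simp add: prob_space)
  from order_tendstoD(1)[OF this, of "1 - \<epsilon>"] e
  have "\<forall>\<^sub>F k in sequentially. 1 - \<epsilon> < prob (A k)"
    by simp
  then have "\<forall>\<^sub>F k in sequentially. 1 - \<epsilon> < prob (A k) \<and> k \<ge> 1"
    using eventually_ge_at_top[of "1::nat"] by (rule eventually_conj)
  then obtain k where "1 - \<epsilon> < prob (A k)" "k \<ge> 1"
    using eventually_happens'[OF sequentially_bot] by blast
  then show ?thesis
    by (intro that[of "real k"]) (auto simp: A_def)
qed

lemma trig_poly_bounded_continuous:
  fixes p :: "'a::euclidean_space \<Rightarrow> real"
  assumes "trig_poly p"
  shows "continuous_on UNIV p \<and> (\<exists>C. \<forall>x. \<bar>p x\<bar> \<le> C)"
  using assms
proof (induction rule: trig_poly.induct)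
  case (cos a t)
  have "\<bar>a * cos (t \<bullet> x)\<bar> \<le> \<bar>a\<bar>" for x
    by (simp add: abs_mult mult_left_le)
  then show ?case
    by (auto intro!: continuous_intros)
next
  case (sin a t)
  have "\<bar>a * sin (t \<bullet> x)\<bar> \<le> \<bar>a\<bar>" for x
    by (simp add: abs_mult mult_left_le)
  then show ?case
    by (auto intro!: continuous_intros)
next
  case (add f g)
  then obtain C D where "\<And>x. \<bar>f x\<bar> \<le> C" "\<And>x. \<bar>g x\<bar> \<le> D"
    by blast
  then have "\<bar>f x + g x\<bar> \<le> C + D" for x
    by (meson abs_triangle_ineq add_mono order_trans)
  then show ?case
    using add by (auto intro!: continuous_intros)
qed

text \<open>On a large ball the test function is close to a trigonometric polynomial. Outside, where
  the approximation fails, the polynomial is still at most \<open>C + \<epsilon>\<close>, and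
  tightness makes this contribution small.\<close>

theorem converges_in_distribution_trigI:
  fixes Y :: "nat \<Rightarrow> 'w \<Rightarrow> 'a::euclidean_space"
  assumes M: "prob_space M" and N: "prob_space N"
    and Y: "\<And>n. Y n \<in> borel_measurable M" and W: "W \<in> borel_measurable N"
    and tight: "\<And>\<epsilon>. \<epsilon> > 0 \<Longrightarrow> \<exists>K. \<forall>\<^sub>F n in sequentially. \<exists>A\<in>sets M. measure M A \<le> \<epsilon> \<and> (\<forall>\<omega>\<in>space M - A. norm (Y n \<omega>) \<le> K)"
    and cos: "\<And>t. (\<lambda>n. \<integral>\<omega>. cos (t \<bullet> Y n \<omega>) \<partial>M) \<longlonglongrightarrow> (\<integral>\<omega>. cos (t \<bullet> W \<omega>) \<partial>N)"
    and sin: "\<And>t. (\<lambda>n. \<integral>\<omega>. sin (t \<bullet> Y n \<omega>) \<partial>M) \<longlonglongrightarrow> (\<integral>\<omega>. sin (t \<bullet> W \<omega>) \<partial>N)"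
  shows "converges_in_distribution M Y N W"
  unfolding converges_in_distribution_def
proof (intro conjI allI impI Y W, elim conjE)
  interpret M: prob_space M by fact
  interpret N: prob_space N by fact
  fix h :: "'a \<Rightarrow> real" assume h: "continuous_on UNIV h" "bounded (range h)"
  obtain C where C: "C > 0" "\<And>x. \<bar>h x\<bar> \<le> C"
    using h(2) unfolding bounded_pos by auto
  have tp: "(\<lambda>n. \<integral>\<omega>. p (Y n \<omega>) \<partial>M) \<longlonglongrightarrow> (\<integral>\<omega>. p (W \<omega>) \<partial>N)" if "trig_poly p" for p
    using that
  proof (induction rule: trig_poly.induct)
    case (cos a t)
    then show ?case
      using tendsto_mult_left[OF assms(6)[of t], of a] by simp
  next
    case (sin a t)
    then show ?case
      using tendsto_mult_left[OF assms(7)[of t], of a] by simp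
  next
    case (add f g)
    obtain Cf Cg where Cf: "\<And>x. \<bar>f x\<bar> \<le> Cf" "f \<in> borel_measurable borel" and Cg: "\<And>x. \<bar>g x\<bar> \<le> Cg" "g \<in> borel_measurable borel"
      using trig_poly_bounded_continuous[OF add.hyps(1)] trig_poly_bounded_continuous[OF add.hyps(2)]
      by (meson borel_measurable_continuous_onI)
    note i = bounded_continuous_integrable[OF M Y Cf(2,1)] bounded_continuous_integrable[OF M Y Cg(2,1)]
      bounded_continuous_integrable[OF N W Cf(2,1)] bounded_continuous_integrable[OF N W Cg(2,1)]
    show ?case
      using tendsto_add[OF add.IH] i by simp
  qed
  show "(\<lambda>n. \<integral>\<omega>. h (Y n \<omega>) \<partial>M) \<longlonglongrightarrow> (\<integral>\<omega>. h (W \<omega>) \<partial>N)"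
  proof (rule tendstoI)
    fix e :: real assume e: "e > 0"
    \<comment> \<open>Since \<open>\<epsilon> \<le> 1\<close>, the total error
      \<open>3 * \<epsilon> + 4 * (C + \<epsilon>) * \<epsilon>\<close> is at most
      \<open>(8 * C + 8) * \<epsilon>\<close>.\<close>
    define \<epsilon> where "\<epsilon> = min 1 (e / (8 * C + 8))"
    have eps: "\<epsilon> > 0" "\<epsilon> \<le> 1" "(8 * C + 8) * \<epsilon> \<le> e"
    proof -
      have C8: "8 * C + 8 > 0"
        using C by simp
      then show "\<epsilon> > 0" "\<epsilon> \<le> 1"
        using e by (simp_all add: \<epsilon>_def)
      have "\<epsilon> \<le> e / (8 * C + 8)"
        by (simp add: \<epsilon>_def)
      then show "(8 * C + 8) * \<epsilon> \<le> e"
        using C8 by (simp add: pos_le_divide_eq mult.commute)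
    qed
    obtain K1 where K1: "\<forall>\<^sub>F n in sequentially. \<exists>A\<in>sets M. measure M A \<le> \<epsilon> \<and> (\<forall>\<omega>\<in>space M - A. norm (Y n \<omega>) \<le> K1)"
      using tight[OF eps(1)] by blast
    obtain K2 where K2: "K2 > 0" "measure N {\<omega> \<in> space N. norm (W \<omega>) \<le> K2} \<ge> 1 - \<epsilon>"
      using prob_space_tight[OF N W eps(1)] by blast
    define K where "K = max K1 K2"
    obtain H p where p: "trig_poly p" "\<And>x. \<bar>H x - p x\<bar> < \<epsilon>" "\<And>x. norm x \<le> K \<Longrightarrow> H x = h x" "\<And>x. \<bar>H x\<bar> \<le> C"
      using trig_poly_approximation[OF h(1) C(2), of K \<epsilon>] eps(1) K2(1) by (metis K_def max.strict_coboundedI2)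
    have hm: "h \<in> borel_measurable borel"
      by (rule borel_measurable_continuous_onI[OF h(1)])
    have pC: "\<bar>p x\<bar> \<le> C + \<epsilon>" for x
      using p(2)[of x] p(4)[of x] by linarith
    have pm: "p \<in> borel_measurable borel"
      using trig_poly_bounded_continuous[OF p(1)] by (auto intro: borel_measurable_continuous_onI)
    have hp: "\<bar>h x - p x\<bar> \<le> \<epsilon>" if "norm x \<le> K" for x
      using p(2)[of x] p(3)[OF that] by simp
    have hC: "\<bar>h x\<bar> \<le> C + \<epsilon>" for x
      using C(2)[of x] eps(1) by linarith
    have WN: "\<bar>(\<integral>\<omega>. h (W \<omega>) \<partial>N) - (\<integral>\<omega>. p (W \<omega>) \<partial>N)\<bar> \<le> \<epsilon> + 2 * (C + \<epsilon>) * \<epsilon>"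
    proof (rule expectation_close[OF N _ _ _ K2(2)])
      show "{\<omega> \<in> space N. norm (W \<omega>) \<le> K2} \<in> N.events"
        using W by measurable
      show "\<bar>h (W \<omega>) - p (W \<omega>)\<bar> \<le> \<epsilon>" if "\<omega> \<in> {\<omega> \<in> space N. norm (W \<omega>) \<le> K2}" for \<omega>
        using that by (intro hp) (auto simp: K_def)
    qed (use bounded_continuous_integrable[OF N W hm C(2)] bounded_continuous_integrable[OF N W pm pC] hC pC eps in auto)
    show "\<forall>\<^sub>F n in sequentially. dist (\<integral>\<omega>. h (Y n \<omega>) \<partial>M) (\<integral>\<omega>. h (W \<omega>) \<partial>N) < e"
      using K1 tendstoD[OF tp[OF p(1)] eps(1)]
    proof eventually_elim
      case (elim n)
      then obtain A where A: "A \<in> M.events" "measure M A \<le> \<epsilon>" "\<forall>\<omega>\<in>space M - A. norm (Y n \<omega>) \<le> K1"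
        by blast
      have "\<bar>(\<integral>\<omega>. h (Y n \<omega>) \<partial>M) - (\<integral>\<omega>. p (Y n \<omega>) \<partial>M)\<bar> \<le> \<epsilon> + 2 * (C + \<epsilon>) * \<epsilon>"
      proof (rule expectation_close[OF M, where A = "space M - A"])
        show "1 - \<epsilon> \<le> measure M (space M - A)"
          using A by (simp add: M.prob_compl)
        show "\<bar>h (Y n \<omega>) - p (Y n \<omega>)\<bar> \<le> \<epsilon>" if "\<omega> \<in> space M - A" for \<omega>
          using A(3)[rule_format, OF that] by (intro hp) (simp add: K_def)
      qed (use bounded_continuous_integrable[OF M Y hm C(2)] bounded_continuous_integrable[OF M Y pm pC] hC pC eps A in auto)
      then have "\<bar>(\<integral>\<omega>. h (Y n \<omega>) \<partial>M) - (\<integral>\<omega>. h (W \<omega>) \<partial>N)\<bar> < 3 * \<epsilon> + 4 * (C + \<epsilon>) * \<epsilon>"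
        using WN elim(2) unfolding dist_real_def by linarith
      moreover have "4 * (C + \<epsilon>) * \<epsilon> \<le> 4 * (C + 1) * \<epsilon>"
        using eps by (intro mult_right_mono) auto
      moreover have "4 * (C + 1) * \<epsilon> + 3 * \<epsilon> \<le> (8 * C + 8) * \<epsilon>"
        using eps C by (simp add: algebra_simps)
      ultimately show ?case
        using eps(3) unfolding dist_real_def by linarith
    qed
  qed
qed


lemma converges_in_distribution_compose:
  assumes "converges_in_distribution M Y N W" "continuous_on UNIV g"
  shows "converges_in_distribution M (\<lambda>n \<omega>. g (Y n \<omega>)) N (\<lambda>\<omega>. g (W \<omega>))"
proof -
  have g: "g \<in> borel_measurable borel"
    by (rule borel_measurable_continuous_onI[OF assms(2)])
  show ?thesis
    unfolding converges_in_distribution_def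
  proof (intro conjI allI impI, goal_cases)
    case (1 n)
    then show ?case
      using assms(1) measurable_compose[OF _ g] by (auto simp: converges_in_distribution_def)
  next
    case 2
    then show ?case
      using assms(1) measurable_compose[OF _ g] by (auto simp: converges_in_distribution_def)
  next
    case (3 h)
    have "continuous_on UNIV (\<lambda>x. h (g x))"
      using 3 assms(2) by (auto intro: continuous_on_compose2)
    moreover have "bounded (range (\<lambda>x. h (g x)))"
      by (rule bounded_subset[of "range h"]) (use 3 in auto)
    ultimately show ?case
      using assms(1) unfolding converges_in_distribution_def by blast
  qed
qed

text \<open>The limit law is tight. A continuous cutoff \<open>k\<close>, zero on the ball of radius
  \<open>K\<close> and one outside radius \<open>K + 1\<close>, transfers this to the
  sequence.\<close>

lemma converges_in_distribution_tight:
  fixes Y :: "nat \<Rightarrow> 'w \<Rightarrow> 'a::euclidean_space"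
  assumes M: "prob_space M" and N: "prob_space N" and conv: "converges_in_distribution M Y N W" and e: "\<epsilon> > 0"
  obtains K where "K > 0"
    "\<forall>\<^sub>F n in sequentially. measure M {\<omega> \<in> space M. norm (Y n \<omega>) \<le> K} \<ge> 1 - \<epsilon>"
proof -
  interpret M: prob_space M by fact
  interpret N: prob_space N by fact
  have Y: "Y n \<in> borel_measurable M" and W: "W \<in> borel_measurable N" for n
    using conv by (auto simp: converges_in_distribution_def)
  obtain K where K: "K > 0" "measure N {\<omega> \<in> space N. norm (W \<omega>) \<le> K} \<ge> 1 - \<epsilon> / 4"
    using prob_space_tight[OF N W, of "\<epsilon> / 4"] e by auto
  define k where "k x = min 1 (max 0 (norm x - K))" for x :: 'a
  have k: "continuous_on UNIV k" "\<And>x. \<bar>k x\<bar> \<le> 1" "\<And>x. 0 \<le> k x"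
    unfolding k_def by (auto intro!: continuous_intros)
  have kb: "bounded (range k)"
    using k(2) by (auto simp: bounded_iff)
  have km: "k \<in> borel_measurable borel"
    by (rule borel_measurable_continuous_onI[OF k(1)])
  have "\<bar>(\<integral>\<omega>. k (W \<omega>) \<partial>N) - (\<integral>\<omega>. 0 \<partial>N)\<bar> \<le> 0 + 2 * 1 * (\<epsilon> / 4)"
  proof (rule expectation_close[OF N _ _ _ K(2)])
    show "{\<omega> \<in> space N. norm (W \<omega>) \<le> K} \<in> N.events"
      using W by measurable
  qed (use bounded_continuous_integrable[OF N W km k(2)] k(2) in \<open>auto simp: k_def\<close>)
  then have "(\<integral>\<omega>. k (W \<omega>) \<partial>N) < \<epsilon>"
    using e by simp
  moreover have "(\<lambda>n. \<integral>\<omega>. k (Y n \<omega>) \<partial>M) \<longlonglongrightarrow> (\<integral>\<omega>. k (W \<omega>) \<partial>N)"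
    using conv k kb unfolding converges_in_distribution_def by blast
  ultimately have ev: "\<forall>\<^sub>F n in sequentially. (\<integral>\<omega>. k (Y n \<omega>) \<partial>M) < \<epsilon>"
    by (intro order_tendstoD(2))
  show ?thesis
  proof (rule that[of "K + 1"])
    show "\<forall>\<^sub>F n in sequentially. measure M {\<omega> \<in> space M. norm (Y n \<omega>) \<le> K + 1} \<ge> 1 - \<epsilon>"
      using ev
    proof eventually_elim
      case (elim n)
      have A: "{\<omega> \<in> space M. norm (Y n \<omega>) \<le> K + 1} \<in> M.events"
        using Y[of n] by measurable
      have "measure M (space M - {\<omega> \<in> space M. norm (Y n \<omega>) \<le> K + 1}) =
          (\<integral>\<omega>. indicator (space M - {\<omega> \<in> space M. norm (Y n \<omega>) \<le> K + 1}) \<omega> \<partial>M)"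
        using A by simp
      also have "\<dots> \<le> (\<integral>\<omega>. k (Y n \<omega>) \<partial>M)"
      proof (rule integral_mono)
        fix \<omega> assume "\<omega> \<in> space M"
        then show "indicator (space M - {\<omega> \<in> space M. norm (Y n \<omega>) \<le> K + 1}) \<omega> \<le> k (Y n \<omega>)"
          using k(3)[of "Y n \<omega>"] by (auto simp: indicator_def k_def)
      qed (use bounded_continuous_integrable[OF M Y km k(2)] A in \<open>auto simp: M.emeasure_eq_measure\<close>)
      finally show ?case
        using elim M.prob_compl[OF A] by linarith
    qed
  qed (use K in auto)
qed

text \<open>Slutsky's lemma. Test functions are merely continuous, so tightness first confines the
  argument to a ball, where they are uniformly continuous. Closeness is required on measurable
  subsets, which is the form that \<open>whp\<close> provides.\<close>

theorem converges_in_distribution_close: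
  fixes Y Y' :: "nat \<Rightarrow> 'w \<Rightarrow> 'a::euclidean_space"
  assumes M: "prob_space M" and N: "prob_space N" and conv: "converges_in_distribution M Y N W"
    and Y': "\<And>n. Y' n \<in> borel_measurable M"
    and close: "\<And>\<eta> \<epsilon>. \<lbrakk>\<eta> > 0; \<epsilon> > 0\<rbrakk> \<Longrightarrow>
      \<forall>\<^sub>F n in sequentially. \<exists>A\<in>sets M. measure M A \<ge> 1 - \<epsilon> \<and> (\<forall>\<omega>\<in>A. norm (Y' n \<omega> - Y n \<omega>) \<le> \<eta>)"
  shows "converges_in_distribution M Y' N W"
proof -
  interpret M: prob_space M by fact
  have Y: "Y n \<in> borel_measurable M" and W: "W \<in> borel_measurable N" for n
    using conv by (auto simp: converges_in_distribution_def)
  have "(\<lambda>n. \<integral>\<omega>. h (Y' n \<omega>) \<partial>M) \<longlonglongrightarrow> (\<integral>\<omega>. h (W \<omega>) \<partial>N)"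
    if h: "continuous_on UNIV h" "bounded (range h)" for h :: "'a \<Rightarrow> real"
  proof -
  obtain C where C: "C > 0" "\<And>x. \<bar>h x\<bar> \<le> C"
    using h(2) unfolding bounded_pos by auto
  have hm: "h \<in> borel_measurable borel"
    by (rule borel_measurable_continuous_onI[OF h(1)])
  have lim: "(\<lambda>n. \<integral>\<omega>. h (Y n \<omega>) \<partial>M) \<longlonglongrightarrow> (\<integral>\<omega>. h (W \<omega>) \<partial>N)"
    using conv h unfolding converges_in_distribution_def by blast
  have "(\<lambda>n. (\<integral>\<omega>. h (Y' n \<omega>) \<partial>M) - (\<integral>\<omega>. h (Y n \<omega>) \<partial>M)) \<longlonglongrightarrow> 0"
  proof (rule tendstoI)
    fix e :: real assume e: "e > 0"
    define \<epsilon> where "\<epsilon> = e / (8 * C)"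
    have eps: "\<epsilon> > 0" "2 * C * (2 * \<epsilon>) = e / 2"
      using e C by (simp_all add: \<epsilon>_def)
    obtain K where K: "K > 0" "\<forall>\<^sub>F n in sequentially. measure M {\<omega> \<in> space M. norm (Y n \<omega>) \<le> K} \<ge> 1 - \<epsilon>"
      using converges_in_distribution_tight[OF M N conv eps(1)] by blast
    have "uniformly_continuous_on (cball 0 (K + 1)) h"
      by (rule compact_uniformly_continuous[OF continuous_on_subset[OF h(1)]]) auto
    moreover have "e / 4 > 0"
      using e by simp
    ultimately obtain d where d0: "d > 0"
      "\<forall>x\<in>cball 0 (K + 1). \<forall>y\<in>cball 0 (K + 1). dist y x < d \<longrightarrow> dist (h y) (h x) < e / 4"
      unfolding uniformly_continuous_on_def by blast
    have d: "\<bar>h y - h x\<bar> < e / 4" if "norm x \<le> K + 1" "norm y \<le> K + 1" "norm (y - x) < d" for x y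
      using d0 that by (simp_all add: dist_norm)
    define \<eta> where "\<eta> = min 1 (d / 2)"
    have eta: "\<eta> > 0" "\<eta> \<le> 1" "\<eta> < d"
      using d0(1) by (auto simp: \<eta>_def)
    show "\<forall>\<^sub>F n in sequentially. dist ((\<integral>\<omega>. h (Y' n \<omega>) \<partial>M) - (\<integral>\<omega>. h (Y n \<omega>) \<partial>M)) 0 < e"
      using K(2) close[OF eta(1) eps(1)]
    proof eventually_elim
      case (elim n)
      then obtain A where A: "A \<in> M.events" "measure M A \<ge> 1 - \<epsilon>" "\<forall>\<omega>\<in>A. norm (Y' n \<omega> - Y n \<omega>) \<le> \<eta>"
        by blast
      define B where "B = {\<omega> \<in> space M. norm (Y n \<omega>) \<le> K}"
      have B: "B \<in> M.events"
        unfolding B_def using Y[of n] by measurable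
      have "measure M (A \<union> B) = measure M A + measure M B - measure M (A \<inter> B)"
        using A B by (intro measure_Un3) (auto simp: M.fmeasurable_eq_sets)
      moreover have "measure M (A \<union> B) \<le> 1"
        by simp
      ultimately have AB: "1 - 2 * \<epsilon> \<le> measure M (A \<inter> B)"
        using A(2) elim(1) unfolding B_def[symmetric] by linarith
      have "\<bar>(\<integral>\<omega>. h (Y' n \<omega>) \<partial>M) - (\<integral>\<omega>. h (Y n \<omega>) \<partial>M)\<bar> \<le> e / 4 + 2 * C * (2 * \<epsilon>)"
      proof (rule expectation_close[OF M _ _ _ AB])
        fix \<omega> assume om: "\<omega> \<in> A \<inter> B"
        have 1: "norm (Y' n \<omega> - Y n \<omega>) \<le> \<eta>" and 2: "norm (Y n \<omega>) \<le> K"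
          using om A(3) by (auto simp: B_def)
        have "norm (Y' n \<omega>) \<le> norm (Y n \<omega>) + norm (Y' n \<omega> - Y n \<omega>)"
          by (metis add.commute diff_add_cancel norm_triangle_ineq)
        then show "\<bar>h (Y' n \<omega>) - h (Y n \<omega>)\<bar> \<le> e / 4"
          using 1 2 eta by (intro less_imp_le[OF d]) auto
      qed (use bounded_continuous_integrable[OF M Y hm C(2)] bounded_continuous_integrable[OF M Y' hm C(2)] A B C e in auto)
      then show ?case
        using eps(2) e by (simp add: dist_real_def)
    qed
  qed
  from tendsto_add[OF this lim] show ?thesis
    by simp
  qed
  then show ?thesis
    using Y' W by (simp add: converges_in_distribution_def)
qed

lemma converges_in_distribution_const:
  fixes w :: "'a::euclidean_space"
  shows "converges_in_distribution M (\<lambda>n \<omega>. w) M (\<lambda>\<omega>. w)"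
  by (simp add: converges_in_distribution_def)

text \<open>The defining limit is joint in step and direction, so one neighbourhood serves all
  nearby directions. Letting the step tend to 0 with the direction fixed passes the bound on to the
  derivative, which makes it continuous.\<close>

lemma hadamard_continuous:
  fixes F :: "'a::real_normed_vector \<Rightarrow> 'b::real_normed_vector"
  assumes "has_hadamard_deriv F x F'" and e: "e > 0"
  obtains s r where "s > 0" "r > 0"
    "\<And>t w'. \<lbrakk>0 < t; t < s; norm (w' - w) < r\<rbrakk> \<Longrightarrow> norm ((F (x + t *\<^sub>R w') - F x) /\<^sub>R t - F' w) < e"
    "\<And>w'. norm (w' - w) < r \<Longrightarrow> norm (F' w' - F' w) \<le> e"
proof -
  have "\<forall>\<^sub>F p in at_right 0 \<times>\<^sub>F nhds w. dist ((\<lambda>(t, w'). (F (x + t *\<^sub>R w') - F x) /\<^sub>R t) p) (F' w) < e"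
    using assms by (auto simp: has_hadamard_deriv_def tendsto_iff)
  then obtain Pt Pw where P: "eventually Pt (at_right 0)" "eventually Pw (nhds w)"
    "\<And>t w'. Pt t \<Longrightarrow> Pw w' \<Longrightarrow> dist ((F (x + t *\<^sub>R w') - F x) /\<^sub>R t) (F' w) < e"
    unfolding eventually_prod_filter by auto
  obtain s where s: "s > 0" "\<And>t. 0 < t \<Longrightarrow> t < s \<Longrightarrow> Pt t"
    using P(1) unfolding eventually_at_right_field by auto
  obtain r where r: "r > 0" "\<And>w'. norm (w' - w) < r \<Longrightarrow> Pw w'"
    using P(2) unfolding eventually_nhds_metric dist_norm by auto
  have 1: "norm ((F (x + t *\<^sub>R w') - F x) /\<^sub>R t - F' w) < e" if "0 < t" "t < s" "norm (w' - w) < r" for t w'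
    using P(3)[OF s(2)[OF that(1,2)] r(2)[OF that(3)]] by (simp add: dist_norm)
  show ?thesis
  proof (rule that[OF s(1) r(1) 1])
    fix w' assume w': "norm (w' - w) < r"
    have "filterlim (\<lambda>t::real. (t, w')) (at_right 0 \<times>\<^sub>F nhds w') (at_right 0)"
      by (intro filterlim_Pair filterlim_ident) (simp add: filterlim_iff eventually_nhds_x_imp_x)
    moreover have "((\<lambda>(t, w'). (F (x + t *\<^sub>R w') - F x) /\<^sub>R t) \<longlongrightarrow> F' w') (at_right 0 \<times>\<^sub>F nhds w')"
      using assms(1) by (simp add: has_hadamard_deriv_def)
    ultimately have "((\<lambda>t. (F (x + t *\<^sub>R w') - F x) /\<^sub>R t) \<longlongrightarrow> F' w') (at_right 0)"
      using filterlim_compose by fastforce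
    then have "((\<lambda>t. norm ((F (x + t *\<^sub>R w') - F x) /\<^sub>R t - F' w)) \<longlongrightarrow> norm (F' w' - F' w)) (at_right 0)"
      by (intro tendsto_intros)
    moreover have "\<forall>\<^sub>F t in at_right 0. norm ((F (x + t *\<^sub>R w') - F x) /\<^sub>R t - F' w) \<le> e"
      unfolding eventually_at_right_field using 1 w' s(1) by (intro exI[of _ s]) (auto intro: less_imp_le)
    ultimately show "norm (F' w' - F' w) \<le> e"
      by (rule tendsto_upperbound) simp
  qed
qed

lemma hadamard_deriv_continuous_on:
  assumes "has_hadamard_deriv F x F'"
  shows "continuous_on UNIV F'"
  unfolding continuous_on_iff
proof (intro ballI allI impI)
  fix w and e :: real assume "e > 0"
  then have "e / 2 > 0" by simp
  obtain r where "r > 0" "\<And>w'. norm (w' - w) < r \<Longrightarrow> norm (F' w' - F' w) \<le> e / 2"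
    using hadamard_continuous[OF assms \<open>e / 2 > 0\<close>, of w] by metis
  then show "\<exists>d>0. \<forall>w'\<in>UNIV. dist w' w < d \<longrightarrow> dist (F' w') (F' w) < e"
    using \<open>e > 0\<close> by (intro exI[of _ r]) (fastforce simp: dist_norm)
qed

text \<open>Compactness of the ball turns the local bounds into one threshold for the step. Random
  directions that are bounded in probability can then be inserted.\<close>

lemma hadamard_uniform:
  fixes F :: "'a::euclidean_space \<Rightarrow> 'b::real_normed_vector"
  assumes "has_hadamard_deriv F x F'" and e: "e > 0"
  obtains s where "s > 0"
    "\<And>t w. \<lbrakk>0 < t; t < s; norm w \<le> K\<rbrakk> \<Longrightarrow> norm ((F (x + t *\<^sub>R w) - F x) /\<^sub>R t - F' w) \<le> e"
proof -
  have "e / 2 > 0"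
    using e by simp
  have "\<forall>w. \<exists>s r. s > 0 \<and> r > 0 \<and>
    (\<forall>t w'. 0 < t \<longrightarrow> t < s \<longrightarrow> norm (w' - w) < r \<longrightarrow> norm ((F (x + t *\<^sub>R w') - F x) /\<^sub>R t - F' w) < e / 2) \<and>
    (\<forall>w'. norm (w' - w) < r \<longrightarrow> norm (F' w' - F' w) \<le> e / 2)"
    using hadamard_continuous[OF assms(1) \<open>e / 2 > 0\<close>] by metis
  then obtain s r where sr: "\<And>w. s w > 0" "\<And>w. r w > 0"
    "\<And>w t w'. \<lbrakk>0 < t; t < s w; norm (w' - w) < r w\<rbrakk> \<Longrightarrow> norm ((F (x + t *\<^sub>R w') - F x) /\<^sub>R t - F' w) < e / 2"
    "\<And>w w'. norm (w' - w) < r w \<Longrightarrow> norm (F' w' - F' w) \<le> e / 2"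
    by metis
  obtain J where J: "J \<subseteq> cball 0 K" "finite J" "cball 0 K \<subseteq> (\<Union>w\<in>J. ball w (r w))"
    by (rule compactE_image[OF compact_cball[of "0::'a" K], of "cball 0 K" "\<lambda>w. ball w (r w)"]) (use sr(2) in auto)
  define s0 where "s0 = Min (insert 1 (s ` J))"
  have s0: "s0 > 0" "\<And>w. w \<in> J \<Longrightarrow> s0 \<le> s w"
    using J sr(1) by (auto simp: s0_def)
  show ?thesis
  proof (rule that[OF s0(1)])
    fix t :: real and w :: 'a assume t: "0 < t" "t < s0" and w: "norm w \<le> K"
    then obtain j where j: "j \<in> J" "norm (w - j) < r j"
      using J(3) unfolding subset_iff mem_cball UN_iff mem_ball dist_norm by (metis diff_zero norm_minus_commute)
    have "norm ((F (x + t *\<^sub>R w) - F x) /\<^sub>R t - F' j) < e / 2"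
      using sr(3)[OF t(1) _ j(2)] s0(2)[OF j(1)] t(2) by simp
    moreover have "norm (F' w - F' j) \<le> e / 2"
      by (rule sr(4)[OF j(2)])
    moreover have "norm ((F (x + t *\<^sub>R w) - F x) /\<^sub>R t - F' w)
        \<le> norm ((F (x + t *\<^sub>R w) - F x) /\<^sub>R t - F' j) + norm (F' w - F' j)"
      using norm_triangle_ineq4[of "(F (x + t *\<^sub>R w) - F x) /\<^sub>R t - F' j" "F' w - F' j"] by simp
    ultimately show "norm ((F (x + t *\<^sub>R w) - F x) /\<^sub>R t - F' w) \<le> e"
      by linarith
  qed
qed

text \<open>The sample is indexed from 1, the sequence in the central limit theorem from 0.\<close>

lemma (in prob_space) indep_vars_Suc:
  assumes "indep_vars N X {1..}"
  shows "indep_vars (\<lambda>i. N (Suc i)) (\<lambda>i. X (Suc i)) UNIV"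
  unfolding indep_vars_def indep_sets_def
proof (intro conjI ballI allI impI)
  let ?G = "\<lambda>i. sigma_sets (space M) {X i -` A \<inter> space M |A. A \<in> sets (N i)}"
  have rv: "random_variable (N i) (X i)" if "i \<ge> 1" for i
    using assms that by (auto simp: indep_vars_def)
  have ind: "indep_sets ?G {1..}"
    using assms by (simp add: indep_vars_def)
  show "random_variable (N (Suc i)) (X (Suc i))" for i
    by (rule rv) simp
  show "?G (Suc i) \<subseteq> events" for i
    using ind by (auto simp: indep_sets_def)
  fix J :: "nat set" and A assume J: "J \<noteq> {}" "finite J" and A: "A \<in> (\<Pi> j\<in>J. ?G (Suc j))"
  define A' where "A' i = A (i - 1)" for i
  have "prob (\<Inter>j\<in>Suc ` J. A' j) = (\<Prod>j\<in>Suc ` J. prob (A' j))"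
    by (rule indep_setsD[OF ind]) (use J A in \<open>auto simp: A'_def\<close>)
  then show "prob (\<Inter>j\<in>J. A j) = (\<Prod>j\<in>J. prob (A j))"
    by (simp add: A'_def prod.reindex)
qed

section \<open>Limit laws of the estimator\<close>

text \<open>The central limit theorem for one projection. A general bounded continuous
  \<open>k\<close> covers cosine and sine, the two parts of the characteristic function.\<close>

lemma (in loss_model) grad_dev_functional_clt:
  fixes Z :: "'z \<Rightarrow> 'p" and k :: "real \<Rightarrow> real"
  assumes N: "prob_space N" and Z: "Z \<in> borel_measurable N"
    and law: "distr N borel (\<lambda>\<omega>. t \<bullet> Z \<omega>) = normal_law 0 (\<integral>x. (t \<bullet> (G\<^sub>0 x - (\<integral>y. G\<^sub>0 y \<partial>P)))\<^sup>2 \<partial>P)"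
    and k: "\<And>x. isCont k x" "\<And>x. \<bar>k x\<bar> \<le> C"
  shows "(\<lambda>n. \<integral>\<omega>. k (t \<bullet> (sqrt (real n) *\<^sub>R grad_dev n \<omega>)) \<partial>M) \<longlonglongrightarrow> (\<integral>\<omega>. k (t \<bullet> Z \<omega>) \<partial>N)"
proof -
  interpret N: prob_space N by fact
  define g where "g x = t \<bullet> (G\<^sub>0 x - (\<integral>y. G\<^sub>0 y \<partial>P))" for x
  define v where "v = (\<integral>x. (g x)\<^sup>2 \<partial>P)"
  have km: "k \<in> borel_measurable borel"
    using k(1) by (intro borel_measurable_continuous_onI continuous_at_imp_continuous_on) auto
  have gm: "g \<in> borel_measurable P"
    unfolding g_def[abs_def] using G0_measurable by measurable
  have gi: "integrable P g"
    unfolding g_def using G0_integrable by (intro integrable_inner_right Bochner_Integration.integrable_diff) auto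
  have g0: "(\<integral>x. g x \<partial>P) = 0"
    unfolding g_def using G0_integrable by (simp add: P.prob_space)
  have g2: "integrable P (\<lambda>x. (g x)\<^sup>2)"
  proof -
    define b where "b = (\<integral>y. G\<^sub>0 y \<partial>P) \<bullet> t"
    have "g x = G\<^sub>0 x \<bullet> t - b" for x
      unfolding g_def b_def inner_diff_right by (simp only: inner_commute)
    then have "(\<lambda>x. (g x)\<^sup>2) = (\<lambda>x. (G\<^sub>0 x \<bullet> t)\<^sup>2 + b\<^sup>2 - 2 * b * (G\<^sub>0 x \<bullet> t))"
      by (simp add: power2_diff mult_ac)
    moreover have "integrable P (\<lambda>x. G\<^sub>0 x \<bullet> t)"
      using G0_integrable by simp
    ultimately show ?thesis
      using component_square_integrable[OF G0_measurable G0_sq, of t] by simp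
  qed
  have sum_eq: "t \<bullet> (sqrt (real n) *\<^sub>R grad_dev n \<omega>) = (\<Sum>i<n. g (X (Suc i) \<omega>)) / sqrt (real n)" for n \<omega>
  proof (cases "n = 0")
    case False
    have "(\<Sum>i<n. g (X (Suc i) \<omega>)) = (\<Sum>i=1..n. g (X i \<omega>))"
      by (rule sum.reindex_bij_witness[of _ "\<lambda>i. i - 1" Suc]) auto
    also have "\<dots> = t \<bullet> (real n *\<^sub>R grad_dev n \<omega>)"
    proof -
      have "real n *\<^sub>R grad_dev n \<omega> = (\<Sum>i=1..n. G\<^sub>0 (X i \<omega>)) - real n *\<^sub>R (\<integral>x. G\<^sub>0 x \<partial>P)"
        using False by (simp add: grad_dev_def scaleR_diff_right)
      then show ?thesis
        by (simp add: g_def inner_diff_right inner_sum_right sum_subtractf)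
    qed
    also have "\<dots> = sqrt (real n) * (t \<bullet> (sqrt (real n) *\<^sub>R grad_dev n \<omega>))"
      by simp
    finally show ?thesis
      using False by simp
  qed simp
  show ?thesis
  proof (cases "v = 0")
    \<comment> \<open>A degenerate projection: \<open>g\<close> vanishes almost surely and both
      sides equal \<open>k 0\<close>, while standardizing would divide by zero.\<close>
    case True
    have "AE x in P. (g x)\<^sup>2 = 0"
      using integral_nonneg_eq_0_iff_AE[OF g2] True by (simp add: v_def)
    then have "AE x in P. g x = 0"
      by (rule eventually_mono) simp
    from AE_X[OF this] have "AE \<omega> in M. k (t \<bullet> (sqrt (real n) *\<^sub>R grad_dev n \<omega>)) = k 0" for n
      unfolding sum_eq by (rule eventually_mono) simp
    moreover have "(\<lambda>\<omega>. k (t \<bullet> (sqrt (real n) *\<^sub>R grad_dev n \<omega>))) \<in> borel_measurable M" for n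
      using grad_dev_measurable[of n] by (intro measurable_compose[OF _ km]) measurable
    ultimately have "(\<integral>\<omega>. k (t \<bullet> (sqrt (real n) *\<^sub>R grad_dev n \<omega>)) \<partial>M) = (\<integral>\<omega>. k 0 \<partial>M)" for n
      by (intro integral_cong_AE) auto
    moreover have "(\<integral>\<omega>. k (t \<bullet> Z \<omega>) \<partial>N) = (\<integral>x. k x \<partial>distr N borel (\<lambda>\<omega>. t \<bullet> Z \<omega>))"
      by (rule integral_distr[symmetric]) (use Z km in measurable)
    moreover have "\<dots> = k 0"
      unfolding law g_def[symmetric] v_def[symmetric] normal_law_def using True km by (simp add: integral_return)
    ultimately show ?thesis
      by (simp add: prob_space)
  next
    case False
    define \<sigma> where "\<sigma> = sqrt v"
    have v: "v > 0"
      using False integral_nonneg_AE[of "\<lambda>x. (g x)\<^sup>2" P] by (simp add: v_def less_le)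
    then have sig: "\<sigma> > 0" "\<sigma>\<^sup>2 = v"
      by (simp_all add: \<sigma>_def)
    \<comment> \<open>The scale is moved into the test function, so that the limit is standard
      normal.\<close>
    define k' where "k' y = k (\<sigma> * y)" for y
    have k': "isCont k' x" "norm (k' x) \<le> C" for x
      unfolding k'_def using k(2) by (auto intro!: isCont_o2[OF _ k(1)] continuous_intros)
    have k'm: "k' \<in> borel_measurable borel"
      unfolding k'_def[abs_def] using km by measurable
    have gX: "integrable M (\<lambda>\<omega>. g (X (Suc i) \<omega>))" "expectation (\<lambda>\<omega>. g (X (Suc i) \<omega>)) = 0"
      "integrable M (\<lambda>\<omega>. (g (X (Suc i) \<omega>))\<^sup>2)" "expectation (\<lambda>\<omega>. (g (X (Suc i) \<omega>))\<^sup>2) = v" for i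
      using integrable_X[OF _ gi, of "Suc i"] integrable_X[OF _ g2, of "Suc i"] g0 by (auto simp: v_def)
    have Xm: "X (Suc i) \<in> measurable M P" for i
      by (rule X_measurable) simp
    define S where "S n \<omega> = (\<Sum>i<n. g (X (Suc i) \<omega>)) / sqrt (real n * \<sigma>\<^sup>2)" for n \<omega>
    have Sm: "S n \<in> borel_measurable M" for n
      unfolding S_def using measurable_compose[OF Xm gm]
      by (intro borel_measurable_divide borel_measurable_sum) auto
    have "weak_conv_m (\<lambda>n. distr M borel (S n)) std_normal_distribution"
      unfolding S_def
    proof (rule central_limit_theorem_zero_mean[where \<mu> = "distr P borel g"])
      have "indep_vars (\<lambda>i. P) (\<lambda>i. X (Suc i)) UNIV"
        by (rule indep_vars_Suc[OF X_indep])
      then show "indep_vars (\<lambda>i. borel) (\<lambda>i \<omega>. g (X (Suc i) \<omega>)) UNIV"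
        by (rule indep_vars_compose2) (rule gm)
      show "distr M borel (\<lambda>\<omega>. g (X (Suc n) \<omega>)) = distr P borel g" for n
      proof -
        have "distr (distr M P (X (Suc n))) borel g = distr M borel (g \<circ> X (Suc n))"
          by (rule distr_distr[OF gm Xm])
        then show ?thesis
          by (simp add: X_distr comp_def)
      qed
    qed (use gX sig in auto)
    then have "(\<lambda>n. integral\<^sup>L (distr M borel (S n)) k') \<longlonglongrightarrow> integral\<^sup>L std_normal_distribution k'"
      by (intro weak_conv_imp_integral_bdd_continuous_conv[OF _ real_dist_normal_dist _ k'])
        (auto intro!: real_distribution_distr Sm)
    moreover have "integral\<^sup>L (distr M borel (S n)) k' = (\<integral>\<omega>. k (t \<bullet> (sqrt (real n) *\<^sub>R grad_dev n \<omega>)) \<partial>M)" for n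
    proof -
      have "k' (S n \<omega>) = k (t \<bullet> (sqrt (real n) *\<^sub>R grad_dev n \<omega>))" for \<omega>
        using sig(1) unfolding sum_eq by (simp add: k'_def S_def real_sqrt_mult)
      then show ?thesis
        by (subst integral_distr[OF Sm k'm]) simp
    qed
    moreover have "integral\<^sup>L std_normal_distribution k' = (\<integral>\<omega>. k (t \<bullet> Z \<omega>) \<partial>N)"
    proof -
      have tZ: "(\<lambda>\<omega>. t \<bullet> Z \<omega>) \<in> borel_measurable N"
        using Z by measurable
      have "distr N lborel (\<lambda>\<omega>. t \<bullet> Z \<omega>) = distr N borel (\<lambda>\<omega>. t \<bullet> Z \<omega>)"
        by (rule distr_cong) auto
      also have "\<dots> = density lborel (normal_density 0 \<sigma>)"
        unfolding law g_def[symmetric] v_def[symmetric] normal_law_def \<sigma>_def using False by simp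
      finally have "distributed N lborel (\<lambda>\<omega>. t \<bullet> Z \<omega>) (normal_density 0 \<sigma>)"
        using tZ by (simp add: distributed_def)
      then have "distributed N lborel (\<lambda>\<omega>. (t \<bullet> Z \<omega> - 0) / \<sigma>) std_normal_density"
        using N.normal_standard_normal_convert[OF sig(1), of "\<lambda>\<omega>. t \<bullet> Z \<omega>" 0] by blast
      then have "std_normal_distribution = distr N lborel (\<lambda>\<omega>. t \<bullet> Z \<omega> / \<sigma>)"
        by (simp add: distributed_def)
      also have "integral\<^sup>L \<dots> k' = (\<integral>\<omega>. k' (t \<bullet> Z \<omega> / \<sigma>) \<partial>N)"
        by (rule integral_distr) (use tZ k'm in auto)
      also have "(\<lambda>\<omega>. k' (t \<bullet> Z \<omega> / \<sigma>)) = (\<lambda>\<omega>. k (t \<bullet> Z \<omega>))"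
        using sig(1) by (simp add: k'_def)
      finally show ?thesis .
    qed
    ultimately show ?thesis
      by simp
  qed
qed

text \<open>The Cramer-Wold device: cosines and sines of all projections converge, and Chebyshev's
  inequality supplies tightness.\<close>

theorem (in loss_model) grad_dev_clt:
  fixes Z :: "'z \<Rightarrow> 'p"
  assumes N: "prob_space N" and Z: "Z \<in> borel_measurable N"
    and law: "\<And>t. distr N borel (\<lambda>\<omega>. t \<bullet> Z \<omega>) = normal_law 0 (\<integral>x. (t \<bullet> (G\<^sub>0 x - (\<integral>y. G\<^sub>0 y \<partial>P)))\<^sup>2 \<partial>P)"
  shows "converges_in_distribution M (\<lambda>n \<omega>. sqrt (real n) *\<^sub>R grad_dev n \<omega>) N Z"
proof (rule converges_in_distribution_trigI[OF prob_space_axioms N _ Z])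
  show "(\<lambda>\<omega>. sqrt (real n) *\<^sub>R grad_dev n \<omega>) \<in> borel_measurable M" for n
    using grad_dev_measurable[of n] by measurable
  show "\<exists>K. \<forall>\<^sub>F n in sequentially. \<exists>A\<in>events. prob A \<le> \<epsilon> \<and> (\<forall>\<omega>\<in>space M - A. norm (sqrt (real n) *\<^sub>R grad_dev n \<omega>) \<le> K)"
    if e: "\<epsilon> > 0" for \<epsilon>
  proof -
    obtain K where "\<And>n. n \<ge> 1 \<Longrightarrow> \<exists>A\<in>events. prob A \<le> \<epsilon> \<and> (\<forall>\<omega>\<in>space M - A. sqrt (real n) * norm (grad_dev n \<omega>) \<le> K)"
      using grad_dev_bounded[OF e] by blast
    then show ?thesis
      by (intro exI[of _ K] eventually_mono[OF eventually_ge_at_top[of 1]]) simp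
  qed
  show "(\<lambda>n. expectation (\<lambda>\<omega>. cos (t \<bullet> sqrt (real n) *\<^sub>R grad_dev n \<omega>))) \<longlonglongrightarrow> (\<integral>\<omega>. cos (t \<bullet> Z \<omega>) \<partial>N)" for t
    by (rule grad_dev_functional_clt[OF N Z law, where C = 1]) auto
  show "(\<lambda>n. expectation (\<lambda>\<omega>. sin (t \<bullet> sqrt (real n) *\<^sub>R grad_dev n \<omega>))) \<longlonglongrightarrow> (\<integral>\<omega>. sin (t \<bullet> Z \<omega>) \<partial>N)" for t
    by (rule grad_dev_functional_clt[OF N Z law, where C = 1]) auto
qed

context loss_model
begin

text \<open>The scaled first order noise is bounded in probability, so a claim may be proved on the
  event that it is at most a given \<open>K\<close>.\<close>

lemma whp_grad_dev_bounded:
  assumes "\<And>K. K \<ge> 0 \<Longrightarrow> whp (\<lambda>n \<omega>. sqrt (real n) * norm (grad_dev n \<omega>) \<le> K \<longrightarrow> E n \<omega>)"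
  shows "whp E"
proof (rule whp_of_bounded[where B = "\<lambda>K n \<omega>. sqrt (real n) * norm (grad_dev n \<omega>) \<le> max 0 K"])
  fix \<epsilon> :: real assume "\<epsilon> > 0"
  then obtain K where "\<And>n. n \<ge> 1 \<Longrightarrow> \<exists>A\<in>events. prob A \<le> \<epsilon> \<and> (\<forall>\<omega>\<in>space M - A. sqrt (real n) * norm (grad_dev n \<omega>) \<le> K)"
    using grad_dev_bounded by blast
  note K = this
  have "\<forall>\<^sub>F n in sequentially. \<exists>A\<in>events. prob A \<le> \<epsilon> \<and>
      (\<forall>\<omega>\<in>space M - A. sqrt (real n) * norm (grad_dev n \<omega>) \<le> max 0 K)"
    using eventually_ge_at_top[of 1]
  proof eventually_elim
    case (elim n)
    from K[OF elim] obtain A where A: "A \<in> events" "prob A \<le> \<epsilon>"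
      "\<forall>\<omega>\<in>space M - A. sqrt (real n) * norm (grad_dev n \<omega>) \<le> K"
      by blast
    from A(3) have "\<forall>\<omega>\<in>space M - A. sqrt (real n) * norm (grad_dev n \<omega>) \<le> max 0 K"
      by (simp add: max.coboundedI2)
    with A(1,2) show ?case
      by blast
  qed
  then show "\<exists>K. \<forall>\<^sub>F n in sequentially. \<exists>A\<in>events. prob A \<le> \<epsilon> \<and>
      (\<forall>\<omega>\<in>space M - A. sqrt (real n) * norm (grad_dev n \<omega>) \<le> max 0 K)" ..
qed (rule assms, simp)

end

context robust_estimation
begin

text \<open>The delta method: \<open>\<theta>bar n \<omega>\<close> is within \<open>o(a n)\<close>
  of \<open>\<theta>sol (\<zeta> n \<omega>)\<close>, and the Hadamard derivative is applied with
  step \<open>a n\<close> in the random direction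
  \<open>(1 / a n) *\<^sub>R \<zeta> n \<omega>\<close>. Continuity of \<open>\<theta>sol'\<close>
  carries the limit of these directions over.\<close>

theorem estimator_limit:
  assumes hadamard: "has_hadamard_deriv \<theta>sol 0 \<theta>sol'" and N: "prob_space N"
    and bar_meas: "\<And>n. \<theta>bar n \<in> borel_measurable M"
    and conv: "converges_in_distribution M (\<lambda>n \<omega>. (1 / a n) *\<^sub>R \<zeta> n \<omega>) N W"
  shows "converges_in_distribution M (\<lambda>n \<omega>. (1 / a n) *\<^sub>R (\<theta>bar n \<omega> - \<theta>\<^sub>0)) N (\<lambda>\<omega>. \<theta>sol' (W \<omega>))"
proof (rule converges_in_distribution_close[OF prob_space_axioms N])
  show "converges_in_distribution M (\<lambda>n \<omega>. \<theta>sol' ((1 / a n) *\<^sub>R \<zeta> n \<omega>)) N (\<lambda>\<omega>. \<theta>sol' (W \<omega>))"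
    by (rule converges_in_distribution_compose[OF conv hadamard_deriv_continuous_on[OF hadamard]])
  show "(\<lambda>\<omega>. (1 / a n) *\<^sub>R (\<theta>bar n \<omega> - \<theta>\<^sub>0)) \<in> borel_measurable M" for n
    using bar_meas[of n] by measurable
  fix \<eta> \<epsilon> :: real assume eta: "\<eta> > 0" and eps: "\<epsilon> > 0"
  have "whp (\<lambda>n \<omega>. norm ((1 / a n) *\<^sub>R (\<theta>bar n \<omega> - \<theta>\<^sub>0) - \<theta>sol' ((1 / a n) *\<^sub>R \<zeta> n \<omega>)) \<le> \<eta>)"
  proof (rule whp_grad_dev_bounded)
    fix K :: real assume K: "K \<ge> 0"
    have e2: "\<eta> / 2 > 0"
      using eta by simp
    \<comment> \<open>Bounds the norm of the direction when the scaled first order noise is at most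
      \<open>K\<close>.\<close>
    define K1 where "K1 = K * Ca + sqrt \<kappa> * Ca * norm \<gamma>"
    obtain s where s: "s > 0"
      "\<And>t w. \<lbrakk>0 < t; t < s; norm w \<le> K1\<rbrakk> \<Longrightarrow> norm ((\<theta>sol (0 + t *\<^sub>R w) - \<theta>sol 0) /\<^sub>R t - \<theta>sol' w) \<le> \<eta> / 2"
      using hadamard_uniform[OF hadamard e2] by blast
    show "whp (\<lambda>n \<omega>. sqrt (real n) * norm (grad_dev n \<omega>) \<le> K \<longrightarrow>
        norm ((1 / a n) *\<^sub>R (\<theta>bar n \<omega> - \<theta>\<^sub>0) - \<theta>sol' ((1 / a n) *\<^sub>R \<zeta> n \<omega>)) \<le> \<eta>)"
    proof (rule whp_mono_eventually[OF solution_comparison[OF K e2]], goal_cases)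
    case 1
      show ?case
        using rates order_tendstoD(2)[OF a_lim s(1)] eventually_ge_at_top[of 1]
      proof (eventually_elim, intro ballI impI, elim conjE)
        fix n \<omega>
        assume ra: "1 / sqrt (real n) \<le> Ca * a n" "sqrt (\<delta> n) \<le> Ca * a n" and as: "a n < s" and n: "1 \<le> n"
          and imp: "sqrt (real n) * norm (grad_dev n \<omega>) \<le> K \<longrightarrow> norm (\<theta>bar n \<omega> - \<theta>sol (\<zeta> n \<omega>)) \<le> \<eta> / 2 * a n"
          and gK: "sqrt (real n) * norm (grad_dev n \<omega>) \<le> K"
        \<comment> \<open>The rates make \<open>a n\<close> positive, so that it can serve as a
          step.\<close>
        have "0 < 1 / sqrt (real n)"
          using n by simp
        then have "0 < Ca * a n"
          using ra(1) by linarith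
        then have an: "0 < a n"
          using Ca by (simp add: zero_less_mult_iff)
        define u where "u = (1 / a n) *\<^sub>R \<zeta> n \<omega>"
        have au: "a n *\<^sub>R u = \<zeta> n \<omega>"
          using an by (simp add: u_def)
        have "norm (grad_dev n \<omega>) \<le> K * (1 / sqrt (real n))"
          using gK n by (simp add: pos_le_divide_eq mult.commute)
        also have "\<dots> \<le> K * (Ca * a n)"
          using ra(1) K by (intro mult_left_mono)
        finally have gn: "norm (grad_dev n \<omega>) \<le> K * (Ca * a n)" .
        have skd: "sqrt (\<kappa> * \<delta> n) \<le> sqrt \<kappa> * (Ca * a n)" "0 \<le> sqrt (\<kappa> * \<delta> n)"
          using ra(2) kappa_pos delta_pos[of n] by (simp_all add: real_sqrt_mult mult_left_mono)
        have "norm (\<zeta> n \<omega>) \<le> norm (grad_dev n \<omega>) + sqrt (\<kappa> * \<delta> n) * norm \<gamma>"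
          unfolding \<zeta>_def using norm_triangle_ineq[of "grad_dev n \<omega>" "sqrt (\<kappa> * \<delta> n) *\<^sub>R \<gamma>"] skd(2) by simp
        also have "\<dots> \<le> K * (Ca * a n) + sqrt \<kappa> * (Ca * a n) * norm \<gamma>"
          using gn skd by (intro add_mono mult_right_mono) auto
        also have "\<dots> = K1 * a n"
          by (simp add: K1_def algebra_simps)
        finally have "norm (a n *\<^sub>R u) \<le> K1 * a n"
          unfolding au .
        then have "norm u \<le> K1"
          using an by simp
        from s(2)[OF an as this] have 1: "norm ((\<theta>sol (\<zeta> n \<omega>) - \<theta>\<^sub>0) /\<^sub>R a n - \<theta>sol' u) \<le> \<eta> / 2"
          by (simp add: au sol_zero)
        have "norm ((1 / a n) *\<^sub>R (\<theta>bar n \<omega> - \<theta>sol (\<zeta> n \<omega>))) \<le> \<eta> / 2"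
          using imp gK an by (simp add: pos_divide_le_eq)
        moreover have "(1 / a n) *\<^sub>R (\<theta>bar n \<omega> - \<theta>\<^sub>0) - \<theta>sol' u
            = (1 / a n) *\<^sub>R (\<theta>bar n \<omega> - \<theta>sol (\<zeta> n \<omega>)) + ((\<theta>sol (\<zeta> n \<omega>) - \<theta>\<^sub>0) /\<^sub>R a n - \<theta>sol' u)"
          by (simp add: divide_inverse algebra_simps)
        then have "norm ((1 / a n) *\<^sub>R (\<theta>bar n \<omega> - \<theta>\<^sub>0) - \<theta>sol' u)
            \<le> norm ((1 / a n) *\<^sub>R (\<theta>bar n \<omega> - \<theta>sol (\<zeta> n \<omega>))) + norm ((\<theta>sol (\<zeta> n \<omega>) - \<theta>\<^sub>0) /\<^sub>R a n - \<theta>sol' u)"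
          by (simp only: norm_triangle_ineq)
        ultimately show "norm ((1 / a n) *\<^sub>R (\<theta>bar n \<omega> - \<theta>\<^sub>0) - \<theta>sol' ((1 / a n) *\<^sub>R \<zeta> n \<omega>)) \<le> \<eta>"
          unfolding u_def[symmetric] using 1 by linarith
      qed
    qed
  qed
  from whpD[OF this eps] show "\<forall>\<^sub>F n in sequentially. \<exists>A\<in>events. prob A \<ge> 1 - \<epsilon> \<and>
      (\<forall>\<omega>\<in>A. norm ((1 / a n) *\<^sub>R (\<theta>bar n \<omega> - \<theta>\<^sub>0) - \<theta>sol' ((1 / a n) *\<^sub>R \<zeta> n \<omega>)) \<le> \<eta>)" .
qed

end

context robust_estimation
begin

text \<open>At the scale \<open>1 / sqrt n\<close> the sampling noise has a Gaussian limit, and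
  \<open>s\<close> is the limiting weight of the deterministic tilt.\<close>

lemma score_limit_gaussian:
  fixes Z :: "'z \<Rightarrow> 'p"
  assumes N: "prob_space N" and Z: "Z \<in> borel_measurable N"
    and law: "\<And>t. distr N borel (\<lambda>\<omega>. t \<bullet> Z \<omega>) = normal_law 0 (\<integral>x. (t \<bullet> (G\<^sub>0 x - (\<integral>y. G\<^sub>0 y \<partial>P)))\<^sup>2 \<partial>P)"
    and a: "a = (\<lambda>n. 1 / sqrt (real n))" and s: "(\<lambda>n. sqrt (real n) * sqrt (\<kappa> * \<delta> n)) \<longlonglongrightarrow> s"
  shows "converges_in_distribution M (\<lambda>n \<omega>. (1 / a n) *\<^sub>R \<zeta> n \<omega>) N (\<lambda>\<omega>. Z \<omega> + s *\<^sub>R \<gamma>)"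
proof (rule converges_in_distribution_close[OF prob_space_axioms N])
  show "converges_in_distribution M (\<lambda>n \<omega>. sqrt (real n) *\<^sub>R grad_dev n \<omega> + s *\<^sub>R \<gamma>) N (\<lambda>\<omega>. Z \<omega> + s *\<^sub>R \<gamma>)"
    by (rule converges_in_distribution_compose[OF grad_dev_clt[OF N Z law], where g = "\<lambda>x. x + s *\<^sub>R \<gamma>"])
      (auto intro!: continuous_intros)
  show "(\<lambda>\<omega>. (1 / a n) *\<^sub>R \<zeta> n \<omega>) \<in> borel_measurable M" for n
    unfolding \<zeta>_def using grad_dev_measurable[of n] by measurable
  fix \<eta> \<epsilon> :: real assume eta: "\<eta> > 0" and eps: "\<epsilon> > 0"
  have eq: "(1 / a n) *\<^sub>R \<zeta> n \<omega> - (sqrt (real n) *\<^sub>R grad_dev n \<omega> + s *\<^sub>R \<gamma>)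
      = (sqrt (real n) * sqrt (\<kappa> * \<delta> n)) *\<^sub>R \<gamma> - s *\<^sub>R \<gamma>" for n \<omega>
    by (simp add: a \<zeta>_def scaleR_add_right)
  have "(\<lambda>n. norm ((sqrt (real n) * sqrt (\<kappa> * \<delta> n)) *\<^sub>R \<gamma> - s *\<^sub>R \<gamma>)) \<longlonglongrightarrow> norm (s *\<^sub>R \<gamma> - s *\<^sub>R \<gamma>)"
    by (intro tendsto_intros s)
  then have "\<forall>\<^sub>F n in sequentially. norm ((sqrt (real n) * sqrt (\<kappa> * \<delta> n)) *\<^sub>R \<gamma> - s *\<^sub>R \<gamma>) < \<eta>"
    using eta by (intro order_tendstoD(2)) auto
  then have "whp (\<lambda>n \<omega>. norm ((1 / a n) *\<^sub>R \<zeta> n \<omega> - (sqrt (real n) *\<^sub>R grad_dev n \<omega> + s *\<^sub>R \<gamma>)) \<le> \<eta>)"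
    by (intro whp_eventually) (auto elim!: eventually_mono simp: eq)
  from whpD[OF this eps] show "\<forall>\<^sub>F n in sequentially. \<exists>A\<in>events. prob A \<ge> 1 - \<epsilon> \<and>
      (\<forall>\<omega>\<in>A. norm ((1 / a n) *\<^sub>R \<zeta> n \<omega> - (sqrt (real n) *\<^sub>R grad_dev n \<omega> + s *\<^sub>R \<gamma>)) \<le> \<eta>)" .
qed

text \<open>The sampling noise is of smaller order than \<open>sqrt (\<delta> n)\<close>, so the
  limit is deterministic. Any probability space can carry it, and \<open>M\<close> is taken.\<close>

lemma score_limit_degenerate:
  assumes a: "a = (\<lambda>n. sqrt (\<delta> n))" and lim: "(\<lambda>n. 1 / sqrt (real n) / sqrt (\<delta> n)) \<longlonglongrightarrow> 0"
  shows "converges_in_distribution M (\<lambda>n \<omega>. (1 / a n) *\<^sub>R \<zeta> n \<omega>) M (\<lambda>\<omega>. sqrt \<kappa> *\<^sub>R \<gamma>)"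
proof (rule converges_in_distribution_close[OF prob_space_axioms prob_space_axioms converges_in_distribution_const])
  show "(\<lambda>\<omega>. (1 / a n) *\<^sub>R \<zeta> n \<omega>) \<in> borel_measurable M" for n
    unfolding \<zeta>_def using grad_dev_measurable[of n] by measurable
  fix \<eta> \<epsilon> :: real assume eta: "\<eta> > 0" and eps: "\<epsilon> > 0"
  have eq: "norm ((1 / a n) *\<^sub>R \<zeta> n \<omega> - sqrt \<kappa> *\<^sub>R \<gamma>) = norm (grad_dev n \<omega>) / sqrt (\<delta> n)" for n \<omega>
  proof -
    have "sqrt (\<delta> n) > 0"
      using delta_pos[of n] by simp
    then show ?thesis
      by (simp add: a \<zeta>_def scaleR_add_right real_sqrt_mult)
  qed
  have "whp (\<lambda>n \<omega>. norm ((1 / a n) *\<^sub>R \<zeta> n \<omega> - sqrt \<kappa> *\<^sub>R \<gamma>) \<le> \<eta>)"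
    unfolding eq
  proof (rule whp_grad_dev_bounded, rule whp_eventually)
    fix K :: real assume K: "K \<ge> 0"
    have "(\<lambda>n. K * (1 / sqrt (real n) / sqrt (\<delta> n))) \<longlonglongrightarrow> 0"
      using tendsto_mult_left[OF lim, of K] by simp
    from order_tendstoD(2)[OF this eta] eventually_ge_at_top[of 1]
    show "\<forall>\<^sub>F n in sequentially. \<forall>\<omega>\<in>space M. sqrt (real n) * norm (grad_dev n \<omega>) \<le> K \<longrightarrow>
        norm (grad_dev n \<omega>) / sqrt (\<delta> n) \<le> \<eta>"
    proof (eventually_elim, intro ballI impI)
      fix n \<omega>
      assume l: "K * (1 / sqrt (real n) / sqrt (\<delta> n)) < \<eta>" and n: "1 \<le> n"
        and g: "sqrt (real n) * norm (grad_dev n \<omega>) \<le> K"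
      have "norm (grad_dev n \<omega>) \<le> K * (1 / sqrt (real n))"
        using g n by (simp add: pos_le_divide_eq mult.commute)
      then have "norm (grad_dev n \<omega>) / sqrt (\<delta> n) \<le> K * (1 / sqrt (real n)) / sqrt (\<delta> n)"
        using delta_pos[of n] by (intro divide_right_mono) auto
      then show "norm (grad_dev n \<omega>) / sqrt (\<delta> n) \<le> \<eta>"
        using l by simp
    qed
  qed
  from whpD[OF this eps] show "\<forall>\<^sub>F n in sequentially. \<exists>A\<in>events. prob A \<ge> 1 - \<epsilon> \<and>
      (\<forall>\<omega>\<in>A. norm ((1 / a n) *\<^sub>R \<zeta> n \<omega> - sqrt \<kappa> *\<^sub>R \<gamma>) \<le> \<eta>)" .
qed

end

section \<open>From the hypotheses on the data to the abstract setting\<close>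

lemma covariance_matrix_quadratic:
  fixes v :: "'x \<Rightarrow> real ^ 'm"
  assumes P: "prob_space P" and v: "v \<in> borel_measurable P" "integrable P (\<lambda>x. (norm (v x))\<^sup>2)" "integrable P v"
  shows "t \<bullet> (covariance_matrix P v *v t) = (\<integral>x. (t \<bullet> (v x - (\<integral>y. v y \<partial>P)))\<^sup>2 \<partial>P)"
proof -
  interpret prob_space P by fact
  define u where "u x = v x - (\<integral>y. v y \<partial>P)" for x
  have um: "u \<in> borel_measurable P"
    unfolding u_def[abs_def] using v by measurable
  have u2: "integrable P (\<lambda>x. (norm (u x))\<^sup>2)"
  proof (rule Bochner_Integration.integrable_bound)
    show "integrable P (\<lambda>x. 2 * (norm (v x))\<^sup>2 + 2 * (norm (\<integral>y. v y \<partial>P))\<^sup>2)"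
      using v by simp
    show "AE x in P. norm ((norm (u x))\<^sup>2) \<le> norm (2 * (norm (v x))\<^sup>2 + 2 * (norm (\<integral>y. v y \<partial>P))\<^sup>2)"
    proof (rule AE_I2)
      fix x
      have "(norm (u x))\<^sup>2 \<le> (norm (v x) + norm (\<integral>y. v y \<partial>P))\<^sup>2"
        unfolding u_def by (intro power_mono norm_triangle_ineq4) auto
      also have "\<dots> \<le> 2 * (norm (v x))\<^sup>2 + 2 * (norm (\<integral>y. v y \<partial>P))\<^sup>2"
        by (rule power2_add_le)
      finally show "norm ((norm (u x))\<^sup>2) \<le> norm (2 * (norm (v x))\<^sup>2 + 2 * (norm (\<integral>y. v y \<partial>P))\<^sup>2)"
        by simp
    qed
  qed (use um in measurable)
  have uij: "integrable P (\<lambda>x. u x $ i * u x $ j)" for i j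
  proof (rule Bochner_Integration.integrable_bound[OF u2])
    show "AE x in P. norm (u x $ i * u x $ j) \<le> norm ((norm (u x))\<^sup>2)"
      by (rule AE_I2) (simp add: abs_mult power2_eq_square mult_mono component_le_norm_cart)
    have "(\<lambda>x. u x $ i) \<in> borel_measurable P" for i
      using borel_measurable_inner[OF um borel_measurable_const[of "axis i 1"]] by (simp add: inner_axis)
    then show "(\<lambda>x. u x $ i * u x $ j) \<in> borel_measurable P"
      by simp
  qed
  have comp: "(\<integral>y. v y $ i \<partial>P) = (\<integral>y. v y \<partial>P) $ i" for i
    using integral_inner_left[OF v(3), of "axis i 1"] by (simp add: inner_axis)
  have cov: "covariance_matrix P v $ i $ j = (\<integral>x. u x $ i * u x $ j \<partial>P)" for i j
    by (simp add: covariance_matrix_def u_def comp)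
  have "(t \<bullet> u x)\<^sup>2 = (\<Sum>i\<in>UNIV. \<Sum>j\<in>UNIV. (t $ i * t $ j) * (u x $ i * u x $ j))" for x
    by (simp add: inner_vec_def power2_eq_square sum_product mult_ac)
  then have "(\<integral>x. (t \<bullet> u x)\<^sup>2 \<partial>P) = (\<Sum>i\<in>UNIV. \<Sum>j\<in>UNIV. (t $ i * t $ j) * (\<integral>x. u x $ i * u x $ j \<partial>P))"
    using uij by (simp add: Bochner_Integration.integral_sum)
  also have "\<dots> = t \<bullet> (covariance_matrix P v *v t)"
    by (simp add: inner_vec_def matrix_vector_mult_def cov sum_distrib_left mult_ac)
  finally show ?thesis
    by (simp add: u_def)
qed

text \<open>The mean value inequality for \<open>g\<close> minus its linear part at
  \<open>\<theta>\<^sub>0\<close>. On the segment the gradient deviates by at most \<open>L\<close>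
  times the larger distance of the endpoints from \<open>\<theta>\<^sub>0\<close>, as balls are
  convex. The segment may leave \<open>T\<close>, so \<open>D\<close> has to contain the convex
  hull.\<close>

lemma first_order_remainder_bound:
  fixes g :: "'p::euclidean_space \<Rightarrow> real"
  assumes T: "convex hull T \<subseteq> D" "\<theta>\<^sub>0 \<in> D"
    and grad: "\<And>\<theta>. \<theta> \<in> D \<Longrightarrow> has_gradient_within g (G \<theta>) \<theta> D"
    and Lip: "\<And>\<theta>. \<theta> \<in> D \<Longrightarrow> norm (G \<theta> - G \<theta>\<^sub>0) \<le> L * norm (\<theta> - \<theta>\<^sub>0)" and L: "L \<ge> 0"
    and th: "\<theta> \<in> T" "\<theta>' \<in> T"
  shows "\<bar>g \<theta> - g \<theta>' - G \<theta>\<^sub>0 \<bullet> (\<theta> - \<theta>')\<bar> \<le> L * max (norm (\<theta> - \<theta>\<^sub>0)) (norm (\<theta>' - \<theta>\<^sub>0)) * norm (\<theta> - \<theta>')"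
proof -
  define m where "m = max (norm (\<theta> - \<theta>\<^sub>0)) (norm (\<theta>' - \<theta>\<^sub>0))"
  define S where "S = closed_segment \<theta>' \<theta>"
  have SD: "S \<subseteq> D"
  proof -
    have "S \<subseteq> convex hull T"
      unfolding S_def segment_convex_hull using th by (intro hull_mono) auto
    then show ?thesis
      using T by blast
  qed
  have Sm: "norm (z - \<theta>\<^sub>0) \<le> m" if "z \<in> S" for z
  proof -
    have "S \<subseteq> cball \<theta>\<^sub>0 m"
      unfolding S_def by (rule closed_segment_subset) (auto simp: m_def dist_norm norm_minus_commute)
    then show ?thesis
      using that by (auto simp: dist_norm norm_minus_commute)
  qed
  have "norm ((g \<theta> - G \<theta>\<^sub>0 \<bullet> \<theta>) - (g \<theta>' - G \<theta>\<^sub>0 \<bullet> \<theta>')) \<le> L * m * norm (\<theta> - \<theta>')"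
  proof (rule differentiable_bound[of S "\<lambda>z. g z - G \<theta>\<^sub>0 \<bullet> z" "\<lambda>z h. (G z - G \<theta>\<^sub>0) \<bullet> h"])
    show "convex S" "\<theta> \<in> S" "\<theta>' \<in> S"
      by (auto simp: S_def)
    show "((\<lambda>z. g z - G \<theta>\<^sub>0 \<bullet> z) has_derivative (\<lambda>h. (G z - G \<theta>\<^sub>0) \<bullet> h)) (at z within S)" if "z \<in> S" for z
    proof -
      have "(g has_derivative (\<lambda>h. G z \<bullet> h)) (at z within S)"
        using grad[of z] SD that unfolding has_gradient_within_def by (blast intro: has_derivative_subset)
      then show ?thesis
        by (auto intro!: derivative_eq_intros simp: inner_diff_left)
    qed
    show "onorm (\<lambda>h. (G z - G \<theta>\<^sub>0) \<bullet> h) \<le> L * m" if z: "z \<in> S" for z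
    proof (rule onorm_bound)
      show "0 \<le> L * m"
        using L by (simp add: m_def le_max_iff_disj)
      fix h
      have "norm ((G z - G \<theta>\<^sub>0) \<bullet> h) \<le> norm (G z - G \<theta>\<^sub>0) * norm h"
        by (simp add: Cauchy_Schwarz_ineq2)
      also have "\<dots> \<le> (L * norm (z - \<theta>\<^sub>0)) * norm h"
        using Lip[of z] SD z by (intro mult_right_mono) auto
      also have "\<dots> \<le> L * m * norm h"
        using Sm[OF z] L by (intro mult_right_mono mult_left_mono) auto
      finally show "norm ((G z - G \<theta>\<^sub>0) \<bullet> h) \<le> L * m * norm h" .
    qed
  qed
  then show ?thesis
    by (simp add: m_def inner_diff_right algebra_simps)
qed

text \<open>Up to \<epsilon> the measure lives on a ball. Its intersection with the closed set
  \<open>S\<close> is compact, so \<open>l\<close> is uniformly continuous on the product with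
  \<open>T\<close>.\<close>

lemma equicontinuous_on_compact_part:
  fixes l :: "'a::euclidean_space \<Rightarrow> 'b::euclidean_space \<Rightarrow> real"
  assumes S: "closed S" and P: "prob_space P" "sets P = sets (restrict_space borel S)" and T: "compact T"
    and l: "continuous_on (S \<times> T) (\<lambda>(x, \<theta>). l x \<theta>)" and e: "\<epsilon> > 0"
  shows "\<exists>K\<in>sets P. measure P K \<ge> 1 - \<epsilon> \<and> (\<exists>\<rho>>0. \<forall>x\<in>K. \<forall>\<theta>\<in>T. \<forall>\<theta>'\<in>T.
        norm (\<theta> - \<theta>') < \<rho> \<longrightarrow> \<bar>l x \<theta> - l x \<theta>'\<bar> \<le> \<epsilon>)"
proof -
  have sp: "space P = S"
    using sets_eq_imp_space_eq[OF P(2)] by (simp add: space_restrict_space)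
  have id: "(\<lambda>x. x) \<in> borel_measurable P"
    unfolding measurable_cong_sets[OF P(2) refl] by (rule measurable_restrict_space1) simp
  obtain R where R: "R > 0" "measure P {x \<in> space P. norm x \<le> R} \<ge> 1 - \<epsilon>"
    using prob_space_tight[OF P(1) id e] by blast
  define K where "K = {x \<in> space P. norm x \<le> R}"
  have K: "K \<in> sets P"
    unfolding K_def using id by measurable
  have "K = S \<inter> cball 0 R"
    by (auto simp: K_def sp)
  then have "compact K"
    using S by (simp add: closed_Int_compact)
  then have "uniformly_continuous_on (K \<times> T) (\<lambda>(x, \<theta>). l x \<theta>)"
    by (intro compact_uniformly_continuous compact_Times T continuous_on_subset[OF l]) (auto simp: K_def sp)
  then obtain \<rho> where rho: "\<rho> > 0"
    "\<forall>z\<in>K \<times> T. \<forall>z'\<in>K \<times> T. dist z' z < \<rho> \<longrightarrow> dist ((\<lambda>(x, \<theta>). l x \<theta>) z') ((\<lambda>(x, \<theta>). l x \<theta>) z) < \<epsilon>"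
    using e unfolding uniformly_continuous_on_def by meson
  have "\<bar>l x \<theta> - l x \<theta>'\<bar> \<le> \<epsilon>" if "x \<in> K" "\<theta> \<in> T" "\<theta>' \<in> T" "norm (\<theta> - \<theta>') < \<rho>" for x \<theta> \<theta>'
    using rho(2)[rule_format, of "(x, \<theta>')" "(x, \<theta>)"] that by (simp add: dist_Pair_Pair dist_norm)
  then show ?thesis
    using K R rho(1) unfolding K_def[symmetric] by blast
qed

text \<open>\<open>gradient_within\<close> picks one of possibly several gradients relative to
  \<open>\<Theta>\<close>; the choice is harmless because the comparison works with any of them. The
  third limit is constant and is therefore realized on \<open>M\<close> itself.\<close>

theorem theorem5p1:
  fixes S :: "(real ^ 'd) set" and P :: "(real ^ 'd) measure"
    and M :: "'w measure" and X :: "nat \<Rightarrow> 'w \<Rightarrow> real ^ 'd"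
    and \<Theta> D :: "(real ^ 'm) set"
    and l :: "real ^ 'd \<Rightarrow> real ^ 'm \<Rightarrow> real"
    and G :: "real ^ 'd \<Rightarrow> real ^ 'm \<Rightarrow> real ^ 'm"
    and \<phi> :: "real \<Rightarrow> ennreal" and \<kappa> :: real
    and \<delta> :: "nat \<Rightarrow> real"
    and \<theta>bar :: "nat \<Rightarrow> 'w \<Rightarrow> real ^ 'm" and \<theta>opt :: "real ^ 'm"
    and \<theta>sol \<theta>sol' :: "real ^ 'm \<Rightarrow> real ^ 'm"
    and N :: "'z measure" and Z :: "'z \<Rightarrow> real ^ 'm"
  \<comment> \<open>the data and the i.i.d. sample \<open>X 1, X 2, \<dots>\<close>\<close>
  assumes S: "closed S" "S \<noteq> {}"
    and P: "prob_space P" "sets P = sets (restrict_space borel S)"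
    and M: "prob_space M"
    and X_indep: "prob_space.indep_vars M (\<lambda>_. P) X {1..}"
    and X_distr: "\<And>i. i \<ge> 1 \<Longrightarrow> distr M P (X i) = P"
    and \<Theta>: "compact \<Theta>"
    and l_cont: "continuous_on (S \<times> \<Theta>) (\<lambda>(x, \<theta>). l x \<theta>)"
  \<comment> \<open>the divergence function\<close>
    and \<phi>: "ennreal_convex \<phi>" "lower_semicontinuous \<phi>" "\<phi> 1 = 0" "\<And>t. t < 0 \<Longrightarrow> \<phi> t = \<infinity>"
  \<comment> \<open>the radii and the distributionally robust solutions\<close>
    and \<delta>: "\<And>n. \<delta> n > 0" "decseq \<delta>" "\<delta> \<longlonglongrightarrow> 0"
    and \<theta>bar_meas: "\<And>n. \<theta>bar n \<in> borel_measurable M"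
    and \<theta>bar: "AE \<omega> in M. \<forall>n\<ge>1.
        is_arg_min (robust_loss \<phi> l (empirical_measure P (\<lambda>i. X i \<omega>) n) (\<delta> n)) (\<lambda>\<theta>. \<theta> \<in> \<Theta>) (\<theta>bar n \<omega>)"
  \<comment> \<open>the unique minimizer and smoothness of the loss\<close>
    and \<theta>opt: "is_arg_min (loss_mean P l) (\<lambda>\<theta>. \<theta> \<in> \<Theta>) \<theta>opt"
        "\<And>\<theta>. is_arg_min (loss_mean P l) (\<lambda>\<theta>. \<theta> \<in> \<Theta>) \<theta> \<Longrightarrow> \<theta> = \<theta>opt"
    and D: "differentiation_domain \<Theta> \<theta>opt D"
    and l_diff: "continuously_differentiable_loss P l G D"
  \<comment> \<open>(1) uniform second order growth\<close>
    and growth: "\<exists>V c. \<theta>opt \<in> interior V \<and> c > 0 \<and>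
        (\<forall>\<^sub>F v in nhds 0.
           is_arg_min (\<lambda>\<theta>. loss_mean P l \<theta> + v \<bullet> \<theta>) (\<lambda>\<theta>. \<theta> \<in> \<Theta>) (\<theta>sol v) \<and> \<theta>sol v \<in> V \<and>
           (\<forall>\<theta>\<in>\<Theta> \<inter> V. loss_mean P l \<theta> + v \<bullet> (\<theta> - \<theta>sol v)
              \<ge> loss_mean P l (\<theta>sol v) + c * (norm (\<theta> - \<theta>sol v))\<^sup>2))"
  \<comment> \<open>(2) square integrable, Lipschitz continuous gradients\<close>
    and grad_sq: "\<exists>\<theta>\<in>\<Theta>. integrable P (\<lambda>x. (norm (G x \<theta>))\<^sup>2)"
    and grad_Lip: "\<exists>\<Psi>. \<Psi> \<in> borel_measurable P \<and> (\<forall>x\<in>S. \<Psi> x \<ge> 0) \<and> integrable P (\<lambda>x. (\<Psi> x)\<^sup>2) \<and>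
        (AE x in P. \<forall>\<theta>\<in>D. \<forall>\<theta>'\<in>D. norm (G x \<theta> - G x \<theta>') \<le> \<Psi> x * norm (\<theta> - \<theta>'))"
  \<comment> \<open>(3) smoothness of \<open>\<phi>\<close> at 1\<close>
    and \<phi>_C2: "\<exists>\<epsilon>>0.
        (\<forall>t\<in>ball 1 \<epsilon>. \<phi> t < \<infinity> \<and> (\<lambda>s. enn2real (\<phi> s)) differentiable (at t) \<and>
                   deriv (\<lambda>s. enn2real (\<phi> s)) differentiable (at t)) \<and>
        continuous_on (ball 1 \<epsilon>) (deriv (deriv (\<lambda>s. enn2real (\<phi> s))))"
    and \<kappa>: "\<kappa> = 2 / deriv (deriv (\<lambda>s. enn2real (\<phi> s))) 1" "\<kappa> > 0"
  \<comment> \<open>(4) essentially bounded loss and nondegenerate variance\<close>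
    and l_bdd: "\<exists>B. AE x in P. \<forall>\<theta>\<in>\<Theta>. \<bar>l x \<theta>\<bar> \<le> B"
    and var_pos: "loss_var P l \<theta>opt > 0"
  \<comment> \<open>(5) directional differentiability of the solution map\<close>
    and hadamard: "has_hadamard_deriv \<theta>sol 0 \<theta>sol'"
    and Z: "multivariate_normal N Z 0 (covariance_matrix P (\<lambda>x. G x \<theta>opt))"
  shows
    "(\<delta> \<in> o(\<lambda>n. 1 / real n) \<longrightarrow>
        converges_in_distribution M (\<lambda>n \<omega>. sqrt (real n) *\<^sub>R (\<theta>bar n \<omega> - \<theta>opt))
          N (\<lambda>\<omega>. \<theta>sol' (Z \<omega>))) \<and>
     (\<forall>\<beta>>0. (\<forall>n\<ge>1. \<delta> n = \<beta> / real n) \<longrightarrow>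
        converges_in_distribution M (\<lambda>n \<omega>. sqrt (real n) *\<^sub>R (\<theta>bar n \<omega> - \<theta>opt))
          N (\<lambda>\<omega>. \<theta>sol' (Z \<omega> + (sqrt \<kappa> * sqrt \<beta>) *\<^sub>R gradient_within (loss_sd P l) \<theta>opt \<Theta>))) \<and>
     ((\<lambda>n. 1 / real n) \<in> o(\<delta>) \<longrightarrow>
        converges_in_distribution M (\<lambda>n \<omega>. (1 / sqrt (\<delta> n)) *\<^sub>R (\<theta>bar n \<omega> - \<theta>opt))
          M (\<lambda>\<omega>. \<theta>sol' (sqrt \<kappa> *\<^sub>R gradient_within (loss_sd P l) \<theta>opt \<Theta>)))"
proof -
  define \<gamma> where "\<gamma> = gradient_within (loss_sd P l) \<theta>opt \<Theta>"
  interpret P: prob_space P by fact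
  have opt: "\<theta>opt \<in> \<Theta>"
    using \<theta>opt(1) by (simp add: is_arg_min_def)
  have space_P: "space P = S"
    using sets_eq_imp_space_eq[OF P(2)] by (simp add: space_restrict_space)
  obtain r where r: "r > 0" "convex hull (\<Theta> \<inter> ball \<theta>opt r) \<subseteq> D" and \<Theta>_D: "\<Theta> \<subseteq> D"
    using D by (auto simp: differentiation_domain_def)
  obtain b where b: "AE x in P. \<forall>\<theta>\<in>\<Theta>. \<bar>l x \<theta>\<bar> \<le> b"
    using l_bdd by blast
  obtain \<Psi> where \<Psi>: "\<Psi> \<in> borel_measurable P" "\<And>x. x \<in> S \<Longrightarrow> \<Psi> x \<ge> 0" "integrable P (\<lambda>x. (\<Psi> x)\<^sup>2)"
    "AE x in P. \<forall>\<theta>\<in>D. \<forall>\<theta>'\<in>D. norm (G x \<theta> - G x \<theta>') \<le> \<Psi> x * norm (\<theta> - \<theta>')"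
    using grad_Lip by blast
  obtain \<theta>1 where \<theta>1: "\<theta>1 \<in> \<Theta>" "integrable P (\<lambda>x. (norm (G x \<theta>1))\<^sup>2)"
    using grad_sq by blast
  obtain V c where V: "\<theta>opt \<in> interior V" and c: "c > 0" and gr: "\<forall>\<^sub>F v in nhds 0.
      is_arg_min (\<lambda>\<theta>. loss_mean P l \<theta> + v \<bullet> \<theta>) (\<lambda>\<theta>. \<theta> \<in> \<Theta>) (\<theta>sol v) \<and> \<theta>sol v \<in> V \<and>
      (\<forall>\<theta>\<in>\<Theta> \<inter> V. loss_mean P l \<theta> + v \<bullet> (\<theta> - \<theta>sol v)
         \<ge> loss_mean P l (\<theta>sol v) + c * (norm (\<theta> - \<theta>sol v))\<^sup>2)"
    using growth by blast
  have G0: "(\<lambda>x. G x \<theta>opt) \<in> borel_measurable P" "(\<lambda>x. G x \<theta>1) \<in> borel_measurable P"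
    using l_diff opt \<theta>1 \<Theta>_D unfolding continuously_differentiable_loss_def by blast+
  \<comment> \<open>\<open>\<Psi>\<close> is nonnegative on \<open>S\<close> only and
    \<open>b\<close> need not be positive; the absolute value and \<open>max b 1\<close> provide
    what the locale asks for.\<close>
  have LM: "loss_model M P X \<Theta> \<theta>opt l (\<lambda>x. G x \<theta>opt) (\<lambda>x. \<bar>\<Psi> x\<bar>) r (max b 1)"
  proof (intro loss_model.intro iid_sample.intro iid_sample_axioms.intro loss_model_axioms.intro)
    show "prob_space M" "prob_space P" "prob_space.indep_vars M (\<lambda>_. P) X {1..}" "compact \<Theta>" "\<theta>opt \<in> \<Theta>" "r > 0"
      "(\<lambda>x. G x \<theta>opt) \<in> borel_measurable P"
      by fact+
    show "distr M P (X i) = P" if "i \<ge> 1" for i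
      by (rule X_distr[OF that])
    show "max b 1 > 0" "\<And>x. 0 \<le> \<bar>\<Psi> x\<bar>"
      by simp_all
    show "(\<lambda>x. l x \<theta>) \<in> borel_measurable P" if "\<theta> \<in> \<Theta>" for \<theta>
    proof -
      have "continuous_on S (\<lambda>x. (\<lambda>(x, \<theta>). l x \<theta>) (x, \<theta>))"
        by (rule continuous_on_compose2[OF l_cont]) (use that in \<open>auto intro!: continuous_intros\<close>)
      then show ?thesis
        unfolding measurable_cong_sets[OF P(2) refl] by (simp add: borel_measurable_continuous_on_restrict)
    qed
    show "(\<lambda>x. \<bar>\<Psi> x\<bar>) \<in> borel_measurable P"
      using \<Psi>(1) by measurable
    show "integrable P (\<lambda>x. \<bar>\<Psi> x\<bar>\<^sup>2)"
      using \<Psi>(3) by simp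
    \<comment> \<open>The Lipschitz bound carries square integrability of the gradient from
      \<open>\<theta>1\<close> to \<open>\<theta>opt\<close>.\<close>
    show "integrable P (\<lambda>x. (norm (G x \<theta>opt))\<^sup>2)"
    proof (rule Bochner_Integration.integrable_bound)
      show "integrable P (\<lambda>x. 2 * (norm (G x \<theta>1))\<^sup>2 + 2 * (norm (\<theta>opt - \<theta>1))\<^sup>2 * (\<Psi> x)\<^sup>2)"
        using \<theta>1(2) \<Psi>(3) by simp
      show "AE x in P. norm ((norm (G x \<theta>opt))\<^sup>2) \<le> norm (2 * (norm (G x \<theta>1))\<^sup>2 + 2 * (norm (\<theta>opt - \<theta>1))\<^sup>2 * (\<Psi> x)\<^sup>2)"
        using \<Psi>(4)
      proof eventually_elim
        case (elim x)
        have "norm (G x \<theta>opt) \<le> norm (G x \<theta>1) + norm (G x \<theta>opt - G x \<theta>1)"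
          by (metis add.commute diff_add_cancel norm_triangle_ineq)
        also have "\<dots> \<le> norm (G x \<theta>1) + \<Psi> x * norm (\<theta>opt - \<theta>1)"
          using elim opt \<theta>1(1) \<Theta>_D by (intro add_left_mono) blast
        finally have "(norm (G x \<theta>opt))\<^sup>2 \<le> (norm (G x \<theta>1) + \<Psi> x * norm (\<theta>opt - \<theta>1))\<^sup>2"
          by (intro power_mono) auto
        also have "\<dots> \<le> 2 * (norm (G x \<theta>1))\<^sup>2 + 2 * (\<Psi> x * norm (\<theta>opt - \<theta>1))\<^sup>2"
          by (rule power2_add_le)
        finally show ?case
          by (simp add: power_mult_distrib mult_ac)
      qed
    qed (use G0(1) in measurable)
    show "AE x in P. \<forall>\<theta>\<in>\<Theta>. \<bar>l x \<theta>\<bar> \<le> max b 1"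
      using b by eventually_elim (auto simp: le_max_iff_disj)
    show "AE x in P. \<forall>\<theta>\<in>\<Theta> \<inter> ball \<theta>opt r. \<forall>\<theta>'\<in>\<Theta> \<inter> ball \<theta>opt r.
        \<bar>l x \<theta> - l x \<theta>' - G x \<theta>opt \<bullet> (\<theta> - \<theta>')\<bar>
          \<le> \<bar>\<Psi> x\<bar> * max (norm (\<theta> - \<theta>opt)) (norm (\<theta>' - \<theta>opt)) * norm (\<theta> - \<theta>')"
    proof -
      have "AE x in P. \<forall>\<theta>\<in>D. has_gradient_within (l x) (G x \<theta>) \<theta> D"
        using conjunct1[OF l_diff[unfolded continuously_differentiable_loss_def]]
        by (rule eventually_mono) (rule conjunct1)
      with \<Psi>(4) show ?thesis
      proof eventually_elim
        case (elim x)
        show ?case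
        proof (intro ballI)
          fix \<theta> \<theta>' assume th: "\<theta> \<in> \<Theta> \<inter> ball \<theta>opt r" "\<theta>' \<in> \<Theta> \<inter> ball \<theta>opt r"
          show "\<bar>l x \<theta> - l x \<theta>' - G x \<theta>opt \<bullet> (\<theta> - \<theta>')\<bar>
              \<le> \<bar>\<Psi> x\<bar> * max (norm (\<theta> - \<theta>opt)) (norm (\<theta>' - \<theta>opt)) * norm (\<theta> - \<theta>')"
          proof (rule first_order_remainder_bound[OF r(2) _ _ _ _ th])
            show opt_D: "\<theta>opt \<in> D"
              using opt \<Theta>_D by blast
            show "has_gradient_within (l x) (G x z) z D" if "z \<in> D" for z
              using elim that by blast
            show "norm (G x z - G x \<theta>opt) \<le> \<bar>\<Psi> x\<bar> * norm (z - \<theta>opt)" if "z \<in> D" for z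
            proof -
              have "norm (G x z - G x \<theta>opt) \<le> \<Psi> x * norm (z - \<theta>opt)"
                using elim that opt_D by blast
              also have "\<dots> \<le> \<bar>\<Psi> x\<bar> * norm (z - \<theta>opt)"
                by (intro mult_right_mono) auto
              finally show ?thesis .
            qed
          qed simp
        qed
      qed
    qed
    show "\<exists>K\<in>sets P. measure P K \<ge> 1 - \<epsilon> \<and> (\<exists>\<rho>>0. \<forall>x\<in>K. \<forall>\<theta>\<in>\<Theta>. \<forall>\<theta>'\<in>\<Theta>.
        norm (\<theta> - \<theta>') < \<rho> \<longrightarrow> \<bar>l x \<theta> - l x \<theta>'\<bar> \<le> \<epsilon>)" if "\<epsilon> > 0" for \<epsilon>
      by (rule equicontinuous_on_compact_part[OF S(1) P \<Theta> l_cont that])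
  qed
  interpret L: loss_model M P X \<Theta> \<theta>opt l "\<lambda>x. G x \<theta>opt" "\<lambda>x. \<bar>\<Psi> x\<bar>" r "max b 1"
    by (rule LM)
  have DG: "divergence_generator \<phi> \<kappa>"
    by (intro divergence_generator.intro) (use \<phi> \<phi>_C2 \<kappa> in auto)
  \<comment> \<open>The choice operator returns a gradient because \<open>L.loss_sd_gradient\<close>
    exhibits one.\<close>
  have grad: "has_gradient_within (loss_sd P l) \<gamma> \<theta>opt \<Theta>"
    unfolding \<gamma>_def gradient_within_def by (rule someI) (rule L.loss_sd_gradient[OF var_pos])
  have f_min: "loss_mean P l \<theta>opt < loss_mean P l \<theta>" if "\<theta> \<in> \<Theta>" "\<theta> \<noteq> \<theta>opt" for \<theta>
  proof (rule ccontr)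
    assume "\<not> ?thesis"
    then have "is_arg_min (loss_mean P l) (\<lambda>\<theta>. \<theta> \<in> \<Theta>) \<theta>"
      using \<theta>opt(1) that(1) unfolding is_arg_min_linorder not_less by (blast intro: order_trans)
    then show False
      using \<theta>opt(2) that(2) by blast
  qed
  \<comment> \<open>For \<open>v = 0\<close> the tilted problem is the original one, whose minimizer
    is unique.\<close>
  have sol_zero: "\<theta>sol 0 = \<theta>opt"
    using eventually_nhds_x_imp_x[OF gr] by (intro \<theta>opt(2)) simp
  have RE: "robust_estimation M P X \<Theta> \<theta>opt l (\<lambda>x. G x \<theta>opt) (\<lambda>x. \<bar>\<Psi> x\<bar>) r (max b 1) \<phi> \<kappa> \<delta> \<theta>bar \<theta>sol V c C a \<gamma>"
    if "\<And>n. a n \<ge> 0" "a \<longlonglongrightarrow> 0" "C > 0"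
      "\<forall>\<^sub>F n in sequentially. 1 / sqrt (real n) \<le> C * a n \<and> sqrt (\<delta> n) \<le> C * a n" for a C
  proof (intro robust_estimation.intro robust_estimation_axioms.intro LM DG \<delta>(1,3) V c sol_zero var_pos grad that)
    show "AE \<omega> in M. \<forall>n\<ge>1. \<theta>bar n \<omega> \<in> \<Theta> \<and> (\<forall>\<theta>\<in>\<Theta>.
        robust_loss \<phi> l (empirical_measure P (\<lambda>i. X i \<omega>) n) (\<delta> n) (\<theta>bar n \<omega>)
          \<le> robust_loss \<phi> l (empirical_measure P (\<lambda>i. X i \<omega>) n) (\<delta> n) \<theta>)"
      using \<theta>bar unfolding is_arg_min_linorder Ball_def .
    show "loss_mean P l \<theta>opt < loss_mean P l \<theta>" if "\<theta> \<in> \<Theta>" "\<theta> \<noteq> \<theta>opt" for \<theta>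
      by (rule f_min[OF that])
    show "\<forall>\<^sub>F v in nhds 0. \<theta>sol v \<in> \<Theta> \<and> \<theta>sol v \<in> V \<and> (\<forall>\<theta>\<in>\<Theta> \<inter> V.
        loss_mean P l \<theta> + v \<bullet> (\<theta> - \<theta>sol v) \<ge> loss_mean P l (\<theta>sol v) + c * (norm (\<theta> - \<theta>sol v))\<^sup>2)"
      using gr by eventually_elim (simp add: is_arg_min_def)
  qed
  have N: "prob_space N" and Zm: "Z \<in> borel_measurable N"
    using Z by (simp_all add: multivariate_normal_def)
  have law: "distr N borel (\<lambda>\<omega>. t \<bullet> Z \<omega>) = normal_law 0 (\<integral>x. (t \<bullet> (G x \<theta>opt - (\<integral>y. G y \<theta>opt \<partial>P)))\<^sup>2 \<partial>P)" for t
    using Z covariance_matrix_quadratic[OF P(1) G0(1) L.G0_sq L.G0_integrable, of t]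
    by (simp add: multivariate_normal_def)
  have inv_sqrt: "(\<lambda>n. 1 / sqrt (real n)) \<longlonglongrightarrow> 0"
    by (intro tendsto_divide_0[OF tendsto_const] filterlim_at_top_imp_at_infinity
        filterlim_compose[OF sqrt_at_top filterlim_real_sequentially])
  \<comment> \<open>The first two regimes at once: \<open>s\<close> is the limit of
    \<open>sqrt (n * \<delta> n)\<close>, namely 0 or \<open>sqrt \<beta>\<close>.\<close>
  have gaussian: "converges_in_distribution M (\<lambda>n \<omega>. sqrt (real n) *\<^sub>R (\<theta>bar n \<omega> - \<theta>opt)) N (\<lambda>\<omega>. \<theta>sol' (Z \<omega> + (sqrt \<kappa> * s) *\<^sub>R \<gamma>))"
    if s: "(\<lambda>n. sqrt (real n) * sqrt (\<delta> n)) \<longlonglongrightarrow> s" for s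
  proof -
    have "0 \<le> s"
      by (rule tendsto_lowerbound[OF s]) (use \<delta>(1) in \<open>auto intro!: always_eventually simp: less_imp_le\<close>)
    \<comment> \<open>\<open>s + 1\<close> serves both bounds: it is at least 1 and eventually
      exceeds \<open>sqrt (n * \<delta> n)\<close>.\<close>
    have rate: "\<forall>\<^sub>F n in sequentially. 1 / sqrt (real n) \<le> (s + 1) * (1 / sqrt (real n)) \<and> sqrt (\<delta> n) \<le> (s + 1) * (1 / sqrt (real n))"
      using order_tendstoD(2)[OF s less_add_one] eventually_ge_at_top[of 1]
    proof eventually_elim
      case (elim n)
      then have "sqrt (\<delta> n) \<le> (s + 1) / sqrt (real n)"
        by (simp add: pos_le_divide_eq mult.commute)
      with \<open>0 \<le> s\<close> show ?case
        by (simp add: divide_right_mono)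
    qed
    interpret R: robust_estimation M P X \<Theta> \<theta>opt l "\<lambda>x. G x \<theta>opt" "\<lambda>x. \<bar>\<Psi> x\<bar>" r "max b 1" \<phi> \<kappa> \<delta> \<theta>bar \<theta>sol V c
        "s + 1" "\<lambda>n. 1 / sqrt (real n)" \<gamma>
      by (rule RE[OF _ inv_sqrt _ rate]) (use \<open>0 \<le> s\<close> in auto)
    have "(\<lambda>n. sqrt \<kappa> * (sqrt (real n) * sqrt (\<delta> n))) \<longlonglongrightarrow> sqrt \<kappa> * s"
      by (intro tendsto_intros s)
    then have "(\<lambda>n. sqrt (real n) * sqrt (\<kappa> * \<delta> n)) \<longlonglongrightarrow> sqrt \<kappa> * s"
      by (simp add: real_sqrt_mult mult_ac)
    from R.estimator_limit[OF hadamard N \<theta>bar_meas R.score_limit_gaussian[OF N Zm law refl this]]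
    show ?thesis
      by simp
  qed
  show ?thesis
    unfolding \<gamma>_def[symmetric]
  proof (intro conjI impI allI)
    assume "\<delta> \<in> o(\<lambda>n. 1 / real n)"
    then have "(\<lambda>n. \<delta> n / (1 / real n)) \<longlonglongrightarrow> 0"
      by (rule smalloD_tendsto)
    then have "(\<lambda>n. sqrt (\<delta> n / (1 / real n))) \<longlonglongrightarrow> sqrt 0"
      by (rule tendsto_real_sqrt)
    then have "(\<lambda>n. sqrt (real n) * sqrt (\<delta> n)) \<longlonglongrightarrow> 0"
      by (simp add: real_sqrt_mult mult.commute)
    from gaussian[OF this]
    show "converges_in_distribution M (\<lambda>n \<omega>. sqrt (real n) *\<^sub>R (\<theta>bar n \<omega> - \<theta>opt)) N (\<lambda>\<omega>. \<theta>sol' (Z \<omega>))"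
      by simp
  next
    fix \<beta> :: real assume \<beta>: "\<beta> > 0" "\<forall>n\<ge>1. \<delta> n = \<beta> / real n"
    have "\<forall>\<^sub>F n in sequentially. sqrt (real n) * sqrt (\<delta> n) = sqrt \<beta>"
      using eventually_ge_at_top[of 1] by eventually_elim (use \<beta> in \<open>simp add: real_sqrt_divide\<close>)
    then have "(\<lambda>n. sqrt (real n) * sqrt (\<delta> n)) \<longlonglongrightarrow> sqrt \<beta>"
      by (rule tendsto_eventually)
    then show "converges_in_distribution M (\<lambda>n \<omega>. sqrt (real n) *\<^sub>R (\<theta>bar n \<omega> - \<theta>opt)) N
        (\<lambda>\<omega>. \<theta>sol' (Z \<omega> + (sqrt \<kappa> * sqrt \<beta>) *\<^sub>R \<gamma>))"
      by (rule gaussian)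
  next
    assume "(\<lambda>n. 1 / real n) \<in> o(\<delta>)"
    then have "(\<lambda>n. 1 / real n / \<delta> n) \<longlonglongrightarrow> 0"
      by (rule smalloD_tendsto)
    then have "(\<lambda>n. sqrt (1 / real n / \<delta> n)) \<longlonglongrightarrow> sqrt 0"
      by (rule tendsto_real_sqrt)
    then have lim: "(\<lambda>n. 1 / sqrt (real n) / sqrt (\<delta> n)) \<longlonglongrightarrow> 0"
      by (simp add: real_sqrt_divide real_sqrt_mult)
    \<comment> \<open>Eventually \<open>sqrt (\<delta> n)\<close> dominates
      \<open>1 / sqrt n\<close>, so the constant 1 works for the rate
      \<open>sqrt (\<delta> n)\<close>.\<close>
    have "\<forall>\<^sub>F n in sequentially. 1 / sqrt (real n) / sqrt (\<delta> n) < 1"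
      using order_tendstoD(2)[OF lim, of 1] by simp
    then have rate: "\<forall>\<^sub>F n in sequentially. 1 / sqrt (real n) \<le> 1 * sqrt (\<delta> n) \<and> sqrt (\<delta> n) \<le> 1 * sqrt (\<delta> n)"
    proof eventually_elim
      case (elim n)
      have "sqrt (\<delta> n) > 0"
        using \<delta>(1) by simp
      then have "1 / sqrt (real n) < 1 * sqrt (\<delta> n)"
        using elim by (subst (asm) pos_divide_less_eq)
      then show ?case
        by simp
    qed
    have "(\<lambda>n. sqrt (\<delta> n)) \<longlonglongrightarrow> 0"
      using tendsto_real_sqrt[OF \<delta>(3)] by simp
    then interpret R: robust_estimation M P X \<Theta> \<theta>opt l "\<lambda>x. G x \<theta>opt" "\<lambda>x. \<bar>\<Psi> x\<bar>" r "max b 1" \<phi> \<kappa> \<delta> \<theta>bar \<theta>sol V c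
        1 "\<lambda>n. sqrt (\<delta> n)" \<gamma>
      by (intro RE rate) (use \<delta>(1) in \<open>auto simp: less_imp_le\<close>)
    show "converges_in_distribution M (\<lambda>n \<omega>. (1 / sqrt (\<delta> n)) *\<^sub>R (\<theta>bar n \<omega> - \<theta>opt)) M
        (\<lambda>\<omega>. \<theta>sol' (sqrt \<kappa> *\<^sub>R \<gamma>))"
      by (rule R.estimator_limit[OF hadamard M \<theta>bar_meas R.score_limit_degenerate[OF refl lim]])
  qed
qed

end
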